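(* Let $\mathcal{K}$ be a 2-category with pullbacks and comma objects. Let $P:\mathcal{K}/I\to\mathcal{K}/J$ be the polynomial 2-functor $\Sigma_t\Pi_p\Delta_s$ associated to a polynomial $$I\xleftarrow{s}E\xrightarrow{p}B\xrightarrow{t}J$$ in $\mathcal{K}$. Also let $f=(f_2,f_1)$ be a cartesian morphism of polynomials from $I\xleftarrow{s_1}E_1\xrightarrow{p_1}B_1\xrightarrow{t_1}J$ to $I\xleftarrow{s_2}E_2\xrightarrow{p_2}B_2\xrightarrow{t_2}J$, so that $f_2:E_1\to E_2$, $f_1:B_1\to B_2$, $s_2f_2=s_1$, $t_2f_1=t_1$, and $p_2f_2=f_1p_1$ is a pullback square; and let $\phi:P\to Q$ be the 2-natural transformation associated to $f$, where in this case $P$ and $Q$ denote the polynomial 2-functors associated to the domain and codomain of $f$ respectively. (1) If $p$ has the structure of a split opfibration and $t$ has the structure of a split fibration, then $P$ lifts to a 2-functor $\overline{P}:\Phi_{\mathcal{K},I}\text{-}\mathrm{Alg}_{\mathrm{s}}\to\Phi_{\mathcal{K},J}\text{-}\mathrm{Alg}_{\mathrm{s}}$ such that $U^{\Phi_{\mathcal{K},J}}\overline{P}=PU^{\Phi_{\mathcal{K},I}}$. (2) If in the situation of (1) $I$ is discrete, then $P$ is a familial 2-functor. (3) If $p_1,p_2$ are split opfibrations, $t_1,t_2$ are split fibrations, $(f_2,f_1):p_1\to p_2$ is a morphism of split opfibrations and $(f_1,1_J):t_1\to t_2$ is a morphism of split fibrations, then $\phi$ lifts to a 2-natural transformation $\overline{\phi}:\overline{P}\to\overline{Q}$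 such that $U^{\Phi_{\mathcal{K},J}}\overline{\phi}=\phi U^{\Phi_{\mathcal{K},I}}$. (4) If in the situation of (3) $I$ is discrete, then $\phi$ is a familial 2-natural transformation.
   Context: Limits in 2-categories have their 2-dimensional universal property. For $f:X\to Y$ in $\mathcal{K}$, $\Sigma_f:\mathcal{K}/X\to\mathcal{K}/Y$ is composition with $f$, $\Delta_f$ its right 2-adjoint (pullback), and $f$ is exponentiable if $\Delta_f$ has a right 2-adjoint $\Pi_f$. In a polynomial $I\xleftarrow{s}E\xrightarrow{p}B\xrightarrow{t}J$ the map $p$ is by definition exponentiable. The 2-natural transformation $\phi$ associated to $f=(f_2,f_1)$ is the composite $$\Sigma_{t_1}\Pi_{p_1}\Delta_{s_1}\cong\Sigma_{t_1}\Pi_{p_1}\Delta_{f_2}\Delta_{s_2}\cong\Sigma_{t_1}\Delta_{f_1}\Pi_{p_2}\Delta_{s_2}\to\Sigma_{t_2}\Pi_{p_2}\Delta_{s_2}$$ (from $s_1=s_2f_2$; the Beck–Chevalley isomorphism; and the mate of $\Sigma_{t_1}=\Sigma_{t_2}\Sigma_{f_1}$). An object $I$ of a 2-category is discrete if every category $\mathcal{K}(X,I)$ is discrete. Split fibrations. A split fibration structure on $f:A\to B$ in a 2-category is a split fibration structure (split cleavage, with chosen cartesian arrows) on each functor $\mathcal{K}(X,f):\mathcal{K}(X,A)\to\mathcal{K}(X,B)$, such that precomposition with any $Y\to X$ preserves chosen cartesian arrows (called chosen $f$-cartesian 2-cells). A morphism of split fibrations $(u,v):f\to g$ is a commutative square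 $gu=vf$ such that post-composition with $u$ sends chosen $f$-cartesian 2-cells to chosen $g$-cartesian 2-cells. Split opfibrations and their morphisms are the duals (reverse 2-cells). $\Phi_{\mathcal{K},B}$ is Street's 2-monad on $\mathcal{K}/B$ sending $f:A\to B$ to the projection $1_B\downarrow f\to B$ of the comma object whose universal 2-cell goes from this projection to $f$ composed with the projection to $A$. Its 2-category $\Phi_{\mathcal{K},B}\text{-}\mathrm{Alg}_{\mathrm{s}}$ of strict algebras and strict morphisms is identified with the 2-category of split fibrations into $B$, morphisms $(u,1_B)$ of split fibrations, and all 2-cells of $\mathcal{K}/B$ between them. $U^{\Phi_{\mathcal{K},B}}:\Phi_{\mathcal{K},B}\text{-}\mathrm{Alg}_{\mathrm{s}}\to\mathcal{K}/B$ is the forgetful 2-functor. The lifts. $\overline{P}=\overline{\Sigma}_t\overline{\Pi}_p\overline{\Delta}_s$ (and similarly $\overline{Q}$), where: $\overline{\Delta}_s$ lifts $\Delta_s$ by giving a pullback of a split fibration its induced cleavage; $\overline{\Sigma}_t$ lifts $\Sigma_t$ by giving the composite of a split fibration into $B$ with the split fibration $t$ the composite cleavage; and $\overline{\Pi}_p$ lifts $\Pi_p$ as follows. The Kleisli 2-category $\mathrm{Kl}(\Phi_{\mathcal{K},B})$ has the objects of $\mathcal{K}/B$, with arrows from $x:X\to B$ to $y:Y\to B$ the pairs $(k:X\to Y,\ \gamma:x\Rightarrow yk)$. The 2-functor $\Delta_p$ extends to $\mathrm{Kl}(\Phi_{\mathcal{K},B})\to\mathrm{Kl}(\Phi_{\mathcal{K},E})$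 by sending $(k,\gamma)$ to $(k_2,\gamma_2)$, where $\gamma_2$ is the chosen $p$-opcartesian lift, with domain $\Delta_p(x)$, of $\gamma$ restricted along the projection from the pullback of $x$ to $X$, and $k_2$ is induced by the codomain of $\gamma_2$ and $k$. This extension corresponds to a 2-natural transformation $\Delta_p\Phi_{\mathcal{K},B}\to\Phi_{\mathcal{K},E}\Delta_p$ (a colax morphism of 2-monads), whose mate under $\Delta_p\dashv\Pi_p$ is a 2-natural transformation $\Phi_{\mathcal{K},B}\Pi_p\to\Pi_p\Phi_{\mathcal{K},E}$ (a lax morphism of 2-monads), which corresponds to the lifting $\overline{\Pi}_p:\Phi_{\mathcal{K},E}\text{-}\mathrm{Alg}_{\mathrm{s}}\to\Phi_{\mathcal{K},B}\text{-}\mathrm{Alg}_{\mathrm{s}}$. Familial. Let $\mathcal{A},\mathcal{L}$ be 2-categories with comma objects, with $\mathcal{A}$ having a terminal object $1$; write $t_X:X\to1$. A familial 2-functor $T:\mathcal{A}\to\mathcal{L}$ is a 2-functor such that $T_1:\mathcal{A}\to\mathcal{L}/T1$, $X\mapsto T(t_X)$, has a left 2-adjoint (equivalently every $T_X:\mathcal{A}/X\to\mathcal{L}/TX$ has one), together with a 2-functor $\overline{T}_1:\mathcal{A}\to\Phi_{\mathcal{L},T1}\text{-}\mathrm{Alg}_{\mathrm{s}}$ with $U^{\Phi_{\mathcal{L},T1}}\overline{T}_1=T_1$; thus each $T(t_X)$ is a split fibration in $\mathcal{L}$. A 2-natural transformation $\alpha:S\to T$ between familial 2-functors is familial when it is cartesian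 (its naturality squares are pullbacks) and for all $X$ the naturality square $(\alpha_X,\alpha_1):S(t_X)\to T(t_X)$ is a morphism of split fibrations. In (2) and (4) these are applied with $\mathcal{A}=\mathcal{K}/I$ (terminal object $1_I$) and $\mathcal{L}=\mathcal{K}/J$, so that $P1=t$ and $P_1=\Pi_p\Delta_s:\mathcal{K}/I\to\mathcal{K}/B=(\mathcal{K}/J)/t$. The familial structure is the one obtained from the lift: since $I$ is discrete every object of $\mathcal{K}/I$ is uniquely a split fibration, and $\overline{P}_1$ is given by $\overline{\Pi}_p\overline{\Delta}_s$ (a split fibration into $B$ in $\mathcal{K}$ being regarded as one into $t$ in $\mathcal{K}/J$). *)

theory Defs
  imports Main
begin

section \<open>Strict 2-categories\<close>

text \<open>
  \<open>g \<odot> f\<close> is composition of 1-cells, \<open>\<beta> \<bullet> \<alpha>\<close> vertical and \<open>\<beta> \<star> \<alpha>\<close> horizontal composition of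
  2-cells (second argument first). The operations are only meaningful on composable elements of the
  carriers; nothing is assumed about their values elsewhere.
\<close>

record ('o, 'a, 'c) twocat =
  Ob :: "'o set"
  Arr :: "'a set"
  Cell :: "'c set"
  Dom :: "'a \<Rightarrow> 'o"
  Cod :: "'a \<Rightarrow> 'o"
  Id1 :: "'o \<Rightarrow> 'a"
  Comp :: "'a \<Rightarrow> 'a \<Rightarrow> 'a" (infixl "\<odot>\<index>" 70)
  Src :: "'c \<Rightarrow> 'a"
  Tgt :: "'c \<Rightarrow> 'a"
  Id2 :: "'a \<Rightarrow> 'c"
  VComp :: "'c \<Rightarrow> 'c \<Rightarrow> 'c" (infixl "\<bullet>\<index>" 70)
  HComp :: "'c \<Rightarrow> 'c \<Rightarrow> 'c" (infixl "\<star>\<index>" 70)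

definition hom1 :: "('o, 'a, 'c) twocat \<Rightarrow> 'o \<Rightarrow> 'o \<Rightarrow> 'a set" where
  "hom1 K X Y = {f \<in> Arr K. Dom K f = X \<and> Cod K f = Y}"

definition hom2 :: "('o, 'a, 'c) twocat \<Rightarrow> 'a \<Rightarrow> 'a \<Rightarrow> 'c set" where
  "hom2 K f g = {\<alpha> \<in> Cell K. Src K \<alpha> = f \<and> Tgt K \<alpha> = g}"

definition whisker_l :: "('o, 'a, 'c) twocat \<Rightarrow> 'a \<Rightarrow> 'c \<Rightarrow> 'c" (infixl "\<rhd>\<index>" 75) where
  "whisker_l K g \<alpha> = Id2 K g \<star>\<^bsub>K\<^esub> \<alpha>"

definition whisker_r :: "('o, 'a, 'c) twocat \<Rightarrow> 'c \<Rightarrow> 'a \<Rightarrow> 'c" (infixl "\<lhd>\<index>" 75) where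
  "whisker_r K \<alpha> f = \<alpha> \<star>\<^bsub>K\<^esub> Id2 K f"

locale two_category =
  fixes K :: "('o, 'a, 'c) twocat" (structure)
  assumes Dom_closed: "f \<in> Arr K \<Longrightarrow> Dom K f \<in> Ob K"
    and Cod_closed: "f \<in> Arr K \<Longrightarrow> Cod K f \<in> Ob K"
    and Id1_hom: "X \<in> Ob K \<Longrightarrow> Id1 K X \<in> hom1 K X X"
    and Comp_hom: "\<lbrakk>f \<in> Arr K; g \<in> Arr K; Dom K g = Cod K f\<rbrakk> \<Longrightarrow> g \<odot> f \<in> hom1 K (Dom K f) (Cod K g)"
    and Comp_Id1: "f \<in> Arr K \<Longrightarrow> f \<odot> Id1 K (Dom K f) = f"
    and Id1_Comp: "f \<in> Arr K \<Longrightarrow> Id1 K (Cod K f) \<odot> f = f"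
    and Comp_assoc: "\<lbrakk>f \<in> Arr K; g \<in> Arr K; h \<in> Arr K; Dom K g = Cod K f; Dom K h = Cod K g\<rbrakk>
        \<Longrightarrow> h \<odot> (g \<odot> f) = (h \<odot> g) \<odot> f"
    and Src_Arr: "\<alpha> \<in> Cell K \<Longrightarrow> Src K \<alpha> \<in> Arr K"
    and Tgt_Arr: "\<alpha> \<in> Cell K \<Longrightarrow> Tgt K \<alpha> \<in> Arr K"
    and Dom_Tgt: "\<alpha> \<in> Cell K \<Longrightarrow> Dom K (Tgt K \<alpha>) = Dom K (Src K \<alpha>)"
    and Cod_Tgt: "\<alpha> \<in> Cell K \<Longrightarrow> Cod K (Tgt K \<alpha>) = Cod K (Src K \<alpha>)"
    and Id2_hom: "f \<in> Arr K \<Longrightarrow> Id2 K f \<in> hom2 K f f"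
    and VComp_hom: "\<lbrakk>\<alpha> \<in> Cell K; \<beta> \<in> Cell K; Src K \<beta> = Tgt K \<alpha>\<rbrakk> \<Longrightarrow> \<beta> \<bullet> \<alpha> \<in> hom2 K (Src K \<alpha>) (Tgt K \<beta>)"
    and VComp_Id2: "\<alpha> \<in> Cell K \<Longrightarrow> \<alpha> \<bullet> Id2 K (Src K \<alpha>) = \<alpha>"
    and Id2_VComp: "\<alpha> \<in> Cell K \<Longrightarrow> Id2 K (Tgt K \<alpha>) \<bullet> \<alpha> = \<alpha>"
    and VComp_assoc: "\<lbrakk>\<alpha> \<in> Cell K; \<beta> \<in> Cell K; \<gamma> \<in> Cell K; Src K \<beta> = Tgt K \<alpha>; Src K \<gamma> = Tgt K \<beta>\<rbrakk>
        \<Longrightarrow> \<gamma> \<bullet> (\<beta> \<bullet> \<alpha>) = (\<gamma> \<bullet> \<beta>) \<bullet> \<alpha>"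
    and HComp_hom: "\<lbrakk>\<alpha> \<in> Cell K; \<beta> \<in> Cell K; Dom K (Src K \<beta>) = Cod K (Src K \<alpha>)\<rbrakk>
        \<Longrightarrow> \<beta> \<star> \<alpha> \<in> hom2 K (Src K \<beta> \<odot> Src K \<alpha>) (Tgt K \<beta> \<odot> Tgt K \<alpha>)"
    and HComp_Id: "\<alpha> \<in> Cell K \<Longrightarrow> \<alpha> \<star> Id2 K (Id1 K (Dom K (Src K \<alpha>))) = \<alpha>"
    and Id_HComp: "\<alpha> \<in> Cell K \<Longrightarrow> Id2 K (Id1 K (Cod K (Src K \<alpha>))) \<star> \<alpha> = \<alpha>"
    and HComp_assoc: "\<lbrakk>\<alpha> \<in> Cell K; \<beta> \<in> Cell K; \<gamma> \<in> Cell K;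
          Dom K (Src K \<beta>) = Cod K (Src K \<alpha>); Dom K (Src K \<gamma>) = Cod K (Src K \<beta>)\<rbrakk>
        \<Longrightarrow> \<gamma> \<star> (\<beta> \<star> \<alpha>) = (\<gamma> \<star> \<beta>) \<star> \<alpha>"
    and HComp_Id2: "\<lbrakk>f \<in> Arr K; g \<in> Arr K; Dom K g = Cod K f\<rbrakk> \<Longrightarrow> Id2 K g \<star> Id2 K f = Id2 K (g \<odot> f)"
    and interchange: "\<lbrakk>\<alpha> \<in> Cell K; \<alpha>' \<in> Cell K; \<beta> \<in> Cell K; \<beta>' \<in> Cell K; Src K \<alpha>' = Tgt K \<alpha>;
          Src K \<beta>' = Tgt K \<beta>; Dom K (Src K \<beta>) = Cod K (Src K \<alpha>)\<rbrakk>
        \<Longrightarrow> (\<beta>' \<bullet> \<beta>) \<star> (\<alpha>' \<bullet> \<alpha>) = (\<beta>' \<star> \<alpha>') \<bullet> (\<beta> \<star> \<alpha>)"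

text \<open>The dual with 2-cells reversed.\<close>

definition co :: "('o, 'a, 'c) twocat \<Rightarrow> ('o, 'a, 'c) twocat" where
  "co K = K\<lparr>Src := Tgt K, Tgt := Src K, VComp := (\<lambda>\<beta> \<alpha>. \<alpha> \<bullet>\<^bsub>K\<^esub> \<beta>)\<rparr>"

definition arr_inv :: "('o, 'a, 'c) twocat \<Rightarrow> 'a \<Rightarrow> 'a" where
  "arr_inv K f = (THE g. g \<in> hom1 K (Cod K f) (Dom K f)
     \<and> g \<odot>\<^bsub>K\<^esub> f = Id1 K (Dom K f) \<and> f \<odot>\<^bsub>K\<^esub> g = Id1 K (Cod K f))"

definition discrete_ob :: "('o, 'a, 'c) twocat \<Rightarrow> 'o \<Rightarrow> bool" where
  "discrete_ob K I \<longleftrightarrow> I \<in> Ob K \<and> (\<forall>\<alpha>\<in>Cell K. Cod K (Src K \<alpha>) = I \<longrightarrow> \<alpha> = Id2 K (Src K \<alpha>))"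

definition terminal_ob :: "('o, 'a, 'c) twocat \<Rightarrow> 'o \<Rightarrow> bool" where
  "terminal_ob K T \<longleftrightarrow> T \<in> Ob K \<and> (\<forall>X\<in>Ob K. \<exists>!f. f \<in> hom1 K X T)
     \<and> (\<forall>\<alpha>\<in>Cell K. Cod K (Src K \<alpha>) = T \<longrightarrow> \<alpha> = Id2 K (Src K \<alpha>))"

definition bang :: "('o, 'a, 'c) twocat \<Rightarrow> 'o \<Rightarrow> 'o \<Rightarrow> 'a" where
  "bang K T X = (THE f. f \<in> hom1 K X T)"


section \<open>2-functors, 2-natural transformations, 2-adjunctions\<close>

record ('o, 'a, 'c, 'p, 'b, 'd) fun2 =
  fob :: "'o \<Rightarrow> 'p"
  farr :: "'a \<Rightarrow> 'b"
  fcell :: "'c \<Rightarrow> 'd"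

definition is_fun2 ::
  "('o, 'a, 'c) twocat \<Rightarrow> ('p, 'b, 'd) twocat \<Rightarrow> ('o, 'a, 'c, 'p, 'b, 'd) fun2 \<Rightarrow> bool" where
  "is_fun2 C D F \<longleftrightarrow>
     (\<forall>X\<in>Ob C. fob F X \<in> Ob D \<and> farr F (Id1 C X) = Id1 D (fob F X)) \<and>
     (\<forall>f\<in>Arr C. farr F f \<in> hom1 D (fob F (Dom C f)) (fob F (Cod C f))
        \<and> fcell F (Id2 C f) = Id2 D (farr F f)) \<and>
     (\<forall>\<alpha>\<in>Cell C. fcell F \<alpha> \<in> hom2 D (farr F (Src C \<alpha>)) (farr F (Tgt C \<alpha>))) \<and>
     (\<forall>f\<in>Arr C. \<forall>g\<in>Arr C. Dom C g = Cod C f \<longrightarrow> farr F (g \<odot>\<^bsub>C\<^esub> f) = farr F g \<odot>\<^bsub>D\<^esub> farr F f) \<and>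
     (\<forall>\<alpha>\<in>Cell C. \<forall>\<beta>\<in>Cell C. Src C \<beta> = Tgt C \<alpha> \<longrightarrow>
        fcell F (\<beta> \<bullet>\<^bsub>C\<^esub> \<alpha>) = fcell F \<beta> \<bullet>\<^bsub>D\<^esub> fcell F \<alpha>) \<and>
     (\<forall>\<alpha>\<in>Cell C. \<forall>\<beta>\<in>Cell C. Dom C (Src C \<beta>) = Cod C (Src C \<alpha>) \<longrightarrow>
        fcell F (\<beta> \<star>\<^bsub>C\<^esub> \<alpha>) = fcell F \<beta> \<star>\<^bsub>D\<^esub> fcell F \<alpha>)"

definition id_fun2 :: "('o, 'a, 'c, 'o, 'a, 'c) fun2" where
  "id_fun2 = \<lparr>fob = (\<lambda>X. X), farr = (\<lambda>f. f), fcell = (\<lambda>\<alpha>. \<alpha>)\<rparr>"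

definition comp_fun2 ::
  "('p, 'b, 'd, 'q, 'e, 'f) fun2 \<Rightarrow> ('o, 'a, 'c, 'p, 'b, 'd) fun2 \<Rightarrow> ('o, 'a, 'c, 'q, 'e, 'f) fun2"
  (infixl "\<circ>\<^sub>2" 70) where
  "G \<circ>\<^sub>2 F = \<lparr>fob = fob G \<circ> fob F, farr = farr G \<circ> farr F, fcell = fcell G \<circ> fcell F\<rparr>"

text \<open>Equality of 2-functors with domain \<open>C\<close> (values outside the carriers are irrelevant).\<close>

definition fun2_eq ::
  "('o, 'a, 'c) twocat \<Rightarrow> ('o, 'a, 'c, 'p, 'b, 'd) fun2 \<Rightarrow> ('o, 'a, 'c, 'p, 'b, 'd) fun2 \<Rightarrow> bool" where
  "fun2_eq C F G \<longleftrightarrow> (\<forall>X\<in>Ob C. fob F X = fob G X) \<and> (\<forall>f\<in>Arr C. farr F f = farr G f)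
     \<and> (\<forall>\<alpha>\<in>Cell C. fcell F \<alpha> = fcell G \<alpha>)"

definition is_nat2 ::
  "('o, 'a, 'c) twocat \<Rightarrow> ('p, 'b, 'd) twocat \<Rightarrow> ('o, 'a, 'c, 'p, 'b, 'd) fun2 \<Rightarrow>
   ('o, 'a, 'c, 'p, 'b, 'd) fun2 \<Rightarrow> ('o \<Rightarrow> 'b) \<Rightarrow> bool" where
  "is_nat2 C D F G \<tau> \<longleftrightarrow>
     (\<forall>X\<in>Ob C. \<tau> X \<in> hom1 D (fob F X) (fob G X)) \<and>
     (\<forall>f\<in>Arr C. \<tau> (Cod C f) \<odot>\<^bsub>D\<^esub> farr F f = farr G f \<odot>\<^bsub>D\<^esub> \<tau> (Dom C f)) \<and>
     (\<forall>\<alpha>\<in>Cell C. \<tau> (Cod C (Src C \<alpha>)) \<rhd>\<^bsub>D\<^esub> fcell F \<alpha> = fcell G \<alpha> \<lhd>\<^bsub>D\<^esub> \<tau> (Dom C (Src C \<alpha>)))"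

text \<open>\<open>F : C \<rightarrow> D\<close> is left 2-adjoint to \<open>G : D \<rightarrow> C\<close> with unit \<open>\<eta>\<close> and counit \<open>\<epsilon>\<close>.\<close>

definition adj2 ::
  "('o, 'a, 'c) twocat \<Rightarrow> ('p, 'b, 'd) twocat \<Rightarrow> ('o, 'a, 'c, 'p, 'b, 'd) fun2 \<Rightarrow>
   ('p, 'b, 'd, 'o, 'a, 'c) fun2 \<Rightarrow> ('o \<Rightarrow> 'a) \<Rightarrow> ('p \<Rightarrow> 'b) \<Rightarrow> bool" where
  "adj2 C D F G \<eta> \<epsilon> \<longleftrightarrow>
     is_fun2 C D F \<and> is_fun2 D C G \<and>
     is_nat2 C C id_fun2 (G \<circ>\<^sub>2 F) \<eta> \<and> is_nat2 D D (F \<circ>\<^sub>2 G) id_fun2 \<epsilon> \<and>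
     (\<forall>X\<in>Ob C. \<epsilon> (fob F X) \<odot>\<^bsub>D\<^esub> farr F (\<eta> X) = Id1 D (fob F X)) \<and>
     (\<forall>Y\<in>Ob D. farr G (\<epsilon> Y) \<odot>\<^bsub>C\<^esub> \<eta> (fob G Y) = Id1 C (fob G Y))"


section \<open>Slices\<close>

text \<open>
  Objects of \<open>K/B\<close> are the arrows into \<open>B\<close>; \<open>(x, k, y)\<close> is \<open>k\<close> regarded as an arrow from \<open>x\<close> to \<open>y\<close>,
  and \<open>(x, \<alpha>, y)\<close> is \<open>\<alpha>\<close> regarded as a 2-cell between arrows from \<open>x\<close> to \<open>y\<close>.
\<close>

type_synonym 'a sarr = "'a \<times> 'a \<times> 'a"
type_synonym ('a, 'c) scell = "'a \<times> 'c \<times> 'a"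

definition mid :: "'x \<times> 'y \<times> 'z \<Rightarrow> 'y" where
  "mid u = fst (snd u)"

definition slice :: "('o, 'a, 'c) twocat \<Rightarrow> 'o \<Rightarrow> ('a, 'a sarr, ('a, 'c) scell) twocat" where
  "slice K B = \<lparr>
     Ob = {x \<in> Arr K. Cod K x = B},
     Arr = {(x, k, y). x \<in> Arr K \<and> y \<in> Arr K \<and> Cod K x = B \<and> Cod K y = B
              \<and> k \<in> hom1 K (Dom K x) (Dom K y) \<and> y \<odot>\<^bsub>K\<^esub> k = x},
     Cell = {(x, \<alpha>, y). x \<in> Arr K \<and> y \<in> Arr K \<and> Cod K x = B \<and> Cod K y = B
              \<and> \<alpha> \<in> Cell K \<and> Dom K (Src K \<alpha>) = Dom K x \<and> Cod K (Src K \<alpha>) = Dom K y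
              \<and> y \<rhd>\<^bsub>K\<^esub> \<alpha> = Id2 K x},
     Dom = (\<lambda>(x, k, y). x),
     Cod = (\<lambda>(x, k, y). y),
     Id1 = (\<lambda>x. (x, Id1 K (Dom K x), x)),
     Comp = (\<lambda>(y', l, z) (x, k, y). (x, l \<odot>\<^bsub>K\<^esub> k, z)),
     Src = (\<lambda>(x, \<alpha>, y). (x, Src K \<alpha>, y)),
     Tgt = (\<lambda>(x, \<alpha>, y). (x, Tgt K \<alpha>, y)),
     Id2 = (\<lambda>(x, k, y). (x, Id2 K k, y)),
     VComp = (\<lambda>(x', \<beta>, y') (x, \<alpha>, y). (x, \<beta> \<bullet>\<^bsub>K\<^esub> \<alpha>, y)),
     HComp = (\<lambda>(y', \<beta>, z) (x, \<alpha>, y). (x, \<beta> \<star>\<^bsub>K\<^esub> \<alpha>, z))\<rparr>"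


section \<open>Pullbacks and comma objects, with their 2-dimensional universal property\<close>

text \<open>\<open>p\<close> and \<open>q\<close> are the projections to the domains of \<open>f\<close> and \<open>g\<close>.\<close>

definition is_pullback :: "('o, 'a, 'c) twocat \<Rightarrow> 'a \<Rightarrow> 'a \<Rightarrow> 'a \<Rightarrow> 'a \<Rightarrow> bool" where
  "is_pullback K f g p q \<longleftrightarrow>
     f \<in> Arr K \<and> g \<in> Arr K \<and> Cod K f = Cod K g \<and>
     p \<in> Arr K \<and> q \<in> Arr K \<and> Dom K p = Dom K q \<and> Cod K p = Dom K f \<and> Cod K q = Dom K g \<and>
     f \<odot>\<^bsub>K\<^esub> p = g \<odot>\<^bsub>K\<^esub> q \<and>
     (\<forall>u\<in>Arr K. \<forall>v\<in>Arr K. Dom K u = Dom K v \<and> Cod K u = Dom K f \<and> Cod K v = Dom K g \<and>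
        f \<odot>\<^bsub>K\<^esub> u = g \<odot>\<^bsub>K\<^esub> v \<longrightarrow>
        (\<exists>!w. w \<in> hom1 K (Dom K u) (Dom K p) \<and> p \<odot>\<^bsub>K\<^esub> w = u \<and> q \<odot>\<^bsub>K\<^esub> w = v)) \<and>
     (\<forall>\<alpha>\<in>Cell K. \<forall>\<beta>\<in>Cell K. Dom K (Src K \<alpha>) = Dom K (Src K \<beta>) \<and>
        Cod K (Src K \<alpha>) = Dom K f \<and> Cod K (Src K \<beta>) = Dom K g \<and> f \<rhd>\<^bsub>K\<^esub> \<alpha> = g \<rhd>\<^bsub>K\<^esub> \<beta> \<longrightarrow>
        (\<exists>!\<gamma>. \<gamma> \<in> Cell K \<and> Cod K (Src K \<gamma>) = Dom K p \<and> p \<rhd>\<^bsub>K\<^esub> \<gamma> = \<alpha> \<and> q \<rhd>\<^bsub>K\<^esub> \<gamma> = \<beta>))"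

type_synonym 'a pbs = "'a \<Rightarrow> 'a \<Rightarrow> 'a \<times> 'a"

definition chosen_pullbacks :: "('o, 'a, 'c) twocat \<Rightarrow> 'a pbs \<Rightarrow> bool" where
  "chosen_pullbacks K pb \<longleftrightarrow> (\<forall>f\<in>Arr K. \<forall>g\<in>Arr K. Cod K f = Cod K g \<longrightarrow>
     is_pullback K f g (fst (pb f g)) (snd (pb f g)))"

definition pb_arr :: "('o, 'a, 'c) twocat \<Rightarrow> 'a pbs \<Rightarrow> 'a \<Rightarrow> 'a \<Rightarrow> 'a \<Rightarrow> 'a \<Rightarrow> 'a" where
  "pb_arr K pb f g u v = (THE w. w \<in> hom1 K (Dom K u) (Dom K (fst (pb f g)))
     \<and> fst (pb f g) \<odot>\<^bsub>K\<^esub> w = u \<and> snd (pb f g) \<odot>\<^bsub>K\<^esub> w = v)"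

definition pb_cell :: "('o, 'a, 'c) twocat \<Rightarrow> 'a pbs \<Rightarrow> 'a \<Rightarrow> 'a \<Rightarrow> 'c \<Rightarrow> 'c \<Rightarrow> 'c" where
  "pb_cell K pb f g \<alpha> \<beta> = (THE \<gamma>. \<gamma> \<in> Cell K \<and> Cod K (Src K \<gamma>) = Dom K (fst (pb f g))
     \<and> fst (pb f g) \<rhd>\<^bsub>K\<^esub> \<gamma> = \<alpha> \<and> snd (pb f g) \<rhd>\<^bsub>K\<^esub> \<gamma> = \<beta>)"

text \<open>The universal 2-cell of a comma object \<open>f \<down> g\<close> is \<open>\<lambda> : f d \<Rightarrow> g q\<close>.\<close>

definition is_comma :: "('o, 'a, 'c) twocat \<Rightarrow> 'a \<Rightarrow> 'a \<Rightarrow> 'a \<Rightarrow> 'a \<Rightarrow> 'c \<Rightarrow> bool" where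
  "is_comma K f g d q l \<longleftrightarrow>
     f \<in> Arr K \<and> g \<in> Arr K \<and> Cod K f = Cod K g \<and>
     d \<in> Arr K \<and> q \<in> Arr K \<and> Dom K d = Dom K q \<and> Cod K d = Dom K f \<and> Cod K q = Dom K g \<and>
     l \<in> hom2 K (f \<odot>\<^bsub>K\<^esub> d) (g \<odot>\<^bsub>K\<^esub> q) \<and>
     (\<forall>u\<in>Arr K. \<forall>v\<in>Arr K. Dom K u = Dom K v \<and> Cod K u = Dom K f \<and> Cod K v = Dom K g \<longrightarrow>
        (\<forall>\<beta>\<in>hom2 K (f \<odot>\<^bsub>K\<^esub> u) (g \<odot>\<^bsub>K\<^esub> v).
           \<exists>!w. w \<in> hom1 K (Dom K u) (Dom K d) \<and> d \<odot>\<^bsub>K\<^esub> w = u \<and> q \<odot>\<^bsub>K\<^esub> w = v \<and> l \<lhd>\<^bsub>K\<^esub> w = \<beta>)) \<and>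
     (\<forall>w\<in>Arr K. \<forall>w'\<in>Arr K. Dom K w = Dom K w' \<and> Cod K w = Dom K d \<and> Cod K w' = Dom K d \<longrightarrow>
        (\<forall>\<zeta>\<in>hom2 K (d \<odot>\<^bsub>K\<^esub> w) (d \<odot>\<^bsub>K\<^esub> w'). \<forall>\<xi>\<in>hom2 K (q \<odot>\<^bsub>K\<^esub> w) (q \<odot>\<^bsub>K\<^esub> w').
           (l \<lhd>\<^bsub>K\<^esub> w') \<bullet>\<^bsub>K\<^esub> (f \<rhd>\<^bsub>K\<^esub> \<zeta>) = (g \<rhd>\<^bsub>K\<^esub> \<xi>) \<bullet>\<^bsub>K\<^esub> (l \<lhd>\<^bsub>K\<^esub> w) \<longrightarrow>
           (\<exists>!\<theta>. \<theta> \<in> hom2 K w w' \<and> d \<rhd>\<^bsub>K\<^esub> \<theta> = \<zeta> \<and> q \<rhd>\<^bsub>K\<^esub> \<theta> = \<xi>)))"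

type_synonym ('a, 'c) commas = "'a \<Rightarrow> 'a \<Rightarrow> 'a \<times> 'a \<times> 'c"

definition chosen_commas :: "('o, 'a, 'c) twocat \<Rightarrow> ('a, 'c) commas \<Rightarrow> bool" where
  "chosen_commas K cm \<longleftrightarrow> (\<forall>f\<in>Arr K. \<forall>g\<in>Arr K. Cod K f = Cod K g \<longrightarrow>
     (case cm f g of (d, q, l) \<Rightarrow> is_comma K f g d q l))"

definition has_commas :: "('o, 'a, 'c) twocat \<Rightarrow> bool" where
  "has_commas K \<longleftrightarrow> (\<forall>f\<in>Arr K. \<forall>g\<in>Arr K. Cod K f = Cod K g \<longrightarrow> (\<exists>d q l. is_comma K f g d q l))"


section \<open>The 2-functors \<open>\<Sigma>\<close>, \<open>\<Delta>\<close>, \<open>\<Pi>\<close>\<close>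

type_synonym ('a, 'c) slice_fun =
  "('a, 'a sarr, ('a, 'c) scell, 'a, 'a sarr, ('a, 'c) scell) fun2"

definition Sig :: "('o, 'a, 'c) twocat \<Rightarrow> 'a \<Rightarrow> ('a, 'c) slice_fun" where
  "Sig K t = \<lparr>
     fob = (\<lambda>x. t \<odot>\<^bsub>K\<^esub> x),
     farr = (\<lambda>(x, k, y). (t \<odot>\<^bsub>K\<^esub> x, k, t \<odot>\<^bsub>K\<^esub> y)),
     fcell = (\<lambda>(x, \<alpha>, y). (t \<odot>\<^bsub>K\<^esub> x, \<alpha>, t \<odot>\<^bsub>K\<^esub> y))\<rparr>"

definition Del :: "('o, 'a, 'c) twocat \<Rightarrow> 'a pbs \<Rightarrow> 'a \<Rightarrow> ('a, 'c) slice_fun" where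
  "Del K pb f = \<lparr>
     fob = (\<lambda>x. fst (pb f x)),
     farr = (\<lambda>(x, k, y). (fst (pb f x), pb_arr K pb f y (fst (pb f x)) (k \<odot>\<^bsub>K\<^esub> snd (pb f x)), fst (pb f y))),
     fcell = (\<lambda>(x, \<alpha>, y). (fst (pb f x),
                pb_cell K pb f y (Id2 K (fst (pb f x))) (\<alpha> \<lhd>\<^bsub>K\<^esub> snd (pb f x)), fst (pb f y)))\<rparr>"

text \<open>The counit of \<open>\<Sigma>\<^sub>f \<stileturn> \<Delta>\<^sub>f\<close> at \<open>x\<close>: the projection from the pullback.\<close>

definition Sig_Del_counit :: "('o, 'a, 'c) twocat \<Rightarrow> 'a pbs \<Rightarrow> 'a \<Rightarrow> 'a \<Rightarrow> 'a sarr" where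
  "Sig_Del_counit K pb f x = (f \<odot>\<^bsub>K\<^esub> fst (pb f x), snd (pb f x), x)"

record ('a, 'c) radj =
  rfun :: "('a, 'c) slice_fun"
  runit :: "'a \<Rightarrow> 'a sarr"
  rcounit :: "'a \<Rightarrow> 'a sarr"

definition is_Pi :: "('o, 'a, 'c) twocat \<Rightarrow> 'a pbs \<Rightarrow> 'a \<Rightarrow> ('a, 'c) radj \<Rightarrow> bool" where
  "is_Pi K pb p R \<longleftrightarrow>
     adj2 (slice K (Cod K p)) (slice K (Dom K p)) (Del K pb p) (rfun R) (runit R) (rcounit R)"

definition exponentiable :: "('o, 'a, 'c) twocat \<Rightarrow> 'a pbs \<Rightarrow> 'a \<Rightarrow> bool" where
  "exponentiable K pb p \<longleftrightarrow> p \<in> Arr K \<and> (\<exists>R. is_Pi K pb p R)"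

definition chosen_Pi :: "('o, 'a, 'c) twocat \<Rightarrow> 'a pbs \<Rightarrow> ('a \<Rightarrow> ('a, 'c) radj) \<Rightarrow> bool" where
  "chosen_Pi K pb Pi \<longleftrightarrow> (\<forall>p. exponentiable K pb p \<longrightarrow> is_Pi K pb p (Pi p))"


section \<open>Polynomials\<close>

text \<open>\<open>I \<leftarrow> E \<rightarrow> B \<rightarrow> J\<close> with legs \<open>ps\<close>, \<open>pp\<close>, \<open>pt\<close>.\<close>

record 'a poly =
  ps :: 'a
  pp :: 'a
  pt :: 'a

definition polynomial :: "('o, 'a, 'c) twocat \<Rightarrow> 'a pbs \<Rightarrow> 'a poly \<Rightarrow> bool" where
  "polynomial K pb P \<longleftrightarrow> ps P \<in> Arr K \<and> pp P \<in> Arr K \<and> pt P \<in> Arr K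
     \<and> Dom K (ps P) = Dom K (pp P) \<and> Cod K (pp P) = Dom K (pt P) \<and> exponentiable K pb (pp P)"

definition poly_fun ::
  "('o, 'a, 'c) twocat \<Rightarrow> 'a pbs \<Rightarrow> ('a \<Rightarrow> ('a, 'c) radj) \<Rightarrow> 'a poly \<Rightarrow> ('a, 'c) slice_fun" where
  "poly_fun K pb Pi P = Sig K (pt P) \<circ>\<^sub>2 rfun (Pi (pp P)) \<circ>\<^sub>2 Del K pb (ps P)"

definition cart_poly_mor :: "('o, 'a, 'c) twocat \<Rightarrow> 'a poly \<Rightarrow> 'a poly \<Rightarrow> 'a \<Rightarrow> 'a \<Rightarrow> bool" where
  "cart_poly_mor K P Q f2 f1 \<longleftrightarrow>
     f2 \<in> hom1 K (Dom K (pp P)) (Dom K (pp Q)) \<and> f1 \<in> hom1 K (Cod K (pp P)) (Cod K (pp Q)) \<and>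
     ps Q \<odot>\<^bsub>K\<^esub> f2 = ps P \<and> pt Q \<odot>\<^bsub>K\<^esub> f1 = pt P \<and> is_pullback K (pp Q) f1 f2 (pp P)"

text \<open>For \<open>g f u = z v\<close>, the arrow into \<open>\<Delta>\<^sub>f \<Delta>\<^sub>g z\<close> induced by \<open>u\<close> and \<open>v\<close>.\<close>

definition pb_arr2 :: "('o, 'a, 'c) twocat \<Rightarrow> 'a pbs \<Rightarrow> 'a \<Rightarrow> 'a \<Rightarrow> 'a \<Rightarrow> 'a \<Rightarrow> 'a \<Rightarrow> 'a" where
  "pb_arr2 K pb f g z u v = pb_arr K pb f (fst (pb g z)) u (pb_arr K pb g z (f \<odot>\<^bsub>K\<^esub> u) v)"

text \<open>The canonical isomorphism \<open>\<Delta>\<^bsub>gf\<^esub> z \<cong> \<Delta>\<^sub>f \<Delta>\<^sub>g z\<close>.\<close>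

definition Del_comp :: "('o, 'a, 'c) twocat \<Rightarrow> 'a pbs \<Rightarrow> 'a \<Rightarrow> 'a \<Rightarrow> 'a \<Rightarrow> 'a sarr" where
  "Del_comp K pb g f z =
     (let h = g \<odot>\<^bsub>K\<^esub> f in
      (fst (pb h z), pb_arr2 K pb f g z (fst (pb h z)) (snd (pb h z)), fst (pb f (fst (pb g z)))))"

text \<open>For \<open>p\<^sub>2 f\<^sub>2 = f\<^sub>1 p\<^sub>1\<close>, the canonical isomorphism \<open>\<Delta>\<^bsub>p1\<^esub> \<Delta>\<^bsub>f1\<^esub> z \<cong> \<Delta>\<^bsub>f2\<^esub> \<Delta>\<^bsub>p2\<^esub> z\<close>.\<close>

definition Del_square :: "('o, 'a, 'c) twocat \<Rightarrow> 'a pbs \<Rightarrow> 'a \<Rightarrow> 'a \<Rightarrow> 'a \<Rightarrow> 'a \<Rightarrow> 'a \<Rightarrow> 'a sarr" where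
  "Del_square K pb p1 p2 f2 f1 z =
     (let x = fst (pb f1 z); u = fst (pb p1 x); v = snd (pb f1 z) \<odot>\<^bsub>K\<^esub> snd (pb p1 x) in
      (u, pb_arr2 K pb f2 p2 z u v, fst (pb f2 (fst (pb p2 z)))))"

text \<open>
  The Beck-Chevalley map \<open>\<Delta>\<^bsub>f1\<^esub> \<Pi>\<^bsub>p2\<^esub> y \<rightarrow> \<Pi>\<^bsub>p1\<^esub> \<Delta>\<^bsub>f2\<^esub> y\<close>, the mate of \<open>Del_square\<close>; it is invertible when the
  square is a pullback.
\<close>

definition beck_chevalley ::
  "('o, 'a, 'c) twocat \<Rightarrow> 'a pbs \<Rightarrow> ('a \<Rightarrow> ('a, 'c) radj) \<Rightarrow> 'a \<Rightarrow> 'a \<Rightarrow> 'a \<Rightarrow> 'a \<Rightarrow> 'a \<Rightarrow> 'a sarr" where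
  "beck_chevalley K pb Pi p1 p2 f2 f1 y =
     (let z = fob (rfun (Pi p2)) y;
          m = farr (Del K pb f2) (rcounit (Pi p2) y) \<odot>\<^bsub>slice K (Dom K p1)\<^esub> Del_square K pb p1 p2 f2 f1 z
      in farr (rfun (Pi p1)) m \<odot>\<^bsub>slice K (Cod K p1)\<^esub> runit (Pi p1) (fob (Del K pb f1) z))"

text \<open>
  The 2-natural transformation \<open>\<phi>\<close> of a cartesian morphism. The mate
  \<open>\<Sigma>\<^bsub>t1\<^esub> \<Delta>\<^bsub>f1\<^esub> \<rightarrow> \<Sigma>\<^bsub>t2\<^esub>\<close> of the identity \<open>\<Sigma>\<^bsub>t1\<^esub> = \<Sigma>\<^bsub>t2\<^esub> \<Sigma>\<^bsub>f1\<^esub>\<close> is \<open>\<Sigma>\<^bsub>t2\<^esub>\<close> of the counit of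
  \<open>\<Sigma>\<^bsub>f1\<^esub> \<stileturn> \<Delta>\<^bsub>f1\<^esub>\<close>.
\<close>

definition poly_nat ::
  "('o, 'a, 'c) twocat \<Rightarrow> 'a pbs \<Rightarrow> ('a \<Rightarrow> ('a, 'c) radj) \<Rightarrow> 'a poly \<Rightarrow> 'a poly \<Rightarrow> 'a \<Rightarrow> 'a
   \<Rightarrow> 'a \<Rightarrow> 'a sarr" where
  "poly_nat K pb Pi P Q f2 f1 x =
     (let y = fob (Del K pb (ps Q)) x;
          B1 = slice K (Cod K (pp P));
          J = slice K (Cod K (pt P));
          \<kappa> = farr (rfun (Pi (pp P))) (Del_comp K pb (ps Q) f2 x);
          \<beta> = arr_inv B1 (beck_chevalley K pb Pi (pp P) (pp Q) f2 f1 y);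
          \<mu> = farr (Sig K (pt Q)) (Sig_Del_counit K pb f1 (fob (rfun (Pi (pp Q))) y))
      in \<mu> \<odot>\<^bsub>J\<^esub> farr (Sig K (pt P)) (\<beta> \<odot>\<^bsub>B1\<^esub> \<kappa>))"


section \<open>Split fibrations\<close>

text \<open>
  A cleavage for \<open>f\<close> assigns to \<open>g\<close> and \<open>\<beta> : b \<Rightarrow> f g\<close> a 2-cell into \<open>g\<close> lying over \<open>\<beta>\<close>.
  The 2-cells \<open>\<beta>\<close> with \<open>g : X \<rightarrow> A\<close> are the lifting problems of the functor \<open>K(X, f)\<close>.
\<close>

type_synonym ('a, 'c) cleavage = "'a \<Rightarrow> 'c \<Rightarrow> 'c"

definition lift_problem :: "('o, 'a, 'c) twocat \<Rightarrow> 'a \<Rightarrow> 'a \<Rightarrow> 'c \<Rightarrow> bool" where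
  "lift_problem K f g \<beta> \<longleftrightarrow> g \<in> Arr K \<and> Cod K g = Dom K f \<and> \<beta> \<in> Cell K \<and> Tgt K \<beta> = f \<odot>\<^bsub>K\<^esub> g"

text \<open>\<open>\<sigma>\<close> is a cartesian arrow for the functor \<open>K(X, f)\<close>, where \<open>X\<close> is the 0-cell domain of \<open>\<sigma>\<close>.\<close>

definition cartesian_cell :: "('o, 'a, 'c) twocat \<Rightarrow> 'a \<Rightarrow> 'c \<Rightarrow> bool" where
  "cartesian_cell K f \<sigma> \<longleftrightarrow> \<sigma> \<in> Cell K \<and> Cod K (Src K \<sigma>) = Dom K f \<and>
     (\<forall>\<rho>\<in>Cell K. Tgt K \<rho> = Tgt K \<sigma> \<longrightarrow>
        (\<forall>\<delta>\<in>hom2 K (f \<odot>\<^bsub>K\<^esub> Src K \<rho>) (f \<odot>\<^bsub>K\<^esub> Src K \<sigma>). (f \<rhd>\<^bsub>K\<^esub> \<sigma>) \<bullet>\<^bsub>K\<^esub> \<delta> = f \<rhd>\<^bsub>K\<^esub> \<rho> \<longrightarrow>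
           (\<exists>!\<tau>. \<tau> \<in> hom2 K (Src K \<rho>) (Src K \<sigma>) \<and> f \<rhd>\<^bsub>K\<^esub> \<tau> = \<delta> \<and> \<sigma> \<bullet>\<^bsub>K\<^esub> \<tau> = \<rho>)))"

definition split_fib :: "('o, 'a, 'c) twocat \<Rightarrow> 'a \<Rightarrow> ('a, 'c) cleavage \<Rightarrow> bool" where
  "split_fib K f \<chi> \<longleftrightarrow> f \<in> Arr K \<and>
     (\<forall>g \<beta>. lift_problem K f g \<beta> \<longrightarrow>
        cartesian_cell K f (\<chi> g \<beta>) \<and> Tgt K (\<chi> g \<beta>) = g \<and> f \<rhd>\<^bsub>K\<^esub> \<chi> g \<beta> = \<beta>) \<and>
     (\<forall>g\<in>Arr K. Cod K g = Dom K f \<longrightarrow> \<chi> g (Id2 K (f \<odot>\<^bsub>K\<^esub> g)) = Id2 K g) \<and>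
     (\<forall>g \<beta>. lift_problem K f g \<beta> \<longrightarrow> (\<forall>\<gamma>\<in>Cell K. Tgt K \<gamma> = Src K \<beta> \<longrightarrow>
        \<chi> g (\<beta> \<bullet>\<^bsub>K\<^esub> \<gamma>) = \<chi> g \<beta> \<bullet>\<^bsub>K\<^esub> \<chi> (Src K (\<chi> g \<beta>)) \<gamma>)) \<and>
     (\<forall>g \<beta>. lift_problem K f g \<beta> \<longrightarrow> (\<forall>h\<in>Arr K. Cod K h = Dom K g \<longrightarrow>
        \<chi> g \<beta> \<lhd>\<^bsub>K\<^esub> h = \<chi> (g \<odot>\<^bsub>K\<^esub> h) (\<beta> \<lhd>\<^bsub>K\<^esub> h)))"

definition chosen_cells :: "('o, 'a, 'c) twocat \<Rightarrow> 'a \<Rightarrow> ('a, 'c) cleavage \<Rightarrow> 'c set" where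
  "chosen_cells K f \<chi> = {\<chi> g \<beta> | g \<beta>. lift_problem K f g \<beta>}"

definition split_fib_mor ::
  "('o, 'a, 'c) twocat \<Rightarrow> 'a \<Rightarrow> ('a, 'c) cleavage \<Rightarrow> 'a \<Rightarrow> ('a, 'c) cleavage \<Rightarrow> 'a \<Rightarrow> 'a \<Rightarrow> bool" where
  "split_fib_mor K f \<chi> g \<psi> u v \<longleftrightarrow>
     u \<in> hom1 K (Dom K f) (Dom K g) \<and> v \<in> hom1 K (Cod K f) (Cod K g) \<and> g \<odot>\<^bsub>K\<^esub> u = v \<odot>\<^bsub>K\<^esub> f \<and>
     (\<forall>\<sigma>\<in>chosen_cells K f \<chi>. u \<rhd>\<^bsub>K\<^esub> \<sigma> \<in> chosen_cells K g \<psi>)"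

definition split_opfib :: "('o, 'a, 'c) twocat \<Rightarrow> 'a \<Rightarrow> ('a, 'c) cleavage \<Rightarrow> bool" where
  "split_opfib K = split_fib (co K)"

definition split_opfib_mor ::
  "('o, 'a, 'c) twocat \<Rightarrow> 'a \<Rightarrow> ('a, 'c) cleavage \<Rightarrow> 'a \<Rightarrow> ('a, 'c) cleavage \<Rightarrow> 'a \<Rightarrow> 'a \<Rightarrow> bool" where
  "split_opfib_mor K = split_fib_mor (co K)"


section \<open>Strict algebras of a 2-monad\<close>

record ('o, 'a, 'c) monad2 =
  mfun :: "('o, 'a, 'c, 'o, 'a, 'c) fun2"
  munit :: "'o \<Rightarrow> 'a"
  mmult :: "'o \<Rightarrow> 'a"

definition is_alg :: "('o, 'a, 'c) twocat \<Rightarrow> ('o, 'a, 'c) monad2 \<Rightarrow> 'o \<times> 'a \<Rightarrow> bool" where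
  "is_alg C M A \<longleftrightarrow> (case A of (x, a) \<Rightarrow>
     x \<in> Ob C \<and> a \<in> hom1 C (fob (mfun M) x) x \<and> a \<odot>\<^bsub>C\<^esub> munit M x = Id1 C x
     \<and> a \<odot>\<^bsub>C\<^esub> mmult M x = a \<odot>\<^bsub>C\<^esub> farr (mfun M) a)"

definition is_alg_mor ::
  "('o, 'a, 'c) twocat \<Rightarrow> ('o, 'a, 'c) monad2 \<Rightarrow> 'o \<times> 'a \<Rightarrow> 'a \<Rightarrow> 'o \<times> 'a \<Rightarrow> bool" where
  "is_alg_mor C M A u A' \<longleftrightarrow> is_alg C M A \<and> is_alg C M A' \<and> u \<in> hom1 C (fst A) (fst A')
     \<and> u \<odot>\<^bsub>C\<^esub> snd A = snd A' \<odot>\<^bsub>C\<^esub> farr (mfun M) u"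

type_synonym ('o, 'a) alg = "'o \<times> 'a"
type_synonym ('o, 'a) alg_arr = "('o, 'a) alg \<times> 'a \<times> ('o, 'a) alg"
type_synonym ('o, 'a, 'c) alg_cell = "('o, 'a) alg \<times> 'c \<times> ('o, 'a) alg"

definition Alg ::
  "('o, 'a, 'c) twocat \<Rightarrow> ('o, 'a, 'c) monad2
   \<Rightarrow> (('o, 'a) alg, ('o, 'a) alg_arr, ('o, 'a, 'c) alg_cell) twocat" where
  "Alg C M = \<lparr>
     Ob = {A. is_alg C M A},
     Arr = {(A, u, A'). is_alg_mor C M A u A'},
     Cell = {(A, \<sigma>, A'). \<sigma> \<in> Cell C \<and> is_alg_mor C M A (Src C \<sigma>) A' \<and> is_alg_mor C M A (Tgt C \<sigma>) A'
               \<and> \<sigma> \<lhd>\<^bsub>C\<^esub> snd A = snd A' \<rhd>\<^bsub>C\<^esub> fcell (mfun M) \<sigma>},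
     Dom = (\<lambda>(A, u, A'). A),
     Cod = (\<lambda>(A, u, A'). A'),
     Id1 = (\<lambda>A. (A, Id1 C (fst A), A)),
     Comp = (\<lambda>(B, v, B') (A, u, A'). (A, v \<odot>\<^bsub>C\<^esub> u, B')),
     Src = (\<lambda>(A, \<sigma>, A'). (A, Src C \<sigma>, A')),
     Tgt = (\<lambda>(A, \<sigma>, A'). (A, Tgt C \<sigma>, A')),
     Id2 = (\<lambda>(A, u, A'). (A, Id2 C u, A')),
     VComp = (\<lambda>(B, \<tau>, B') (A, \<sigma>, A'). (A, \<tau> \<bullet>\<^bsub>C\<^esub> \<sigma>, A')),
     HComp = (\<lambda>(B, \<tau>, B') (A, \<sigma>, A'). (A, \<tau> \<star>\<^bsub>C\<^esub> \<sigma>, B'))\<rparr>"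

definition forget :: "(('o, 'a) alg, ('o, 'a) alg_arr, ('o, 'a, 'c) alg_cell, 'o, 'a, 'c) fun2" where
  "forget = \<lparr>fob = fst, farr = mid, fcell = mid\<rparr>"

text \<open>
  A 2-functor between 2-categories of algebras (resp. into one) over a given 2-functor \<open>F\<close> is
  determined by its action on objects.
\<close>

definition alg_lift ::
  "('o, 'a, 'c, 'p, 'b, 'd) fun2 \<Rightarrow> (('o, 'a) alg \<Rightarrow> ('p, 'b) alg)
   \<Rightarrow> (('o, 'a) alg, ('o, 'a) alg_arr, ('o, 'a, 'c) alg_cell,
       ('p, 'b) alg, ('p, 'b) alg_arr, ('p, 'b, 'd) alg_cell) fun2" where
  "alg_lift F G = \<lparr>
     fob = G,
     farr = (\<lambda>(A, u, A'). (G A, farr F u, G A')),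
     fcell = (\<lambda>(A, \<sigma>, A'). (G A, fcell F \<sigma>, G A'))\<rparr>"

definition alg_lift0 ::
  "('o, 'a, 'c) twocat \<Rightarrow> ('o, 'a, 'c, 'p, 'b, 'd) fun2 \<Rightarrow> ('o \<Rightarrow> ('p, 'b) alg)
   \<Rightarrow> ('o, 'a, 'c, ('p, 'b) alg, ('p, 'b) alg_arr, ('p, 'b, 'd) alg_cell) fun2" where
  "alg_lift0 C F G = \<lparr>
     fob = G,
     farr = (\<lambda>u. (G (Dom C u), farr F u, G (Cod C u))),
     fcell = (\<lambda>\<sigma>. (G (Dom C (Src C \<sigma>)), fcell F \<sigma>, G (Cod C (Src C \<sigma>))))\<rparr>"


section \<open>Street's 2-monad\<close>

text \<open>
  The comma object \<open>1\<^sub>B \<down> x\<close>, with projections \<open>cm_d\<close> to \<open>B\<close> and \<open>cm_q\<close> to the domain of \<open>x\<close> and universal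
  2-cell \<open>cm_l : cm_d \<Rightarrow> x cm_q\<close>.
\<close>

definition cm_d :: "('o, 'a, 'c) twocat \<Rightarrow> ('a, 'c) commas \<Rightarrow> 'o \<Rightarrow> 'a \<Rightarrow> 'a" where
  "cm_d K cm B x = fst (cm (Id1 K B) x)"

definition cm_q :: "('o, 'a, 'c) twocat \<Rightarrow> ('a, 'c) commas \<Rightarrow> 'o \<Rightarrow> 'a \<Rightarrow> 'a" where
  "cm_q K cm B x = fst (snd (cm (Id1 K B) x))"

definition cm_l :: "('o, 'a, 'c) twocat \<Rightarrow> ('a, 'c) commas \<Rightarrow> 'o \<Rightarrow> 'a \<Rightarrow> 'c" where
  "cm_l K cm B x = snd (snd (cm (Id1 K B) x))"

definition cm_arr :: "('o, 'a, 'c) twocat \<Rightarrow> ('a, 'c) commas \<Rightarrow> 'o \<Rightarrow> 'a \<Rightarrow> 'a \<Rightarrow> 'a \<Rightarrow> 'c \<Rightarrow> 'a" where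
  "cm_arr K cm B x u v \<beta> = (THE w. w \<in> hom1 K (Dom K u) (Dom K (cm_d K cm B x))
     \<and> cm_d K cm B x \<odot>\<^bsub>K\<^esub> w = u \<and> cm_q K cm B x \<odot>\<^bsub>K\<^esub> w = v \<and> cm_l K cm B x \<lhd>\<^bsub>K\<^esub> w = \<beta>)"

definition cm_cell ::
  "('o, 'a, 'c) twocat \<Rightarrow> ('a, 'c) commas \<Rightarrow> 'o \<Rightarrow> 'a \<Rightarrow> 'a \<Rightarrow> 'a \<Rightarrow> 'c \<Rightarrow> 'c \<Rightarrow> 'c" where
  "cm_cell K cm B x w w' \<zeta> \<xi> = (THE \<theta>. \<theta> \<in> hom2 K w w'
     \<and> cm_d K cm B x \<rhd>\<^bsub>K\<^esub> \<theta> = \<zeta> \<and> cm_q K cm B x \<rhd>\<^bsub>K\<^esub> \<theta> = \<xi>)"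

definition Phi_arr :: "('o, 'a, 'c) twocat \<Rightarrow> ('a, 'c) commas \<Rightarrow> 'o \<Rightarrow> 'a \<Rightarrow> 'a \<Rightarrow> 'a \<Rightarrow> 'a" where
  "Phi_arr K cm B x k y =
     cm_arr K cm B y (cm_d K cm B x) (k \<odot>\<^bsub>K\<^esub> cm_q K cm B x) (cm_l K cm B x)"

definition Phi :: "('o, 'a, 'c) twocat \<Rightarrow> ('a, 'c) commas \<Rightarrow> 'o \<Rightarrow> ('a, 'a sarr, ('a, 'c) scell) monad2" where
  "Phi K cm B = \<lparr>
     mfun = \<lparr>
       fob = cm_d K cm B,
       farr = (\<lambda>(x, k, y). (cm_d K cm B x, Phi_arr K cm B x k y, cm_d K cm B y)),
       fcell = (\<lambda>(x, \<alpha>, y). (cm_d K cm B x,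
                 cm_cell K cm B y (Phi_arr K cm B x (Src K \<alpha>) y) (Phi_arr K cm B x (Tgt K \<alpha>) y)
                   (Id2 K (cm_d K cm B x)) (\<alpha> \<lhd>\<^bsub>K\<^esub> cm_q K cm B x),
                 cm_d K cm B y))\<rparr>,
     munit = (\<lambda>x. (x, cm_arr K cm B x x (Id1 K (Dom K x)) (Id2 K x), cm_d K cm B x)),
     mmult = (\<lambda>x. let y = cm_d K cm B x in
                (cm_d K cm B y,
                 cm_arr K cm B x (cm_d K cm B y) (cm_q K cm B x \<odot>\<^bsub>K\<^esub> cm_q K cm B y)
                   ((cm_l K cm B x \<lhd>\<^bsub>K\<^esub> cm_q K cm B y) \<bullet>\<^bsub>K\<^esub> cm_l K cm B y),
                 y))\<rparr>"

definition PhiAlg ::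
  "('o, 'a, 'c) twocat \<Rightarrow> ('a, 'c) commas \<Rightarrow> 'o
   \<Rightarrow> (('a, 'a sarr) alg, ('a, 'a sarr) alg_arr, ('a, 'a sarr, ('a, 'c) scell) alg_cell) twocat" where
  "PhiAlg K cm B = Alg (slice K B) (Phi K cm B)"

text \<open>
  The identification of strict algebras with split fibrations. A cleavage \<open>\<chi>\<close> of \<open>x\<close> gives the action
  \<open>1\<^sub>B \<down> x \<rightarrow> x\<close> that is the domain of the chosen lift of the universal 2-cell. Conversely the chosen
  lift of \<open>\<beta> : b \<Rightarrow> x g\<close> is the image under the action of the 2-cell \<open>(b, g, \<beta>) \<Rightarrow> (x g, g, id)\<close> in
  \<open>1\<^sub>B \<down> x\<close> with components \<open>\<beta>\<close> and \<open>id\<^sub>g\<close>.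
\<close>

definition alg_of_fib ::
  "('o, 'a, 'c) twocat \<Rightarrow> ('a, 'c) commas \<Rightarrow> 'o \<Rightarrow> 'a \<Rightarrow> ('a, 'c) cleavage \<Rightarrow> ('a, 'a sarr) alg" where
  "alg_of_fib K cm B x \<chi> =
     (x, (cm_d K cm B x, Src K (\<chi> (cm_q K cm B x) (cm_l K cm B x)), x))"

definition fib_of_alg ::
  "('o, 'a, 'c) twocat \<Rightarrow> ('a, 'c) commas \<Rightarrow> 'o \<Rightarrow> ('a, 'a sarr) alg \<Rightarrow> ('a, 'c) cleavage" where
  "fib_of_alg K cm B A = (\<lambda>g \<beta>. let x = fst A in
     mid (snd A) \<rhd>\<^bsub>K\<^esub> cm_cell K cm B x (cm_arr K cm B x (Src K \<beta>) g \<beta>)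
                     (cm_arr K cm B x (x \<odot>\<^bsub>K\<^esub> g) g (Id2 K (x \<odot>\<^bsub>K\<^esub> g))) \<beta> (Id2 K g))"


section \<open>The lifts of \<open>\<Delta>\<close>, \<open>\<Sigma>\<close> and \<open>\<Pi>\<close>\<close>

type_synonym ('a, 'c) alg_fun =
  "(('a, 'a sarr) alg, ('a, 'a sarr) alg_arr, ('a, 'a sarr, ('a, 'c) scell) alg_cell,
    ('a, 'a sarr) alg, ('a, 'a sarr) alg_arr, ('a, 'a sarr, ('a, 'c) scell) alg_cell) fun2"

definition pb_cleavage ::
  "('o, 'a, 'c) twocat \<Rightarrow> 'a pbs \<Rightarrow> 'a \<Rightarrow> 'a \<Rightarrow> ('a, 'c) cleavage \<Rightarrow> ('a, 'c) cleavage" where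
  "pb_cleavage K pb s x \<chi> = (\<lambda>g \<beta>. pb_cell K pb s x \<beta> (\<chi> (snd (pb s x) \<odot>\<^bsub>K\<^esub> g) (s \<rhd>\<^bsub>K\<^esub> \<beta>)))"

definition comp_cleavage ::
  "('o, 'a, 'c) twocat \<Rightarrow> ('a, 'c) cleavage \<Rightarrow> 'a \<Rightarrow> ('a, 'c) cleavage \<Rightarrow> ('a, 'c) cleavage" where
  "comp_cleavage K \<chi>t x \<chi> = (\<lambda>g \<beta>. \<chi> g (\<chi>t (x \<odot>\<^bsub>K\<^esub> g) \<beta>))"

definition DelBar ::
  "('o, 'a, 'c) twocat \<Rightarrow> 'a pbs \<Rightarrow> ('a, 'c) commas \<Rightarrow> 'a \<Rightarrow> ('a, 'c) alg_fun" where
  "DelBar K pb cm s = alg_lift (Del K pb s)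
     (\<lambda>A. alg_of_fib K cm (Dom K s) (fob (Del K pb s) (fst A))
            (pb_cleavage K pb s (fst A) (fib_of_alg K cm (Cod K s) A)))"

definition SigBar ::
  "('o, 'a, 'c) twocat \<Rightarrow> ('a, 'c) commas \<Rightarrow> 'a \<Rightarrow> ('a, 'c) cleavage \<Rightarrow> ('a, 'c) alg_fun" where
  "SigBar K cm t \<chi>t = alg_lift (Sig K t)
     (\<lambda>A. alg_of_fib K cm (Cod K t) (fob (Sig K t) (fst A))
            (comp_cleavage K \<chi>t (fst A) (fib_of_alg K cm (Dom K t) A)))"

text \<open>
  The action \<open>(k, \<gamma>) \<mapsto> (k\<^sub>2, \<gamma>\<^sub>2)\<close> of the extension of \<open>\<Delta>\<^sub>p\<close> on an arrow \<open>(k, \<gamma>)\<close> from \<open>x\<close> to \<open>y\<close> of the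
  Kleisli 2-category; \<open>\<chi>\<close> is the split opcleavage of \<open>p\<close>.
\<close>

definition kl_Del ::
  "('o, 'a, 'c) twocat \<Rightarrow> 'a pbs \<Rightarrow> 'a \<Rightarrow> ('a, 'c) cleavage \<Rightarrow> 'a \<Rightarrow> 'a \<Rightarrow> 'a \<times> 'c \<Rightarrow> 'a \<times> 'c" where
  "kl_Del K pb p \<chi> x y = (\<lambda>(k, \<gamma>).
     let \<gamma>2 = \<chi> (fst (pb p x)) (\<gamma> \<lhd>\<^bsub>K\<^esub> snd (pb p x))
     in (pb_arr K pb p y (Tgt K \<gamma>2) (k \<odot>\<^bsub>K\<^esub> snd (pb p x)), \<gamma>2))"

text \<open>The arrow \<open>x \<rightarrow> \<Phi>\<^sub>B y\<close> of \<open>K/B\<close> corresponding to a Kleisli arrow \<open>(k, \<gamma>)\<close> from \<open>x\<close> to \<open>y\<close>.\<close>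

definition kl_arr ::
  "('o, 'a, 'c) twocat \<Rightarrow> ('a, 'c) commas \<Rightarrow> 'o \<Rightarrow> 'a \<Rightarrow> 'a \<Rightarrow> 'a \<times> 'c \<Rightarrow> 'a sarr" where
  "kl_arr K cm B x y = (\<lambda>(k, \<gamma>). (x, cm_arr K cm B y x k \<gamma>, cm_d K cm B y))"

text \<open>
  The colax structure \<open>\<Delta>\<^sub>p \<Phi>\<^sub>B y \<rightarrow> \<Phi>\<^sub>E \<Delta>\<^sub>p y\<close> is the extension of \<open>\<Delta>\<^sub>p\<close> applied to the Kleisli arrow from
  \<open>\<Phi>\<^sub>B y\<close> to \<open>y\<close> given by the identity of \<open>\<Phi>\<^sub>B y\<close>.
\<close>

definition Del_colax ::
  "('o, 'a, 'c) twocat \<Rightarrow> 'a pbs \<Rightarrow> ('a, 'c) commas \<Rightarrow> 'a \<Rightarrow> ('a, 'c) cleavage \<Rightarrow> 'a \<Rightarrow> 'a sarr" where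
  "Del_colax K pb cm p \<chi> y =
     (let B = Cod K p; z = cm_d K cm B y in
      kl_arr K cm (Dom K p) (fob (Del K pb p) z) (fob (Del K pb p) y)
        (kl_Del K pb p \<chi> z y (cm_q K cm B y, cm_l K cm B y)))"

text \<open>Its mate \<open>\<Phi>\<^sub>B \<Pi>\<^sub>p x \<rightarrow> \<Pi>\<^sub>p \<Phi>\<^sub>E x\<close>.\<close>

definition Pi_lax ::
  "('o, 'a, 'c) twocat \<Rightarrow> 'a pbs \<Rightarrow> ('a, 'c) commas \<Rightarrow> ('a \<Rightarrow> ('a, 'c) radj) \<Rightarrow> 'a
   \<Rightarrow> ('a, 'c) cleavage \<Rightarrow> 'a \<Rightarrow> 'a sarr" where
  "Pi_lax K pb cm Pi p \<chi> x =
     (let SB = slice K (Cod K p); R = Pi p; y = fob (rfun R) x in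
      farr (rfun R) (farr (mfun (Phi K cm (Dom K p))) (rcounit R x))
        \<odot>\<^bsub>SB\<^esub> (farr (rfun R) (Del_colax K pb cm p \<chi> y)
        \<odot>\<^bsub>SB\<^esub> runit R (fob (mfun (Phi K cm (Cod K p))) y)))"

definition PiBar ::
  "('o, 'a, 'c) twocat \<Rightarrow> 'a pbs \<Rightarrow> ('a, 'c) commas \<Rightarrow> ('a \<Rightarrow> ('a, 'c) radj) \<Rightarrow> 'a
   \<Rightarrow> ('a, 'c) cleavage \<Rightarrow> ('a, 'c) alg_fun" where
  "PiBar K pb cm Pi p \<chi> = alg_lift (rfun (Pi p))
     (\<lambda>A. (fob (rfun (Pi p)) (fst A),
           farr (rfun (Pi p)) (snd A) \<odot>\<^bsub>slice K (Cod K p)\<^esub> Pi_lax K pb cm Pi p \<chi> (fst A)))"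

text \<open>\<open>\<chi>p\<close> and \<open>\<chi>t\<close> are the split opcleavage of \<open>p\<close> and the split cleavage of \<open>t\<close>.\<close>

definition poly_bar ::
  "('o, 'a, 'c) twocat \<Rightarrow> 'a pbs \<Rightarrow> ('a, 'c) commas \<Rightarrow> ('a \<Rightarrow> ('a, 'c) radj) \<Rightarrow> 'a poly
   \<Rightarrow> ('a, 'c) cleavage \<Rightarrow> ('a, 'c) cleavage \<Rightarrow> ('a, 'c) alg_fun" where
  "poly_bar K pb cm Pi P \<chi>p \<chi>t =
     SigBar K cm (pt P) \<chi>t \<circ>\<^sub>2 PiBar K pb cm Pi (pp P) \<chi>p \<circ>\<^sub>2 DelBar K pb cm (ps P)"


section \<open>Familial 2-functors and familial 2-natural transformations\<close>

text \<open>For a terminal object \<open>one\<close> of \<open>A\<close>, the 2-functor \<open>T\<^sub>1 : A \<rightarrow> L/T1\<close>.\<close>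

definition fun_at_one ::
  "('o, 'a, 'c) twocat \<Rightarrow> 'o \<Rightarrow> ('o, 'a, 'c, 'p, 'b, 'd) fun2
   \<Rightarrow> ('o, 'a, 'c, 'b, 'b sarr, ('b, 'd) scell) fun2" where
  "fun_at_one A one T = \<lparr>
     fob = (\<lambda>X. farr T (bang A one X)),
     farr = (\<lambda>f. (farr T (bang A one (Dom A f)), farr T f, farr T (bang A one (Cod A f)))),
     fcell = (\<lambda>\<alpha>. (farr T (bang A one (Dom A (Src A \<alpha>))), fcell T \<alpha>,
                   farr T (bang A one (Cod A (Src A \<alpha>)))))\<rparr>"

definition familial_fun ::
  "('o, 'a, 'c) twocat \<Rightarrow> ('p, 'b, 'd) twocat \<Rightarrow> ('b, 'd) commas \<Rightarrow> 'o \<Rightarrow> ('o, 'a, 'c, 'p, 'b, 'd) fun2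
   \<Rightarrow> ('o, 'a, 'c, ('b, 'b sarr) alg, ('b, 'b sarr) alg_arr, ('b, 'b sarr, ('b, 'd) scell) alg_cell) fun2
   \<Rightarrow> bool" where
  "familial_fun A L cm one T Tbar \<longleftrightarrow>
     two_category A \<and> two_category L \<and> has_commas A \<and> chosen_commas L cm \<and> terminal_ob A one \<and>
     is_fun2 A L T \<and>
     (\<exists>F \<eta> \<epsilon>. adj2 (slice L (fob T one)) A F (fun_at_one A one T) \<eta> \<epsilon>) \<and>
     is_fun2 A (PhiAlg L cm (fob T one)) Tbar \<and>
     fun2_eq A (forget \<circ>\<^sub>2 Tbar) (fun_at_one A one T)"

definition familial_nat ::
  "('o, 'a, 'c) twocat \<Rightarrow> ('p, 'b, 'd) twocat \<Rightarrow> ('b, 'd) commas \<Rightarrow> 'o \<Rightarrow> ('o, 'a, 'c, 'p, 'b, 'd) fun2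
   \<Rightarrow> ('o, 'a, 'c, ('b, 'b sarr) alg, ('b, 'b sarr) alg_arr, ('b, 'b sarr, ('b, 'd) scell) alg_cell) fun2
   \<Rightarrow> ('o, 'a, 'c, 'p, 'b, 'd) fun2
   \<Rightarrow> ('o, 'a, 'c, ('b, 'b sarr) alg, ('b, 'b sarr) alg_arr, ('b, 'b sarr, ('b, 'd) scell) alg_cell) fun2
   \<Rightarrow> ('o \<Rightarrow> 'b) \<Rightarrow> bool" where
  "familial_nat A L cm one S Sbar T Tbar \<alpha> \<longleftrightarrow>
     familial_fun A L cm one S Sbar \<and> familial_fun A L cm one T Tbar \<and> is_nat2 A L S T \<alpha> \<and>
     (\<forall>f\<in>Arr A. is_pullback L (farr T f) (\<alpha> (Cod A f)) (\<alpha> (Dom A f)) (farr S f)) \<and>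
     (\<forall>X\<in>Ob A. split_fib_mor L
        (farr S (bang A one X)) (fib_of_alg L cm (fob S one) (fob Sbar X))
        (farr T (bang A one X)) (fib_of_alg L cm (fob T one) (fob Tbar X))
        (\<alpha> X) (\<alpha> one))"

text \<open>
  Every arrow \<open>x\<close> into a discrete object is uniquely a split fibration: all lifting problems are identities.
\<close>

definition disc_alg :: "('o, 'a, 'c) twocat \<Rightarrow> ('a, 'c) commas \<Rightarrow> 'o \<Rightarrow> 'a \<Rightarrow> ('a, 'a sarr) alg" where
  "disc_alg K cm I x = alg_of_fib K cm I x (\<lambda>g \<beta>. Id2 K g)"

text \<open>
  Let \<open>f : A \<rightarrow> M\<close> be an arrow and \<open>m : M \<rightarrow> B\<close> an isomorphism over \<open>J\<close>. A cleavage \<open>\<chi>\<close> of \<open>m f\<close> in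
  \<open>K\<close> is regarded as a cleavage of \<open>f\<close> in \<open>K/J\<close>. Since \<open>m\<close> is invertible, the lifts of \<open>\<beta>\<close> along \<open>f\<close>
  are the lifts of \<open>m \<beta>\<close> along \<open>m f\<close>.
\<close>

definition slice_cleavage ::
  "('o, 'a, 'c) twocat \<Rightarrow> 'a \<Rightarrow> ('a, 'c) cleavage \<Rightarrow> ('a sarr, ('a, 'c) scell) cleavage" where
  "slice_cleavage K m \<chi> = (\<lambda>(y, g, z) (y', \<beta>, z'). (y, \<chi> g (m \<rhd>\<^bsub>K\<^esub> \<beta>), z))"

text \<open>
  The familial structure of a polynomial 2-functor \<open>P\<close> with discrete \<open>I\<close>. Here \<open>P1 = t m\<close> with
  \<open>m = \<Pi>\<^sub>p \<Delta>\<^sub>s (1\<^sub>I)\<close>, which is invertible, being terminal in \<open>K/B\<close>; it is the identity when the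
  2-functors \<open>\<Delta>\<^sub>s\<close> and \<open>\<Pi>\<^sub>p\<close> are chosen to preserve identities, and then \<open>P1 = t\<close>.
\<close>

definition poly_bar1 ::
  "('o, 'a, 'c) twocat \<Rightarrow> 'a pbs \<Rightarrow> ('a, 'c) commas \<Rightarrow> ('a sarr, ('a, 'c) scell) commas
   \<Rightarrow> ('a \<Rightarrow> ('a, 'c) radj) \<Rightarrow> 'a poly \<Rightarrow> ('a, 'c) cleavage
   \<Rightarrow> ('a, 'a sarr, ('a, 'c) scell, ('a sarr, 'a sarr sarr) alg, ('a sarr, 'a sarr sarr) alg_arr,
       ('a sarr, 'a sarr sarr, ('a sarr, ('a, 'c) scell) scell) alg_cell) fun2" where
  "poly_bar1 K pb cm cmJ Pi P \<chi>p =
     (let I = Cod K (ps P); B = Cod K (pp P); J = Cod K (pt P); one = Id1 K I;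
          T = poly_fun K pb Pi P;
          T1 = fun_at_one (slice K I) one T;
          m = fob (rfun (Pi (pp P))) (fob (Del K pb (ps P)) one)
      in alg_lift0 (slice K I) T1
           (\<lambda>x. alg_of_fib (slice K J) cmJ (fob T one) (fob T1 x)
                  (slice_cleavage K m
                    (fib_of_alg K cm B
                      (fob (PiBar K pb cm Pi (pp P) \<chi>p \<circ>\<^sub>2 DelBar K pb cm (ps P)) (disc_alg K cm I x))))))"

end

theory Submission
  imports Defs
begin

text \<open>
  All constructions are computed on generalized elements. Let x be an arrow into B. An arrow
  \<open>1\<^sub>B \<down> x \<rightarrow> x\<close> is determined by its effect on pairs of an element v of
  the domain of x and a 2-cell \<beta> : b \<Rightarrow> x v, and so an algebra A on x is an operation
  act B A v \<beta>, an element over b, natural under restriction, with \<open>act v id = v\<close> and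
  \<open>act v (\<beta> \<bullet> \<gamma>) = act (act v \<beta>) \<gamma>\<close> (is_alg_action). Under
  the identification of algebras with split fibrations it is the domain of the chosen lift of \<beta>
  (split_fib_of_alg, alg_of_fib, fib_of_alg_of_fib). Morphisms are the arrows commuting with act, and all
  2-cells of the slice between them are 2-cells of algebras (alg_cell). To lift a 2-functor or a 2-natural
  transformation is therefore to lift its values on objects and to check that the arrows involved commute
  with act.

  The lift exists because \<open>\<Delta>\<^sub>s\<close>, \<open>\<Pi>\<^sub>p\<close> and
  \<open>\<Sigma>\<^sub>t\<close> lift separately. For \<Delta> and \<Sigma> these are the pullback and the
  composite of split fibrations. For \<open>\<Pi>\<^sub>p\<close>, an element v of
  \<open>\<Pi>\<^sub>p x\<close> over b is the family of its values ev x e v, one for each e with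
  \<open>p e = b\<close>. The mate formula for the lift says that the action at \<beta> is computed by
  pushing e forward along the chosen opcartesian lift \<chi> e \<beta>, evaluating v at the codomain of this
  lift, and acting on the value by the lift (pact_ev). The two laws for act on
  \<open>\<Pi>\<^sub>p x\<close> follow from those on x and from the splitness of the opcleavage.

  The transformation \<phi> is an inverse Beck-Chevalley map after \<Pi> of an isomorphism
  \<Delta> \<cong> \<Delta> \<Delta>, followed by a counit of \<Sigma> \<stileturn> \<Delta>. The
  Beck-Chevalley map reindexes evaluation along \<open>f\<^sub>2\<close> (BC_ev); it commutes with the
  actions because \<open>f\<^sub>2\<close> preserves chosen opcartesian cells (BC_algmor), and it is
  invertible because an e of the second polynomial over an element in the image of \<open>f\<^sub>1\<close>
  comes from a unique element of the first one (BC_inverse_ex). The counit commutes with the actions because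
  \<open>f\<^sub>1\<close> preserves the chosen cells of the fibrations t (counit_algmor).

  Now let I be discrete. The 2-functor \<open>\<Pi>\<^sub>p \<Delta>\<^sub>s\<close> has the left 2-adjoint
  \<open>\<Sigma>\<^sub>s \<Delta>\<^sub>p\<close>, and it sends \<open>1\<^sub>I\<close> to an isomorphism
  m onto B. Composition with m embeds the slice of K/J over \<open>P1 = t m\<close> fully faithfully into
  K/B, so that the adjunction restricts to one for \<open>P\<^sub>1\<close> (T1_left_adjoint), and a
  cleavage of m f in K is one of f in K/J (slice_split_fib). The naturality squares of \<phi> are pullbacks,
  since those of the counit of \<Sigma> \<stileturn> \<Delta> are (Del_counit_pullback) and the other factor
  of \<phi> is invertible. That \<phi> preserves the chosen cells is the compatibility with the actions over
  B already established for the lift.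
\<close>

section \<open>Calculus in a 2-category\<close>

text \<open>
  2-cells are written in the normal form of a vertical composite of whiskered cells, with 1-cells associated
  to the right. The reassociation lemmas apply an equation \<open>g f = k\<close> inside a right-nested
  composite.
\<close>

context two_category
begin

lemma Arr_ends [simp]: "f \<in> Arr K \<Longrightarrow> Dom K f \<in> Ob K" "f \<in> Arr K \<Longrightarrow> Cod K f \<in> Ob K"
  by (simp_all add: Dom_closed Cod_closed)

lemma Id1_simps [simp]:
  assumes "X \<in> Ob K"
  shows "Id1 K X \<in> Arr K" "Dom K (Id1 K X) = X" "Cod K (Id1 K X) = X"
  using Id1_hom[OF assms] by (simp_all add: hom1_def)

lemma Comp_simps [simp]:
  assumes "f \<in> Arr K" "g \<in> Arr K" "Dom K g = Cod K f"
  shows "g \<odot> f \<in> Arr K" "Dom K (g \<odot> f) = Dom K f" "Cod K (g \<odot> f) = Cod K g"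
  using Comp_hom[OF assms] by (simp_all add: hom1_def)

lemma Comp_Id1' [simp]: "\<lbrakk>f \<in> Arr K; X = Dom K f\<rbrakk> \<Longrightarrow> f \<odot> Id1 K X = f"
  by (simp add: Comp_Id1)

lemma Id1_Comp' [simp]: "\<lbrakk>f \<in> Arr K; X = Cod K f\<rbrakk> \<Longrightarrow> Id1 K X \<odot> f = f"
  by (simp add: Id1_Comp)

lemma Comp_assoc' [simp]:
  "\<lbrakk>f \<in> Arr K; g \<in> Arr K; h \<in> Arr K; Dom K g = Cod K f; Dom K h = Cod K g\<rbrakk>
    \<Longrightarrow> (h \<odot> g) \<odot> f = h \<odot> (g \<odot> f)"
  by (simp add: Comp_assoc)

lemma Comp_reassoc:
  assumes "g \<odot> f = k" "f \<in> Arr K" "g \<in> Arr K" "Dom K g = Cod K f" "h \<in> Arr K" "Cod K h = Dom K f"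
  shows "g \<odot> (f \<odot> h) = k \<odot> h"
  using assms by (metis Comp_assoc)

lemma Cell_ends [simp]:
  assumes "\<alpha> \<in> Cell K"
  shows "Src K \<alpha> \<in> Arr K" "Tgt K \<alpha> \<in> Arr K" "Dom K (Tgt K \<alpha>) = Dom K (Src K \<alpha>)"
    "Cod K (Tgt K \<alpha>) = Cod K (Src K \<alpha>)"
  using assms by (simp_all add: Src_Arr Tgt_Arr Dom_Tgt Cod_Tgt)

lemma Id2_simps [simp]:
  assumes "f \<in> Arr K"
  shows "Id2 K f \<in> Cell K" "Src K (Id2 K f) = f" "Tgt K (Id2 K f) = f"
  using Id2_hom[OF assms] by (simp_all add: hom2_def)

lemma VComp_simps [simp]:
  assumes "\<alpha> \<in> Cell K" "\<beta> \<in> Cell K" "Src K \<beta> = Tgt K \<alpha>"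
  shows "\<beta> \<bullet> \<alpha> \<in> Cell K" "Src K (\<beta> \<bullet> \<alpha>) = Src K \<alpha>" "Tgt K (\<beta> \<bullet> \<alpha>) = Tgt K \<beta>"
  using VComp_hom[OF assms] by (simp_all add: hom2_def)

lemma VComp_Id2' [simp]: "\<lbrakk>\<alpha> \<in> Cell K; f = Src K \<alpha>\<rbrakk> \<Longrightarrow> \<alpha> \<bullet> Id2 K f = \<alpha>"
  by (simp add: VComp_Id2)

lemma Id2_VComp' [simp]: "\<lbrakk>\<alpha> \<in> Cell K; f = Tgt K \<alpha>\<rbrakk> \<Longrightarrow> Id2 K f \<bullet> \<alpha> = \<alpha>"
  by (simp add: Id2_VComp)

lemma VComp_assoc' [simp]:
  "\<lbrakk>\<alpha> \<in> Cell K; \<beta> \<in> Cell K; \<gamma> \<in> Cell K; Src K \<beta> = Tgt K \<alpha>; Src K \<gamma> = Tgt K \<beta>\<rbrakk>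
        \<Longrightarrow> (\<gamma> \<bullet> \<beta>) \<bullet> \<alpha> = \<gamma> \<bullet> (\<beta> \<bullet> \<alpha>)"
  by (simp add: VComp_assoc)

lemma HComp_simps [simp]:
  assumes "\<alpha> \<in> Cell K" "\<beta> \<in> Cell K" "Dom K (Src K \<beta>) = Cod K (Src K \<alpha>)"
  shows "\<beta> \<star> \<alpha> \<in> Cell K" "Src K (\<beta> \<star> \<alpha>) = Src K \<beta> \<odot> Src K \<alpha>" "Tgt K (\<beta> \<star> \<alpha>) = Tgt K \<beta> \<odot> Tgt K \<alpha>"
  using HComp_hom[OF assms] by (simp_all add: hom2_def)

lemma whisker_l_simps [simp]:
  assumes "f \<in> Arr K" "\<alpha> \<in> Cell K" "Dom K f = Cod K (Src K \<alpha>)"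
  shows "f \<rhd> \<alpha> \<in> Cell K" "Src K (f \<rhd> \<alpha>) = f \<odot> Src K \<alpha>" "Tgt K (f \<rhd> \<alpha>) = f \<odot> Tgt K \<alpha>"
  using assms by (simp_all add: whisker_l_def)

lemma whisker_r_simps [simp]:
  assumes "f \<in> Arr K" "\<alpha> \<in> Cell K" "Cod K f = Dom K (Src K \<alpha>)"
  shows "\<alpha> \<lhd> f \<in> Cell K" "Src K (\<alpha> \<lhd> f) = Src K \<alpha> \<odot> f" "Tgt K (\<alpha> \<lhd> f) = Tgt K \<alpha> \<odot> f"
  using assms by (simp_all add: whisker_r_def)

lemma whisker_Id2 [simp]:
  assumes "f \<in> Arr K" "g \<in> Arr K" "Dom K g = Cod K f"
  shows "g \<rhd> Id2 K f = Id2 K (g \<odot> f)" "Id2 K g \<lhd> f = Id2 K (g \<odot> f)"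
  using assms by (simp_all add: whisker_l_def whisker_r_def HComp_Id2)

lemma whisker_Id1 [simp]:
  "\<lbrakk>\<alpha> \<in> Cell K; X = Cod K (Src K \<alpha>)\<rbrakk> \<Longrightarrow> Id1 K X \<rhd> \<alpha> = \<alpha>"
  "\<lbrakk>\<alpha> \<in> Cell K; X = Dom K (Src K \<alpha>)\<rbrakk> \<Longrightarrow> \<alpha> \<lhd> Id1 K X = \<alpha>"
  by (simp_all add: whisker_l_def whisker_r_def HComp_Id Id_HComp)

lemma whisker_Comp [simp]:
  "\<lbrakk>f \<in> Arr K; g \<in> Arr K; \<alpha> \<in> Cell K; Dom K g = Cod K f; Dom K f = Cod K (Src K \<alpha>)\<rbrakk>
     \<Longrightarrow> (g \<odot> f) \<rhd> \<alpha> = g \<rhd> (f \<rhd> \<alpha>)"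
  "\<lbrakk>f \<in> Arr K; g \<in> Arr K; \<alpha> \<in> Cell K; Dom K g = Cod K f; Cod K g = Dom K (Src K \<alpha>)\<rbrakk>
     \<Longrightarrow> \<alpha> \<lhd> (g \<odot> f) = (\<alpha> \<lhd> g) \<lhd> f"
  "\<lbrakk>f \<in> Arr K; g \<in> Arr K; \<alpha> \<in> Cell K; Dom K (Src K \<alpha>) = Cod K f; Dom K g = Cod K (Src K \<alpha>)\<rbrakk>
     \<Longrightarrow> (g \<rhd> \<alpha>) \<lhd> f = g \<rhd> (\<alpha> \<lhd> f)"
  by (simp_all add: whisker_l_def whisker_r_def HComp_assoc flip: HComp_Id2)

lemma whisker_VComp [simp]:
  "\<lbrakk>f \<in> Arr K; \<alpha> \<in> Cell K; \<beta> \<in> Cell K; Src K \<beta> = Tgt K \<alpha>; Dom K f = Cod K (Src K \<alpha>)\<rbrakk>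
     \<Longrightarrow> f \<rhd> (\<beta> \<bullet> \<alpha>) = (f \<rhd> \<beta>) \<bullet> (f \<rhd> \<alpha>)"
  "\<lbrakk>f \<in> Arr K; \<alpha> \<in> Cell K; \<beta> \<in> Cell K; Src K \<beta> = Tgt K \<alpha>; Cod K f = Dom K (Src K \<alpha>)\<rbrakk>
     \<Longrightarrow> (\<beta> \<bullet> \<alpha>) \<lhd> f = (\<beta> \<lhd> f) \<bullet> (\<alpha> \<lhd> f)"
  using interchange[of \<alpha> \<beta> "Id2 K f" "Id2 K f"] interchange[of "Id2 K f" "Id2 K f" \<alpha> \<beta>]
  by (simp_all add: whisker_l_def whisker_r_def)

lemma HComp_whisker:
  assumes "\<alpha> \<in> Cell K" "\<beta> \<in> Cell K" "Dom K (Src K \<beta>) = Cod K (Src K \<alpha>)"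
  shows "\<beta> \<star> \<alpha> = (\<beta> \<lhd> Tgt K \<alpha>) \<bullet> (Src K \<beta> \<rhd> \<alpha>)" "\<beta> \<star> \<alpha> = (Tgt K \<beta> \<rhd> \<alpha>) \<bullet> (\<beta> \<lhd> Src K \<alpha>)"
  using interchange[of \<alpha> "Id2 K (Tgt K \<alpha>)" "Id2 K (Src K \<beta>)" \<beta>]
    interchange[of "Id2 K (Src K \<alpha>)" \<alpha> \<beta> "Id2 K (Tgt K \<beta>)"] assms
  by (simp_all add: whisker_l_def whisker_r_def)

text \<open>
  The two ways of pasting horizontally adjacent cells; naturality of a cell with respect to another one.
\<close>

lemma exchange:
  assumes "\<alpha> \<in> Cell K" "\<beta> \<in> Cell K" "Dom K (Src K \<beta>) = Cod K (Src K \<alpha>)"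
  shows "(\<beta> \<lhd> Tgt K \<alpha>) \<bullet> (Src K \<beta> \<rhd> \<alpha>) = (Tgt K \<beta> \<rhd> \<alpha>) \<bullet> (\<beta> \<lhd> Src K \<alpha>)"
  using HComp_whisker[OF assms] by simp

lemma whisker_l_reassoc:
  assumes "g \<odot> f = k" "f \<in> Arr K" "g \<in> Arr K" "Dom K g = Cod K f" "\<alpha> \<in> Cell K" "Cod K (Src K \<alpha>) = Dom K f"
  shows "g \<rhd> (f \<rhd> \<alpha>) = k \<rhd> \<alpha>"
  using assms by (metis whisker_Comp(1))

lemma whisker_r_reassoc:
  assumes "g \<odot> f = k" "f \<in> Arr K" "g \<in> Arr K" "Dom K g = Cod K f" "\<alpha> \<in> Cell K" "Dom K (Src K \<alpha>) = Cod K g"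
  shows "(\<alpha> \<lhd> g) \<lhd> f = \<alpha> \<lhd> k"
  using assms by (metis whisker_Comp(2))

end

section \<open>Pullbacks\<close>

context two_category
begin

lemma is_pullbackD:
  assumes "is_pullback K f g p q"
  shows "f \<in> Arr K" "g \<in> Arr K" "Cod K f = Cod K g" "p \<in> Arr K" "q \<in> Arr K" "Dom K q = Dom K p"
    "Cod K p = Dom K f" "Cod K q = Dom K g" "g \<odot> q = f \<odot> p"
  using assms unfolding is_pullback_def by auto

lemma is_pullback_arr:
  assumes "is_pullback K f g p q" "u \<in> Arr K" "v \<in> Arr K" "Dom K u = Dom K v" "Cod K u = Dom K f"
    "Cod K v = Dom K g" "f \<odot> u = g \<odot> v"
  shows "\<exists>!w. w \<in> hom1 K (Dom K u) (Dom K p) \<and> p \<odot> w = u \<and> q \<odot> w = v"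
  using assms unfolding is_pullback_def by blast

lemma is_pullback_cell:
  assumes "is_pullback K f g p q" "\<alpha> \<in> Cell K" "\<beta> \<in> Cell K" "Dom K (Src K \<alpha>) = Dom K (Src K \<beta>)"
    "Cod K (Src K \<alpha>) = Dom K f" "Cod K (Src K \<beta>) = Dom K g" "f \<rhd> \<alpha> = g \<rhd> \<beta>"
  shows "\<exists>!\<gamma>. \<gamma> \<in> Cell K \<and> Cod K (Src K \<gamma>) = Dom K p \<and> p \<rhd> \<gamma> = \<alpha> \<and> q \<rhd> \<gamma> = \<beta>"
  using assms unfolding is_pullback_def by blast

lemma is_pullback_arr_eqI:
  assumes P: "is_pullback K f g p q" and w: "w \<in> Arr K" "w' \<in> Arr K" "Dom K w = Dom K w'" "Cod K w = Dom K p"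
    "Cod K w' = Dom K p" and e: "p \<odot> w = p \<odot> w'" "q \<odot> w = q \<odot> w'"
  shows "w = w'"
proof -
  note [simp] = is_pullbackD[OF P]
  have "f \<odot> (p \<odot> w') = g \<odot> (q \<odot> w')"
    using w is_pullbackD[OF P] by (simp add: Comp_reassoc[of g q "f \<odot> p"])
  then have "\<exists>!v. v \<in> hom1 K (Dom K (p \<odot> w')) (Dom K p) \<and> p \<odot> v = p \<odot> w' \<and> q \<odot> v = q \<odot> w'"
    using w by (intro is_pullback_arr[OF P]) auto
  then show ?thesis using w e by (auto simp: hom1_def)
qed

lemma is_pullback_cell_eqI:
  assumes P: "is_pullback K f g p q" and w: "\<gamma> \<in> Cell K" "\<gamma>' \<in> Cell K"
    "Cod K (Src K \<gamma>) = Dom K p" "Cod K (Src K \<gamma>') = Dom K p"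
    and e: "p \<rhd> \<gamma> = p \<rhd> \<gamma>'" "q \<rhd> \<gamma> = q \<rhd> \<gamma>'"
  shows "\<gamma> = \<gamma>'"
proof -
  note [simp] = is_pullbackD[OF P]
  have "f \<rhd> (p \<rhd> \<gamma>') = g \<rhd> (q \<rhd> \<gamma>')"
    using w is_pullbackD[OF P] by (simp add: whisker_l_reassoc[of g q "f \<odot> p"])
  then have "\<exists>!v. v \<in> Cell K \<and> Cod K (Src K v) = Dom K p \<and> p \<rhd> v = p \<rhd> \<gamma>' \<and> q \<rhd> v = q \<rhd> \<gamma>'"
    using w by (intro is_pullback_cell[OF P]) auto
  then show ?thesis using w e by auto
qed

end

text \<open>
  pr1 f g and pr2 f g are the projections to the domains of f and of g. Simplification replaces g (pr2 f g)
  by f (pr1 f g).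
\<close>

locale pullbacks = two_category K for K :: "('o, 'a, 'c) twocat" (structure) +
  fixes pb :: "'a pbs"
  assumes chosen_pullbacks: "chosen_pullbacks K pb"
begin

abbreviation "pr1 f g \<equiv> fst (pb f g)"
abbreviation "pr2 f g \<equiv> snd (pb f g)"

lemma is_pb: "\<lbrakk>f \<in> Arr K; g \<in> Arr K; Cod K f = Cod K g\<rbrakk> \<Longrightarrow> is_pullback K f g (pr1 f g) (pr2 f g)"
  using chosen_pullbacks unfolding chosen_pullbacks_def by blast

lemma pr_simps [simp]:
  assumes "f \<in> Arr K" "g \<in> Arr K" "Cod K f = Cod K g"
  shows "pr1 f g \<in> Arr K" "pr2 f g \<in> Arr K" "Dom K (pr2 f g) = Dom K (pr1 f g)"
    "Cod K (pr1 f g) = Dom K f" "Cod K (pr2 f g) = Dom K g" "g \<odot> pr2 f g = f \<odot> pr1 f g"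
  using is_pullbackD[OF is_pb[OF assms]] by auto

lemma pr_square [simp]:
  "\<lbrakk>f \<in> Arr K; g \<in> Arr K; Cod K f = Cod K g; h \<in> Arr K; Cod K h = Dom K (pr1 f g)\<rbrakk>
    \<Longrightarrow> g \<odot> (pr2 f g \<odot> h) = f \<odot> (pr1 f g \<odot> h)"
  "\<lbrakk>f \<in> Arr K; g \<in> Arr K; Cod K f = Cod K g; \<alpha> \<in> Cell K; Cod K (Src K \<alpha>) = Dom K (pr1 f g)\<rbrakk>
    \<Longrightarrow> g \<rhd> (pr2 f g \<rhd> \<alpha>) = f \<rhd> (pr1 f g \<rhd> \<alpha>)"
  by (simp_all add: Comp_reassoc[of g "pr2 f g" "f \<odot> pr1 f g"] whisker_l_reassoc[of g "pr2 f g" "f \<odot> pr1 f g"])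

lemma pb_arr_simps [simp]:
  assumes "f \<in> Arr K" "g \<in> Arr K" "Cod K f = Cod K g"
    "u \<in> Arr K" "v \<in> Arr K" "Dom K u = Dom K v" "Cod K u = Dom K f" "Cod K v = Dom K g" "f \<odot> u = g \<odot> v"
  shows "pb_arr K pb f g u v \<in> Arr K" "Dom K (pb_arr K pb f g u v) = Dom K u"
    "Cod K (pb_arr K pb f g u v) = Dom K (pr1 f g)"
    "pr1 f g \<odot> pb_arr K pb f g u v = u" "pr2 f g \<odot> pb_arr K pb f g u v = v"
  using theI'[OF is_pullback_arr[OF is_pb[OF assms(1-3)] assms(4-)]]
  unfolding pb_arr_def[symmetric] by (auto simp: hom1_def)

lemma pb_arr_reassoc [simp]:
  assumes "f \<in> Arr K" "g \<in> Arr K" "Cod K f = Cod K g"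
    "u \<in> Arr K" "v \<in> Arr K" "Dom K u = Dom K v" "Cod K u = Dom K f" "Cod K v = Dom K g" "f \<odot> u = g \<odot> v"
    "h \<in> Arr K" "Cod K h = Dom K u"
  shows "pr1 f g \<odot> (pb_arr K pb f g u v \<odot> h) = u \<odot> h" "pr2 f g \<odot> (pb_arr K pb f g u v \<odot> h) = v \<odot> h"
  using assms by (simp_all add: Comp_reassoc[of "pr1 f g" _ u] Comp_reassoc[of "pr2 f g" _ v])

lemma pb_arr_whisker [simp]:
  assumes "f \<in> Arr K" "g \<in> Arr K" "Cod K f = Cod K g"
    "u \<in> Arr K" "v \<in> Arr K" "Dom K u = Dom K v" "Cod K u = Dom K f" "Cod K v = Dom K g" "f \<odot> u = g \<odot> v"
    "\<alpha> \<in> Cell K" "Cod K (Src K \<alpha>) = Dom K u"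
  shows "pr1 f g \<rhd> (pb_arr K pb f g u v \<rhd> \<alpha>) = u \<rhd> \<alpha>" "pr2 f g \<rhd> (pb_arr K pb f g u v \<rhd> \<alpha>) = v \<rhd> \<alpha>"
  using assms by (simp_all add: whisker_l_reassoc[of "pr1 f g" _ u] whisker_l_reassoc[of "pr2 f g" _ v])

lemma pr_eqI:
  assumes "pr1 f g \<odot> w = pr1 f g \<odot> w'" "pr2 f g \<odot> w = pr2 f g \<odot> w'" "w \<in> Arr K" "w' \<in> Arr K"
    "Dom K w = Dom K w'" "Cod K w = Dom K (pr1 f g)" "Cod K w' = Dom K (pr1 f g)"
    "f \<in> Arr K" "g \<in> Arr K" "Cod K f = Cod K g"
  shows "w = w'"
  using is_pullback_arr_eqI[OF is_pb[of f g]] assms by blast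

lemma pb_arr_comp:
  assumes "f \<in> Arr K" "g \<in> Arr K" "Cod K f = Cod K g"
    "u \<in> Arr K" "v \<in> Arr K" "Dom K u = Dom K v" "Cod K u = Dom K f" "Cod K v = Dom K g" "f \<odot> u = g \<odot> v"
    "h \<in> Arr K" "Cod K h = Dom K u"
  shows "pb_arr K pb f g u v \<odot> h = pb_arr K pb f g (u \<odot> h) (v \<odot> h)"
proof -
  have "f \<odot> (u \<odot> h) = g \<odot> (v \<odot> h)"
    using assms Comp_reassoc[of f u "g \<odot> v" h] by simp
  with assms show ?thesis by - (rule pr_eqI[of f g], simp_all)
qed

lemma pb_cell_simps [simp]:
  assumes "f \<in> Arr K" "g \<in> Arr K" "Cod K f = Cod K g" "\<alpha> \<in> Cell K" "\<beta> \<in> Cell K"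
    "Dom K (Src K \<alpha>) = Dom K (Src K \<beta>)" "Cod K (Src K \<alpha>) = Dom K f" "Cod K (Src K \<beta>) = Dom K g"
    "f \<rhd> \<alpha> = g \<rhd> \<beta>"
  shows "pb_cell K pb f g \<alpha> \<beta> \<in> Cell K"
    "pr1 f g \<rhd> pb_cell K pb f g \<alpha> \<beta> = \<alpha>" "pr2 f g \<rhd> pb_cell K pb f g \<alpha> \<beta> = \<beta>"
    "Src K (pb_cell K pb f g \<alpha> \<beta>) = pb_arr K pb f g (Src K \<alpha>) (Src K \<beta>)"
    "Tgt K (pb_cell K pb f g \<alpha> \<beta>) = pb_arr K pb f g (Tgt K \<alpha>) (Tgt K \<beta>)"
proof -
  define c where "c = pb_cell K pb f g \<alpha> \<beta>"
  have c: "c \<in> Cell K" "Cod K (Src K c) = Dom K (pr1 f g)" "pr1 f g \<rhd> c = \<alpha>" "pr2 f g \<rhd> c = \<beta>"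
    using theI'[OF is_pullback_cell[OF is_pb[OF assms(1-3)] assms(4-)]]
    unfolding pb_cell_def[symmetric] c_def by blast+
  then show "pb_cell K pb f g \<alpha> \<beta> \<in> Cell K" "pr1 f g \<rhd> pb_cell K pb f g \<alpha> \<beta> = \<alpha>" "pr2 f g \<rhd> pb_cell K pb f g \<alpha> \<beta> = \<beta>"
    unfolding c_def by blast+
  have e: "pr1 f g \<odot> Src K c = Src K \<alpha>" "pr2 f g \<odot> Src K c = Src K \<beta>"
    "pr1 f g \<odot> Tgt K c = Tgt K \<alpha>" "pr2 f g \<odot> Tgt K c = Tgt K \<beta>"
    using assms(1-3) c whisker_l_simps(2,3)[of "pr1 f g" c] whisker_l_simps(2,3)[of "pr2 f g" c] by simp_all
  have ab: "f \<odot> Src K \<alpha> = g \<odot> Src K \<beta>" "f \<odot> Tgt K \<alpha> = g \<odot> Tgt K \<beta>"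
    unfolding e[symmetric] using assms(1-3) c(1,2) by simp_all
  have d: "Dom K (Src K c) = Dom K (Src K \<alpha>)" "Dom K (Tgt K c) = Dom K (Src K \<alpha>)" "Cod K (Tgt K c) = Dom K (pr1 f g)"
    using arg_cong[OF c(3), of "\<lambda>\<alpha>. Dom K (Src K \<alpha>)"] assms(1-3) c(1,2) by simp_all
  show "Src K (pb_cell K pb f g \<alpha> \<beta>) = pb_arr K pb f g (Src K \<alpha>) (Src K \<beta>)"
    unfolding c_def[symmetric] using assms(1-8) c(1,2) e ab d
    by - (rule pr_eqI[of f g], simp_all)
  show "Tgt K (pb_cell K pb f g \<alpha> \<beta>) = pb_arr K pb f g (Tgt K \<alpha>) (Tgt K \<beta>)"
    unfolding c_def[symmetric] using assms(1-8) c(1,2) e ab d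
    by - (rule pr_eqI[of f g], simp_all)
qed

lemma pr_cell_eqI:
  assumes "pr1 f g \<rhd> \<gamma> = pr1 f g \<rhd> \<gamma>'" "pr2 f g \<rhd> \<gamma> = pr2 f g \<rhd> \<gamma>'" "\<gamma> \<in> Cell K" "\<gamma>' \<in> Cell K"
    "Cod K (Src K \<gamma>) = Dom K (pr1 f g)" "Cod K (Src K \<gamma>') = Dom K (pr1 f g)"
    "f \<in> Arr K" "g \<in> Arr K" "Cod K f = Cod K g"
  shows "\<gamma> = \<gamma>'"
  using is_pullback_cell_eqI[OF is_pb[of f g]] assms by blast

end

section \<open>Comma objects\<close>

text \<open>
  Only the comma objects \<open>1\<^sub>B \<down> x\<close> occur in \<open>\<Phi>\<^sub>B\<close>. An arrow
  into one is a pair of an element v of the domain of x and a 2-cell into x v.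
\<close>

locale commas = two_category K for K :: "('o, 'a, 'c) twocat" (structure) +
  fixes cm :: "('a, 'c) commas"
  assumes chosen_commas: "chosen_commas K cm"
begin

abbreviation "cd B x \<equiv> cm_d K cm B x"
abbreviation "cq B x \<equiv> cm_q K cm B x"
abbreviation "cl B x \<equiv> cm_l K cm B x"
abbreviation "carr B x u v \<beta> \<equiv> cm_arr K cm B x u v \<beta>"
abbreviation "ccell B x w w' \<zeta> \<xi> \<equiv> cm_cell K cm B x w w' \<zeta> \<xi>"

lemma is_cm: "x \<in> Arr K \<Longrightarrow> Cod K x = B \<Longrightarrow> is_comma K (Id1 K B) x (cd B x) (cq B x) (cl B x)"
  using chosen_commas unfolding chosen_commas_def cm_d_def cm_q_def cm_l_def
  by (drule_tac x="Id1 K B" in bspec) (auto split: prod.splits dest!: bspec[of _ _ x])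

lemma comma_simps [simp]:
  assumes "x \<in> Arr K" "Cod K x = B"
  shows "cd B x \<in> Arr K" "cq B x \<in> Arr K" "Dom K (cq B x) = Dom K (cd B x)" "Cod K (cd B x) = B" "Cod K (cq B x) = Dom K x"
    "cl B x \<in> Cell K" "Src K (cl B x) = cd B x" "Tgt K (cl B x) = x \<odot> cq B x"
proof -
  have "cd B x \<in> Arr K" "cq B x \<in> Arr K" "Dom K (cq B x) = Dom K (cd B x)" "Cod K (cd B x) = B" "Cod K (cq B x) = Dom K x"
    "cl B x \<in> hom2 K (Id1 K B \<odot> cd B x) (x \<odot> cq B x)"
    using is_cm[OF assms] assms unfolding is_comma_def by auto
  then show "cd B x \<in> Arr K" "cq B x \<in> Arr K" "Dom K (cq B x) = Dom K (cd B x)" "Cod K (cd B x) = B" "Cod K (cq B x) = Dom K x"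
    "cl B x \<in> Cell K" "Src K (cl B x) = cd B x" "Tgt K (cl B x) = x \<odot> cq B x"
    using assms by (auto simp: hom2_def)
qed

lemma comma_arr_ex1:
  assumes "x \<in> Arr K" "Cod K x = B" "v \<in> Arr K" "Cod K v = Dom K x" "\<beta> \<in> Cell K" "Tgt K \<beta> = x \<odot> v"
  shows "\<exists>!w. w \<in> hom1 K (Dom K v) (Dom K (cd B x)) \<and> cd B x \<odot> w = Src K \<beta> \<and> cq B x \<odot> w = v \<and> cl B x \<lhd> w = \<beta>"
proof -
  have [simp]: "B \<in> Ob K" using assms(1,2) by auto
  have [simp]: "Dom K (Src K \<beta>) = Dom K v" "Cod K (Src K \<beta>) = B"
    using assms(1-4) Cell_ends(3,4)[OF assms(5)] unfolding assms(6) by simp_all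
  have U: "\<exists>!w. w \<in> hom1 K (Dom K u) (Dom K (cd B x)) \<and> cd B x \<odot> w = u \<and> cq B x \<odot> w = v \<and> cl B x \<lhd> w = \<beta>"
    if "u \<in> Arr K" "v \<in> Arr K" "Dom K u = Dom K v" "Cod K u = Dom K (Id1 K B)" "Cod K v = Dom K x"
      "\<beta> \<in> hom2 K (Id1 K B \<odot> u) (x \<odot> v)" for u v \<beta>
    using is_cm[OF assms(1,2)] that unfolding is_comma_def by blast
  have "Src K \<beta> \<in> Arr K" "Dom K (Src K \<beta>) = Dom K v" "Cod K (Src K \<beta>) = Dom K (Id1 K B)"
     "\<beta> \<in> hom2 K (Id1 K B \<odot> Src K \<beta>) (x \<odot> v)"
    using assms by (simp_all add: hom2_def)
  from U[OF this(1) assms(3) this(2,3) assms(4) this(4)] this(2) show ?thesis by simp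
qed

lemma carr_simps [simp]:
  assumes "x \<in> Arr K" "Cod K x = B" "v \<in> Arr K" "Cod K v = Dom K x" "\<beta> \<in> Cell K" "Tgt K \<beta> = x \<odot> v" "u = Src K \<beta>"
  shows "carr B x u v \<beta> \<in> Arr K" "Dom K (carr B x u v \<beta>) = Dom K v" "Cod K (carr B x u v \<beta>) = Dom K (cd B x)"
    "cd B x \<odot> carr B x u v \<beta> = u" "cq B x \<odot> carr B x u v \<beta> = v" "cl B x \<lhd> carr B x u v \<beta> = \<beta>"
proof -
  have [simp]: "Dom K (Src K \<beta>) = Dom K v"
    using assms(1-4) Cell_ends(3)[OF assms(5)] unfolding assms(6) by simp_all
  show "carr B x u v \<beta> \<in> Arr K" "Dom K (carr B x u v \<beta>) = Dom K v" "Cod K (carr B x u v \<beta>) = Dom K (cd B x)"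
    "cd B x \<odot> carr B x u v \<beta> = u" "cq B x \<odot> carr B x u v \<beta> = v" "cl B x \<lhd> carr B x u v \<beta> = \<beta>"
    using theI'[OF comma_arr_ex1[OF assms(1-6)]] unfolding cm_arr_def by (auto simp: hom1_def assms(7))
qed

lemma carr_reassoc [simp]:
  assumes "x \<in> Arr K" "Cod K x = B" "v \<in> Arr K" "Cod K v = Dom K x" "\<beta> \<in> Cell K" "Tgt K \<beta> = x \<odot> v" "u = Src K \<beta>"
    "h \<in> Arr K" "Cod K h = Dom K v"
  shows "cd B x \<odot> (carr B x u v \<beta> \<odot> h) = u \<odot> h" "cq B x \<odot> (carr B x u v \<beta> \<odot> h) = v \<odot> h"
  using assms by (simp_all add: Comp_reassoc[of "cd B x" _ "Src K \<beta>"] Comp_reassoc[of "cq B x" _ v])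

lemma comma_arr_eqI:
  assumes "cq B x \<odot> w = cq B x \<odot> w'" "cl B x \<lhd> w = cl B x \<lhd> w'" "w \<in> Arr K" "w' \<in> Arr K"
    "Cod K w = Dom K (cd B x)" "Cod K w' = Dom K (cd B x)" "x \<in> Arr K" "Cod K x = B"
  shows "w = w'"
proof -
  have s: "cd B x \<odot> w = cd B x \<odot> w'" using whisker_r_simps(2)[of w "cl B x"] whisker_r_simps(2)[of w' "cl B x"] assms by simp
  have "Dom K w = Dom K w'" using Comp_simps(2)[of w "cq B x"] Comp_simps(2)[of w' "cq B x"] assms by simp
  with s assms comma_arr_ex1[of x B "cq B x \<odot> w'" "cl B x \<lhd> w'"] show ?thesis
    by (auto simp: hom1_def)
qed

lemma comma_cell_ex1:
  assumes "x \<in> Arr K" "Cod K x = B" "w \<in> Arr K" "w' \<in> Arr K" "Dom K w = Dom K w'" "Cod K w = Dom K (cd B x)" "Cod K w' = Dom K (cd B x)"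
    "\<zeta> \<in> Cell K" "Src K \<zeta> = cd B x \<odot> w" "Tgt K \<zeta> = cd B x \<odot> w'"
    "\<xi> \<in> Cell K" "Src K \<xi> = cq B x \<odot> w" "Tgt K \<xi> = cq B x \<odot> w'"
    "(cl B x \<lhd> w') \<bullet> \<zeta> = (x \<rhd> \<xi>) \<bullet> (cl B x \<lhd> w)"
  shows "\<exists>!\<theta>. \<theta> \<in> hom2 K w w' \<and> cd B x \<rhd> \<theta> = \<zeta> \<and> cq B x \<rhd> \<theta> = \<xi>"
proof -
  have "\<zeta> \<in> hom2 K (cd B x \<odot> w) (cd B x \<odot> w')" "\<xi> \<in> hom2 K (cq B x \<odot> w) (cq B x \<odot> w')"
    "(cl B x \<lhd> w') \<bullet> (Id1 K B \<rhd> \<zeta>) = (x \<rhd> \<xi>) \<bullet> (cl B x \<lhd> w)"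
    using assms by (simp_all add: hom2_def)
  with is_cm[OF assms(1,2)] assms(3-7) show ?thesis
    unfolding is_comma_def by blast
qed

lemma comma_cell_simps [simp]:
  assumes "x \<in> Arr K" "Cod K x = B" "w \<in> Arr K" "w' \<in> Arr K" "Dom K w = Dom K w'" "Cod K w = Dom K (cd B x)" "Cod K w' = Dom K (cd B x)"
    "\<zeta> \<in> Cell K" "Src K \<zeta> = cd B x \<odot> w" "Tgt K \<zeta> = cd B x \<odot> w'"
    "\<xi> \<in> Cell K" "Src K \<xi> = cq B x \<odot> w" "Tgt K \<xi> = cq B x \<odot> w'"
    "(cl B x \<lhd> w') \<bullet> \<zeta> = (x \<rhd> \<xi>) \<bullet> (cl B x \<lhd> w)"
  shows "ccell B x w w' \<zeta> \<xi> \<in> Cell K" "Src K (ccell B x w w' \<zeta> \<xi>) = w"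
    "Tgt K (ccell B x w w' \<zeta> \<xi>) = w'"
    "cd B x \<rhd> ccell B x w w' \<zeta> \<xi> = \<zeta>" "cq B x \<rhd> ccell B x w w' \<zeta> \<xi> = \<xi>"
  using theI'[OF comma_cell_ex1[OF assms]] unfolding cm_cell_def by (auto simp: hom2_def)

lemma comma_cell_eqI:
  assumes "cd B x \<rhd> \<theta> = cd B x \<rhd> \<theta>'" "cq B x \<rhd> \<theta> = cq B x \<rhd> \<theta>'" "\<theta> \<in> Cell K" "\<theta>' \<in> Cell K"
    "Src K \<theta> = Src K \<theta>'" "Tgt K \<theta> = Tgt K \<theta>'" "Cod K (Src K \<theta>) = Dom K (cd B x)" "x \<in> Arr K" "Cod K x = B"
  shows "\<theta> = \<theta>'"
proof -
  have [simp]: "Cod K (Src K \<theta>') = Dom K (cd B x)" using assms by auto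
  have "Dom K (Tgt K \<theta>) = Dom K (Src K \<theta>)" "Cod K (Tgt K \<theta>) = Cod K (Src K \<theta>)" using assms(3) by simp_all
  then have [simp]: "Dom K (Tgt K \<theta>') = Dom K (Src K \<theta>')" "Cod K (Tgt K \<theta>') = Dom K (cd B x)" using assms by auto
  have "(cl B x \<lhd> Tgt K \<theta>') \<bullet> (cd B x \<rhd> \<theta>') = (x \<rhd> (cq B x \<rhd> \<theta>')) \<bullet> (cl B x \<lhd> Src K \<theta>')"
    using exchange[of \<theta>' "cl B x"] assms by simp
  then have "\<exists>!\<theta>. \<theta> \<in> hom2 K (Src K \<theta>') (Tgt K \<theta>') \<and> cd B x \<rhd> \<theta> = cd B x \<rhd> \<theta>' \<and> cq B x \<rhd> \<theta> = cq B x \<rhd> \<theta>'"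
    using assms by (intro comma_cell_ex1) simp_all
  then show ?thesis using assms by (auto simp: hom2_def)
qed

end

section \<open>Slices\<close>

lemma mid_simp [simp]: "mid (a, b, c) = b"
  by (simp add: mid_def)

lemma slice_simps [simp]:
  "x \<in> Ob (slice K B) \<longleftrightarrow> x \<in> Arr K \<and> Cod K x = B"
  "(x, k, y) \<in> Arr (slice K B) \<longleftrightarrow> x \<in> Arr K \<and> y \<in> Arr K \<and> Cod K x = B \<and> Cod K y = B
     \<and> k \<in> Arr K \<and> Dom K k = Dom K x \<and> Cod K k = Dom K y \<and> y \<odot>\<^bsub>K\<^esub> k = x"
  "(x, \<alpha>, y) \<in> Cell (slice K B) \<longleftrightarrow> x \<in> Arr K \<and> y \<in> Arr K \<and> Cod K x = B \<and> Cod K y = B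
     \<and> \<alpha> \<in> Cell K \<and> Dom K (Src K \<alpha>) = Dom K x \<and> Cod K (Src K \<alpha>) = Dom K y \<and> y \<rhd>\<^bsub>K\<^esub> \<alpha> = Id2 K x"
  "Dom (slice K B) (x, k, y) = x" "Cod (slice K B) (x, k, y) = y"
  "Id1 (slice K B) x = (x, Id1 K (Dom K x), x)"
  "(y', l, z) \<odot>\<^bsub>slice K B\<^esub> (x, k, y) = (x, l \<odot>\<^bsub>K\<^esub> k, z)"
  "Src (slice K B) (x, \<alpha>, y) = (x, Src K \<alpha>, y)" "Tgt (slice K B) (x, \<alpha>, y) = (x, Tgt K \<alpha>, y)"
  "Id2 (slice K B) (x, k, y) = (x, Id2 K k, y)"
  "(y', \<tau>, z) \<bullet>\<^bsub>slice K B\<^esub> (x, \<alpha>, y) = (x, \<tau> \<bullet>\<^bsub>K\<^esub> \<alpha>, y)"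
  "(y', \<tau>, z) \<star>\<^bsub>slice K B\<^esub> (x, \<alpha>, y) = (x, \<tau> \<star>\<^bsub>K\<^esub> \<alpha>, z)"
  "(y', l, z) \<rhd>\<^bsub>slice K B\<^esub> (x, \<alpha>, y) = (x, l \<rhd>\<^bsub>K\<^esub> \<alpha>, z)"
  "(y', \<tau>, z) \<lhd>\<^bsub>slice K B\<^esub> (x, k, y) = (x, \<tau> \<lhd>\<^bsub>K\<^esub> k, z)"
  by (auto simp: slice_def hom1_def whisker_l_def whisker_r_def)

lemma Ball_slice:
  "(\<forall>f\<in>Arr (slice K B). Q f) \<longleftrightarrow> (\<forall>x k y. (x, k, y) \<in> Arr (slice K B) \<longrightarrow> Q (x, k, y))"
  "(\<forall>f\<in>Cell (slice K B). R f) \<longleftrightarrow> (\<forall>x \<alpha> y. (x, \<alpha>, y) \<in> Cell (slice K B) \<longrightarrow> R (x, \<alpha>, y))"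
  by auto

lemma hom1_iff: "f \<in> hom1 K X Y \<longleftrightarrow> f \<in> Arr K \<and> Dom K f = X \<and> Cod K f = Y"
  by (auto simp: hom1_def)

lemma hom2_iff: "\<alpha> \<in> hom2 K f g \<longleftrightarrow> \<alpha> \<in> Cell K \<and> Src K \<alpha> = f \<and> Tgt K \<alpha> = g"
  by (auto simp: hom2_def)

context two_category
begin

lemma over_reassoc:
  "\<lbrakk>y \<odot> k = x; (x, k, y) \<in> Arr (slice K B); h \<in> Arr K; Cod K h = Dom K k\<rbrakk> \<Longrightarrow> y \<odot> (k \<odot> h) = x \<odot> h"
  by (simp add: Comp_reassoc)

lemma slice_Cell_Arr:
  assumes "(x, \<alpha>, y) \<in> Cell (slice K B)"
  shows "y \<odot> Src K \<alpha> = x" "y \<odot> Tgt K \<alpha> = x"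
proof -
  have "y \<in> Arr K" "\<alpha> \<in> Cell K" "Dom K y = Cod K (Src K \<alpha>)" and a: "y \<rhd> \<alpha> = Id2 K x" "x \<in> Arr K"
    using assms by simp_all
  from whisker_l_simps(2,3)[OF this(1-3)] a show "y \<odot> Src K \<alpha> = x" "y \<odot> Tgt K \<alpha> = x" by simp_all
qed

text \<open>
  A horizontal composite is a vertical composite of two whiskerings, each of which lies over an identity of
  the base.
\<close>

lemma HComp_slice:
  assumes "(x, \<alpha>, y) \<in> Cell (slice K B)" "(y, \<beta>, z) \<in> Cell (slice K B)"
  shows "z \<rhd> (\<beta> \<star> \<alpha>) = Id2 K x"
proof -
  note [simp] = slice_Cell_Arr[OF assms(1)] slice_Cell_Arr[OF assms(2)]
  have [simp]: "x \<in> Arr K" "y \<in> Arr K" "z \<in> Arr K" "Cod K x = B" "Cod K y = B" "Cod K z = B"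
    "\<alpha> \<in> Cell K" "\<beta> \<in> Cell K" "Dom K (Src K \<alpha>) = Dom K x" "Cod K (Src K \<alpha>) = Dom K y" "Dom K (Src K \<beta>) = Dom K y"
    "Cod K (Src K \<beta>) = Dom K z" "y \<rhd> \<alpha> = Id2 K x" "z \<rhd> \<beta> = Id2 K y"
    using assms by simp_all
  have "z \<rhd> (\<beta> \<lhd> Tgt K \<alpha>) = Id2 K x" using whisker_Comp(3)[of "Tgt K \<alpha>" z \<beta>] by simp
  moreover have "z \<rhd> (Src K \<beta> \<rhd> \<alpha>) = Id2 K x" using whisker_l_reassoc[of z "Src K \<beta>" y \<alpha>] by simp
  ultimately show ?thesis by (simp add: HComp_whisker(1))
qed

lemma two_category_slice:
  assumes [simp]: "B \<in> Ob K"
  shows "two_category (slice K B)"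
proof (unfold_locales, goal_cases)
  case (1 f) then show ?case by (cases f) auto
next
  case (2 f) then show ?case by (cases f) auto
next
  case (3 X) then show ?case by (auto simp: hom1_iff)
next
  case (4 f g) then show ?case by (cases f; cases g) (auto simp: hom1_iff over_reassoc)
next
  case (5 f) then show ?case by (cases f) auto
next
  case (6 f) then show ?case by (cases f) auto
next
  case (7 f g h) then show ?case by (cases f; cases g; cases h) auto
next
  case (8 \<alpha>) then show ?case by (cases \<alpha>) (auto simp: slice_Cell_Arr)
next
  case (9 \<alpha>) then show ?case by (cases \<alpha>) (auto simp: slice_Cell_Arr)
next
  case (10 \<alpha>) then show ?case by (cases \<alpha>) auto
next
  case (11 \<alpha>) then show ?case by (cases \<alpha>) auto
next
  case (12 f) then show ?case by (cases f) (auto simp: hom2_iff)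
next
  case (13 \<alpha> \<beta>) then show ?case by (cases \<alpha>; cases \<beta>) (auto simp: hom2_iff)
next
  case (14 \<alpha>) then show ?case by (cases \<alpha>) auto
next
  case (15 \<alpha>) then show ?case by (cases \<alpha>) auto
next
  case (16 \<alpha> \<beta> \<gamma>) then show ?case by (cases \<alpha>; cases \<beta>; cases \<gamma>) auto
next
  case (17 \<alpha> \<beta>) then show ?case
    using HComp_slice[of "fst \<alpha>" "mid \<alpha>" "snd (snd \<alpha>)" B "mid \<beta>" "snd (snd \<beta>)"]
    by (cases \<alpha>; cases \<beta>) (simp add: hom2_iff)
next
  case (18 \<alpha>) then show ?case by (cases \<alpha>) (auto simp: whisker_Id1[unfolded whisker_l_def whisker_r_def])
next
  case (19 \<alpha>) then show ?case by (cases \<alpha>) (auto simp: whisker_Id1[unfolded whisker_l_def whisker_r_def])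
next
  case (20 \<alpha> \<beta> \<gamma>) then show ?case by (cases \<alpha>; cases \<beta>; cases \<gamma>) (auto simp: HComp_assoc)
next
  case (21 f g) then show ?case by (cases f; cases g) (auto simp: HComp_Id2)
next
  case (22 \<alpha> \<alpha>' \<beta> \<beta>') then show ?case
    by (cases \<alpha>; cases \<beta>; cases \<alpha>'; cases \<beta>') (auto simp: interchange)
qed

end

section \<open>Actions of Street's 2-monad\<close>

context two_category
begin

lemma lift_problemD:
  assumes "lift_problem K x v \<beta>"
  shows "v \<in> Arr K" "Cod K v = Dom K x" "\<beta> \<in> Cell K" "Tgt K \<beta> = x \<odot> v"
  using assms unfolding lift_problem_def by auto

lemma lift_problem_ends:
  assumes "lift_problem K x v \<beta>" "x \<in> Arr K"
  shows "Dom K (Src K \<beta>) = Dom K v" "Cod K (Src K \<beta>) = Cod K x"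
  using lift_problemD[OF assms(1)] assms(2) Cell_ends(3,4)[of \<beta>] by simp_all

lemma lift_problem_Id2: "\<lbrakk>x \<in> Arr K; v \<in> Arr K; Cod K v = Dom K x\<rbrakk> \<Longrightarrow> lift_problem K x v (Id2 K (x \<odot> v))"
  unfolding lift_problem_def by simp

lemma lift_problem_restrict:
  assumes "lift_problem K x v \<beta>" "x \<in> Arr K" "h \<in> Arr K" "Cod K h = Dom K v"
  shows "lift_problem K x (v \<odot> h) (\<beta> \<lhd> h)"
  using lift_problemD[OF assms(1)] lift_problem_ends[OF assms(1,2)] assms(2-) unfolding lift_problem_def by simp

lemma lift_problem_mor:
  assumes "lift_problem K x v \<beta>" "x \<in> Arr K" "y \<in> Arr K" "k \<in> Arr K" "Dom K k = Dom K x" "Cod K k = Dom K y" "y \<odot> k = x"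
  shows "lift_problem K y (k \<odot> v) \<beta>"
  using lift_problemD[OF assms(1)] assms(2-) unfolding lift_problem_def by (simp add: Comp_reassoc[of y k x])

end

context commas
begin

lemma comma_lift_problem: "\<lbrakk>x \<in> Arr K; Cod K x = B\<rbrakk> \<Longrightarrow> lift_problem K x (cq B x) (cl B x)"
  unfolding lift_problem_def by simp

lemma carr_comp:
  assumes "x \<in> Arr K" "Cod K x = B" "lift_problem K x v \<beta>" "u = Src K \<beta>" "h \<in> Arr K" "Cod K h = Dom K v"
  shows "carr B x u v \<beta> \<odot> h = carr B x (u \<odot> h) (v \<odot> h) (\<beta> \<lhd> h)"
  using assms lift_problemD[OF assms(3)] lift_problem_ends[OF assms(3,1)]
  by - (rule comma_arr_eqI[of B x], simp_all)

lemma carr_id: "\<lbrakk>x \<in> Arr K; Cod K x = B\<rbrakk> \<Longrightarrow> carr B x (cd B x) (cq B x) (cl B x) = Id1 K (Dom K (cd B x))"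
  by (rule comma_arr_eqI[of B x]) simp_all

text \<open>
  The algebra laws for \<open>a : 1\<^sub>B \<down> x \<rightarrow> x\<close>, read on generalized elements.
\<close>

definition action :: "'o \<Rightarrow> 'a \<Rightarrow> 'a \<Rightarrow> bool" where
  "action B x a \<longleftrightarrow> x \<in> Arr K \<and> Cod K x = B \<and> a \<in> Arr K \<and> Dom K a = Dom K (cd B x) \<and> Cod K a = Dom K x
     \<and> x \<odot> a = cd B x
     \<and> (\<forall>v\<in>Arr K. Cod K v = Dom K x \<longrightarrow> a \<odot> carr B x (x \<odot> v) v (Id2 K (x \<odot> v)) = v)
     \<and> (\<forall>v \<beta> \<gamma>. lift_problem K x v \<beta> \<and> \<gamma> \<in> Cell K \<and> Tgt K \<gamma> = Src K \<beta> \<longrightarrow>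
          a \<odot> carr B x (Src K \<gamma>) v (\<beta> \<bullet> \<gamma>) = a \<odot> carr B x (Src K \<gamma>) (a \<odot> carr B x (Src K \<beta>) v \<beta>) \<gamma>)"

lemma Phi_simps:
  "fob (mfun (Phi K cm B)) = cm_d K cm B"
  "farr (mfun (Phi K cm B)) (x, k, y) = (cd B x, carr B y (cd B x) (k \<odot> cq B x) (cl B x), cd B y)"
  "munit (Phi K cm B) x = (x, carr B x x (Id1 K (Dom K x)) (Id2 K x), cd B x)"
  "mmult (Phi K cm B) x = (cd B (cd B x), carr B x (cd B (cd B x)) (cq B x \<odot> cq B (cd B x))
      ((cl B x \<lhd> cq B (cd B x)) \<bullet> cl B (cd B x)), cd B x)"
  by (simp_all add: Phi_def Phi_arr_def Let_def)

text \<open>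
  The elements \<open>v = 1\<close> with \<open>\<beta> = id\<close>, and the universal pair of composable
  2-cells on \<open>1\<^sub>B \<down> (1\<^sub>B \<down> x)\<close>, give back the unit and multiplication
  laws from the laws on elements; conversely the latter are restrictions of the former.
\<close>

lemma is_alg_action:
  "is_alg (slice K B) (Phi K cm B) A \<longleftrightarrow> (\<exists>x a. A = (x, (cd B x, a, x)) \<and> action B x a)"
proof
  assume A: "is_alg (slice K B) (Phi K cm B) A"
  obtain x d a y where Aeq: "A = (x, (d, a, y))" by (metis prod.exhaust)
  have [simp]: "d = cd B x" "y = x" and [simp]: "x \<in> Arr K" "Cod K x = B"
    and a [simp]: "a \<in> Arr K" "Dom K a = Dom K (cd B x)" "Cod K a = Dom K x" "x \<odot> a = cd B x"
    and u: "a \<odot> carr B x x (Id1 K (Dom K x)) (Id2 K x) = Id1 K (Dom K x)"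
    and m: "a \<odot> carr B x (cd B (cd B x)) (cq B x \<odot> cq B (cd B x)) ((cl B x \<lhd> cq B (cd B x)) \<bullet> cl B (cd B x))
       = a \<odot> carr B x (cd B (cd B x)) (a \<odot> cq B (cd B x)) (cl B (cd B x))"
  proof -
    have H: "x \<in> Ob (slice K B)" "(d, a, y) \<in> hom1 (slice K B) (cd B x) x"
      "(d, a, y) \<odot>\<^bsub>slice K B\<^esub> munit (Phi K cm B) x = Id1 (slice K B) x"
      "(d, a, y) \<odot>\<^bsub>slice K B\<^esub> mmult (Phi K cm B) x = (d, a, y) \<odot>\<^bsub>slice K B\<^esub> farr (mfun (Phi K cm B)) (d, a, y)"
      using A unfolding Aeq is_alg_def prod.case Phi_simps(1) by blast+
    show x: "x \<in> Arr K" "Cod K x = B" using H(1) by simp_all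
    show dy: "d = cd B x" "y = x" using H(2) by (simp_all add: hom1_iff)
    show "a \<in> Arr K" "Dom K a = Dom K (cd B x)" "Cod K a = Dom K x" "x \<odot> a = cd B x"
      using H(2) unfolding dy by (simp_all add: hom1_iff)
    show "a \<odot> carr B x x (Id1 K (Dom K x)) (Id2 K x) = Id1 K (Dom K x)"
      using H(3) unfolding Phi_simps by simp
    show "a \<odot> carr B x (cd B (cd B x)) (cq B x \<odot> cq B (cd B x)) ((cl B x \<lhd> cq B (cd B x)) \<bullet> cl B (cd B x))
       = a \<odot> carr B x (cd B (cd B x)) (a \<odot> cq B (cd B x)) (cl B (cd B x))"
      using H(4) unfolding Phi_simps dy by simp
  qed
  have 1: "a \<odot> carr B x (x \<odot> v) v (Id2 K (x \<odot> v)) = v" if [simp]: "v \<in> Arr K" "Cod K v = Dom K x" for v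
  proof -
    have "carr B x (x \<odot> v) v (Id2 K (x \<odot> v)) = carr B x x (Id1 K (Dom K x)) (Id2 K x) \<odot> v"
      using lift_problem_Id2[of x "Id1 K (Dom K x)"] by (subst carr_comp) simp_all
    with u show ?thesis by (simp add: Comp_reassoc[OF u])
  qed
  have 2: "a \<odot> carr B x (Src K \<gamma>) v (\<beta> \<bullet> \<gamma>) = a \<odot> carr B x (Src K \<gamma>) (a \<odot> carr B x (Src K \<beta>) v \<beta>) \<gamma>"
    if lp: "lift_problem K x v \<beta>" and [simp]: "\<gamma> \<in> Cell K" "Tgt K \<gamma> = Src K \<beta>" for v \<beta> \<gamma>
  proof -
    note [simp] = lift_problemD[OF lp] lift_problem_ends[OF lp]
    have [simp]: "Dom K (Src K \<gamma>) = Dom K v" "Cod K (Src K \<gamma>) = B"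
      using Cell_ends(3,4)[of \<gamma>] by simp_all
    define y w where "y = cd B x" "w = carr B x (Src K \<beta>) v \<beta>"
    \<comment> \<open>W is the element of \<open>\<Phi>\<^sup>2 x\<close> given by the pair \<gamma>, \<beta>; ?m is the multiplication and ?f is \<Phi> a.\<close>
    define W where "W = carr B y (Src K \<gamma>) w \<gamma>"
    note D = this y_w_def
    have [simp]: "y \<in> Arr K" "Cod K y = B" "w \<in> Arr K" "Dom K w = Dom K v" "Cod K w = Dom K y" "y \<odot> w = Src K \<beta>"
       "cq B x \<odot> w = v" "cl B x \<lhd> w = \<beta>" "x \<odot> a = y" "Dom K a = Dom K y"
       "cl B x \<in> Cell K" "Src K (cl B x) = y" "Tgt K (cl B x) = x \<odot> cq B x" "cq B x \<in> Arr K" "Dom K (cq B x) = Dom K y"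
      "Cod K (cq B x) = Dom K x"
      unfolding D(2,3) by simp_all
    have [simp]: "W \<in> Arr K" "Dom K W = Dom K v" "Cod K W = Dom K (cd B y)" "cd B y \<odot> W = Src K \<gamma>" "cq B y \<odot> W = w"
       "cl B y \<lhd> W = \<gamma>"
      unfolding D(1) by simp_all
    let ?m = "carr B x (cd B y) (cq B x \<odot> cq B y) ((cl B x \<lhd> cq B y) \<bullet> cl B y)"
    let ?f = "carr B x (cd B y) (a \<odot> cq B y) (cl B y)"
    note [simp] = y_w_def(1)[symmetric]
    have [simp]: "x \<odot> (a \<odot> h) = y \<odot> h" if "h \<in> Arr K" "Cod K h = Dom K y" for h
      using that by (simp add: Comp_reassoc[of x a y])
    have p: "lift_problem K x (cq B x \<odot> cq B y) ((cl B x \<lhd> cq B y) \<bullet> cl B y)"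
      by (simp add: lift_problem_def)
    have p': "lift_problem K x (a \<odot> cq B y) (cl B y)"
      by (simp add: lift_problem_def)
    have [simp]: "(cl B x \<lhd> cq B y) \<lhd> W = \<beta>"
      by (simp add: whisker_r_reassoc[of "cq B y" W w])
    have "?m \<odot> W = carr B x (Src K \<gamma>) v (\<beta> \<bullet> \<gamma>)"
      by (subst carr_comp[OF _ _ p]) simp_all
    moreover have "?f \<odot> W = carr B x (Src K \<gamma>) (a \<odot> w) \<gamma>"
      by (subst carr_comp[OF _ _ p']) simp_all
    moreover have "a \<odot> (?m \<odot> W) = a \<odot> (?f \<odot> W)"
      using m p p' unfolding D(2)[symmetric] by (simp add: Comp_reassoc[of a ?m "a \<odot> ?f"] lift_problem_def)
    ultimately show ?thesis unfolding D by simp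
  qed
  show "\<exists>x a. A = (x, (cd B x, a, x)) \<and> action B x a"
    unfolding Aeq action_def using 1 2 by simp
next
  assume "\<exists>x a. A = (x, (cd B x, a, x)) \<and> action B x a"
  then obtain x a where [simp]: "A = (x, (cd B x, a, x))" and *: "action B x a" by blast
  have [simp]: "x \<in> Arr K" "Cod K x = B" "a \<in> Arr K" "Dom K a = Dom K (cd B x)" "Cod K a = Dom K x" "x \<odot> a = cd B x"
    using * unfolding action_def by auto
  have 1: "a \<odot> carr B x x (Id1 K (Dom K x)) (Id2 K x) = Id1 K (Dom K x)"
    using * unfolding action_def by (auto dest!: bspec[of _ _ "Id1 K (Dom K x)"])
  have 2: "a \<odot> carr B x (Src K \<gamma>) v (\<beta> \<bullet> \<gamma>) = a \<odot> carr B x (Src K \<gamma>) (a \<odot> carr B x (Src K \<beta>) v \<beta>) \<gamma>"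
    if "lift_problem K x v \<beta>" "\<gamma> \<in> Cell K" "Tgt K \<gamma> = Src K \<beta>" for v \<beta> \<gamma>
    using * that unfolding action_def by blast
  define y where "y = cd B x"
  have [simp]: "y \<in> Arr K" "Cod K y = B" "cl B x \<in> Cell K" "Src K (cl B x) = y" "Tgt K (cl B x) = x \<odot> cq B x"
     "cq B x \<in> Arr K" "Dom K (cq B x) = Dom K y" "Cod K (cq B x) = Dom K x"
    unfolding y_def by simp_all
  have lp: "lift_problem K x (cq B x \<odot> cq B y) (cl B x \<lhd> cq B y)"
    by (simp add: lift_problem_def)
  have e: "carr B x (y \<odot> cq B y) (cq B x \<odot> cq B y) (cl B x \<lhd> cq B y) = cq B y"
    by (rule comma_arr_eqI[of B x]) (simp_all add: y_def)
  have m: "a \<odot> carr B x (cd B y) (cq B x \<odot> cq B y) ((cl B x \<lhd> cq B y) \<bullet> cl B y)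
       = a \<odot> carr B x (cd B y) (a \<odot> cq B y) (cl B y)"
    using 2[OF lp, of "cl B y"] e by simp
  have xa: "x \<odot> (a \<odot> cq B y) = y \<odot> cq B y" by (simp add: Comp_reassoc[of x a y] y_def)
  show "is_alg (slice K B) (Phi K cm B) A"
    unfolding is_alg_def using 1 m by (simp add: Phi_simps hom1_iff xa flip: y_def)
qed

definition act :: "'o \<Rightarrow> ('a, 'a sarr) alg \<Rightarrow> 'a \<Rightarrow> 'c \<Rightarrow> 'a" where
  "act B A v \<beta> = mid (snd A) \<odot> carr B (fst A) (Src K \<beta>) v \<beta>"

abbreviation "alg B A \<equiv> is_alg (slice K B) (Phi K cm B) A"
abbreviation "algmor B A u A' \<equiv> is_alg_mor (slice K B) (Phi K cm B) A u A'"

lemma algD: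
  assumes "alg B A"
  shows "fst A \<in> Arr K" "Cod K (fst A) = B" "mid (snd A) \<in> Arr K" "Dom K (mid (snd A)) = Dom K (cd B (fst A))"
    "Cod K (mid (snd A)) = Dom K (fst A)" "fst A \<odot> mid (snd A) = cd B (fst A)"
    "A = (fst A, (cd B (fst A), mid (snd A), fst A))"
  using assms unfolding is_alg_action action_def by auto

lemma act_simps:
  assumes "alg B A" "lift_problem K (fst A) v \<beta>"
  shows "act B A v \<beta> \<in> Arr K" "Dom K (act B A v \<beta>) = Dom K v" "Cod K (act B A v \<beta>) = Dom K (fst A)"
    "fst A \<odot> act B A v \<beta> = Src K \<beta>"
  using algD[OF assms(1)] lift_problemD[OF assms(2)] unfolding act_def
  by (simp_all add: Comp_reassoc[of "fst A" "mid (snd A)" "cd B (fst A)"])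

lemma act_Id2:
  assumes "alg B A" "v \<in> Arr K" "Cod K v = Dom K (fst A)"
  shows "act B A v (Id2 K (fst A \<odot> v)) = v"
  using assms unfolding is_alg_action action_def act_def by auto

lemma act_VComp:
  assumes "alg B A" "lift_problem K (fst A) v \<beta>" "\<gamma> \<in> Cell K" "Tgt K \<gamma> = Src K \<beta>"
  shows "act B A v (\<beta> \<bullet> \<gamma>) = act B A (act B A v \<beta>) \<gamma>"
  using assms lift_problemD[OF assms(2)] unfolding is_alg_action action_def act_def by auto

lemma algI:
  assumes [simp]: "x \<in> Arr K" "Cod K x = B" "a \<in> Arr K" "Dom K a = Dom K (cd B x)" "Cod K a = Dom K x" "x \<odot> a = cd B x"
    and "\<And>v. \<lbrakk>v \<in> Arr K; Cod K v = Dom K x\<rbrakk> \<Longrightarrow> act B (x, (cd B x, a, x)) v (Id2 K (x \<odot> v)) = v"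
    and "\<And>v \<beta> \<gamma>. \<lbrakk>lift_problem K x v \<beta>; \<gamma> \<in> Cell K; Tgt K \<gamma> = Src K \<beta>\<rbrakk> \<Longrightarrow>
      act B (x, (cd B x, a, x)) v (\<beta> \<bullet> \<gamma>) = act B (x, (cd B x, a, x)) (act B (x, (cd B x, a, x)) v \<beta>) \<gamma>"
  shows "alg B (x, (cd B x, a, x))"
proof -
  have "action B x a"
    unfolding action_def using assms lift_problemD[of x] by (simp add: act_def)
  then show ?thesis unfolding is_alg_action by blast
qed

lemma act_universal: "alg B A \<Longrightarrow> act B A (cq B (fst A)) (cl B (fst A)) = mid (snd A)"
  using algD[of B A] by (simp add: act_def carr_id)

text \<open>
  Compatibility of u with the structure arrows is the case of the universal 2-cell, and every other case is
  a restriction of it.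
\<close>

lemma algmor_iff:
  "algmor B A u A' \<longleftrightarrow> alg B A \<and> alg B A' \<and> (\<exists>k. u = (fst A, k, fst A') \<and> k \<in> Arr K \<and> Dom K k = Dom K (fst A)
     \<and> Cod K k = Dom K (fst A') \<and> fst A' \<odot> k = fst A
     \<and> (\<forall>v \<beta>. lift_problem K (fst A) v \<beta> \<longrightarrow> k \<odot> act B A v \<beta> = act B A' (k \<odot> v) \<beta>))"
   (is "?L \<longleftrightarrow> ?R")
proof
  assume L: ?L
  then have A: "alg B A" "alg B A'" by (auto simp: is_alg_mor_def)
  note D = algD[OF A(1)] algD[OF A(2)]
  define x a x' a' where xa: "x = fst A" "a = mid (snd A)" "x' = fst A'" "a' = mid (snd A')"
  from D have Aeq: "A = (x, (cd B x, a, x))" "A' = (x', (cd B x', a', x'))" unfolding xa by auto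
  note [simp] = D(1-6,8-13)[folded xa]
  obtain k where u: "u = (x, k, x')" and [simp]: "k \<in> Arr K" "Dom K k = Dom K x" "Cod K k = Dom K x'" "x' \<odot> k = x"
    using L unfolding is_alg_mor_def by (cases u) (auto simp: hom1_iff xa)
  have eq: "k \<odot> a = a' \<odot> carr B x' (cd B x) (k \<odot> cq B x) (cl B x)"
    using L unfolding is_alg_mor_def u Aeq by (simp add: Phi_simps)
  have [simp]: "x' \<odot> (k \<odot> h) = x \<odot> h" if "h \<in> Arr K" "Cod K h = Dom K x" for h
    using that by (simp add: Comp_reassoc)
  have "k \<odot> act B A v \<beta> = act B A' (k \<odot> v) \<beta>" if lp: "lift_problem K x v \<beta>" for v \<beta>
  proof -
    note [simp] = lift_problemD[OF lp]
    have "carr B x' (cd B x) (k \<odot> cq B x) (cl B x) \<odot> carr B x (Src K \<beta>) v \<beta> = carr B x' (Src K \<beta>) (k \<odot> v) \<beta>"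
      using lift_problem_mor[OF comma_lift_problem[of x B], of x' k] by (subst carr_comp) simp_all
    then show ?thesis unfolding act_def Aeq using eq
      by (simp add: Comp_reassoc[of k a "a' \<odot> carr B x' (cd B x) (k \<odot> cq B x) (cl B x)"])
  qed
  with A u show ?R unfolding xa(1,3)[symmetric] by auto
next
  assume R: ?R
  then have A: "alg B A" "alg B A'" by auto
  note D = algD[OF A(1)] algD[OF A(2)]
  define x a x' a' where xa: "x = fst A" "a = mid (snd A)" "x' = fst A'" "a' = mid (snd A')"
  from D have Aeq: "A = (x, (cd B x, a, x))" "A' = (x', (cd B x', a', x'))" unfolding xa by auto
  note [simp] = D(1-6,8-13)[folded xa]
  from R obtain k where u: "u = (x, k, x')" and [simp]: "k \<in> Arr K" "Dom K k = Dom K x" "Cod K k = Dom K x'" "x' \<odot> k = x"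
    and k: "\<And>v \<beta>. lift_problem K x v \<beta> \<Longrightarrow> k \<odot> act B A v \<beta> = act B A' (k \<odot> v) \<beta>"
    unfolding xa by blast
  from k[OF comma_lift_problem] have "k \<odot> a = a' \<odot> carr B x' (cd B x) (k \<odot> cq B x) (cl B x)"
    by (simp add: act_def Aeq carr_id)
  then show ?L using A unfolding is_alg_mor_def u Aeq by (simp add: hom1_iff Phi_simps)
qed

end

section \<open>Split fibrations and algebras\<close>

context two_category
begin

lemma split_fibD:
  assumes "split_fib K f \<chi>"
  shows "f \<in> Arr K"
    and "lift_problem K f g \<beta> \<Longrightarrow> cartesian_cell K f (\<chi> g \<beta>)"
    and "lift_problem K f g \<beta> \<Longrightarrow> \<chi> g \<beta> \<in> Cell K"
    and "lift_problem K f g \<beta> \<Longrightarrow> Tgt K (\<chi> g \<beta>) = g"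
    and "lift_problem K f g \<beta> \<Longrightarrow> f \<rhd> \<chi> g \<beta> = \<beta>"
    and "\<lbrakk>g \<in> Arr K; Cod K g = Dom K f\<rbrakk> \<Longrightarrow> \<chi> g (Id2 K (f \<odot> g)) = Id2 K g"
    and "\<lbrakk>lift_problem K f g \<beta>; \<gamma> \<in> Cell K; Tgt K \<gamma> = Src K \<beta>\<rbrakk>
      \<Longrightarrow> \<chi> g (\<beta> \<bullet> \<gamma>) = \<chi> g \<beta> \<bullet> \<chi> (Src K (\<chi> g \<beta>)) \<gamma>"
    and "\<lbrakk>lift_problem K f g \<beta>; h \<in> Arr K; Cod K h = Dom K g\<rbrakk> \<Longrightarrow> \<chi> g \<beta> \<lhd> h = \<chi> (g \<odot> h) (\<beta> \<lhd> h)"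
  using assms unfolding split_fib_def by (blast, blast, simp_all add: cartesian_cell_def)

lemma split_fib_ends:
  assumes "split_fib K f \<chi>" "lift_problem K f g \<beta>"
  shows "Dom K (Src K (\<chi> g \<beta>)) = Dom K g" "Cod K (Src K (\<chi> g \<beta>)) = Dom K f" "f \<odot> Src K (\<chi> g \<beta>) = Src K \<beta>"
proof -
  note [simp] = split_fibD(3,4)[OF assms] split_fibD(1)[OF assms(1)] lift_problemD[OF assms(2)]
  show 1: "Dom K (Src K (\<chi> g \<beta>)) = Dom K g" "Cod K (Src K (\<chi> g \<beta>)) = Dom K f"
    using Cell_ends(3,4)[of "\<chi> g \<beta>"] by simp_all
  have "Src K (f \<rhd> \<chi> g \<beta>) = f \<odot> Src K (\<chi> g \<beta>)" by (rule whisker_l_simps) (simp_all add: 1)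
  then show "f \<odot> Src K (\<chi> g \<beta>) = Src K \<beta>" by (simp add: split_fibD(5)[OF assms])
qed

lemma cartesian_cellD:
  assumes "cartesian_cell K f \<sigma>" "\<rho> \<in> Cell K" "Tgt K \<rho> = Tgt K \<sigma>" "\<delta> \<in> Cell K" "Src K \<delta> = f \<odot> Src K \<rho>"
    "Tgt K \<delta> = f \<odot> Src K \<sigma>" "(f \<rhd> \<sigma>) \<bullet> \<delta> = f \<rhd> \<rho>"
  shows "\<exists>!\<tau>. \<tau> \<in> hom2 K (Src K \<rho>) (Src K \<sigma>) \<and> f \<rhd> \<tau> = \<delta> \<and> \<sigma> \<bullet> \<tau> = \<rho>"
proof -
  have "\<delta> \<in> hom2 K (f \<odot> Src K \<rho>) (f \<odot> Src K \<sigma>)" using assms(4-6) by (simp add: hom2_iff)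
  with assms(1-3,7) show ?thesis unfolding cartesian_cell_def by blast
qed

lemma cartesian_cell_eqI:
  assumes c: "cartesian_cell K f \<sigma>" and f: "f \<in> Arr K" and t: "\<tau> \<in> Cell K" "\<tau>' \<in> Cell K" "Src K \<tau> = Src K \<tau>'" "Tgt K \<tau> = Src K \<sigma>"
    "Tgt K \<tau>' = Src K \<sigma>" and e: "f \<rhd> \<tau> = f \<rhd> \<tau>'" "\<sigma> \<bullet> \<tau> = \<sigma> \<bullet> \<tau>'"
  shows "\<tau> = \<tau>'"
proof -
  have s: "\<sigma> \<in> Cell K" "Cod K (Src K \<sigma>) = Dom K f" using c unfolding cartesian_cell_def by auto
  have "Cod K (Src K \<tau>') = Dom K f" using Cell_ends(4)[OF t(2)] s t(5) by simp
  then have "\<exists>!t. t \<in> hom2 K (Src K (\<sigma> \<bullet> \<tau>')) (Src K \<sigma>) \<and> f \<rhd> t = f \<rhd> \<tau>' \<and> \<sigma> \<bullet> t = \<sigma> \<bullet> \<tau>'"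
    using s t f by (intro cartesian_cellD[OF c]) simp_all
  moreover have "Src K (\<sigma> \<bullet> \<tau>') = Src K \<tau>'" using s t by simp
  ultimately show ?thesis using t e unfolding hom2_iff by auto
qed

end

context commas
begin

lemma alg_unit: "alg B A \<Longrightarrow> mid (snd A) \<odot> carr B (fst A) (fst A) (Id1 K (Dom K (fst A))) (Id2 K (fst A)) = Id1 K (Dom K (fst A))"
  using act_Id2[of B A "Id1 K (Dom K (fst A))"] algD[of B A] by (simp add: act_def)

lemma alg_mult:
  assumes A: "alg B A" and y: "y = cd B (fst A)"
  shows "mid (snd A) \<odot> carr B (fst A) (cd B y) (cq B (fst A) \<odot> cq B y) ((cl B (fst A) \<lhd> cq B y) \<bullet> cl B y)
    = mid (snd A) \<odot> carr B (fst A) (cd B y) (mid (snd A) \<odot> cq B y) (cl B y)"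
proof -
  define x where "x = fst A"
  note [simp] = algD(1-6)[OF A, folded x_def]
  have [simp]: "y \<in> Arr K" "Cod K y = B" "cl B x \<in> Cell K" "Src K (cl B x) = y" "Tgt K (cl B x) = x \<odot> cq B x"
     "cq B x \<in> Arr K" "Dom K (cq B x) = Dom K y" "Cod K (cq B x) = Dom K x"
    unfolding y x_def[symmetric] by simp_all
  have lp: "lift_problem K x (cq B x \<odot> cq B y) (cl B x \<lhd> cq B y)"
    by (simp add: lift_problem_def)
  have e: "carr B x (y \<odot> cq B y) (cq B x \<odot> cq B y) (cl B x \<lhd> cq B y) = cq B y"
    by (rule comma_arr_eqI[of B x]) (simp_all add: y x_def[symmetric])
  show ?thesis
    using act_VComp[OF A, folded x_def, OF lp, of "cl B y"] unfolding act_def x_def[symmetric] by (simp add: e)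
qed

lemma fib_of_alg_simps:
  assumes A: "alg B A" and lp: "lift_problem K (fst A) g \<beta>"
  shows "fib_of_alg K cm B A g \<beta> \<in> Cell K" "Src K (fib_of_alg K cm B A g \<beta>) = act B A g \<beta>"
    "Tgt K (fib_of_alg K cm B A g \<beta>) = g" "fst A \<rhd> fib_of_alg K cm B A g \<beta> = \<beta>"
  using algD[OF A] lift_problemD[OF lp] act_Id2[OF A, of g]
  by (simp_all add: fib_of_alg_def Let_def act_def whisker_l_reassoc[of "fst A" "mid (snd A)" "cd B (fst A)"])

lemma fib_of_alg_Id2:
  assumes A: "alg B A" and g: "g \<in> Arr K" "Cod K g = Dom K (fst A)"
  shows "fib_of_alg K cm B A g (Id2 K (fst A \<odot> g)) = Id2 K g"
proof -
  note [simp] = algD(1-6)[OF A] g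
  define w where "w = carr B (fst A) (fst A \<odot> g) g (Id2 K (fst A \<odot> g))"
  have [simp]: "w \<in> Arr K" "Dom K w = Dom K g" "Cod K w = Dom K (cd B (fst A))" "cd B (fst A) \<odot> w = fst A \<odot> g"
    "cq B (fst A) \<odot> w = g" "cl B (fst A) \<lhd> w = Id2 K (fst A \<odot> g)" unfolding w_def by simp_all
  have "ccell B (fst A) w w (Id2 K (fst A \<odot> g)) (Id2 K g) = Id2 K w"
    by (rule comma_cell_eqI[of B "fst A"]) simp_all
  then show ?thesis using act_Id2[OF A g] unfolding fib_of_alg_def act_def w_def by simp
qed

lemma fib_of_alg_restrict:
  assumes A: "alg B A" and lp: "lift_problem K (fst A) g \<beta>" and h: "h \<in> Arr K" "Cod K h = Dom K g"
  shows "fib_of_alg K cm B A g \<beta> \<lhd> h = fib_of_alg K cm B A (g \<odot> h) (\<beta> \<lhd> h)"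
proof -
  define x where "x = fst A"
  note [simp] = algD(1-6)[OF A, folded x_def] lift_problemD[OF lp, folded x_def] lift_problem_ends[OF lp, folded x_def] h
  define w w' where ww: "w = carr B x (Src K \<beta>) g \<beta>" "w' = carr B x (x \<odot> g) g (Id2 K (x \<odot> g))"
  define \<theta> where "\<theta> = ccell B x w w' \<beta> (Id2 K g)"
  have [simp]: "\<theta> \<in> Cell K" "Src K \<theta> = w" "Tgt K \<theta> = w'" "cd B x \<rhd> \<theta> = \<beta>" "cq B x \<rhd> \<theta> = Id2 K g"
    unfolding \<theta>_def ww by simp_all
  have [simp]: "w \<in> Arr K" "Dom K w = Dom K g" "Cod K w = Dom K (cd B x)" unfolding ww by simp_all
  have wh: "w \<odot> h = carr B x (Src K \<beta> \<odot> h) (g \<odot> h) (\<beta> \<lhd> h)"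
      "w' \<odot> h = carr B x (x \<odot> (g \<odot> h)) (g \<odot> h) (Id2 K (x \<odot> (g \<odot> h)))"
    unfolding ww using lp lift_problem_Id2[of x g] by (simp_all add: carr_comp x_def[symmetric])
  have [simp]: "cd B x \<rhd> (\<theta> \<lhd> h) = \<beta> \<lhd> h" "cq B x \<rhd> (\<theta> \<lhd> h) = Id2 K (g \<odot> h)"
    using whisker_Comp(3)[of h "cd B x" \<theta>] whisker_Comp(3)[of h "cq B x" \<theta>] by simp_all
  have "\<theta> \<lhd> h = ccell B x (w \<odot> h) (w' \<odot> h) (\<beta> \<lhd> h) (Id2 K (g \<odot> h))"
    by - (rule comma_cell_eqI[of B x], simp_all add: wh)
  then show ?thesis unfolding fib_of_alg_def Let_def x_def[symmetric] by (simp add: ww[symmetric] \<theta>_def[symmetric] wh)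
qed

text \<open>
  The multiplication law \<open>a \<mu> = a (\<Phi> a)\<close> whiskered with 2-cells of
  \<open>\<Phi>\<^sup>2 x\<close>. The first statement gives the functoriality of the cleavage fib_of_alg;
  the second says that a sends to an identity the canonical cell from the unit at the domain of the chosen
  lift of \<beta> to the element (b, g, \<beta>), which gives uniqueness in the cartesian property.
\<close>

lemma alg_mult_cells:
  assumes A: "alg B A" and lp: "lift_problem K (fst A) g \<beta>"
    and c: "\<gamma> \<in> Cell K" "Tgt K \<gamma> = Src K \<beta>"
  shows "mid (snd A) \<rhd> ccell B (fst A) (carr B (fst A) (Src K \<gamma>) g (\<beta> \<bullet> \<gamma>)) (carr B (fst A) (Src K \<beta>) g \<beta>) \<gamma> (Id2 K g)
    = fib_of_alg K cm B A (act B A g \<beta>) \<gamma>"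
    and "mid (snd A) \<rhd> ccell B (fst A) (carr B (fst A) (Src K \<beta>) (act B A g \<beta>) (Id2 K (Src K \<beta>))) (carr B (fst A) (Src K \<beta>) g \<beta>)
       (Id2 K (Src K \<beta>)) (fib_of_alg K cm B A g \<beta>) = Id2 K (act B A g \<beta>)"
proof -
  define x a b y w where D: "x = fst A" "a = mid (snd A)" "b = Src K \<beta>" "y = cd B x" "w = carr B x b g \<beta>"
  note [simp] = algD(1-6)[OF A, folded D] lift_problemD[OF lp, folded D] lift_problem_ends[OF lp, folded D] c[folded D]
  have b [simp]: "Src K \<beta> = b" by (simp add: D)
  have [simp]: "b \<in> Arr K" "Dom K b = Dom K g" "Cod K b = B"
    using Cell_ends(1)[of \<beta>] lift_problem_ends[OF lp, folded D] by simp_all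
  have [simp]: "y \<in> Arr K" "Cod K y = B" "cl B x \<in> Cell K" "Src K (cl B x) = y" "Tgt K (cl B x) = x \<odot> cq B x"
     "cq B x \<in> Arr K" "Dom K (cq B x) = Dom K y" "Cod K (cq B x) = Dom K x"
    unfolding D(4) by simp_all
  have [simp]: "w \<in> Arr K" "Dom K w = Dom K g" "Cod K w = Dom K y" "y \<odot> w = b" "cq B x \<odot> w = g" "cl B x \<lhd> w = \<beta>"
    unfolding D(4,5) by simp_all
  have act: "act B A g \<beta> = a \<odot> w" unfolding act_def D by simp
  have [simp]: "Dom K (Src K \<gamma>) = Dom K g" "Cod K (Src K \<gamma>) = B" using Cell_ends(3,4)[OF c(1)] by simp_all
  define i where "i = carr B x x (Id1 K (Dom K x)) (Id2 K x)"
  define m where "m = carr B x (cd B y) (cq B x \<odot> cq B y) ((cl B x \<lhd> cq B y) \<bullet> cl B y)"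
  define f where "f = carr B x (cd B y) (a \<odot> cq B y) (cl B y)"
  note [simp] = D(4)[symmetric]
  have [simp]: "x \<odot> (a \<odot> h) = y \<odot> h" if "h \<in> Arr K" "Cod K h = Dom K y" for h
    using that by (simp add: Comp_reassoc[of x a y])
  have [simp]: "x \<rhd> (a \<rhd> h) = y \<rhd> h" if "h \<in> Cell K" "Cod K (Src K h) = Dom K y" for h
    using that by (simp add: whisker_l_reassoc[of x a y])
  have [simp]: "i \<in> Arr K" "Dom K i = Dom K x" "Cod K i = Dom K y" "y \<odot> i = x" "cq B x \<odot> i = Id1 K (Dom K x)" "cl B x \<lhd> i = Id2 K x"
    unfolding i_def using carr_simps[of x B "Id1 K (Dom K x)" "Id2 K x" x] by simp_all
  have ai [simp]: "a \<odot> i = Id1 K (Dom K x)" using alg_unit[OF A] unfolding D(1,2)[symmetric] i_def .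
  have [simp]: "m \<in> Arr K" "Dom K m = Dom K (cd B y)" "Cod K m = Dom K y" "y \<odot> m = cd B y" "cq B x \<odot> m = cq B x \<odot> cq B y"
    "cl B x \<lhd> m = (cl B x \<lhd> cq B y) \<bullet> cl B y"
    unfolding m_def using carr_simps[of x B "cq B x \<odot> cq B y" "(cl B x \<lhd> cq B y) \<bullet> cl B y" "cd B y"] by simp_all
  have [simp]: "f \<in> Arr K" "Dom K f = Dom K (cd B y)" "Cod K f = Dom K y" "y \<odot> f = cd B y" "cq B x \<odot> f = a \<odot> cq B y"
    "cl B x \<lhd> f = cl B y"
    unfolding f_def using carr_simps[of x B "a \<odot> cq B y" "cl B y" "cd B y"] by simp_all
  have am: "a \<odot> m = a \<odot> f" using alg_mult[OF A, of y] unfolding D(1,2)[symmetric] m_def f_def by simp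
  have amf: "a \<rhd> (m \<rhd> M) = a \<rhd> (f \<rhd> M)" if "M \<in> Cell K" "Cod K (Src K M) = Dom K (cd B y)" for M
    using whisker_Comp(1)[of m a M] whisker_Comp(1)[of f a M] that am by simp
  have 1: "y \<rhd> (i \<rhd> z) = x \<rhd> z" "cq B x \<rhd> (i \<rhd> z) = z" "a \<rhd> (i \<rhd> z) = z" if "z \<in> Cell K" "Cod K (Src K z) = Dom K x" for z
    using that by (simp_all add: whisker_l_reassoc[of y i x] whisker_l_reassoc[of _ i "Id1 K (Dom K x)"])
  have 2 [simp]: "y \<rhd> (m \<rhd> z) = cd B y \<rhd> z" "cq B x \<rhd> (m \<rhd> z) = cq B x \<rhd> (cq B y \<rhd> z)" 
    "y \<rhd> (f \<rhd> z) = cd B y \<rhd> z" "cq B x \<rhd> (f \<rhd> z) = a \<rhd> (cq B y \<rhd> z)" if "z \<in> Cell K" "Cod K (Src K z) = Dom K (cd B y)" for z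
    using that by (simp_all add: whisker_l_reassoc[of y m "cd B y"] whisker_l_reassoc[of y f "cd B y"]
        whisker_l_reassoc[of _ m "cq B x \<odot> cq B y"] whisker_l_reassoc[of _ f "a \<odot> cq B y"])
  have 3 [simp]: "y \<odot> (i \<odot> z) = x \<odot> z" "cq B x \<odot> (i \<odot> z) = z" "a \<odot> (i \<odot> z) = z" if "z \<in> Arr K" "Cod K z = Dom K x" for z
    using that by (simp_all add: Comp_reassoc[of y i x] Comp_reassoc[of _ i "Id1 K (Dom K x)"])
  have 4 [simp]: "y \<odot> (m \<odot> z) = cd B y \<odot> z" "cq B x \<odot> (m \<odot> z) = cq B x \<odot> (cq B y \<odot> z)" 
    "y \<odot> (f \<odot> z) = cd B y \<odot> z" "cq B x \<odot> (f \<odot> z) = a \<odot> (cq B y \<odot> z)" if "z \<in> Arr K" "Cod K z = Dom K (cd B y)" for z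
    using that by (simp_all add: Comp_reassoc[of y m "cd B y"] Comp_reassoc[of y f "cd B y"]
        Comp_reassoc[of _ m "cq B x \<odot> cq B y"] Comp_reassoc[of _ f "a \<odot> cq B y"])
  have ig: "carr B x (x \<odot> g) g (Id2 K (x \<odot> g)) = i \<odot> g"
    by (rule comma_arr_eqI[of B x]) simp_all
  have iaw: "carr B x b (a \<odot> w) (Id2 K b) = i \<odot> (a \<odot> w)"
    by (rule comma_arr_eqI[of B x]) simp_all
  \<comment> \<open>W1, W2 and W3 are the elements of \<open>\<Phi>\<^sup>2 x\<close> given by the composable pairs (id, \<beta>), (\<beta>, id) and (\<gamma>, \<beta>).\<close>
  define W1 where "W1 = carr B y b w (Id2 K b)"
  have [simp]: "W1 \<in> Arr K" "Dom K W1 = Dom K g" "Cod K W1 = Dom K (cd B y)" "cd B y \<odot> W1 = b" "cq B y \<odot> W1 = w"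
    "cl B y \<lhd> W1 = Id2 K b" unfolding W1_def by simp_all
  define W2 where "W2 = carr B y b (i \<odot> g) \<beta>"
  have [simp]: "W2 \<in> Arr K" "Dom K W2 = Dom K g" "Cod K W2 = Dom K (cd B y)" "cd B y \<odot> W2 = b" "cq B y \<odot> W2 = i \<odot> g"
    "cl B y \<lhd> W2 = \<beta>" unfolding W2_def by simp_all
  define W3 where "W3 = carr B y (Src K \<gamma>) w \<gamma>"
  have [simp]: "W3 \<in> Arr K" "Dom K W3 = Dom K g" "Cod K W3 = Dom K (cd B y)" "cd B y \<odot> W3 = Src K \<gamma>" "cq B y \<odot> W3 = w"
    "cl B y \<lhd> W3 = \<gamma>" unfolding W3_def by simp_all
  have r: "(cl B x \<lhd> cq B y) \<lhd> W1 = \<beta>" "(cl B x \<lhd> cq B y) \<lhd> W3 = \<beta>" "(cl B x \<lhd> cq B y) \<lhd> W2 = Id2 K (x \<odot> g)"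
    by (simp_all add: whisker_r_reassoc[of _ _ w] whisker_r_reassoc[of _ _ "i \<odot> g"])
  have mW: "m \<odot> W1 = w" "m \<odot> W2 = w" "m \<odot> W3 = carr B x (Src K \<gamma>) g (\<beta> \<bullet> \<gamma>)"
    by (rule comma_arr_eqI[of B x]; simp add: r)+
  have fW: "f \<odot> W1 = i \<odot> (a \<odot> w)" "f \<odot> W2 = w" "f \<odot> W3 = carr B x (Src K \<gamma>) (a \<odot> w) \<gamma>"
    by (rule comma_arr_eqI[of B x]; simp)+
  have [simp]: "y \<odot> carr B x (Src K \<gamma>) g (\<beta> \<bullet> \<gamma>) = Src K \<gamma>" "y \<odot> carr B x (Src K \<gamma>) (a \<odot> w) \<gamma> = Src K \<gamma>"
    using carr_simps(4)[of x B g "\<beta> \<bullet> \<gamma>" "Src K \<gamma>"] carr_simps(4)[of x B "a \<odot> w" \<gamma> "Src K \<gamma>"] by simp_all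
  define N where "N = ccell B x (carr B x (Src K \<gamma>) g (\<beta> \<bullet> \<gamma>)) w \<gamma> (Id2 K g)"
  have [simp]: "N \<in> Cell K" "Src K N = carr B x (Src K \<gamma>) g (\<beta> \<bullet> \<gamma>)" "Tgt K N = w" "y \<rhd> N = \<gamma>" "cq B x \<rhd> N = Id2 K g"
    unfolding N_def using comma_cell_simps[of x B "carr B x (Src K \<gamma>) g (\<beta> \<bullet> \<gamma>)" w \<gamma> "Id2 K g"] by simp_all
  define M where "M = ccell B y W3 W1 \<gamma> (Id2 K w)"
  have [simp]: "M \<in> Cell K" "Src K M = W3" "Tgt K M = W1" "cd B y \<rhd> M = \<gamma>" "cq B y \<rhd> M = Id2 K w"
    unfolding M_def by simp_all
  define T where "T = ccell B x (carr B x (Src K \<gamma>) (a \<odot> w) \<gamma>) (i \<odot> (a \<odot> w)) \<gamma> (Id2 K (a \<odot> w))"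
  have [simp]: "T \<in> Cell K" "Src K T = carr B x (Src K \<gamma>) (a \<odot> w) \<gamma>" "Tgt K T = i \<odot> (a \<odot> w)" "y \<rhd> T = \<gamma>" "cq B x \<rhd> T = Id2 K (a \<odot> w)"
    unfolding T_def using comma_cell_simps[of x B "carr B x (Src K \<gamma>) (a \<odot> w) \<gamma>" "i \<odot> (a \<odot> w)" \<gamma> "Id2 K (a \<odot> w)"] by simp_all
  \<comment> \<open>The multiplication composes the pairs, while \<open>f = \<Phi> a\<close> lets the inner 2-cell act.\<close>
  have "m \<rhd> M = N" by (rule comma_cell_eqI[of B x]) (simp_all add: mW)
  moreover have "f \<rhd> M = T" by (rule comma_cell_eqI[of B x]) (simp_all add: fW)
  ultimately have "a \<rhd> N = a \<rhd> T" using amf[of M] by simp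
  then show "mid (snd A) \<rhd> ccell B (fst A) (carr B (fst A) (Src K \<gamma>) g (\<beta> \<bullet> \<gamma>)) (carr B (fst A) (Src K \<beta>) g \<beta>) \<gamma> (Id2 K g)
    = fib_of_alg K cm B A (act B A g \<beta>) \<gamma>"
    unfolding fib_of_alg_def Let_def act D(1,2)[symmetric] N_def T_def by (simp add: D(5)[symmetric] iaw)
  define \<theta> where "\<theta> = ccell B x w (i \<odot> g) \<beta> (Id2 K g)"
  have [simp]: "\<theta> \<in> Cell K" "Src K \<theta> = w" "Tgt K \<theta> = i \<odot> g" "y \<rhd> \<theta> = \<beta>" "cq B x \<rhd> \<theta> = Id2 K g"
    unfolding \<theta>_def using comma_cell_simps[of x B w "i \<odot> g" \<beta> "Id2 K g"] by simp_all
  have fib: "fib_of_alg K cm B A g \<beta> = a \<rhd> \<theta>"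
    unfolding fib_of_alg_def Let_def D(1,2)[symmetric] \<theta>_def by (simp add: D(5)[symmetric] ig)
  define E where "E = ccell B y W1 W2 (Id2 K b) \<theta>"
  have [simp]: "E \<in> Cell K" "Src K E = W1" "Tgt K E = W2" "cd B y \<rhd> E = Id2 K b" "cq B y \<rhd> E = \<theta>"
    unfolding E_def by simp_all
  have "m \<rhd> E = Id2 K w" by (rule comma_cell_eqI[of B x]) (simp_all add: mW)
  moreover have "f \<rhd> E = ccell B x (i \<odot> (a \<odot> w)) w (Id2 K b) (a \<rhd> \<theta>)"
    using comma_cell_simps[of x B "i \<odot> (a \<odot> w)" w "Id2 K b" "a \<rhd> \<theta>"] by - (rule comma_cell_eqI[of B x], simp_all add: fW)
  ultimately have "a \<rhd> ccell B x (i \<odot> (a \<odot> w)) w (Id2 K b) (a \<rhd> \<theta>) = Id2 K (a \<odot> w)" using amf[of E] by simp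
  then show "mid (snd A) \<rhd> ccell B (fst A) (carr B (fst A) (Src K \<beta>) (act B A g \<beta>) (Id2 K (Src K \<beta>))) (carr B (fst A) (Src K \<beta>) g \<beta>)
       (Id2 K (Src K \<beta>)) (fib_of_alg K cm B A g \<beta>) = Id2 K (act B A g \<beta>)"
    unfolding act D(1,2)[symmetric] fib by (simp add: D(5)[symmetric] iaw)
qed

text \<open>The unit i of \<Phi> at x sends an element g to the pair of g and an identity 2-cell.\<close>

lemma unit_simps:
  assumes x: "x \<in> Arr K" "Cod K x = B" and i: "i = carr B x x (Id1 K (Dom K x)) (Id2 K x)"
  shows "i \<in> Arr K" "Dom K i = Dom K x" "Cod K i = Dom K (cd B x)" "cd B x \<odot> i = x" "cq B x \<odot> i = Id1 K (Dom K x)"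
    and "\<lbrakk>g \<in> Arr K; Cod K g = Dom K x\<rbrakk> \<Longrightarrow> carr B x (x \<odot> g) g (Id2 K (x \<odot> g)) = i \<odot> g"
    and "\<lbrakk>g \<in> Arr K; Cod K g = Dom K x\<rbrakk> \<Longrightarrow> cd B x \<odot> (i \<odot> g) = x \<odot> g"
    and "\<lbrakk>g \<in> Arr K; Cod K g = Dom K x\<rbrakk> \<Longrightarrow> cq B x \<odot> (i \<odot> g) = g"
    and "\<lbrakk>g \<in> Arr K; Cod K g = Dom K x\<rbrakk> \<Longrightarrow> (cl B x \<lhd> i) \<lhd> g = Id2 K (x \<odot> g)"
    and "\<lbrakk>z \<in> Cell K; Cod K (Src K z) = Dom K x\<rbrakk> \<Longrightarrow> cd B x \<rhd> (i \<rhd> z) = x \<rhd> z"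
    and "\<lbrakk>z \<in> Cell K; Cod K (Src K z) = Dom K x\<rbrakk> \<Longrightarrow> cq B x \<rhd> (i \<rhd> z) = z"
proof -
  note [simp] = x
  show 1 [simp]: "i \<in> Arr K" "Dom K i = Dom K x" "Cod K i = Dom K (cd B x)" "cd B x \<odot> i = x" "cq B x \<odot> i = Id1 K (Dom K x)"
    unfolding i by simp_all
  have [simp]: "cl B x \<lhd> i = Id2 K x" unfolding i by simp
  show [simp]: "cd B x \<odot> (i \<odot> g) = x \<odot> g" "cq B x \<odot> (i \<odot> g) = g" "(cl B x \<lhd> i) \<lhd> g = Id2 K (x \<odot> g)"
    if "g \<in> Arr K" "Cod K g = Dom K x" for g
    using that by (simp_all add: Comp_reassoc[of _ i x] Comp_reassoc[of _ i "Id1 K (Dom K x)"])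
  show "carr B x (x \<odot> g) g (Id2 K (x \<odot> g)) = i \<odot> g" if "g \<in> Arr K" "Cod K g = Dom K x" for g
    using that by - (rule comma_arr_eqI[of B x], simp_all)
  show "cd B x \<rhd> (i \<rhd> z) = x \<rhd> z" "cq B x \<rhd> (i \<rhd> z) = z" if "z \<in> Cell K" "Cod K (Src K z) = Dom K x" for z
    using that by (simp_all add: whisker_l_reassoc[of _ i x] whisker_l_reassoc[of _ i "Id1 K (Dom K x)"])
qed

text \<open>
  Given \<rho> into g over \<beta> \<bullet> \<delta>, the components \<delta> and \<rho> form a 2-cell
  \<kappa> of \<open>1\<^sub>B \<down> x\<close> from the unit at the domain of \<rho> to (b, g, \<beta>),
  and a \<kappa> is the factorization. Any other factorization \<tau> has
  \<open>\<kappa> = e \<bullet> i \<tau>\<close> for a cell e that a sends to an identity.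
\<close>

lemma fib_of_alg_cartesian:
  assumes A: "alg B A" and lp: "lift_problem K (fst A) g \<beta>"
  shows "cartesian_cell K (fst A) (fib_of_alg K cm B A g \<beta>)"
proof -
  define x a b w \<chi> where D: "x = fst A" "a = mid (snd A)" "b = Src K \<beta>" "w = carr B x b g \<beta>"
    "\<chi> = fib_of_alg K cm B A g \<beta>"
  note [simp] = algD(1-6)[OF A, folded D] lift_problemD[OF lp, folded D] lift_problem_ends[OF lp, folded D]
  have b [simp]: "Src K \<beta> = b" by (simp add: D)
  have [simp]: "b \<in> Arr K" "Dom K b = Dom K g" "Cod K b = B"
    using Cell_ends(1)[of \<beta>] lift_problem_ends[OF lp, folded D] by simp_all
  have [simp]: "w \<in> Arr K" "Dom K w = Dom K g" "Cod K w = Dom K (cd B x)" "cd B x \<odot> w = b" "cq B x \<odot> w = g" "cl B x \<lhd> w = \<beta>"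
    unfolding D(4) by simp_all
  have act: "act B A g \<beta> = a \<odot> w" unfolding act_def D by simp
  have \<chi> [simp]: "\<chi> \<in> Cell K" "Src K \<chi> = a \<odot> w" "Tgt K \<chi> = g" "x \<rhd> \<chi> = \<beta>"
    using fib_of_alg_simps[OF A lp] unfolding D(1,5)[symmetric] act by simp_all
  define i where "i = carr B x x (Id1 K (Dom K x)) (Id2 K x)"
  have x: "x \<in> Arr K" "Cod K x = B" by simp_all
  note [simp] = unit_simps(1-5,7-11)[OF x i_def]
  note ig = unit_simps(6)[OF x i_def]
  have ai: "a \<odot> i = Id1 K (Dom K x)" using alg_unit[OF A] unfolding D(1,2)[symmetric] i_def .
  have [simp]: "a \<odot> (i \<odot> z) = z" if "z \<in> Arr K" "Cod K z = Dom K x" for z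
    using that by (simp add: Comp_reassoc[OF ai])
  have [simp]: "a \<rhd> (i \<rhd> z) = z" if "z \<in> Cell K" "Cod K (Src K z) = Dom K x" for z
    using that by (simp add: whisker_l_reassoc[OF ai])
  have [simp]: "x \<odot> (a \<odot> h) = cd B x \<odot> h" if "h \<in> Arr K" "Cod K h = Dom K (cd B x)" for h
    using that by (simp add: Comp_reassoc[of x a "cd B x"])
  have [simp]: "x \<rhd> (a \<rhd> h) = cd B x \<rhd> h" if "h \<in> Cell K" "Cod K (Src K h) = Dom K (cd B x)" for h
    using that by (simp add: whisker_l_reassoc[of x a "cd B x"])
  have [simp]: "carr B x b (a \<odot> w) (Id2 K b) = i \<odot> (a \<odot> w)"
    using ig[of "a \<odot> w"] by simp
  \<comment> \<open>The cell that the action sends to an identity.\<close>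
  define e where "e = ccell B x (i \<odot> (a \<odot> w)) w (Id2 K b) \<chi>"
  have [simp]: "e \<in> Cell K" "Src K e = i \<odot> (a \<odot> w)" "Tgt K e = w" "cd B x \<rhd> e = Id2 K b" "cq B x \<rhd> e = \<chi>"
    unfolding e_def by simp_all
  have ae [simp]: "a \<rhd> e = Id2 K (a \<odot> w)"
    using alg_mult_cells(2)[OF A lp, of "Id2 K b"] unfolding D(1,2)[symmetric] act e_def D(5)[symmetric] by (simp add: D(4)[symmetric])
  define \<theta> where "\<theta> = ccell B x w (i \<odot> g) \<beta> (Id2 K g)"
  have [simp]: "\<theta> \<in> Cell K" "Src K \<theta> = w" "Tgt K \<theta> = i \<odot> g" "cd B x \<rhd> \<theta> = \<beta>" "cq B x \<rhd> \<theta> = Id2 K g"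
    unfolding \<theta>_def by simp_all
  have fib: "\<chi> = a \<rhd> \<theta>"
    unfolding fib_of_alg_def Let_def D(1,2)[symmetric] \<theta>_def D(5) by (simp add: D(4)[symmetric] ig)
  have "\<exists>!\<tau>. \<tau> \<in> hom2 K (Src K \<rho>) (Src K \<chi>) \<and> x \<rhd> \<tau> = \<delta> \<and> \<chi> \<bullet> \<tau> = \<rho>"
    if \<rho> [simp]: "\<rho> \<in> Cell K" "Tgt K \<rho> = g"
      and d: "\<delta> \<in> hom2 K (x \<odot> Src K \<rho>) (x \<odot> Src K \<chi>)" and eq: "(x \<rhd> \<chi>) \<bullet> \<delta> = x \<rhd> \<rho>" for \<rho> \<delta>
  proof -
    define r where "r = Src K \<rho>"
    have [simp]: "Src K \<rho> = r" by (simp add: r_def)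
    have r [simp]: "r \<in> Arr K" "Dom K r = Dom K g" "Cod K r = Dom K x" 
      using Cell_ends[of \<rho>] by simp_all
    have d [simp]: "\<delta> \<in> Cell K" "Src K \<delta> = x \<odot> r" "Tgt K \<delta> = b"
      using d by (simp_all add: hom2_iff)
    have eq [simp]: "\<beta> \<bullet> \<delta> = x \<rhd> \<rho>" using eq by simp
    define \<kappa> where "\<kappa> = ccell B x (i \<odot> r) w \<delta> \<rho>"
    have [simp]: "\<kappa> \<in> Cell K" "Src K \<kappa> = i \<odot> r" "Tgt K \<kappa> = w" "cd B x \<rhd> \<kappa> = \<delta>" "cq B x \<rhd> \<kappa> = \<rho>"
      unfolding \<kappa>_def by simp_all
    show ?thesis
    proof (rule ex1I[of _ "a \<rhd> \<kappa>"])
      have "\<theta> \<bullet> \<kappa> = i \<rhd> \<rho>" by (rule comma_cell_eqI[of B x]) simp_all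
      then have "a \<rhd> (\<theta> \<bullet> \<kappa>) = \<rho>" by simp
      then show "a \<rhd> \<kappa> \<in> hom2 K (Src K \<rho>) (Src K \<chi>) \<and> x \<rhd> (a \<rhd> \<kappa>) = \<delta> \<and> \<chi> \<bullet> (a \<rhd> \<kappa>) = \<rho>"
        by (simp add: hom2_iff) (simp add: fib)
    next
      fix \<tau> assume "\<tau> \<in> hom2 K (Src K \<rho>) (Src K \<chi>) \<and> x \<rhd> \<tau> = \<delta> \<and> \<chi> \<bullet> \<tau> = \<rho>"
      then have [simp]: "\<tau> \<in> Cell K" "Src K \<tau> = r" "Tgt K \<tau> = a \<odot> w" "x \<rhd> \<tau> = \<delta>" "\<chi> \<bullet> \<tau> = \<rho>"
        by (simp_all add: hom2_iff)
      have "e \<bullet> (i \<rhd> \<tau>) = \<kappa>" by (rule comma_cell_eqI[of B x]) simp_all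
      then have "a \<rhd> \<kappa> = a \<rhd> (e \<bullet> (i \<rhd> \<tau>))" by simp
      also have "\<dots> = \<tau>" by simp
      finally show "\<tau> = a \<rhd> \<kappa>" by simp
    qed
  qed
  then show ?thesis unfolding D(1,5)[symmetric] cartesian_cell_def by simp
qed

theorem split_fib_of_alg:
  assumes A: "alg B A"
  shows "split_fib K (fst A) (fib_of_alg K cm B A)"
proof -
  define x a where D: "x = fst A" "a = mid (snd A)"
  note [simp] = algD(1-6)[OF A, folded D]
  have "fib_of_alg K cm B A g (\<beta> \<bullet> \<gamma>) = fib_of_alg K cm B A g \<beta> \<bullet> fib_of_alg K cm B A (Src K (fib_of_alg K cm B A g \<beta>)) \<gamma>"
    if lp: "lift_problem K x g \<beta>" and c: "\<gamma> \<in> Cell K" "Tgt K \<gamma> = Src K \<beta>" for g \<beta> \<gamma>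
  proof -
    note lp' = lp[unfolded D]
    note [simp] = lift_problemD[OF lp] c
    define w v z where W: "w = carr B x (Src K \<beta>) g \<beta>" "v = carr B x (Src K \<gamma>) g (\<beta> \<bullet> \<gamma>)" "z = carr B x (x \<odot> g) g (Id2 K (x \<odot> g))"
    have Dc: "Dom K (Src K \<gamma>) = Dom K g" using Cell_ends(3)[OF c(1)] lift_problem_ends[OF lp] by simp
    have [simp]: "w \<in> Arr K" "Dom K w = Dom K g" "Cod K w = Dom K (cd B x)" "cd B x \<odot> w = Src K \<beta>" "cq B x \<odot> w = g" "cl B x \<lhd> w = \<beta>"
      "z \<in> Arr K" "Dom K z = Dom K g" "Cod K z = Dom K (cd B x)" "cd B x \<odot> z = x \<odot> g" "cq B x \<odot> z = g" "cl B x \<lhd> z = Id2 K (x \<odot> g)"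
      "v \<in> Arr K" "Dom K v = Dom K g" "Cod K v = Dom K (cd B x)" "cd B x \<odot> v = Src K \<gamma>" "cq B x \<odot> v = g" "cl B x \<lhd> v = \<beta> \<bullet> \<gamma>"
      unfolding W by simp_all
    have "ccell B x v z (\<beta> \<bullet> \<gamma>) (Id2 K g) = ccell B x w z \<beta> (Id2 K g) \<bullet> ccell B x v w \<gamma> (Id2 K g)"
      by (rule comma_cell_eqI[of B x]) simp_all
    then have "a \<rhd> ccell B x v z (\<beta> \<bullet> \<gamma>) (Id2 K g) = (a \<rhd> ccell B x w z \<beta> (Id2 K g)) \<bullet> (a \<rhd> ccell B x v w \<gamma> (Id2 K g))"
      by simp
    moreover have "a \<rhd> ccell B x v w \<gamma> (Id2 K g) = fib_of_alg K cm B A (Src K (fib_of_alg K cm B A g \<beta>)) \<gamma>"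
      using alg_mult_cells(1)[OF A lp' c] unfolding fib_of_alg_simps(2)[OF A lp'] D[symmetric] W[symmetric] .
    moreover have "a \<rhd> ccell B x v z (\<beta> \<bullet> \<gamma>) (Id2 K g) = fib_of_alg K cm B A g (\<beta> \<bullet> \<gamma>)"
      "a \<rhd> ccell B x w z \<beta> (Id2 K g) = fib_of_alg K cm B A g \<beta>"
      unfolding fib_of_alg_def Let_def D[symmetric] by (simp_all add: W[symmetric])
    ultimately show ?thesis by simp
  qed
  then show ?thesis
    unfolding split_fib_def
    using fib_of_alg_simps[OF A] fib_of_alg_cartesian[OF A] fib_of_alg_Id2[OF A] fib_of_alg_restrict[OF A]
    unfolding D[symmetric] by simp
qed

subsection \<open>Algebras from split fibrations\<close>

lemma act_alg_of_fib:
  assumes \<chi>: "split_fib K x \<chi>" and B: "Cod K x = B" and lp: "lift_problem K x v \<beta>"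
  shows "act B (alg_of_fib K cm B x \<chi>) v \<beta> = Src K (\<chi> v \<beta>)"
proof -
  note [simp] = split_fibD(1)[OF \<chi>] B lift_problemD[OF lp]
  have l: "lift_problem K x (cq B x) (cl B x)" by (rule comma_lift_problem) simp_all
  note [simp] = split_fibD(3,4)[OF \<chi> l] split_fib_ends[OF \<chi> l]
  have "\<chi> (cq B x) (cl B x) \<lhd> carr B x (Src K \<beta>) v \<beta> = \<chi> v \<beta>"
    by (simp add: split_fibD(8)[OF \<chi> l])
  from arg_cong[OF this, of "Src K"] show ?thesis
    unfolding act_def alg_of_fib_def by simp
qed

theorem alg_of_fib:
  assumes \<chi>: "split_fib K x \<chi>" and B: "Cod K x = B"
  shows "alg B (alg_of_fib K cm B x \<chi>)"
proof -
  note [simp] = split_fibD(1)[OF \<chi>] B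
  have l: "lift_problem K x (cq B x) (cl B x)" by (rule comma_lift_problem) simp_all
  note [simp] = split_fibD(3,4)[OF \<chi> l] split_fib_ends[OF \<chi> l]
  have lp: "lift_problem K x v (\<beta> \<bullet> \<gamma>)" if "lift_problem K x v \<beta>" "\<gamma> \<in> Cell K" "Tgt K \<gamma> = Src K \<beta>" for v \<beta> \<gamma>
    using lift_problemD[OF that(1)] that(2,3) by (simp add: lift_problem_def)
  have lp': "lift_problem K x (Src K (\<chi> v \<beta>)) \<gamma>" if "lift_problem K x v \<beta>" "\<gamma> \<in> Cell K" "Tgt K \<gamma> = Src K \<beta>" for v \<beta> \<gamma>
    using split_fib_ends[OF \<chi> that(1)] split_fibD(3)[OF \<chi> that(1)] that(2,3) by (simp add: lift_problem_def)
  show ?thesis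
    unfolding alg_of_fib_def
    by (rule algI; (simp; fail)?; fold alg_of_fib_def)
       (simp_all add: act_alg_of_fib[OF \<chi> B] lift_problem_Id2 split_fibD[OF \<chi>] lp lp' split_fib_ends[OF \<chi>])
qed

lemma fst_alg_of_fib [simp]: "fst (alg_of_fib K cm B x \<chi>) = x"
  by (simp add: alg_of_fib_def)

text \<open>
  Restricted along the two ends of the 2-cell of the comma object that defines fib_of_alg, the chosen lift
  of the universal 2-cell becomes \<chi> g \<beta> and an identity. By exchange with this 2-cell its image
  under the action is \<chi> g \<beta>.
\<close>

theorem fib_of_alg_of_fib:
  assumes \<chi>: "split_fib K x \<chi>" and B: "Cod K x = B" and lp: "lift_problem K x g \<beta>"
  shows "fib_of_alg K cm B (alg_of_fib K cm B x \<chi>) g \<beta> = \<chi> g \<beta>"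
proof -
  note [simp] = split_fibD(1)[OF \<chi>] B lift_problemD[OF lp]
  have l: "lift_problem K x (cq B x) (cl B x)" by (rule comma_lift_problem) simp_all
  define s a where sa: "s = \<chi> (cq B x) (cl B x)" "a = Src K s"
  have a [simp]: "Src K s = a" by (simp add: sa)
  have s [simp]: "s \<in> Cell K" "Tgt K s = cq B x" "a \<in> Arr K" "Dom K a = Dom K (cd B x)" "Cod K a = Dom K x"
    using split_fibD(3,4)[OF \<chi> l] split_fib_ends[OF \<chi> l] unfolding sa by simp_all
  define w z where W: "w = carr B x (Src K \<beta>) g \<beta>" "z = carr B x (x \<odot> g) g (Id2 K (x \<odot> g))"
  have [simp]: "w \<in> Arr K" "Dom K w = Dom K g" "Cod K w = Dom K (cd B x)" "cd B x \<odot> w = Src K \<beta>" "cq B x \<odot> w = g" "cl B x \<lhd> w = \<beta>"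
    "z \<in> Arr K" "Dom K z = Dom K g" "Cod K z = Dom K (cd B x)" "cd B x \<odot> z = x \<odot> g" "cq B x \<odot> z = g" "cl B x \<lhd> z = Id2 K (x \<odot> g)"
    unfolding W by simp_all
  define \<theta> where "\<theta> = ccell B x w z \<beta> (Id2 K g)"
  have [simp]: "\<theta> \<in> Cell K" "Src K \<theta> = w" "Tgt K \<theta> = z" "cd B x \<rhd> \<theta> = \<beta>" "cq B x \<rhd> \<theta> = Id2 K g"
    unfolding \<theta>_def by simp_all
  have w: "s \<lhd> w = \<chi> g \<beta>" "s \<lhd> z = Id2 K g"
    unfolding sa by (simp_all add: split_fibD(8)[OF \<chi> l] split_fibD(6)[OF \<chi>])
  have sw: "Src K (s \<lhd> z) = a \<odot> z" "Tgt K (s \<lhd> w) = cq B x \<odot> w" "s \<lhd> w \<in> Cell K" by simp_all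
  have az: "a \<odot> z = g" "Tgt K (\<chi> g \<beta>) = g" "\<chi> g \<beta> \<in> Cell K" using sw unfolding w by simp_all
  have "a \<rhd> \<theta> = \<chi> g \<beta>" using exchange[of \<theta> s] by (simp add: w az)
  then show ?thesis
    unfolding fib_of_alg_def Let_def \<theta>_def W by (simp add: alg_of_fib_def sa)
qed

subsection \<open>Morphisms\<close>

lemma algmorD:
  assumes "algmor B A u A'"
  shows "alg B A" "alg B A'" "u = (fst A, mid u, fst A')" "mid u \<in> Arr K" "Dom K (mid u) = Dom K (fst A)"
    "Cod K (mid u) = Dom K (fst A')" "fst A' \<odot> mid u = fst A"
    and "lift_problem K (fst A) v \<beta> \<Longrightarrow> mid u \<odot> act B A v \<beta> = act B A' (mid u \<odot> v) \<beta>"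
  using assms unfolding algmor_iff by auto

lemma algmorI:
  assumes "alg B A" "alg B A'" "k \<in> Arr K" "Dom K k = Dom K (fst A)"
    "Cod K k = Dom K (fst A')" "fst A' \<odot> k = fst A"
    "\<And>v \<beta>. lift_problem K (fst A) v \<beta> \<Longrightarrow> k \<odot> act B A v \<beta> = act B A' (k \<odot> v) \<beta>"
  shows "algmor B A (fst A, k, fst A') A'"
  using assms unfolding algmor_iff by auto

text \<open>
  Both cells are images under an action of the same kind of 2-cell in a comma object, and u carries one of
  these 2-cells to the other.
\<close>

lemma algmor_fib:
  assumes u: "algmor B A u A'" and lp: "lift_problem K (fst A) g \<beta>"
  shows "mid u \<rhd> fib_of_alg K cm B A g \<beta> = fib_of_alg K cm B A' (mid u \<odot> g) \<beta>"
proof -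
  define x a x' a' k where D: "x = fst A" "a = mid (snd A)" "x' = fst A'" "a' = mid (snd A')" "k = mid u"
  note [simp] = algD(1-6)[OF algmorD(1)[OF u], folded D] algD(1-6)[OF algmorD(2)[OF u], folded D] algmorD(4-7)[OF u, folded D]
    lift_problemD[OF lp, folded D] lift_problem_ends[OF lp, folded D]
  have l: "lift_problem K x (cq B x) (cl B x)" by (rule comma_lift_problem) simp_all
  have [simp]: "x' \<odot> (k \<odot> h) = x \<odot> h" if "h \<in> Arr K" "Cod K h = Dom K x" for h
    using that by (simp add: Comp_reassoc)
  define f where "f = carr B x' (cd B x) (k \<odot> cq B x) (cl B x)"
  have [simp]: "f \<in> Arr K" "Dom K f = Dom K (cd B x)" "Cod K f = Dom K (cd B x')" and f [simp]: "cd B x' \<odot> f = cd B x"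
     "cq B x' \<odot> f = k \<odot> cq B x" "cl B x' \<lhd> f = cl B x"
    unfolding f_def by simp_all
  have ka: "k \<odot> a = a' \<odot> f"
    using algmorD(8)[OF u, folded D, OF l] unfolding act_def f_def D by (simp add: carr_id D[symmetric])
  define w z where W: "w = carr B x (Src K \<beta>) g \<beta>" "z = carr B x (x \<odot> g) g (Id2 K (x \<odot> g))"
  have [simp]: "w \<in> Arr K" "Dom K w = Dom K g" "Cod K w = Dom K (cd B x)" "cd B x \<odot> w = Src K \<beta>" "cq B x \<odot> w = g" "cl B x \<lhd> w = \<beta>"
    "z \<in> Arr K" "Dom K z = Dom K g" "Cod K z = Dom K (cd B x)" "cd B x \<odot> z = x \<odot> g" "cq B x \<odot> z = g" "cl B x \<lhd> z = Id2 K (x \<odot> g)"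
    unfolding W by simp_all
  define \<theta> where "\<theta> = ccell B x w z \<beta> (Id2 K g)"
  have [simp]: "\<theta> \<in> Cell K" "Src K \<theta> = w" "Tgt K \<theta> = z" "cd B x \<rhd> \<theta> = \<beta>" "cq B x \<rhd> \<theta> = Id2 K g"
    unfolding \<theta>_def by simp_all
  have [simp]: "cd B x' \<odot> (f \<odot> h) = cd B x \<odot> h" "cq B x' \<odot> (f \<odot> h) = k \<odot> (cq B x \<odot> h)"
    if "h \<in> Arr K" "Cod K h = Dom K (cd B x)" for h
    using that by (simp_all add: Comp_reassoc[OF f(1)] Comp_reassoc[OF f(2)])
  have [simp]: "cd B x' \<rhd> (f \<rhd> h) = cd B x \<rhd> h" "cq B x' \<rhd> (f \<rhd> h) = k \<rhd> (cq B x \<rhd> h)"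
    if "h \<in> Cell K" "Cod K (Src K h) = Dom K (cd B x)" for h
    using that by (simp_all add: whisker_l_reassoc[OF f(1)] whisker_l_reassoc[OF f(2)])
  have fw: "f \<odot> w = carr B x' (Src K \<beta>) (k \<odot> g) \<beta>" "f \<odot> z = carr B x' (x' \<odot> (k \<odot> g)) (k \<odot> g) (Id2 K (x' \<odot> (k \<odot> g)))"
    by (rule comma_arr_eqI[of B x']; simp)+
  have "f \<rhd> \<theta> = ccell B x' (f \<odot> w) (f \<odot> z) \<beta> (Id2 K (k \<odot> g))"
    by (rule comma_cell_eqI[of B x']) simp_all
  moreover have "k \<rhd> (a \<rhd> \<theta>) = a' \<rhd> (f \<rhd> \<theta>)"
    using whisker_Comp(1)[of a k \<theta>] whisker_Comp(1)[of f a' \<theta>] ka by simp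
  ultimately show ?thesis
    unfolding fib_of_alg_def Let_def D[symmetric] W[symmetric] fw[symmetric] \<theta>_def[symmetric] by simp
qed

lemma algmor_iff_fib:
  assumes "alg B A" "alg B A'" "k \<in> Arr K" "Dom K k = Dom K (fst A)"
    "Cod K k = Dom K (fst A')" "fst A' \<odot> k = fst A"
    and e: "\<And>g \<beta>. lift_problem K (fst A) g \<beta> \<Longrightarrow> k \<rhd> fib_of_alg K cm B A g \<beta> = fib_of_alg K cm B A' (k \<odot> g) \<beta>"
  shows "algmor B A (fst A, k, fst A') A'"
proof (rule algmorI)
  fix v \<beta> assume lp: "lift_problem K (fst A) v \<beta>"
  have lp': "lift_problem K (fst A') (k \<odot> v) \<beta>"
    by (rule lift_problem_mor[OF lp]) (use assms algD[OF assms(1)] algD[OF assms(2)] in simp_all)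
  have "Src K (k \<rhd> fib_of_alg K cm B A v \<beta>) = k \<odot> act B A v \<beta>"
    using fib_of_alg_simps[OF assms(1) lp] act_simps[OF assms(1) lp] assms(3,4) by simp
  then show "k \<odot> act B A v \<beta> = act B A' (k \<odot> v) \<beta>"
    using fib_of_alg_simps[OF assms(2) lp'] e[OF lp] by simp
qed (use assms in simp_all)

end

section \<open>The 2-category of algebras\<close>

context commas
begin

lemma Phi_cell:
  "fcell (mfun (Phi K cm B)) (x, \<sigma>, y) = (cd B x, ccell B y (carr B y (cd B x) (Src K \<sigma> \<odot> cq B x) (cl B x))
     (carr B y (cd B x) (Tgt K \<sigma> \<odot> cq B x) (cl B x)) (Id2 K (cd B x)) (\<sigma> \<lhd> cq B x), cd B y)"
  by (simp add: Phi_def Phi_arr_def)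

text \<open>
  Any 2-cell over B between algebra morphisms is an algebra 2-cell: both sides lie over an identity, and
  they become equal after composition with a chosen cartesian cell, by naturality of the 2-cell on the one
  hand and by the description of chosen cells as images under the action on the other.
\<close>

lemma alg_cell:
  assumes u: "algmor B A (Src (slice K B) \<sigma>) A'" and v: "algmor B A (Tgt (slice K B) \<sigma>) A'"
    and c: "\<sigma> \<in> Cell (slice K B)"
  shows "\<sigma> \<lhd>\<^bsub>slice K B\<^esub> snd A = snd A' \<rhd>\<^bsub>slice K B\<^esub> fcell (mfun (Phi K cm B)) \<sigma>"
proof -
  obtain x s x' where \<sigma>: "\<sigma> = (x, s, x')" by (cases \<sigma>)
  have fst: "fst A = x" "fst A' = x'" using algmorD(3)[OF u] unfolding \<sigma> by simp_all
  define k k' a a' where D: "k = Src K s" "k' = Tgt K s" "a = mid (snd A)" "a' = mid (snd A')"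
  note [simp] = D(1,2)[symmetric]
  note alg = algmorD(1)[OF u] algmorD(2)[OF u]
  note [simp] = algD(1-6)[OF alg(1), folded D, unfolded fst] algD(1-6)[OF alg(2), folded D, unfolded fst]
    algmorD(4-7)[OF u, unfolded \<sigma> fst, simplified] algmorD(4-7)[OF v, unfolded \<sigma> fst, simplified]
  have s [simp]: "s \<in> Cell K" "x' \<rhd> s = Id2 K x" using c unfolding \<sigma> by simp_all
  have l: "lift_problem K x (cq B x) (cl B x)" by (rule comma_lift_problem) simp_all
  have ov [simp]: "x' \<odot> (k \<odot> h) = x \<odot> h" "x' \<odot> (k' \<odot> h) = x \<odot> h" if "h \<in> Arr K" "Cod K h = Dom K x" for h
    using that by (simp_all add: Comp_reassoc[of x' _ x])
  have sh [simp]: "x' \<rhd> (s \<lhd> h) = Id2 K (x \<odot> h)" if "h \<in> Arr K" "Cod K h = Dom K x" for h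
    using whisker_Comp(3)[of h x' s] that by simp
  have [simp]: "x' \<odot> (a' \<odot> h) = cd B x' \<odot> h" if "h \<in> Arr K" "Cod K h = Dom K (cd B x')" for h
    using that by (simp add: Comp_reassoc[of x' a' "cd B x'"])
  have [simp]: "x' \<rhd> (a' \<rhd> h) = cd B x' \<rhd> h" if "h \<in> Cell K" "Cod K (Src K h) = Dom K (cd B x')" for h
    using that by (simp add: whisker_l_reassoc[of x' a' "cd B x'"])
  define f f' where f: "f = carr B x' (cd B x) (k \<odot> cq B x) (cl B x)" "f' = carr B x' (cd B x) (k' \<odot> cq B x) (cl B x)"
  have [simp]: "f \<in> Arr K" "Dom K f = Dom K (cd B x)" "Cod K f = Dom K (cd B x')" "cd B x' \<odot> f = cd B x"
     "cq B x' \<odot> f = k \<odot> cq B x" "cl B x' \<lhd> f = cl B x"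
     "f' \<in> Arr K" "Dom K f' = Dom K (cd B x)" "Cod K f' = Dom K (cd B x')" "cd B x' \<odot> f' = cd B x"
     "cq B x' \<odot> f' = k' \<odot> cq B x" "cl B x' \<lhd> f' = cl B x"
    unfolding f by simp_all
  have ka [simp]: "k \<odot> a = a' \<odot> f" "k' \<odot> a = a' \<odot> f'"
    using algmorD(8)[OF u, unfolded \<sigma> fst, OF l] algmorD(8)[OF v, unfolded \<sigma> fst, OF l]
    unfolding act_def f fst D(3,4)[symmetric] by (simp_all add: carr_id)
  define F where "F = ccell B x' f f' (Id2 K (cd B x)) (s \<lhd> cq B x)"
  have [simp]: "F \<in> Cell K" "Src K F = f" "Tgt K F = f'" "cd B x' \<rhd> F = Id2 K (cd B x)" "cq B x' \<rhd> F = s \<lhd> cq B x"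
    unfolding F_def by simp_all
  define i where "i = carr B x' x' (Id1 K (Dom K x')) (Id2 K x')"
  have x: "x' \<in> Arr K" "Cod K x' = B" by simp_all
  note [simp] = unit_simps(1-5,7-11)[OF x i_def]
  note ig = unit_simps(6)[OF x i_def]
  have ai: "a' \<odot> i = Id1 K (Dom K x')" using alg_unit[OF alg(2)] unfolding fst D(3,4)[symmetric] i_def .
  have [simp]: "a' \<rhd> (i \<rhd> z) = z" if "z \<in> Cell K" "Cod K (Src K z) = Dom K x'" for z
    using that by (simp add: whisker_l_reassoc[OF ai])
  have [simp]: "a' \<odot> (i \<odot> z) = z" if "z \<in> Arr K" "Cod K z = Dom K x'" for z
    using that by (simp add: Comp_reassoc[OF ai])
  define c where "c = fib_of_alg K cm B A (cq B x) (cl B x)"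
  have [simp]: "c \<in> Cell K" "Src K c = a" "Tgt K c = cq B x"
    using fib_of_alg_simps[OF alg(1), unfolded fst, OF l] act_universal[OF alg(1), unfolded fst] unfolding c_def D by simp_all
  define t t' where t: "t = ccell B x' f (i \<odot> (k \<odot> cq B x)) (cl B x) (Id2 K (k \<odot> cq B x))"
     "t' = ccell B x' f' (i \<odot> (k' \<odot> cq B x)) (cl B x) (Id2 K (k' \<odot> cq B x))"
  have [simp]: "t \<in> Cell K" "Src K t = f" "Tgt K t = i \<odot> (k \<odot> cq B x)" "cd B x' \<rhd> t = cl B x" "cq B x' \<rhd> t = Id2 K (k \<odot> cq B x)"
    "t' \<in> Cell K" "Src K t' = f'" "Tgt K t' = i \<odot> (k' \<odot> cq B x)" "cd B x' \<rhd> t' = cl B x" "cq B x' \<rhd> t' = Id2 K (k' \<odot> cq B x)"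
    unfolding t by simp_all
  have kc: "k \<rhd> c = a' \<rhd> t" "k' \<rhd> c = a' \<rhd> t'"
    using algmor_fib[OF u, unfolded \<sigma> fst, OF l] algmor_fib[OF v, unfolded \<sigma> fst, OF l]
    unfolding c_def[symmetric] unfolding fib_of_alg_def Let_def fst D(3,4)[symmetric]
    using ig[of "k \<odot> cq B x"] ig[of "k' \<odot> cq B x"] by (simp_all add: t f)
  have lk: "lift_problem K x' (k' \<odot> cq B x) (cl B x)" by (rule lift_problem_mor[OF l]) simp_all
  have cart: "cartesian_cell K x' (k' \<rhd> c)"
    using fib_of_alg_cartesian[OF alg(2), unfolded fst, OF lk] algmor_fib[OF v, unfolded \<sigma> fst, OF l]
    unfolding c_def by simp
  have eq1: "(k' \<rhd> c) \<bullet> (s \<lhd> a) = (s \<lhd> cq B x) \<bullet> (k \<rhd> c)"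
    using exchange[of c s] by simp
  have "t' \<bullet> F = (i \<rhd> (s \<lhd> cq B x)) \<bullet> t"
    by (rule comma_cell_eqI[of B x']) simp_all
  then have "a' \<rhd> (t' \<bullet> F) = a' \<rhd> ((i \<rhd> (s \<lhd> cq B x)) \<bullet> t)" by simp
  then have eq2: "(k' \<rhd> c) \<bullet> (a' \<rhd> F) = (s \<lhd> cq B x) \<bullet> (k \<rhd> c)"
    by (simp add: kc)
  have xsa: "x' \<rhd> (s \<lhd> a) = Id2 K (cd B x)" by simp
  \<comment> \<open>k' \<rhd> c is cartesian, so cells into its domain over the same cell of B are equal once they agree after it.\<close>
  have "s \<lhd> a = a' \<rhd> F"
    by (rule cartesian_cell_eqI[OF cart]) (simp_all add: eq1 eq2 xsa)
  moreover obtain xa: "snd A = (cd B x, a, x)" "snd A' = (cd B x', a', x')"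
    using algD(7)[OF alg(1)] algD(7)[OF alg(2)] unfolding fst D(3,4)[symmetric] by (metis snd_conv)
  ultimately show ?thesis
    unfolding \<sigma> Phi_cell xa by (simp add: F_def f)
qed

lemma PhiAlg_simps [simp]:
  "A \<in> Ob (PhiAlg K cm B) \<longleftrightarrow> alg B A"
  "(A, u, A') \<in> Arr (PhiAlg K cm B) \<longleftrightarrow> algmor B A u A'"
  "(A, \<sigma>, A') \<in> Cell (PhiAlg K cm B) \<longleftrightarrow> \<sigma> \<in> Cell (slice K B) \<and> algmor B A (Src (slice K B) \<sigma>) A' \<and> algmor B A (Tgt (slice K B) \<sigma>) A'"
  "Dom (PhiAlg K cm B) (A, u, A') = A" "Cod (PhiAlg K cm B) (A, u, A') = A'"
  "Id1 (PhiAlg K cm B) A = (A, Id1 (slice K B) (fst A), A)"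
  "(B1, w, B2) \<odot>\<^bsub>PhiAlg K cm B\<^esub> (A, u, A') = (A, w \<odot>\<^bsub>slice K B\<^esub> u, B2)"
  "Src (PhiAlg K cm B) (A, \<sigma>, A') = (A, Src (slice K B) \<sigma>, A')" "Tgt (PhiAlg K cm B) (A, \<sigma>, A') = (A, Tgt (slice K B) \<sigma>, A')"
  "Id2 (PhiAlg K cm B) (A, u, A') = (A, Id2 (slice K B) u, A')"
  "(B1, \<tau>, B2) \<bullet>\<^bsub>PhiAlg K cm B\<^esub> (A, \<sigma>, A') = (A, \<tau> \<bullet>\<^bsub>slice K B\<^esub> \<sigma>, A')"
  "(B1, \<tau>, B2) \<star>\<^bsub>PhiAlg K cm B\<^esub> (A, \<sigma>, A') = (A, \<tau> \<star>\<^bsub>slice K B\<^esub> \<sigma>, B2)"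
  "(B1, w, B2) \<rhd>\<^bsub>PhiAlg K cm B\<^esub> (A, \<sigma>, A') = (A, w \<rhd>\<^bsub>slice K B\<^esub> \<sigma>, B2)"
  "(B1, \<tau>, B2) \<lhd>\<^bsub>PhiAlg K cm B\<^esub> (A, u, A') = (A, \<tau> \<lhd>\<^bsub>slice K B\<^esub> u, B2)"
  using alg_cell[of B A \<sigma> A'] by (auto simp: PhiAlg_def Alg_def whisker_l_def whisker_r_def)

lemma algmor_slice: "algmor B A u A' \<Longrightarrow> u \<in> Arr (slice K B) \<and> Dom (slice K B) u = fst A \<and> Cod (slice K B) u = fst A'"
  unfolding is_alg_mor_def by (auto simp: hom1_iff)

end

lemma is_fun2D:
  assumes "is_fun2 C D F"
  shows "X \<in> Ob C \<Longrightarrow> fob F X \<in> Ob D" "X \<in> Ob C \<Longrightarrow> farr F (Id1 C X) = Id1 D (fob F X)"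
    "f \<in> Arr C \<Longrightarrow> farr F f \<in> Arr D" "f \<in> Arr C \<Longrightarrow> Dom D (farr F f) = fob F (Dom C f)"
    "f \<in> Arr C \<Longrightarrow> Cod D (farr F f) = fob F (Cod C f)"
    "f \<in> Arr C \<Longrightarrow> fcell F (Id2 C f) = Id2 D (farr F f)"
    "\<alpha> \<in> Cell C \<Longrightarrow> fcell F \<alpha> \<in> Cell D" "\<alpha> \<in> Cell C \<Longrightarrow> Src D (fcell F \<alpha>) = farr F (Src C \<alpha>)"
    "\<alpha> \<in> Cell C \<Longrightarrow> Tgt D (fcell F \<alpha>) = farr F (Tgt C \<alpha>)"
    "\<lbrakk>f \<in> Arr C; g \<in> Arr C; Dom C g = Cod C f\<rbrakk> \<Longrightarrow> farr F (g \<odot>\<^bsub>C\<^esub> f) = farr F g \<odot>\<^bsub>D\<^esub> farr F f"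
    "\<lbrakk>\<alpha> \<in> Cell C; \<beta> \<in> Cell C; Src C \<beta> = Tgt C \<alpha>\<rbrakk> \<Longrightarrow> fcell F (\<beta> \<bullet>\<^bsub>C\<^esub> \<alpha>) = fcell F \<beta> \<bullet>\<^bsub>D\<^esub> fcell F \<alpha>"
    "\<lbrakk>\<alpha> \<in> Cell C; \<beta> \<in> Cell C; Dom C (Src C \<beta>) = Cod C (Src C \<alpha>)\<rbrakk> \<Longrightarrow> fcell F (\<beta> \<star>\<^bsub>C\<^esub> \<alpha>) = fcell F \<beta> \<star>\<^bsub>D\<^esub> fcell F \<alpha>"
  using assms unfolding is_fun2_def hom1_iff hom2_iff by blast+

lemma is_fun2I:
  assumes "\<And>X. X \<in> Ob C \<Longrightarrow> fob F X \<in> Ob D" "\<And>X. X \<in> Ob C \<Longrightarrow> farr F (Id1 C X) = Id1 D (fob F X)"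
    "\<And>f. f \<in> Arr C \<Longrightarrow> farr F f \<in> Arr D \<and> Dom D (farr F f) = fob F (Dom C f) \<and> Cod D (farr F f) = fob F (Cod C f)"
    "\<And>f. f \<in> Arr C \<Longrightarrow> fcell F (Id2 C f) = Id2 D (farr F f)"
    "\<And>\<alpha>. \<alpha> \<in> Cell C \<Longrightarrow> fcell F \<alpha> \<in> Cell D \<and> Src D (fcell F \<alpha>) = farr F (Src C \<alpha>) \<and> Tgt D (fcell F \<alpha>) = farr F (Tgt C \<alpha>)"
    "\<And>f g. \<lbrakk>f \<in> Arr C; g \<in> Arr C; Dom C g = Cod C f\<rbrakk> \<Longrightarrow> farr F (g \<odot>\<^bsub>C\<^esub> f) = farr F g \<odot>\<^bsub>D\<^esub> farr F f"
    "\<And>\<alpha> \<beta>. \<lbrakk>\<alpha> \<in> Cell C; \<beta> \<in> Cell C; Src C \<beta> = Tgt C \<alpha>\<rbrakk> \<Longrightarrow> fcell F (\<beta> \<bullet>\<^bsub>C\<^esub> \<alpha>) = fcell F \<beta> \<bullet>\<^bsub>D\<^esub> fcell F \<alpha>"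
    "\<And>\<alpha> \<beta>. \<lbrakk>\<alpha> \<in> Cell C; \<beta> \<in> Cell C; Dom C (Src C \<beta>) = Cod C (Src C \<alpha>)\<rbrakk> \<Longrightarrow> fcell F (\<beta> \<star>\<^bsub>C\<^esub> \<alpha>) = fcell F \<beta> \<star>\<^bsub>D\<^esub> fcell F \<alpha>"
  shows "is_fun2 C D F"
  using assms unfolding is_fun2_def hom1_iff hom2_iff by blast

lemma comp_fun2_simps [simp]:
  "fob (G \<circ>\<^sub>2 F) X = fob G (fob F X)" "farr (G \<circ>\<^sub>2 F) f = farr G (farr F f)" "fcell (G \<circ>\<^sub>2 F) \<alpha> = fcell G (fcell F \<alpha>)"
  by (simp_all add: comp_fun2_def)

lemma id_fun2_simps [simp]: "fob id_fun2 X = X" "farr id_fun2 f = f" "fcell id_fun2 \<alpha> = \<alpha>"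
  by (simp_all add: id_fun2_def)

lemma is_fun2_whisker:
  assumes "is_fun2 C D F" "two_category C"
  shows "\<lbrakk>\<alpha> \<in> Cell C; f \<in> Arr C; Dom C f = Cod C (Src C \<alpha>)\<rbrakk> \<Longrightarrow> fcell F (f \<rhd>\<^bsub>C\<^esub> \<alpha>) = farr F f \<rhd>\<^bsub>D\<^esub> fcell F \<alpha>"
    "\<lbrakk>\<alpha> \<in> Cell C; f \<in> Arr C; Cod C f = Dom C (Src C \<alpha>)\<rbrakk> \<Longrightarrow> fcell F (\<alpha> \<lhd>\<^bsub>C\<^esub> f) = fcell F \<alpha> \<lhd>\<^bsub>D\<^esub> farr F f"
  using is_fun2D[OF assms(1)] two_category.Id2_simps[OF assms(2)] by (simp_all add: whisker_l_def whisker_r_def)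

lemma is_fun2_comp:
  assumes F: "is_fun2 C D F" and G: "is_fun2 D E G" and C: "two_category C"
  shows "is_fun2 C E (G \<circ>\<^sub>2 F)"
proof -
  interpret C: two_category C by fact
  show ?thesis
    by (rule is_fun2I) (simp_all add: is_fun2D[OF F] is_fun2D[OF G])
qed

text \<open>Horizontal composites are vertical composites of whiskerings.\<close>

lemma is_fun2I':
  assumes C: "two_category C" and D: "two_category D" and
   1: "\<And>X. X \<in> Ob C \<Longrightarrow> fob F X \<in> Ob D" "\<And>X. X \<in> Ob C \<Longrightarrow> farr F (Id1 C X) = Id1 D (fob F X)"
    "\<And>f. f \<in> Arr C \<Longrightarrow> farr F f \<in> Arr D \<and> Dom D (farr F f) = fob F (Dom C f) \<and> Cod D (farr F f) = fob F (Cod C f)"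
    "\<And>f. f \<in> Arr C \<Longrightarrow> fcell F (Id2 C f) = Id2 D (farr F f)"
    "\<And>\<alpha>. \<alpha> \<in> Cell C \<Longrightarrow> fcell F \<alpha> \<in> Cell D \<and> Src D (fcell F \<alpha>) = farr F (Src C \<alpha>) \<and> Tgt D (fcell F \<alpha>) = farr F (Tgt C \<alpha>)"
    "\<And>f g. \<lbrakk>f \<in> Arr C; g \<in> Arr C; Dom C g = Cod C f\<rbrakk> \<Longrightarrow> farr F (g \<odot>\<^bsub>C\<^esub> f) = farr F g \<odot>\<^bsub>D\<^esub> farr F f"
    "\<And>\<alpha> \<beta>. \<lbrakk>\<alpha> \<in> Cell C; \<beta> \<in> Cell C; Src C \<beta> = Tgt C \<alpha>\<rbrakk> \<Longrightarrow> fcell F (\<beta> \<bullet>\<^bsub>C\<^esub> \<alpha>) = fcell F \<beta> \<bullet>\<^bsub>D\<^esub> fcell F \<alpha>"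
    and w: "\<And>\<alpha> f. \<lbrakk>\<alpha> \<in> Cell C; f \<in> Arr C; Dom C f = Cod C (Src C \<alpha>)\<rbrakk> \<Longrightarrow> fcell F (f \<rhd>\<^bsub>C\<^esub> \<alpha>) = farr F f \<rhd>\<^bsub>D\<^esub> fcell F \<alpha>"
    "\<And>\<alpha> f. \<lbrakk>\<alpha> \<in> Cell C; f \<in> Arr C; Cod C f = Dom C (Src C \<alpha>)\<rbrakk> \<Longrightarrow> fcell F (\<alpha> \<lhd>\<^bsub>C\<^esub> f) = fcell F \<alpha> \<lhd>\<^bsub>D\<^esub> farr F f"
  shows "is_fun2 C D F"
proof (rule is_fun2I[OF 1])
  interpret C: two_category C by fact
  interpret D: two_category D by fact
  fix \<alpha> \<beta> assume [simp]: "\<alpha> \<in> Cell C" "\<beta> \<in> Cell C" "Dom C (Src C \<beta>) = Cod C (Src C \<alpha>)"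
  show "fcell F (\<beta> \<star>\<^bsub>C\<^esub> \<alpha>) = fcell F \<beta> \<star>\<^bsub>D\<^esub> fcell F \<alpha>"
    using 1(3)[of "Src C \<beta>"] 1(3)[of "Src C \<alpha>"] 1(3)[of "Tgt C \<alpha>"] 1(5)[of \<alpha>] 1(5)[of \<beta>]
    by (simp add: C.HComp_whisker(1) D.HComp_whisker(1) 1(7) w)
qed

context commas
begin

text \<open>
  All 2-cells of the slice between algebra morphisms are algebra 2-cells, so nothing has to be checked on
  2-cells beyond the 2-functoriality of F.
\<close>

lemma alg_lift_fun2:
  assumes F: "is_fun2 (slice K B) (slice K B') F"
    and G: "\<And>A. alg B A \<Longrightarrow> alg B' (G A)" "\<And>A. alg B A \<Longrightarrow> fst (G A) = fob F (fst A)"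
    and m: "\<And>A u A'. algmor B A u A' \<Longrightarrow> algmor B' (G A) (farr F u) (G A')"
  shows "is_fun2 (PhiAlg K cm B) (PhiAlg K cm B') (alg_lift F G)"
proof (rule is_fun2I, goal_cases)
  case (1 X) then show ?case by (simp add: alg_lift_def G)
next
  case (2 X) then show ?case using is_fun2D(2)[OF F, of "fst X"] algD[of B X] by (simp add: alg_lift_def G)
next
  case (3 f) then show ?case by (cases f) (simp add: alg_lift_def m)
next
  case (4 f) then show ?case 
    using is_fun2D(6)[OF F, of "mid f"] algmor_slice[of B "fst f" "mid f" "snd (snd f)"]
    by (cases f) (simp add: alg_lift_def del: slice_simps)
next
  case (5 \<alpha>) then show ?case
    by (cases \<alpha>) (use m in \<open>auto simp: alg_lift_def is_fun2D(7-9)[OF F]\<close>)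
next
  case (6 f g)
  with is_fun2D(10)[OF F, of "mid f" "mid g"] algmor_slice[of B "fst f" "mid f" "snd (snd f)"]
    algmor_slice[of B "fst g" "mid g" "snd (snd g)"] show ?case
    by (cases f; cases g) (simp add: alg_lift_def del: slice_simps)
next
  case (7 \<alpha> \<beta>)
  with is_fun2D(11)[OF F, of "mid \<alpha>" "mid \<beta>"] show ?case
    by (cases \<alpha>; cases \<beta>) (simp add: alg_lift_def del: slice_simps)
next
  case (8 \<alpha> \<beta>)
  with is_fun2D(12)[OF F, of "mid \<alpha>" "mid \<beta>"] algmor_slice[of B "fst \<alpha>" "Src (slice K B) (mid \<alpha>)" "snd (snd \<alpha>)"]
    algmor_slice[of B "fst \<beta>" "Src (slice K B) (mid \<beta>)" "snd (snd \<beta>)"] show ?case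
    by (cases \<alpha>; cases \<beta>) (simp add: alg_lift_def del: slice_simps)
qed

lemma alg_lift0_fun2:
  assumes C: "two_category C" and F: "is_fun2 C (slice K B') F"
    and G: "\<And>X. X \<in> Ob C \<Longrightarrow> alg B' (G X)" "\<And>X. X \<in> Ob C \<Longrightarrow> fst (G X) = fob F X"
    and m: "\<And>u. u \<in> Arr C \<Longrightarrow> algmor B' (G (Dom C u)) (farr F u) (G (Cod C u))"
  shows "is_fun2 C (PhiAlg K cm B') (alg_lift0 C F G)"
proof -
  interpret C: two_category C by fact
  have m': "algmor B' (G (Dom C (Src C \<alpha>))) (farr F (Tgt C \<alpha>)) (G (Cod C (Src C \<alpha>)))" if "\<alpha> \<in> Cell C" for \<alpha>
    using m[of "Tgt C \<alpha>"] that by simp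
  show ?thesis
    by (rule is_fun2I) (simp_all add: alg_lift0_def G m m' is_fun2D[OF F] del: slice_simps)
qed

end

section \<open>The lifts of \<open>\<Sigma>\<close> and \<open>\<Delta>\<close>\<close>

context two_category
begin

lemma Sig_simps [simp]:
  "fob (Sig K t) x = t \<odot> x" "farr (Sig K t) (x, k, y) = (t \<odot> x, k, t \<odot> y)" "fcell (Sig K t) (x, \<alpha>, y) = (t \<odot> x, \<alpha>, t \<odot> y)"
  by (simp_all add: Sig_def)

lemma Sig_fun2:
  assumes [simp]: "t \<in> Arr K"
  shows "is_fun2 (slice K (Dom K t)) (slice K (Cod K t)) (Sig K t)"
  by (rule is_fun2I; clarsimp)

end

context pullbacks
begin

lemma Del_simps [simp]:
  "fob (Del K pb s) x = pr1 s x"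
  "farr (Del K pb s) (x, k, y) = (pr1 s x, pb_arr K pb s y (pr1 s x) (k \<odot> pr2 s x), pr1 s y)"
  "fcell (Del K pb s) (x, \<alpha>, y) = (pr1 s x, pb_cell K pb s y (Id2 K (pr1 s x)) (\<alpha> \<lhd> pr2 s x), pr1 s y)"
  by (simp_all add: Del_def)

lemma Del_fun2:
  assumes s [simp]: "s \<in> Arr K"
  shows "is_fun2 (slice K (Cod K s)) (slice K (Dom K s)) (Del K pb s)"
proof (rule is_fun2I'; (rule two_category_slice, simp)?)
  show "fob (Del K pb s) X \<in> Ob (slice K (Dom K s))" if "X \<in> Ob (slice K (Cod K s))" for X
    using that by simp
  show "farr (Del K pb s) (Id1 (slice K (Cod K s)) X) = Id1 (slice K (Dom K s)) (fob (Del K pb s) X)"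
    if "X \<in> Ob (slice K (Cod K s))" for X
  proof -
    have [simp]: "X \<in> Arr K" "Cod K X = Cod K s" using that by simp_all
    have "pb_arr K pb s X (pr1 s X) (pr2 s X) = Id1 K (Dom K (pr1 s X))"
      by (rule pr_eqI[of s X]) simp_all
    then show ?thesis by simp
  qed
  have arr: "y \<odot> (k \<odot> pr2 s x) = s \<odot> pr1 s x" if "(x, k, y) \<in> Arr (slice K (Cod K s))" for x k y
    using that by (simp add: Comp_reassoc[of y k x])
  show "farr (Del K pb s) f \<in> Arr (slice K (Dom K s)) \<and>
         Dom (slice K (Dom K s)) (farr (Del K pb s) f) = fob (Del K pb s) (Dom (slice K (Cod K s)) f) \<and>
         Cod (slice K (Dom K s)) (farr (Del K pb s) f) = fob (Del K pb s) (Cod (slice K (Cod K s)) f)"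
    if "f \<in> Arr (slice K (Cod K s))" for f
    using that by (cases f) (simp add: arr)
  have cell: "y \<rhd> (\<alpha> \<lhd> pr2 s x) = Id2 K (s \<odot> pr1 s x)" "y \<odot> (Src K \<alpha> \<odot> pr2 s x) = s \<odot> pr1 s x"
    "y \<odot> (Tgt K \<alpha> \<odot> pr2 s x) = s \<odot> pr1 s x" if "(x, \<alpha>, y) \<in> Cell (slice K (Cod K s))" for x \<alpha> y
    using that whisker_Comp(3)[of "pr2 s x" y \<alpha>] slice_Cell_Arr[OF that]
    by (simp_all add: Comp_reassoc[of y _ x])
  show "fcell (Del K pb s) (Id2 (slice K (Cod K s)) f) = Id2 (slice K (Dom K s)) (farr (Del K pb s) f)"
    if f: "f \<in> Arr (slice K (Cod K s))" for f
  proof -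
    obtain x k y where f': "f = (x, k, y)" by (cases f)
    note [simp] = f' f[unfolded f', simplified] arr[OF f[unfolded f']]
    have "pb_cell K pb s y (Id2 K (pr1 s x)) (Id2 K (k \<odot> pr2 s x)) = Id2 K (pb_arr K pb s y (pr1 s x) (k \<odot> pr2 s x))"
      by (rule pr_cell_eqI[of s y]) simp_all
    then show ?thesis by simp
  qed
  show "fcell (Del K pb s) \<alpha> \<in> Cell (slice K (Dom K s)) \<and>
         Src (slice K (Dom K s)) (fcell (Del K pb s) \<alpha>) = farr (Del K pb s) (Src (slice K (Cod K s)) \<alpha>) \<and>
         Tgt (slice K (Dom K s)) (fcell (Del K pb s) \<alpha>) = farr (Del K pb s) (Tgt (slice K (Cod K s)) \<alpha>)"
    if c: "\<alpha> \<in> Cell (slice K (Cod K s))" for \<alpha>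
  proof -
    obtain x a y where c': "\<alpha> = (x, a, y)" by (cases \<alpha>)
    note [simp] = c' c[unfolded c', simplified] cell[OF c[unfolded c']]
    show ?thesis by simp
  qed
  show "farr (Del K pb s) (g \<odot>\<^bsub>slice K (Cod K s)\<^esub> f) = farr (Del K pb s) g \<odot>\<^bsub>slice K (Dom K s)\<^esub> farr (Del K pb s) f"
    if fg: "f \<in> Arr (slice K (Cod K s))" "g \<in> Arr (slice K (Cod K s))" "Dom (slice K (Cod K s)) g = Cod (slice K (Cod K s)) f" for f g
  proof -
    obtain x k y l z where fg': "f = (x, k, y)" "g = (y, l, z)" using fg by (cases f; cases g) auto
    note [simp] = fg[unfolded fg', simplified] arr[OF fg(1)[unfolded fg']] arr[OF fg(2)[unfolded fg']]
    have [simp]: "z \<odot> (l \<odot> (k \<odot> pr2 s x)) = s \<odot> pr1 s x" by (simp add: Comp_reassoc[of z l y])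
    have "pb_arr K pb s z (pr1 s x) (l \<odot> (k \<odot> pr2 s x))
       = pb_arr K pb s z (pr1 s y) (l \<odot> pr2 s y) \<odot> pb_arr K pb s y (pr1 s x) (k \<odot> pr2 s x)"
      by (rule pr_eqI[of s z]) simp_all
    then show ?thesis by (simp add: fg')
  qed
  show "fcell (Del K pb s) (\<beta> \<bullet>\<^bsub>slice K (Cod K s)\<^esub> \<alpha>) = fcell (Del K pb s) \<beta> \<bullet>\<^bsub>slice K (Dom K s)\<^esub> fcell (Del K pb s) \<alpha>"
    if fg: "\<alpha> \<in> Cell (slice K (Cod K s))" "\<beta> \<in> Cell (slice K (Cod K s))" "Src (slice K (Cod K s)) \<beta> = Tgt (slice K (Cod K s)) \<alpha>" for \<alpha> \<beta>
  proof -
    obtain x k y l where fg': "\<alpha> = (x, k, y)" "\<beta> = (x, l, y)" using fg by (cases \<alpha>; cases \<beta>) auto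
    note [simp] = fg[unfolded fg', simplified] cell[OF fg(1)[unfolded fg']] cell[OF fg(2)[unfolded fg']]
    have "pb_cell K pb s y (Id2 K (pr1 s x)) ((l \<lhd> pr2 s x) \<bullet> (k \<lhd> pr2 s x))
       = pb_cell K pb s y (Id2 K (pr1 s x)) (l \<lhd> pr2 s x) \<bullet> pb_cell K pb s y (Id2 K (pr1 s x)) (k \<lhd> pr2 s x)"
      by (rule pr_cell_eqI[of s y]) simp_all
    then show ?thesis by (simp add: fg')
  qed
  show "fcell (Del K pb s) (f \<rhd>\<^bsub>slice K (Cod K s)\<^esub> \<alpha>) = farr (Del K pb s) f \<rhd>\<^bsub>slice K (Dom K s)\<^esub> fcell (Del K pb s) \<alpha>"
    if fg: "\<alpha> \<in> Cell (slice K (Cod K s))" "f \<in> Arr (slice K (Cod K s))" "Dom (slice K (Cod K s)) f = Cod (slice K (Cod K s)) (Src (slice K (Cod K s)) \<alpha>)" for \<alpha> f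
  proof -
    obtain x k y l z where fg': "\<alpha> = (x, k, y)" "f = (y, l, z)" using fg by (cases \<alpha>; cases f) auto
    note [simp] = fg[unfolded fg', simplified] cell[OF fg(1)[unfolded fg']] arr[OF fg(2)[unfolded fg']]
    have [simp]: "z \<odot> (l \<odot> h) = y \<odot> h" if "h \<in> Arr K" "Cod K h = Dom K y" for h using that by (simp add: Comp_reassoc[of z l y])
    have [simp]: "z \<rhd> (l \<rhd> h) = y \<rhd> h" if "h \<in> Cell K" "Cod K (Src K h) = Dom K y" for h using that by (simp add: whisker_l_reassoc[of z l y])
    have "pb_cell K pb s z (Id2 K (pr1 s x)) (l \<rhd> (k \<lhd> pr2 s x))
       = pb_arr K pb s z (pr1 s y) (l \<odot> pr2 s y) \<rhd> pb_cell K pb s y (Id2 K (pr1 s x)) (k \<lhd> pr2 s x)"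
      by (rule pr_cell_eqI[of s z]) simp_all
    then show ?thesis by (simp add: fg')
  qed
  show "fcell (Del K pb s) (\<alpha> \<lhd>\<^bsub>slice K (Cod K s)\<^esub> f) = fcell (Del K pb s) \<alpha> \<lhd>\<^bsub>slice K (Dom K s)\<^esub> farr (Del K pb s) f"
    if fg: "\<alpha> \<in> Cell (slice K (Cod K s))" "f \<in> Arr (slice K (Cod K s))" "Cod (slice K (Cod K s)) f = Dom (slice K (Cod K s)) (Src (slice K (Cod K s)) \<alpha>)" for \<alpha> f
  proof -
    obtain x k y l z where fg': "f = (x, k, y)" "\<alpha> = (y, l, z)" using fg by (cases \<alpha>; cases f) auto
    note [simp] = fg[unfolded fg', simplified] cell[OF fg(1)[unfolded fg']] arr[OF fg(2)[unfolded fg']]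
    define m where "m = pb_arr K pb s y (pr1 s x) (k \<odot> pr2 s x)"
    have [simp]: "m \<in> Arr K" "Dom K m = Dom K (pr1 s x)" "Cod K m = Dom K (pr1 s y)" "pr1 s y \<odot> m = pr1 s x" "pr2 s y \<odot> m = k \<odot> pr2 s x"
      unfolding m_def by simp_all
    define c where "c = pb_cell K pb s z (Id2 K (pr1 s y)) (l \<lhd> pr2 s y)"
    have [simp]: "c \<in> Cell K" "pr1 s z \<rhd> c = Id2 K (pr1 s y)" "pr2 s z \<rhd> c = l \<lhd> pr2 s y"
      "Dom K (Src K c) = Dom K (pr1 s y)" "Cod K (Src K c) = Dom K (pr1 s z)"
      unfolding c_def by simp_all
    have p: "pr1 s z \<rhd> (c \<lhd> m) = Id2 K (pr1 s x)" "pr2 s z \<rhd> (c \<lhd> m) = (l \<lhd> k) \<lhd> pr2 s x"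
      using whisker_Comp(3)[of m "pr1 s z" c] whisker_Comp(3)[of m "pr2 s z" c] by (simp_all add: whisker_r_reassoc[of "pr2 s y" m])
    have q: "z \<rhd> ((l \<lhd> k) \<lhd> pr2 s x) = Id2 K (s \<odot> pr1 s x)"
    proof -
      have "z \<rhd> (l \<lhd> k) = Id2 K x" using whisker_Comp(3)[of k z l] by simp
      then show ?thesis using whisker_Comp(3)[of "pr2 s x" z "l \<lhd> k"] by simp
    qed
    have r: "z \<odot> (Src K l \<odot> (k \<odot> pr2 s x)) = s \<odot> pr1 s x"
      using slice_Cell_Arr[OF fg(1)[unfolded fg']] by (simp add: Comp_reassoc[of z _ y])
    have "pb_cell K pb s z (Id2 K (pr1 s x)) ((l \<lhd> k) \<lhd> pr2 s x) = c \<lhd> m"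
      by (rule pr_cell_eqI[of s z]) (simp_all add: p q r)
    then show ?thesis by (simp add: fg' m_def c_def)
  qed
qed

end

context pullbacks
begin

lemma pb_lift_problem:
  assumes "lift_problem K (pr1 s x) g \<beta>" "s \<in> Arr K" "x \<in> Arr K" "Cod K s = Cod K x"
  shows "lift_problem K x (pr2 s x \<odot> g) (s \<rhd> \<beta>)"
  using lift_problemD[OF assms(1)] lift_problem_ends[OF assms(1)] assms(2-) unfolding lift_problem_def by simp

lemma pb_cleavage_simps:
  assumes \<chi>: "split_fib K x \<chi>" and s: "s \<in> Arr K" "Cod K s = Cod K x" and lp: "lift_problem K (pr1 s x) g \<beta>"
  shows "pb_cleavage K pb s x \<chi> g \<beta> \<in> Cell K" "Src K (pb_cleavage K pb s x \<chi> g \<beta>) = pb_arr K pb s x (Src K \<beta>) (Src K (\<chi> (pr2 s x \<odot> g) (s \<rhd> \<beta>)))"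
    "Tgt K (pb_cleavage K pb s x \<chi> g \<beta>) = g" "pr1 s x \<rhd> pb_cleavage K pb s x \<chi> g \<beta> = \<beta>"
    "pr2 s x \<rhd> pb_cleavage K pb s x \<chi> g \<beta> = \<chi> (pr2 s x \<odot> g) (s \<rhd> \<beta>)"
    "s \<odot> Src K \<beta> = x \<odot> Src K (\<chi> (pr2 s x \<odot> g) (s \<rhd> \<beta>))"
proof -
  note x = split_fibD(1)[OF \<chi>]
  note lp' = pb_lift_problem[OF lp s(1) x s(2)]
  note [simp] = x s lift_problemD[OF lp] lift_problem_ends[OF lp]
    split_fibD(3-5)[OF \<chi> lp'] split_fib_ends[OF \<chi> lp']
  have 1 [simp]: "s \<odot> pr1 s x \<odot> g = x \<odot> (pr2 s x \<odot> g)" by simp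
  show "s \<odot> Src K \<beta> = x \<odot> Src K (\<chi> (pr2 s x \<odot> g) (s \<rhd> \<beta>))" by simp
  have "pb_arr K pb s x (pr1 s x \<odot> g) (pr2 s x \<odot> g) = g" by (rule pr_eqI[of s x]) simp_all
  then show "pb_cleavage K pb s x \<chi> g \<beta> \<in> Cell K" "Src K (pb_cleavage K pb s x \<chi> g \<beta>) = pb_arr K pb s x (Src K \<beta>) (Src K (\<chi> (pr2 s x \<odot> g) (s \<rhd> \<beta>)))"
    "Tgt K (pb_cleavage K pb s x \<chi> g \<beta>) = g" "pr1 s x \<rhd> pb_cleavage K pb s x \<chi> g \<beta> = \<beta>"
    "pr2 s x \<rhd> pb_cleavage K pb s x \<chi> g \<beta> = \<chi> (pr2 s x \<odot> g) (s \<rhd> \<beta>)"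
    unfolding pb_cleavage_def by simp_all
qed

text \<open>
  A 2-cell into the pullback is a pair of 2-cells, and the second component of a chosen lift is a chosen
  lift for x, so each law holds componentwise.
\<close>

theorem pb_split_fib:
  assumes \<chi>: "split_fib K x \<chi>" and s: "s \<in> Arr K" "Cod K s = Cod K x"
  shows "split_fib K (pr1 s x) (pb_cleavage K pb s x \<chi>)"
proof -
  note x [simp] = split_fibD(1)[OF \<chi>]
  note [simp] = s
  define c where "c = pb_cleavage K pb s x \<chi>"
  note cs = pb_cleavage_simps[OF \<chi> s, folded c_def]
  have ce: "Dom K (Src K (c g \<beta>)) = Dom K g" "Cod K (Src K (c g \<beta>)) = Dom K (pr1 s x)" if lp: "lift_problem K (pr1 s x) g \<beta>" for g \<beta>
    using cs(1,3)[OF lp] lift_problemD[OF lp] Cell_ends(3,4)[of "c g \<beta>"] by simp_all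
  have cart: "cartesian_cell K (pr1 s x) (c g \<beta>)" if lp: "lift_problem K (pr1 s x) g \<beta>" for g \<beta>
    unfolding cartesian_cell_def
  proof (intro conjI ballI impI)
    note lp' = pb_lift_problem[OF lp s(1) x s(2)]
    note [simp] = cs(1,3-5)[OF lp] ce[OF lp] lift_problemD[OF lp] lift_problem_ends[OF lp]
       split_fibD(3-5)[OF \<chi> lp'] split_fib_ends(1,2)[OF \<chi> lp']
    let ?\<chi> = "\<chi> (pr2 s x \<odot> g) (s \<rhd> \<beta>)"
    have sc: "pr2 s x \<odot> Src K (c g \<beta>) = Src K ?\<chi>" "pr1 s x \<odot> Src K (c g \<beta>) = Src K \<beta>"
      using whisker_l_simps(2)[of "pr1 s x" "c g \<beta>"] whisker_l_simps(2)[of "pr2 s x" "c g \<beta>"] by simp_all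
    show "c g \<beta> \<in> Cell K" "Cod K (Src K (c g \<beta>)) = Dom K (pr1 s x)" by simp_all
    fix \<rho> \<delta>
    assume r [simp]: "\<rho> \<in> Cell K" "Tgt K \<rho> = Tgt K (c g \<beta>)"
     and d: "\<delta> \<in> hom2 K (pr1 s x \<odot> Src K \<rho>) (pr1 s x \<odot> Src K (c g \<beta>))"
     and eq: "(pr1 s x \<rhd> c g \<beta>) \<bullet> \<delta> = pr1 s x \<rhd> \<rho>"
    have [simp]: "Dom K (Src K \<rho>) = Dom K g" "Cod K (Src K \<rho>) = Dom K (pr1 s x)"
      using Cell_ends(3,4)[OF r(1)] by simp_all
    have [simp]: "\<delta> \<in> Cell K" "Src K \<delta> = pr1 s x \<odot> Src K \<rho>" "Tgt K \<delta> = Src K \<beta>" using d by (simp_all add: hom2_iff sc)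
    have eq' [simp]: "\<beta> \<bullet> \<delta> = pr1 s x \<rhd> \<rho>" using eq by simp
    have sx: "x \<odot> Src K ?\<chi> = s \<odot> Src K \<beta>" using cs(6)[OF lp] by simp
    have ex: "\<exists>!t. t \<in> hom2 K (Src K (pr2 s x \<rhd> \<rho>)) (Src K ?\<chi>) \<and> x \<rhd> t = s \<rhd> \<delta> \<and> ?\<chi> \<bullet> t = pr2 s x \<rhd> \<rho>"
    proof (rule cartesian_cellD[OF split_fibD(2)[OF \<chi> lp']])
      have "(s \<rhd> \<beta>) \<bullet> (s \<rhd> \<delta>) = s \<rhd> (\<beta> \<bullet> \<delta>)" by (subst whisker_VComp) simp_all
      then show "(x \<rhd> ?\<chi>) \<bullet> (s \<rhd> \<delta>) = x \<rhd> (pr2 s x \<rhd> \<rho>)" by simp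
    qed (simp_all add: sx)
    then obtain t where t0: "t \<in> hom2 K (Src K (pr2 s x \<rhd> \<rho>)) (Src K ?\<chi>) \<and> x \<rhd> t = s \<rhd> \<delta> \<and> ?\<chi> \<bullet> t = pr2 s x \<rhd> \<rho>" by blast
    then have t [simp]: "t \<in> Cell K" "Src K t = pr2 s x \<odot> Src K \<rho>" "Tgt K t = Src K ?\<chi>" "x \<rhd> t = s \<rhd> \<delta>" "?\<chi> \<bullet> t = pr2 s x \<rhd> \<rho>"
      by (simp_all add: hom2_iff)
    define \<tau> where "\<tau> = pb_cell K pb s x \<delta> t"
    have e1: "pb_arr K pb s x (pr1 s x \<odot> Src K \<rho>) (pr2 s x \<odot> Src K \<rho>) = Src K \<rho>"
      by (rule pr_eqI[of s x]) simp_all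
    have e2: "pb_arr K pb s x (Src K \<beta>) (Src K ?\<chi>) = Src K (c g \<beta>)"
      using cs(2)[OF lp] by simp
    have \<tau>: "\<tau> \<in> Cell K" "Src K \<tau> = Src K \<rho>" "Tgt K \<tau> = Src K (c g \<beta>)" "pr1 s x \<rhd> \<tau> = \<delta>" "pr2 s x \<rhd> \<tau> = t"
      unfolding \<tau>_def using pb_cell_simps[of s x \<delta> t] by (simp_all add: e1 e2)
    show "\<exists>!\<tau>. \<tau> \<in> hom2 K (Src K \<rho>) (Src K (c g \<beta>)) \<and> pr1 s x \<rhd> \<tau> = \<delta> \<and> c g \<beta> \<bullet> \<tau> = \<rho>"
    proof (rule ex1I[of _ \<tau>])
      have "c g \<beta> \<bullet> \<tau> = \<rho>" by (rule pr_cell_eqI[of s x]) (simp_all add: \<tau>)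
      then show "\<tau> \<in> hom2 K (Src K \<rho>) (Src K (c g \<beta>)) \<and> pr1 s x \<rhd> \<tau> = \<delta> \<and> c g \<beta> \<bullet> \<tau> = \<rho>"
        by (simp add: \<tau> hom2_iff)
      fix \<tau>' assume a: "\<tau>' \<in> hom2 K (Src K \<rho>) (Src K (c g \<beta>)) \<and> pr1 s x \<rhd> \<tau>' = \<delta> \<and> c g \<beta> \<bullet> \<tau>' = \<rho>"
      then have [simp]: "\<tau>' \<in> Cell K" "Src K \<tau>' = Src K \<rho>" "Tgt K \<tau>' = Src K (c g \<beta>)" "pr1 s x \<rhd> \<tau>' = \<delta>" by (simp_all add: hom2_iff)
      have "pr2 s x \<rhd> (c g \<beta> \<bullet> \<tau>') = ?\<chi> \<bullet> (pr2 s x \<rhd> \<tau>')" by simp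
      then have "?\<chi> \<bullet> (pr2 s x \<rhd> \<tau>') = pr2 s x \<rhd> \<rho>" using a by simp
      then have "pr2 s x \<rhd> \<tau>' \<in> hom2 K (Src K (pr2 s x \<rhd> \<rho>)) (Src K ?\<chi>) \<and> x \<rhd> (pr2 s x \<rhd> \<tau>') = s \<rhd> \<delta> \<and> ?\<chi> \<bullet> (pr2 s x \<rhd> \<tau>') = pr2 s x \<rhd> \<rho>"
        by (simp add: hom2_iff sc)
      with ex t0 have "pr2 s x \<rhd> \<tau>' = t" by blast
      then show "\<tau>' = \<tau>" by - (rule pr_cell_eqI[of s x], simp_all add: \<tau>)
    qed
  qed
  have idc: "c g (Id2 K (pr1 s x \<odot> g)) = Id2 K g" if [simp]: "g \<in> Arr K" "Cod K g = Dom K (pr1 s x)" for g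
  proof -
    have lp: "lift_problem K (pr1 s x) g (Id2 K (pr1 s x \<odot> g))" by (rule lift_problem_Id2) simp_all
    have "\<chi> (pr2 s x \<odot> g) (Id2 K (x \<odot> (pr2 s x \<odot> g))) = Id2 K (pr2 s x \<odot> g)"
      by (rule split_fibD(6)[OF \<chi>]) simp_all
    then show ?thesis
      using cs[OF lp] ce[OF lp] by - (rule pr_cell_eqI[of s x], simp_all)
  qed
  have comp: "c g (\<beta> \<bullet> \<gamma>) = c g \<beta> \<bullet> c (Src K (c g \<beta>)) \<gamma>"
    if lp: "lift_problem K (pr1 s x) g \<beta>" and g: "\<gamma> \<in> Cell K" "Tgt K \<gamma> = Src K \<beta>" for g \<beta> \<gamma>
  proof -
    note lp' = pb_lift_problem[OF lp s(1) x s(2)]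
    note [simp] = cs(1,3-5)[OF lp] ce[OF lp] lift_problemD[OF lp] lift_problem_ends[OF lp] g
       split_fibD(3-5)[OF \<chi> lp'] split_fib_ends(1,2)[OF \<chi> lp']
    have sc: "pr2 s x \<odot> Src K (c g \<beta>) = Src K (\<chi> (pr2 s x \<odot> g) (s \<rhd> \<beta>))" "pr1 s x \<odot> Src K (c g \<beta>) = Src K \<beta>"
      using whisker_l_simps(2)[of "pr1 s x" "c g \<beta>"] whisker_l_simps(2)[of "pr2 s x" "c g \<beta>"] by simp_all
    have [simp]: "Dom K (Src K \<gamma>) = Dom K g" "Cod K (Src K \<gamma>) = Dom K s"
      using Cell_ends(3,4)[OF g(1)] by simp_all
    have l2: "lift_problem K (pr1 s x) (Src K (c g \<beta>)) \<gamma>" by (simp add: lift_problem_def sc)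
    have l3: "lift_problem K (pr1 s x) g (\<beta> \<bullet> \<gamma>)" by (simp add: lift_problem_def)
    have "\<chi> (pr2 s x \<odot> g) ((s \<rhd> \<beta>) \<bullet> (s \<rhd> \<gamma>)) = \<chi> (pr2 s x \<odot> g) (s \<rhd> \<beta>) \<bullet> \<chi> (Src K (\<chi> (pr2 s x \<odot> g) (s \<rhd> \<beta>))) (s \<rhd> \<gamma>)"
      by (rule split_fibD(7)[OF \<chi> lp']) simp_all
    then show ?thesis
      using cs(1,3-5)[OF l2] ce[OF l2] cs(1,3-5)[OF l3] ce[OF l3] by - (rule pr_cell_eqI[of s x], simp_all add: sc)
  qed
  have restr: "c g \<beta> \<lhd> h = c (g \<odot> h) (\<beta> \<lhd> h)"
    if lp: "lift_problem K (pr1 s x) g \<beta>" and h: "h \<in> Arr K" "Cod K h = Dom K g" for g \<beta> h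
  proof -
    note lp' = pb_lift_problem[OF lp s(1) x s(2)]
    have l2: "lift_problem K (pr1 s x) (g \<odot> h) (\<beta> \<lhd> h)" by (rule lift_problem_restrict[OF lp]) (simp_all add: h)
    note [simp] = cs(1,3-5)[OF lp] ce[OF lp] lift_problemD[OF lp] lift_problem_ends[OF lp] h
       split_fibD(3-5)[OF \<chi> lp'] split_fib_ends(1,2)[OF \<chi> lp']
    have "\<chi> (pr2 s x \<odot> g) (s \<rhd> \<beta>) \<lhd> h = \<chi> (pr2 s x \<odot> g \<odot> h) ((s \<rhd> \<beta>) \<lhd> h)"
      by (rule split_fibD(8)[OF \<chi> lp']) simp_all
    moreover have "pr1 s x \<rhd> (c g \<beta> \<lhd> h) = \<beta> \<lhd> h" "pr2 s x \<rhd> (c g \<beta> \<lhd> h) = \<chi> (pr2 s x \<odot> g) (s \<rhd> \<beta>) \<lhd> h"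
      using whisker_Comp(3)[of h "pr1 s x" "c g \<beta>"] whisker_Comp(3)[of h "pr2 s x" "c g \<beta>"] by simp_all
    ultimately show ?thesis
      using cs(1,3-5)[OF l2] ce[OF l2] by - (rule pr_cell_eqI[of s x], simp_all)
  qed
  show ?thesis
    unfolding split_fib_def c_def[symmetric] using cart cs idc comp restr by simp
qed

end

context two_category
begin

lemma comp_lift_problem:
  assumes t: "split_fib K t \<chi>t" and x: "x \<in> Arr K" "Cod K x = Dom K t" and lp: "lift_problem K (t \<odot> x) g \<beta>"
  shows "lift_problem K t (x \<odot> g) \<beta>" "lift_problem K x g (\<chi>t (x \<odot> g) \<beta>)"
proof -
  note [simp] = split_fibD(1)[OF t] x
  show l: "lift_problem K t (x \<odot> g) \<beta>" using lift_problemD[OF lp] by (simp add: lift_problem_def)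
  show "lift_problem K x g (\<chi>t (x \<odot> g) \<beta>)"
    using lift_problemD[OF lp] split_fibD(3,4)[OF t l] by (simp add: lift_problem_def)
qed

text \<open>
  The lift along t x is the lift along x of the lift along t. Factorizations are obtained by factoring first
  through the t-cartesian cell and then through the x-cartesian one.
\<close>

theorem comp_split_fib:
  assumes t: "split_fib K t \<chi>t" and \<chi>: "split_fib K x \<chi>" and xt: "Cod K x = Dom K t"
  shows "split_fib K (t \<odot> x) (comp_cleavage K \<chi>t x \<chi>)"
proof -
  note x [simp] = split_fibD(1)[OF \<chi>]
  note [simp] = split_fibD(1)[OF t] xt
  have c: "comp_cleavage K \<chi>t x \<chi> g \<beta> = \<chi> g (\<chi>t (x \<odot> g) \<beta>)" for g \<beta> by (simp add: comp_cleavage_def)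
  have main: "cartesian_cell K (t \<odot> x) (\<chi> g (\<chi>t (x \<odot> g) \<beta>)) \<and> Tgt K (\<chi> g (\<chi>t (x \<odot> g) \<beta>)) = g \<and> (t \<odot> x) \<rhd> \<chi> g (\<chi>t (x \<odot> g) \<beta>) = \<beta>"
    if lp: "lift_problem K (t \<odot> x) g \<beta>" for g \<beta>
  proof -
    note l1 = comp_lift_problem(1)[OF t x xt lp]
    note l2 = comp_lift_problem(2)[OF t x xt lp]
    note [simp] = lift_problemD[OF lp] lift_problemD(4)[OF l1] split_fibD(3-5)[OF t l1] split_fib_ends(1,2)[OF t l1]
      split_fibD(3-5)[OF \<chi> l2] split_fib_ends(1,2)[OF \<chi> l2]
    define d c where D: "d = \<chi>t (x \<odot> g) \<beta>" "c = \<chi> g d"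
    have [simp]: "d \<in> Cell K" "c \<in> Cell K" "Tgt K d = x \<odot> g" "Tgt K c = g" "Dom K (Src K d) = Dom K g" "Dom K (Src K c) = Dom K g"
      "Cod K (Src K c) = Dom K x" "Cod K (Src K d) = Dom K t" "x \<rhd> c = d" "t \<rhd> d = \<beta>"
      unfolding D by simp_all
    note [simp] = D[symmetric]
    have sc: "x \<odot> Src K c = Src K d" using split_fib_ends(3)[OF \<chi> l2] by simp
    have ct: "cartesian_cell K t d" "cartesian_cell K x c" using split_fibD(2)[OF t l1] split_fibD(2)[OF \<chi> l2] by simp_all
    have "\<exists>!\<tau>. \<tau> \<in> hom2 K (Src K \<rho>) (Src K c) \<and> (t \<odot> x) \<rhd> \<tau> = \<delta> \<and> c \<bullet> \<tau> = \<rho>"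
      if r [simp]: "\<rho> \<in> Cell K" "Tgt K \<rho> = g" and d: "\<delta> \<in> hom2 K ((t \<odot> x) \<odot> Src K \<rho>) ((t \<odot> x) \<odot> Src K c)"
      and eq: "((t \<odot> x) \<rhd> c) \<bullet> \<delta> = (t \<odot> x) \<rhd> \<rho>" for \<rho> \<delta>
    proof -
      have [simp]: "Dom K (Src K \<rho>) = Dom K g" "Cod K (Src K \<rho>) = Dom K x"
        using Cell_ends(3,4)[OF r(1)] by simp_all
      have [simp]: "\<delta> \<in> Cell K" "Src K \<delta> = t \<odot> (x \<odot> Src K \<rho>)" "Tgt K \<delta> = t \<odot> Src K d" "\<beta> \<bullet> \<delta> = t \<rhd> (x \<rhd> \<rho>)"
        using d eq by (simp_all add: hom2_iff sc)
      have ex1: "\<exists>!s. s \<in> hom2 K (Src K (x \<rhd> \<rho>)) (Src K d) \<and> t \<rhd> s = \<delta> \<and> d \<bullet> s = x \<rhd> \<rho>"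
        by (rule cartesian_cellD[OF ct(1)]) simp_all
      then obtain s where s0: "s \<in> hom2 K (Src K (x \<rhd> \<rho>)) (Src K d) \<and> t \<rhd> s = \<delta> \<and> d \<bullet> s = x \<rhd> \<rho>" by blast
      then have [simp]: "s \<in> Cell K" "Src K s = x \<odot> Src K \<rho>" "Tgt K s = Src K d" "t \<rhd> s = \<delta>" "d \<bullet> s = x \<rhd> \<rho>"
        by (simp_all add: hom2_iff)
      have ex2: "\<exists>!\<tau>. \<tau> \<in> hom2 K (Src K \<rho>) (Src K c) \<and> x \<rhd> \<tau> = s \<and> c \<bullet> \<tau> = \<rho>"
        by (rule cartesian_cellD[OF ct(2)]) (simp_all add: sc)
      have "x \<rhd> \<tau> = s" if a: "\<tau> \<in> hom2 K (Src K \<rho>) (Src K c) \<and> (t \<odot> x) \<rhd> \<tau> = \<delta> \<and> c \<bullet> \<tau> = \<rho>" for \<tau>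
      proof -
        have [simp]: "\<tau> \<in> Cell K" "Src K \<tau> = Src K \<rho>" "Tgt K \<tau> = Src K c" using a by (simp_all add: hom2_iff)
        have "x \<rhd> (c \<bullet> \<tau>) = d \<bullet> (x \<rhd> \<tau>)" by simp
        then have "x \<rhd> \<tau> \<in> hom2 K (Src K (x \<rhd> \<rho>)) (Src K d) \<and> t \<rhd> (x \<rhd> \<tau>) = \<delta> \<and> d \<bullet> (x \<rhd> \<tau>) = x \<rhd> \<rho>"
          using a by (simp add: hom2_iff sc)
        with ex1 s0 show ?thesis by blast
      qed
      moreover have "(t \<odot> x) \<rhd> \<tau> = \<delta>" if "\<tau> \<in> hom2 K (Src K \<rho>) (Src K c)" "x \<rhd> \<tau> = s" for \<tau>
        using that by (simp add: hom2_iff)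
      ultimately show ?thesis using ex2 by blast
    qed
    then have "cartesian_cell K (t \<odot> x) c" unfolding cartesian_cell_def by simp
    then show ?thesis by simp
  qed
  have comp: "\<chi> g (\<chi>t (x \<odot> g) (\<beta> \<bullet> \<gamma>)) = \<chi> g (\<chi>t (x \<odot> g) \<beta>) \<bullet> \<chi> (Src K (\<chi> g (\<chi>t (x \<odot> g) \<beta>))) (\<chi>t (x \<odot> Src K (\<chi> g (\<chi>t (x \<odot> g) \<beta>))) \<gamma>)"
    if lp: "lift_problem K (t \<odot> x) g \<beta>" and g: "\<gamma> \<in> Cell K" "Tgt K \<gamma> = Src K \<beta>" for g \<beta> \<gamma>
  proof -
    note l1 = comp_lift_problem(1)[OF t x xt lp]
    note l2 = comp_lift_problem(2)[OF t x xt lp]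
    have l3: "lift_problem K t (Src K (\<chi>t (x \<odot> g) \<beta>)) \<gamma>"
      using split_fib_ends[OF t l1] split_fibD(3)[OF t l1] g by (simp add: lift_problem_def)
    show ?thesis
      using split_fibD(7)[OF t l1 g] split_fibD(7)[OF \<chi> l2 split_fibD(3)[OF t l3] split_fibD(4)[OF t l3]]
        split_fib_ends(3)[OF \<chi> l2] by simp
  qed
  have restr: "\<chi> g (\<chi>t (x \<odot> g) \<beta>) \<lhd> h = \<chi> (g \<odot> h) (\<chi>t (x \<odot> (g \<odot> h)) (\<beta> \<lhd> h))"
    if lp: "lift_problem K (t \<odot> x) g \<beta>" and h: "h \<in> Arr K" "Cod K h = Dom K g" for g \<beta> h
    using split_fibD(8)[OF t comp_lift_problem(1)[OF t x xt lp], of h] split_fibD(8)[OF \<chi> comp_lift_problem(2)[OF t x xt lp], of h]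
      h lift_problemD[OF lp] by simp
  have "\<chi> g (\<chi>t (x \<odot> g) (Id2 K (t \<odot> (x \<odot> g)))) = Id2 K g" if "g \<in> Arr K" "Cod K g = Dom K x" for g
    using that split_fibD(6)[OF t, of "x \<odot> g"] split_fibD(6)[OF \<chi>, of g] by simp
  then show ?thesis
    unfolding split_fib_def c using main comp restr by simp
qed

theorem discrete_split_fib:
  assumes "discrete_ob K I" "x \<in> Arr K" "Cod K x = I"
  shows "split_fib K x (\<lambda>g \<beta>. Id2 K g)"
proof -
  note [simp] = assms(2,3)
  have d: "\<alpha> = Id2 K (Src K \<alpha>)" if "\<alpha> \<in> Cell K" "Cod K (Src K \<alpha>) = I" for \<alpha>
    using assms(1) that unfolding discrete_ob_def by blast
  have b: "\<beta> = Id2 K (x \<odot> g)" if lp: "lift_problem K x g \<beta>" for g \<beta>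
  proof -
    have "\<beta> = Id2 K (Src K \<beta>)" by (rule d) (use lift_problemD[OF lp] lift_problem_ends[OF lp] in simp_all)
    moreover from arg_cong[OF this, of "Tgt K"] have "Tgt K \<beta> = Src K \<beta>" using lift_problemD[OF lp] by simp
    ultimately show ?thesis using lift_problemD(4)[OF lp] by simp
  qed
  have "cartesian_cell K x (Id2 K g)" if [simp]: "g \<in> Arr K" "Cod K g = Dom K x" for g
    unfolding cartesian_cell_def
  proof (intro conjI ballI impI)
    fix \<rho> \<delta>
    assume r [simp]: "\<rho> \<in> Cell K" "Tgt K \<rho> = Tgt K (Id2 K g)"
      and "\<delta> \<in> hom2 K (x \<odot> Src K \<rho>) (x \<odot> Src K (Id2 K g))" "(x \<rhd> Id2 K g) \<bullet> \<delta> = x \<rhd> \<rho>"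
    then have \<delta>: "\<delta> = x \<rhd> \<rho>" by (simp add: hom2_iff)
    show "\<exists>!\<tau>. \<tau> \<in> hom2 K (Src K \<rho>) (Src K (Id2 K g)) \<and> x \<rhd> \<tau> = \<delta> \<and> Id2 K g \<bullet> \<tau> = \<rho>"
    proof (rule ex1I[of _ \<rho>])
      show "\<rho> \<in> hom2 K (Src K \<rho>) (Src K (Id2 K g)) \<and> x \<rhd> \<rho> = \<delta> \<and> Id2 K g \<bullet> \<rho> = \<rho>"
        by (simp add: hom2_iff \<delta>)
      fix \<tau> assume a: "\<tau> \<in> hom2 K (Src K \<rho>) (Src K (Id2 K g)) \<and> x \<rhd> \<tau> = \<delta> \<and> Id2 K g \<bullet> \<tau> = \<rho>"
      then have "\<tau> \<in> Cell K" "Tgt K \<tau> = g" by (simp_all add: hom2_iff)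
      then have "Id2 K g \<bullet> \<tau> = \<tau>" by simp
      with a show "\<tau> = \<rho>" by simp
    qed
  qed simp_all
  moreover have "Id2 K g = Id2 K g \<bullet> Id2 K (Src K (Id2 K g))" "x \<rhd> Id2 K g = \<beta>" "Id2 K g \<lhd> h = Id2 K (g \<odot> h)"
    if lp: "lift_problem K x g \<beta>" and "h \<in> Arr K" "Cod K h = Dom K g" for g \<beta> h
    using lift_problemD(1,2)[OF lp] that(2,3) b[OF lp] by simp_all
  moreover have "x \<rhd> Id2 K g = \<beta>" if lp: "lift_problem K x g \<beta>" for g \<beta>
    using lift_problemD(1,2)[OF lp] b[OF lp] by simp
  ultimately show ?thesis
    unfolding split_fib_def using lift_problemD(1,2)[of x] by simp
qed

end

locale pullbacks_commas = pullbacks K pb + commas K cm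
  for K :: "('o, 'a, 'c) twocat" (structure) and pb :: "'a pbs" and cm :: "('a, 'c) commas"
begin

lemma DelBar_simps:
  assumes s: "s \<in> Arr K" and A: "alg (Cod K s) A"
  shows "fst (fob (DelBar K pb cm s) A) = pr1 s (fst A)" "alg (Dom K s) (fob (DelBar K pb cm s) A)"
    and "lift_problem K (pr1 s (fst A)) v \<beta> \<Longrightarrow>
      pr2 s (fst A) \<odot> act (Dom K s) (fob (DelBar K pb cm s) A) v \<beta> = act (Cod K s) A (pr2 s (fst A) \<odot> v) (s \<rhd> \<beta>)"
proof -
  note [simp] = algD(1-6)[OF A] s
  note f = split_fib_of_alg[OF A]
  have f': "split_fib K (pr1 s (fst A)) (pb_cleavage K pb s (fst A) (fib_of_alg K cm (Cod K s) A))"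
    by (rule pb_split_fib[OF f]) simp_all
  show "fst (fob (DelBar K pb cm s) A) = pr1 s (fst A)" "alg (Dom K s) (fob (DelBar K pb cm s) A)"
    unfolding DelBar_def by (simp_all add: alg_lift_def alg_of_fib[OF f'])
  assume lp: "lift_problem K (pr1 s (fst A)) v \<beta>"
  note lp' = pb_lift_problem[OF lp s, simplified]
  show "pr2 s (fst A) \<odot> act (Dom K s) (fob (DelBar K pb cm s) A) v \<beta> = act (Cod K s) A (pr2 s (fst A) \<odot> v) (s \<rhd> \<beta>)"
    unfolding DelBar_def using fib_of_alg_simps(2)[OF A lp'] lift_problemD[OF lp] lift_problem_ends[OF lp]
      pb_cleavage_simps(2,6)[OF f s _ lp] act_simps[OF A lp']
    by (simp add: alg_lift_def act_alg_of_fib[OF f' _ lp])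
qed

lemma DelBar_fun2:
  assumes s [simp]: "s \<in> Arr K"
  shows "is_fun2 (PhiAlg K cm (Cod K s)) (PhiAlg K cm (Dom K s)) (DelBar K pb cm s)"
  unfolding DelBar_def
proof (rule alg_lift_fun2[OF Del_fun2])
  have G: "alg_of_fib K cm (Dom K s) (fob (Del K pb s) (fst A)) (pb_cleavage K pb s (fst A) (fib_of_alg K cm (Cod K s) A))
    = fob (DelBar K pb cm s) A" for A unfolding DelBar_def by (simp add: alg_lift_def)
  fix A u A' assume u: "algmor (Cod K s) A u A'"
  note A = algmorD(1)[OF u] and A' = algmorD(2)[OF u]
  define k x x' where D: "k = mid u" "x = fst A" "x' = fst A'"
  note [simp] = algD(1-6)[OF A, folded D] algD(1-6)[OF A', folded D] algmorD(4-7)[OF u, folded D]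
  have u': "u = (x, k, x')" using algmorD(3)[OF u] unfolding D .
  note S = DelBar_simps[OF s A, folded D] DelBar_simps[OF s A', folded D]
  have [simp]: "x' \<odot> (k \<odot> h) = x \<odot> h" if "h \<in> Arr K" "Cod K h = Dom K x" for h
    using that by (simp add: Comp_reassoc)
  define h where "h = pb_arr K pb s x' (pr1 s x) (k \<odot> pr2 s x)"
  have [simp]: "h \<in> Arr K" "Dom K h = Dom K (pr1 s x)" "Cod K h = Dom K (pr1 s x')" and h [simp]: "pr1 s x' \<odot> h = pr1 s x" "pr2 s x' \<odot> h = k \<odot> pr2 s x"
    unfolding h_def by simp_all
  have hr [simp]: "pr1 s x' \<odot> (h \<odot> z) = pr1 s x \<odot> z" "pr2 s x' \<odot> (h \<odot> z) = k \<odot> (pr2 s x \<odot> z)" if "z \<in> Arr K" "Cod K z = Dom K (pr1 s x)" for z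
    using that by (simp_all add: Comp_reassoc[OF h(1)] Comp_reassoc[OF h(2)])
  have "algmor (Dom K s) (fob (DelBar K pb cm s) A) (fst (fob (DelBar K pb cm s) A), h, fst (fob (DelBar K pb cm s) A')) (fob (DelBar K pb cm s) A')"
  proof (rule algmorI)
    fix v \<beta> assume "lift_problem K (fst (fob (DelBar K pb cm s) A)) v \<beta>"
    then have lp: "lift_problem K (pr1 s x) v \<beta>" unfolding S .
    note [simp] = lift_problemD[OF lp]
    have lp2: "lift_problem K (pr1 s x') (h \<odot> v) \<beta>" by (simp add: lift_problem_def)
    have lp3: "lift_problem K x (pr2 s x \<odot> v) (s \<rhd> \<beta>)" by (rule pb_lift_problem[OF lp]) simp_all
    note [simp] = act_simps[OF S(2), unfolded S(1), OF lp] act_simps[OF S(5), unfolded S(4), OF lp2] S(3)[OF lp] S(6)[OF lp2]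
    show "h \<odot> act (Dom K s) (fob (DelBar K pb cm s) A) v \<beta> = act (Dom K s) (fob (DelBar K pb cm s) A') (h \<odot> v) \<beta>"
      by (rule pr_eqI[of s x']) (simp_all add: algmorD(8)[OF u, folded D, OF lp3])
  qed (simp_all add: S)
  then show "algmor (Dom K s) (alg_of_fib K cm (Dom K s) (fob (Del K pb s) (fst A)) (pb_cleavage K pb s (fst A) (fib_of_alg K cm (Cod K s) A)))
    (farr (Del K pb s) u) (alg_of_fib K cm (Dom K s) (fob (Del K pb s) (fst A')) (pb_cleavage K pb s (fst A') (fib_of_alg K cm (Cod K s) A')))"
    unfolding G u' by (simp add: S h_def)
qed (use DelBar_simps(2)[OF s] in \<open>simp_all add: DelBar_def alg_lift_def\<close>)

lemma SigBar_simps: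
  assumes t: "split_fib K t \<chi>t" and A: "alg (Dom K t) A"
  shows "fst (fob (SigBar K cm t \<chi>t) A) = t \<odot> fst A" "alg (Cod K t) (fob (SigBar K cm t \<chi>t) A)"
    and "lift_problem K (t \<odot> fst A) v \<beta> \<Longrightarrow>
      act (Cod K t) (fob (SigBar K cm t \<chi>t) A) v \<beta> = act (Dom K t) A v (\<chi>t (fst A \<odot> v) \<beta>)"
proof -
  note [simp] = algD(1-6)[OF A] split_fibD(1)[OF t]
  note f = split_fib_of_alg[OF A]
  have f': "split_fib K (t \<odot> fst A) (comp_cleavage K \<chi>t (fst A) (fib_of_alg K cm (Dom K t) A))"
    by (rule comp_split_fib[OF t f]) simp_all
  show "fst (fob (SigBar K cm t \<chi>t) A) = t \<odot> fst A" "alg (Cod K t) (fob (SigBar K cm t \<chi>t) A)"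
    unfolding SigBar_def by (simp_all add: alg_lift_def alg_of_fib[OF f'])
  assume lp: "lift_problem K (t \<odot> fst A) v \<beta>"
  show "act (Cod K t) (fob (SigBar K cm t \<chi>t) A) v \<beta> = act (Dom K t) A v (\<chi>t (fst A \<odot> v) \<beta>)"
  proof -
    have "act (Cod K t) (fob (SigBar K cm t \<chi>t) A) v \<beta> = Src K (comp_cleavage K \<chi>t (fst A) (fib_of_alg K cm (Dom K t) A) v \<beta>)"
      unfolding SigBar_def by (simp add: alg_lift_def act_alg_of_fib[OF f' _ lp])
    then show ?thesis
      using fib_of_alg_simps(2)[OF A comp_lift_problem(2)[OF t _ _ lp]] by (simp add: comp_cleavage_def)
  qed
qed

lemma SigBar_fun2:
  assumes t: "split_fib K t \<chi>t"
  shows "is_fun2 (PhiAlg K cm (Dom K t)) (PhiAlg K cm (Cod K t)) (SigBar K cm t \<chi>t)"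
  unfolding SigBar_def
proof (rule alg_lift_fun2[OF Sig_fun2[OF split_fibD(1)[OF t]]])
  note [simp] = split_fibD(1)[OF t]
  have G: "alg_of_fib K cm (Cod K t) (fob (Sig K t) (fst A)) (comp_cleavage K \<chi>t (fst A) (fib_of_alg K cm (Dom K t) A))
    = fob (SigBar K cm t \<chi>t) A" for A unfolding SigBar_def by (simp add: alg_lift_def)
  fix A u A' assume u: "algmor (Dom K t) A u A'"
  note A = algmorD(1)[OF u] and A' = algmorD(2)[OF u]
  define k x x' where D: "k = mid u" "x = fst A" "x' = fst A'"
  note [simp] = algD(1-6)[OF A, folded D] algD(1-6)[OF A', folded D] algmorD(4-7)[OF u, folded D]
  have u': "u = (x, k, x')" using algmorD(3)[OF u] unfolding D .
  note S = SigBar_simps[OF t A, folded D] SigBar_simps[OF t A', folded D]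
  have [simp]: "x' \<odot> (k \<odot> h) = x \<odot> h" if "h \<in> Arr K" "Cod K h = Dom K x" for h
    using that by (simp add: Comp_reassoc)
  have "algmor (Cod K t) (fob (SigBar K cm t \<chi>t) A) (fst (fob (SigBar K cm t \<chi>t) A), k, fst (fob (SigBar K cm t \<chi>t) A')) (fob (SigBar K cm t \<chi>t) A')"
  proof (rule algmorI)
    fix v \<beta> assume "lift_problem K (fst (fob (SigBar K cm t \<chi>t) A)) v \<beta>"
    then have lp: "lift_problem K (t \<odot> x) v \<beta>" unfolding S .
    note [simp] = lift_problemD[OF lp]
    have lp2: "lift_problem K (t \<odot> x') (k \<odot> v) \<beta>" by (simp add: lift_problem_def)
    have lp3: "lift_problem K x v (\<chi>t (x \<odot> v) \<beta>)" by (rule comp_lift_problem(2)[OF t _ _ lp]) simp_all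
    show "k \<odot> act (Cod K t) (fob (SigBar K cm t \<chi>t) A) v \<beta> = act (Cod K t) (fob (SigBar K cm t \<chi>t) A') (k \<odot> v) \<beta>"
      by (simp add: S(3)[OF lp] S(6)[OF lp2] algmorD(8)[OF u, folded D, OF lp3])
  qed (simp_all add: S)
  then show "algmor (Cod K t) (alg_of_fib K cm (Cod K t) (fob (Sig K t) (fst A)) (comp_cleavage K \<chi>t (fst A) (fib_of_alg K cm (Dom K t) A)))
    (farr (Sig K t) u) (alg_of_fib K cm (Cod K t) (fob (Sig K t) (fst A')) (comp_cleavage K \<chi>t (fst A') (fib_of_alg K cm (Dom K t) A')))"
    unfolding G u' by (simp add: S)
qed (use SigBar_simps(2)[OF t] in \<open>simp_all add: SigBar_def alg_lift_def\<close>)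

end

section \<open>Evaluation\<close>

lemma is_nat2D:
  assumes "is_nat2 C D F G \<tau>"
  shows "X \<in> Ob C \<Longrightarrow> \<tau> X \<in> Arr D" "X \<in> Ob C \<Longrightarrow> Dom D (\<tau> X) = fob F X" "X \<in> Ob C \<Longrightarrow> Cod D (\<tau> X) = fob G X"
    "f \<in> Arr C \<Longrightarrow> \<tau> (Cod C f) \<odot>\<^bsub>D\<^esub> farr F f = farr G f \<odot>\<^bsub>D\<^esub> \<tau> (Dom C f)"
    "\<alpha> \<in> Cell C \<Longrightarrow> \<tau> (Cod C (Src C \<alpha>)) \<rhd>\<^bsub>D\<^esub> fcell F \<alpha> = fcell G \<alpha> \<lhd>\<^bsub>D\<^esub> \<tau> (Dom C (Src C \<alpha>))"
  using assms unfolding is_nat2_def hom1_iff by blast+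

lemma adj2D:
  assumes "adj2 C D F G \<eta> \<epsilon>"
  shows "is_fun2 C D F" "is_fun2 D C G" "is_nat2 C C id_fun2 (G \<circ>\<^sub>2 F) \<eta>" "is_nat2 D D (F \<circ>\<^sub>2 G) id_fun2 \<epsilon>"
    "X \<in> Ob C \<Longrightarrow> \<epsilon> (fob F X) \<odot>\<^bsub>D\<^esub> farr F (\<eta> X) = Id1 D (fob F X)"
    "Y \<in> Ob D \<Longrightarrow> farr G (\<epsilon> Y) \<odot>\<^bsub>C\<^esub> \<eta> (fob G Y) = Id1 C (fob G Y)"
  using assms unfolding adj2_def by blast+

text \<open>
  A right 2-adjoint R of \<open>\<Delta>\<^sub>p\<close>. Below, zz and tr are its values on objects and on
  the underlying arrows, ce and un the arrows underlying counit and unit.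
\<close>

locale pushforward = pullbacks K pb for K :: "('o, 'a, 'c) twocat" (structure) and pb :: "'a pbs" +
  fixes p :: 'a and R :: "('a, 'c) radj"
  assumes p [simp]: "p \<in> Arr K" and is_Pi: "is_Pi K pb p R"
begin

abbreviation "zz x \<equiv> fob (rfun R) x"

definition tr :: "'a \<Rightarrow> 'a \<Rightarrow> 'a \<Rightarrow> 'a" where "tr x k y = mid (farr (rfun R) (x, k, y))"

lemma adj: "adj2 (slice K (Cod K p)) (slice K (Dom K p)) (Del K pb p) (rfun R) (runit R) (rcounit R)"
  using is_Pi unfolding is_Pi_def .

lemma zz_simps [simp]: "\<lbrakk>x \<in> Arr K; Cod K x = Dom K p\<rbrakk> \<Longrightarrow> zz x \<in> Arr K" "\<lbrakk>x \<in> Arr K; Cod K x = Dom K p\<rbrakk> \<Longrightarrow> Cod K (zz x) = Cod K p"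
  using is_fun2D(1)[OF adj2D(2)[OF adj], of x] by simp_all

lemma farr_R:
  assumes "(x, k, y) \<in> Arr (slice K (Dom K p))"
  shows "farr (rfun R) (x, k, y) = (zz x, tr x k y, zz y)"
  using is_fun2D(3-5)[OF adj2D(2)[OF adj], OF assms] unfolding tr_def
  by (cases "farr (rfun R) (x, k, y)") simp

lemma tr_simps [simp]:
  assumes "x \<in> Arr K" "y \<in> Arr K" "Cod K x = Dom K p" "Cod K y = Dom K p" "k \<in> Arr K" "Dom K k = Dom K x" "Cod K k = Dom K y" "y \<odot> k = x"
  shows "tr x k y \<in> Arr K" "Dom K (tr x k y) = Dom K (zz x)" "Cod K (tr x k y) = Dom K (zz y)" "zz y \<odot> tr x k y = zz x"
  using is_fun2D(3)[OF adj2D(2)[OF adj], of "(x, k, y)"] assms by (simp_all add: farr_R)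

lemma tr_Comp:
  assumes "(x, k, y) \<in> Arr (slice K (Dom K p))" "(y, l, z) \<in> Arr (slice K (Dom K p))"
  shows "tr x (l \<odot> k) z = tr y l z \<odot> tr x k y"
proof -
  interpret S: two_category "slice K (Dom K p)" by (rule two_category_slice) simp
  have "(x, l \<odot> k, z) \<in> Arr (slice K (Dom K p))"
    using S.Comp_simps(1)[OF assms] by simp
  then show ?thesis
    using is_fun2D(10)[OF adj2D(2)[OF adj], OF assms] assms by (simp add: farr_R del: slice_simps(2)) 
qed

definition ce :: "'a \<Rightarrow> 'a" where "ce x = mid (rcounit R x)"
definition un :: "'a \<Rightarrow> 'a" where "un y = mid (runit R y)"

lemma ce_simps:
  assumes "x \<in> Arr K" "Cod K x = Dom K p"
  shows "rcounit R x = (pr1 p (zz x), ce x, x)" "ce x \<in> Arr K" "Dom K (ce x) = Dom K (pr1 p (zz x))" "Cod K (ce x) = Dom K x" "x \<odot> ce x = pr1 p (zz x)"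
proof -
  have "rcounit R x \<in> Arr (slice K (Dom K p))" "Dom (slice K (Dom K p)) (rcounit R x) = pr1 p (zz x)" "Cod (slice K (Dom K p)) (rcounit R x) = x"
    using is_nat2D(1-3)[OF adj2D(4)[OF adj], of x] assms by simp_all
  then show "rcounit R x = (pr1 p (zz x), ce x, x)" "ce x \<in> Arr K" "Dom K (ce x) = Dom K (pr1 p (zz x))" "Cod K (ce x) = Dom K x" "x \<odot> ce x = pr1 p (zz x)"
    unfolding ce_def by (cases "rcounit R x"; simp)+
qed

lemma un_simps:
  assumes "y \<in> Arr K" "Cod K y = Cod K p"
  shows "runit R y = (y, un y, zz (pr1 p y))" "un y \<in> Arr K" "Dom K (un y) = Dom K y" "Cod K (un y) = Dom K (zz (pr1 p y))" "zz (pr1 p y) \<odot> un y = y"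
proof -
  have "runit R y \<in> Arr (slice K (Cod K p))" "Dom (slice K (Cod K p)) (runit R y) = y" "Cod (slice K (Cod K p)) (runit R y) = zz (pr1 p y)"
    using is_nat2D(1-3)[OF adj2D(3)[OF adj], of y] assms by simp_all
  then show "runit R y = (y, un y, zz (pr1 p y))" "un y \<in> Arr K" "Dom K (un y) = Dom K y" "Cod K (un y) = Dom K (zz (pr1 p y))" "zz (pr1 p y) \<odot> un y = y"
    unfolding un_def by (cases "runit R y"; simp)+
qed

lemma ce_nat:
  assumes k: "(x, k, y) \<in> Arr (slice K (Dom K p))"
  shows "ce y \<odot> pb_arr K pb p (zz y) (pr1 p (zz x)) (tr x k y \<odot> pr2 p (zz x)) = k \<odot> ce x"
  using is_nat2D(4)[OF adj2D(4)[OF adj], OF k] k by (simp add: farr_R ce_simps)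

lemma un_nat:
  assumes k: "(x, k, y) \<in> Arr (slice K (Cod K p))"
  shows "un y \<odot> k = tr (pr1 p x) (pb_arr K pb p y (pr1 p x) (k \<odot> pr2 p x)) (pr1 p y) \<odot> un x"
proof -
  have "farr (Del K pb p) (x, k, y) \<in> Arr (slice K (Dom K p))"
    using is_fun2D(3)[OF adj2D(1)[OF adj], OF k] .
  then show ?thesis
    using is_nat2D(4)[OF adj2D(3)[OF adj], OF k] k by (simp add: farr_R un_simps)
qed

lemma ce_un:
  assumes "y \<in> Arr K" "Cod K y = Cod K p"
  shows "ce (pr1 p y) \<odot> pb_arr K pb p (zz (pr1 p y)) (pr1 p y) (un y \<odot> pr2 p y) = Id1 K (Dom K (pr1 p y))"
  using adj2D(5)[OF adj, of y] assms by (simp add: ce_simps un_simps)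

lemma tr_ce_un:
  assumes "x \<in> Arr K" "Cod K x = Dom K p"
  shows "tr (pr1 p (zz x)) (ce x) x \<odot> un (zz x) = Id1 K (Dom K (zz x))"
  using adj2D(6)[OF adj, of x] assms by (simp add: ce_simps un_simps farr_R)

text \<open>
  For \<open>p e = zz x v\<close>, the value at e of v, regarded as a family of elements of x over the fibre
  of p.
\<close>

definition ev :: "'a \<Rightarrow> 'a \<Rightarrow> 'a \<Rightarrow> 'a" where "ev x e v = ce x \<odot> pb_arr K pb p (zz x) e v"

lemma ev_simps [simp]:
  assumes "x \<in> Arr K" "Cod K x = Dom K p" "e \<in> Arr K" "v \<in> Arr K" "Dom K e = Dom K v" "Cod K e = Dom K p" "Cod K v = Dom K (zz x)"
    "p \<odot> e = zz x \<odot> v"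
  shows "ev x e v \<in> Arr K" "Dom K (ev x e v) = Dom K v" "Cod K (ev x e v) = Dom K x" "x \<odot> ev x e v = e"
  using assms ce_simps[OF assms(1,2)] unfolding ev_def
  by (simp_all add: Comp_reassoc[of x "ce x" "pr1 p (zz x)"])

lemma ev_restrict:
  assumes "x \<in> Arr K" "Cod K x = Dom K p" "e \<in> Arr K" "v \<in> Arr K" "Dom K e = Dom K v" "Cod K e = Dom K p" "Cod K v = Dom K (zz x)"
    "p \<odot> e = zz x \<odot> v" "h \<in> Arr K" "Cod K h = Dom K v"
  shows "ev x e v \<odot> h = ev x (e \<odot> h) (v \<odot> h)"
  using assms ce_simps[OF assms(1,2)] unfolding ev_def by (simp add: pb_arr_comp)

lemma ev_tr:
  assumes k: "(x, k, y) \<in> Arr (slice K (Dom K p))" and "e \<in> Arr K" "v \<in> Arr K" "Dom K e = Dom K v" "Cod K e = Dom K p" "Cod K v = Dom K (zz x)"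
    "p \<odot> e = zz x \<odot> v"
  shows "ev y e (tr x k y \<odot> v) = k \<odot> ev x e v"
proof -
  have [simp]: "x \<in> Arr K" "y \<in> Arr K" "Cod K x = Dom K p" "Cod K y = Dom K p" "k \<in> Arr K" "Dom K k = Dom K x" "Cod K k = Dom K y" "y \<odot> k = x"
    using k by simp_all
  note [simp] = assms(2-) ce_simps[of x] ce_simps[of y]
  have [simp]: "zz y \<odot> (tr x k y \<odot> h) = zz x \<odot> h" if "h \<in> Arr K" "Cod K h = Dom K (zz x)" for h
    using that by (simp add: Comp_reassoc[of "zz y" "tr x k y" "zz x"])
  define w where "w = pb_arr K pb p (zz y) (pr1 p (zz x)) (tr x k y \<odot> pr2 p (zz x))"
  have [simp]: "w \<in> Arr K" "Dom K w = Dom K (pr1 p (zz x))" "Cod K w = Dom K (pr1 p (zz y))" unfolding w_def by simp_all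
  have "pb_arr K pb p (zz y) e (tr x k y \<odot> v) = w \<odot> pb_arr K pb p (zz x) e v"
    unfolding w_def by (rule pr_eqI[of p "zz y"]) simp_all
  then show ?thesis unfolding ev_def using ce_nat[OF k, folded w_def] by (simp add: Comp_reassoc[of "ce y" w])
qed

lemma ev_un:
  assumes "y \<in> Arr K" "Cod K y = Cod K p" "e \<in> Arr K" "v \<in> Arr K" "Dom K e = Dom K v" "Cod K e = Dom K p" "Cod K v = Dom K y"
    "p \<odot> e = y \<odot> v"
  shows "ev (pr1 p y) e (un y \<odot> v) = pb_arr K pb p y e v"
proof -
  note [simp] = assms ce_simps[of "pr1 p y"] un_simps[of y]
  have [simp]: "zz (pr1 p y) \<odot> (un y \<odot> h) = y \<odot> h" if "h \<in> Arr K" "Cod K h = Dom K y" for h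
    using that by (simp add: Comp_reassoc[of "zz (pr1 p y)" "un y" y])
  define w where "w = pb_arr K pb p (zz (pr1 p y)) (pr1 p y) (un y \<odot> pr2 p y)"
  have [simp]: "w \<in> Arr K" "Dom K w = Dom K (pr1 p y)" "Cod K w = Dom K (pr1 p (zz (pr1 p y)))" unfolding w_def by simp_all
  have "pb_arr K pb p (zz (pr1 p y)) e (un y \<odot> v) = w \<odot> pb_arr K pb p y e v"
    unfolding w_def by (rule pr_eqI[of p "zz (pr1 p y)"]) simp_all
  then show ?thesis unfolding ev_def using ce_un[of y, folded w_def] by (simp add: Comp_reassoc[of "ce (pr1 p y)" w])
qed

text \<open>
  An arrow into \<open>\<Pi>\<^sub>p x\<close> is the transpose of its family of values, here at the
  universal element of the fibres, which is the pullback of b along p.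
\<close>

lemma transpose:
  assumes x: "x \<in> Arr K" "Cod K x = Dom K p" and u: "u \<in> Arr K" "Cod K u = Dom K (zz x)" "zz x \<odot> u = b"
  shows "u = tr (pr1 p b) (ev x (pr1 p b) (u \<odot> pr2 p b)) x \<odot> un b"
proof -
  have [simp]: "b \<in> Arr K" "Cod K b = Cod K p" "Dom K b = Dom K u" unfolding u(3)[symmetric] using x u(1,2) by simp_all
  note [simp] = x u ce_simps[of x]
  note [simp] = un_simps[of "zz x"] un_simps[of b]
  have [simp]: "zz x \<odot> (u \<odot> h) = b \<odot> h" if "h \<in> Arr K" "Cod K h = Dom K b" for h
    using that by (simp add: Comp_reassoc[of "zz x" u b])
  define w where "w = pb_arr K pb p (zz x) (pr1 p b) (u \<odot> pr2 p b)"
  have [simp]: "w \<in> Arr K" "Dom K w = Dom K (pr1 p b)" "Cod K w = Dom K (pr1 p (zz x))" "pr1 p (zz x) \<odot> w = pr1 p b"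
     unfolding w_def by simp_all
  have "tr (pr1 p b) (ce x \<odot> w) x = tr (pr1 p (zz x)) (ce x) x \<odot> tr (pr1 p b) w (pr1 p (zz x))"
    by (rule tr_Comp) simp_all
  moreover have "un (zz x) \<odot> u = tr (pr1 p b) w (pr1 p (zz x)) \<odot> un b"
    unfolding w_def by (rule un_nat) simp
  moreover have "tr (pr1 p (zz x)) (ce x) x \<odot> (un (zz x) \<odot> u) = u"
    by (simp add: Comp_reassoc[OF tr_ce_un[OF x]])
  ultimately show ?thesis unfolding ev_def w_def[symmetric] by simp
qed

lemma ev_eqI:
  assumes x: "x \<in> Arr K" "Cod K x = Dom K p" and u: "u \<in> Arr K" "Cod K u = Dom K (zz x)" "zz x \<odot> u = b"
    and v: "v \<in> Arr K" "Cod K v = Dom K (zz x)" "zz x \<odot> v = b"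
    and e: "ev x (pr1 p b) (u \<odot> pr2 p b) = ev x (pr1 p b) (v \<odot> pr2 p b)"
  shows "u = v"
  using transpose[OF x u] transpose[OF x v] e by simp

lemma ev_ex:
  assumes x: "x \<in> Arr K" "Cod K x = Dom K p" and b: "b \<in> Arr K" "Cod K b = Cod K p"
    and k: "k \<in> Arr K" "Dom K k = Dom K (pr1 p b)" "Cod K k = Dom K x" "x \<odot> k = pr1 p b"
  obtains u where "u \<in> Arr K" "Dom K u = Dom K b" "Cod K u = Dom K (zz x)" "zz x \<odot> u = b" "ev x (pr1 p b) (u \<odot> pr2 p b) = k"
proof (rule that)
  note [simp] = x b k un_simps[of b]
  have [simp]: "zz (pr1 p b) \<odot> (un b \<odot> h) = b \<odot> h" if "h \<in> Arr K" "Cod K h = Dom K b" for h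
    using that by (simp add: Comp_reassoc[of _ "un b" b])
  let ?u = "tr (pr1 p b) k x \<odot> un b"
  show "?u \<in> Arr K" "Dom K ?u = Dom K b" "Cod K ?u = Dom K (zz x)" "zz x \<odot> ?u = b"
    by (simp_all add: Comp_reassoc[of "zz x" "tr (pr1 p b) k x" "zz (pr1 p b)"])
  have pbid: "pb_arr K pb p b (pr1 p b) (pr2 p b) = Id1 K (Dom K (pr1 p b))" by (rule pr_eqI[of p b]) simp_all
  show "ev x (pr1 p b) (?u \<odot> pr2 p b) = k"
  proof -
    have "ev x (pr1 p b) (tr (pr1 p b) k x \<odot> (un b \<odot> pr2 p b)) = k \<odot> ev (pr1 p b) (pr1 p b) (un b \<odot> pr2 p b)"
      by (rule ev_tr) simp_all
    also have "ev (pr1 p b) (pr1 p b) (un b \<odot> pr2 p b) = pb_arr K pb p b (pr1 p b) (pr2 p b)"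
      by (rule ev_un) simp_all
    also have "k \<odot> \<dots> = k" by (simp add: pbid)
    finally show ?thesis by simp
  qed
qed

end

section \<open>The lift of \<open>\<Pi>\<close>\<close>

context two_category
begin

lemma split_opfibD:
  assumes "split_opfib K p \<chi>" "e \<in> Arr K" "Cod K e = Dom K p" "\<beta> \<in> Cell K" "Src K \<beta> = p \<odot> e"
  shows "\<chi> e \<beta> \<in> Cell K" "Src K (\<chi> e \<beta>) = e" "p \<rhd> \<chi> e \<beta> = \<beta>"
    and "\<lbrakk>\<gamma> \<in> Cell K; Src K \<gamma> = Tgt K \<beta>\<rbrakk> \<Longrightarrow> \<chi> e (\<gamma> \<bullet> \<beta>) = \<chi> (Tgt K (\<chi> e \<beta>)) \<gamma> \<bullet> \<chi> e \<beta>"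
    and "\<lbrakk>h \<in> Arr K; Cod K h = Dom K e\<rbrakk> \<Longrightarrow> \<chi> e \<beta> \<lhd> h = \<chi> (e \<odot> h) (\<beta> \<lhd> h)"
proof -
  have s: "split_fib (co K) p \<chi>" and lp: "lift_problem (co K) p e \<beta>"
    using assms by (simp_all add: split_opfib_def lift_problem_def co_def)
  have c: "\<chi> e \<beta> \<in> Cell K" "Src K (\<chi> e \<beta>) = e" "p \<rhd> \<chi> e \<beta> = \<beta>"
    using s lp unfolding split_fib_def cartesian_cell_def by (simp_all add: co_def whisker_l_def)
  then show "\<chi> e \<beta> \<in> Cell K" "Src K (\<chi> e \<beta>) = e" "p \<rhd> \<chi> e \<beta> = \<beta>" by blast+
  show "\<chi> e (\<gamma> \<bullet> \<beta>) = \<chi> (Tgt K (\<chi> e \<beta>)) \<gamma> \<bullet> \<chi> e \<beta>" if "\<gamma> \<in> Cell K" "Src K \<gamma> = Tgt K \<beta>"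
    using s lp that unfolding split_fib_def by (auto simp: co_def)
  show "\<chi> e \<beta> \<lhd> h = \<chi> (e \<odot> h) (\<beta> \<lhd> h)" if "h \<in> Arr K" "Cod K h = Dom K e"
    using s lp that unfolding split_fib_def by (auto simp: co_def whisker_r_def)
qed

lemma split_opfib_ends:
  assumes "split_opfib K p \<chi>" "p \<in> Arr K" "e \<in> Arr K" "Cod K e = Dom K p" "\<beta> \<in> Cell K" "Src K \<beta> = p \<odot> e"
  shows "Tgt K (\<chi> e \<beta>) \<in> Arr K" "Dom K (Tgt K (\<chi> e \<beta>)) = Dom K e" "Cod K (Tgt K (\<chi> e \<beta>)) = Dom K p" "p \<odot> Tgt K (\<chi> e \<beta>) = Tgt K \<beta>"
proof -
  note D = split_opfibD(1-3)[OF assms(1,3-6)]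
  show "Tgt K (\<chi> e \<beta>) \<in> Arr K" "Dom K (Tgt K (\<chi> e \<beta>)) = Dom K e" "Cod K (Tgt K (\<chi> e \<beta>)) = Dom K p"
    using D assms(3,4) by simp_all
  show "p \<odot> Tgt K (\<chi> e \<beta>) = Tgt K \<beta>"
    using whisker_l_simps(3)[of p "\<chi> e \<beta>"] D assms(2-4) by simp
qed

lemma split_opfib_Id2:
  assumes "split_opfib K p \<chi>" "e \<in> Arr K" "Cod K e = Dom K p"
  shows "\<chi> e (Id2 K (p \<odot> e)) = Id2 K e"
  using assms unfolding split_opfib_def split_fib_def by (simp add: co_def)

end

text \<open>
  \<chi> is the split opcleavage of p; its cells are lifts with a given domain, so
  \<chi> e \<beta> : e \<Rightarrow> e' for \<beta> with domain p e.
\<close>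

locale pushforward_opfib = pushforward K pb p R + pullbacks_commas K pb cm
  for K :: "('o, 'a, 'c) twocat" (structure) and pb :: "'a pbs" and cm :: "('a, 'c) commas" and p :: 'a and R :: "('a, 'c) radj" +
  fixes Pi :: "'a \<Rightarrow> ('a, 'c) radj" and \<chi> :: "('a, 'c) cleavage"
  assumes R: "R = Pi p" and opfib: "split_opfib K p \<chi>"
begin

text \<open>
  The composite that defines the lift of \<Pi> is the transpose of the arrow t that takes the opcartesian
  lift of the universal 2-cell, evaluates at its codomain, and acts by it. Evaluating a transpose gives back
  t.
\<close>

lemma PiBar_action:
  assumes A: "alg (Dom K p) A" and b: "snd (fob (PiBar K pb cm Pi p \<chi>) A) = (d, \<alpha>, y)"
  shows "fst (fob (PiBar K pb cm Pi p \<chi>) A) = zz (fst A)" "d = cd (Cod K p) (zz (fst A))" "y = zz (fst A)"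
    "\<alpha> \<in> Arr K" "Dom K \<alpha> = Dom K (cd (Cod K p) (zz (fst A)))" "Cod K \<alpha> = Dom K (zz (fst A))" "zz (fst A) \<odot> \<alpha> = cd (Cod K p) (zz (fst A))"
    and "\<lbrakk>lift_problem K (zz (fst A)) v \<beta>; e \<in> Arr K; Cod K e = Dom K p; Dom K e = Dom K v; p \<odot> e = Src K \<beta>\<rbrakk> \<Longrightarrow>
      ev (fst A) e (\<alpha> \<odot> carr (Cod K p) (zz (fst A)) (Src K \<beta>) v \<beta>) = act (Dom K p) A (ev (fst A) (Tgt K (\<chi> e \<beta>)) v) (\<chi> e \<beta>)"
proof -
  define x a B E z where D: "x = fst A" "a = mid (snd A)" "B = Cod K p" "E = Dom K p" "z = zz x"
  have [simp]: "Cod K p = B" "Dom K p = E" "zz x = z" by (simp_all add: D)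
  note [simp] = algD(1-6)[OF A, folded D] ce_simps[of x, unfolded D(4)[symmetric], simplified]
  have [simp]: "z \<in> Arr K" "Cod K z = B" using zz_simps[of x] by simp_all
  define n where "n = pr1 p z"
  have [simp]: "pr1 p z = n" by (simp add: n_def)
  have [simp]: "n \<in> Arr K" "Cod K n = E" "pr2 p z \<in> Arr K" "Dom K (pr2 p z) = Dom K n" "Cod K (pr2 p z) = Dom K z"
    using pr_simps[of p z] by simp_all
  define c g2 k2 where C: "c = cd B z" "g2 = \<chi> (pr1 p c) (cl B z \<lhd> pr2 p c)" "k2 = pb_arr K pb p z (Tgt K g2) (cq B z \<odot> pr2 p c)"
  have [simp]: "cd B z = c" by (simp add: C)
  have [simp]: "c \<in> Arr K" "Cod K c = B" "cl B z \<in> Cell K" "Src K (cl B z) = c" "Tgt K (cl B z) = z \<odot> cq B z"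
    "cq B z \<in> Arr K" "Dom K (cq B z) = Dom K c" "Cod K (cq B z) = Dom K z"
    using comma_simps[of z B] by simp_all
  have l: "cl B z \<lhd> pr2 p c \<in> Cell K" "Src K (cl B z \<lhd> pr2 p c) = p \<odot> pr1 p c" "Tgt K (cl B z \<lhd> pr2 p c) = z \<odot> (cq B z \<odot> pr2 p c)"
    by simp_all
  note o = split_opfibD(1-3)[OF opfib _ _ l(1,2), simplified] split_opfib_ends[OF opfib p _ _ l(1,2), simplified]
  have g2 [simp]: "g2 \<in> Cell K" "Src K g2 = pr1 p c" "p \<rhd> g2 = cl B z \<lhd> pr2 p c" "Tgt K g2 \<in> Arr K" 
     "Dom K (Tgt K g2) = Dom K (pr1 p c)" "Cod K (Tgt K g2) = E" "p \<odot> Tgt K g2 = z \<odot> (cq B z \<odot> pr2 p c)"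
    using o unfolding C(2) by simp_all
  have [simp]: "k2 \<in> Arr K" "Dom K k2 = Dom K (pr1 p c)" "Cod K k2 = Dom K n" "n \<odot> k2 = Tgt K g2" "pr2 p z \<odot> k2 = cq B z \<odot> pr2 p c"
    unfolding C(3) using pb_arr_simps[of p z "Tgt K g2" "cq B z \<odot> pr2 p c"] by simp_all
  \<comment> \<open>\<theta> is the colax structure map, \<psi> is \<Phi> of the counit.\<close>
  define \<theta> where "\<theta> = carr E n (pr1 p c) k2 g2"
  have [simp]: "\<theta> \<in> Arr K" "Dom K \<theta> = Dom K (pr1 p c)" "Cod K \<theta> = Dom K (cd E n)" "cd E n \<odot> \<theta> = pr1 p c" "cq E n \<odot> \<theta> = k2" "cl E n \<lhd> \<theta> = g2"
    unfolding \<theta>_def by simp_all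
  have Dc: "Del_colax K pb cm p \<chi> z = (pr1 p c, \<theta>, cd E n)"
    unfolding Del_colax_def kl_arr_def kl_Del_def by (simp add: Let_def \<theta>_def C(2,3))
  define \<psi> where "\<psi> = carr E x (cd E n) (ce x \<odot> cq E n) (cl E n)"
  have xce [simp]: "x \<odot> (ce x \<odot> h) = n \<odot> h" if "h \<in> Arr K" "Cod K h = Dom K n" for h
    using that by (simp add: Comp_reassoc[of x "ce x" n])
  have [simp]: "\<psi> \<in> Arr K" "Dom K \<psi> = Dom K (cd E n)" "Cod K \<psi> = Dom K (cd E x)" "cd E x \<odot> \<psi> = cd E n" "cq E x \<odot> \<psi> = ce x \<odot> cq E n" "cl E x \<lhd> \<psi> = cl E n"
    unfolding \<psi>_def by simp_all
  have [simp]: "cd E x \<odot> (\<psi> \<odot> h) = cd E n \<odot> h" "cq E x \<odot> (\<psi> \<odot> h) = ce x \<odot> (cq E n \<odot> h)" if "h \<in> Arr K" "Cod K h = Dom K (cd E n)" for h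
    using that by (simp_all add: Comp_reassoc[of _ \<psi> "cd E n"] Comp_reassoc[of _ \<psi> "ce x \<odot> cq E n"])
  have [simp]: "cd E n \<odot> (\<theta> \<odot> h) = pr1 p c \<odot> h" "cq E n \<odot> (\<theta> \<odot> h) = k2 \<odot> h" if "h \<in> Arr K" "Cod K h = Dom K (pr1 p c)" for h
    using that by (simp_all add: Comp_reassoc[of _ \<theta> "pr1 p c"] Comp_reassoc[of _ \<theta> "k2"])
  have P: "farr (mfun (Phi K cm E)) (n, ce x, x) = (cd E n, \<psi>, cd E x)"
    by (simp add: Phi_simps \<psi>_def)
  note [simp] = un_simps[of c, simplified]
  define t where "t = a \<odot> (\<psi> \<odot> \<theta>)"
  have xa [simp]: "x \<odot> (a \<odot> h) = cd E x \<odot> h" if "h \<in> Arr K" "Cod K h = Dom K (cd E x)" for h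
    using that by (simp add: Comp_reassoc[of x a "cd E x"])
  have [simp]: "t \<in> Arr K" "Dom K t = Dom K (pr1 p c)" "Cod K t = Dom K x" "x \<odot> t = pr1 p c"
    unfolding t_def by simp_all
  have Aeq: "snd A = (cd E x, a, x)" using algD(7)[OF A] unfolding D(1,2)[symmetric] by (metis \<open>Dom K p = E\<close> snd_conv)
  have r: "farr (rfun R) (cd E x, a, x) = (zz (cd E x), tr (cd E x) a x, z)"
     "farr (rfun R) (cd E n, \<psi>, cd E x) = (zz (cd E n), tr (cd E n) \<psi> (cd E x), zz (cd E x))"
     "farr (rfun R) (pr1 p c, \<theta>, cd E n) = (zz (pr1 p c), tr (pr1 p c) \<theta> (cd E n), zz (cd E n))"
    by (simp_all add: farr_R)
  have "farr (rfun R) (snd A) \<odot>\<^bsub>slice K B\<^esub> Pi_lax K pb cm Pi p \<chi> x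
    = (c, tr (cd E x) a x \<odot> (tr (cd E n) \<psi> (cd E x) \<odot> (tr (pr1 p c) \<theta> (cd E n) \<odot> un c)), z)"
    unfolding Pi_lax_def Let_def R[symmetric] by (simp add: Phi_simps(1) P Dc r Aeq del: slice_simps(2))
  also have "tr (cd E x) a x \<odot> (tr (cd E n) \<psi> (cd E x) \<odot> (tr (pr1 p c) \<theta> (cd E n) \<odot> un c)) = tr (pr1 p c) t x \<odot> un c"
    unfolding t_def using tr_Comp[of "pr1 p c" "\<psi> \<odot> \<theta>" "cd E x" a x] tr_Comp[of "pr1 p c" \<theta> "cd E n" \<psi> "cd E x"] by simp
  finally have sn: "fob (PiBar K pb cm Pi p \<chi>) A = (z, c, tr (pr1 p c) t x \<odot> un c, z)"
    unfolding PiBar_def by (simp add: alg_lift_def D(1)[symmetric] R[symmetric])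
  have al: "d = c" "y = z" "\<alpha> = tr (pr1 p c) t x \<odot> un c" proof -
    from b[unfolded sn snd_conv prod.inject] have "c = d" "tr (pr1 p c) t x \<odot> un c = \<alpha>" "z = y" by blast+
    then show "d = c" "y = z" "\<alpha> = tr (pr1 p c) t x \<odot> un c" by blast+
  qed
  show "fst (fob (PiBar K pb cm Pi p \<chi>) A) = zz (fst A)" "d = cd (Cod K p) (zz (fst A))" "y = zz (fst A)"
    "\<alpha> \<in> Arr K" "Dom K \<alpha> = Dom K (cd (Cod K p) (zz (fst A)))" "Cod K \<alpha> = Dom K (zz (fst A))" "zz (fst A) \<odot> \<alpha> = cd (Cod K p) (zz (fst A))"
    unfolding D(1)[symmetric] al sn using tr_simps[of "pr1 p c" x t]
    by (simp_all add: Comp_reassoc[of z "tr (pr1 p c) t x" "zz (pr1 p c)"])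
  assume lp: "lift_problem K (zz (fst A)) v \<beta>" and e: "e \<in> Arr K" "Cod K e = Dom K p" "Dom K e = Dom K v" "p \<odot> e = Src K \<beta>"
  note [simp] = lift_problemD[OF lp, unfolded D(1)[symmetric], simplified] lift_problem_ends[OF lp, unfolded D(1)[symmetric], simplified] e(1-3) e(2)[simplified]
  have [simp]: "Src K \<beta> = p \<odot> e" by (simp add: e(4))
  define w where "w = carr B z (Src K \<beta>) v \<beta>"
  have [simp]: "w \<in> Arr K" "Dom K w = Dom K v" "Cod K w = Dom K c" "c \<odot> w = p \<odot> e" "cq B z \<odot> w = v" "cl B z \<lhd> w = \<beta>"
    unfolding w_def using carr_simps[of z B v \<beta> "Src K \<beta>"] by simp_all
  define q where "q = pb_arr K pb p c e w"
  have [simp]: "q \<in> Arr K" "Dom K q = Dom K v" "Cod K q = Dom K (pr1 p c)" "pr1 p c \<odot> q = e" "pr2 p c \<odot> q = w"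
    unfolding q_def by simp_all
  have "ev x e (\<alpha> \<odot> w) = t \<odot> ev (pr1 p c) e (un c \<odot> w)"
    unfolding al using ev_tr[of "pr1 p c" t x e "un c \<odot> w"] tr_simps[of "pr1 p c" x t]
    by (simp add: Comp_reassoc[of "zz (pr1 p c)" "un c" c])
  also have "\<dots> = t \<odot> q" by (simp add: ev_un q_def)
  also have "\<dots> = a \<odot> (\<psi> \<odot> (\<theta> \<odot> q))" by (simp add: t_def)
  also have "\<psi> \<odot> (\<theta> \<odot> q) = carr E x e (ev x (Tgt K (\<chi> e \<beta>)) v) (\<chi> e \<beta>)"
  proof -
    note oe = split_opfibD(1-3)[OF opfib, of e \<beta>, simplified] split_opfib_ends[OF opfib p, of e \<beta>, simplified]
    note [simp] = oe
    have gq: "g2 \<lhd> q = \<chi> e \<beta>"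
      unfolding C(2) using split_opfibD(5)[OF opfib, of "pr1 p c" "cl B z \<lhd> pr2 p c" q]
      by (simp add: whisker_r_reassoc[of "pr2 p c" q w])
    have tq: "Tgt K g2 \<odot> q = Tgt K (\<chi> e \<beta>)" using arg_cong[OF gq, of "Tgt K"] by simp
    have k2q: "k2 \<odot> q = pb_arr K pb p z (Tgt K (\<chi> e \<beta>)) v"
      unfolding C(3) by (simp add: pb_arr_comp tq)
    have evs: "ev x (Tgt K (\<chi> e \<beta>)) v = ce x \<odot> (k2 \<odot> q)" unfolding ev_def by (simp add: k2q)
    have c1: "(cl E x \<lhd> \<psi>) \<lhd> (\<theta> \<odot> q) = \<chi> e \<beta>" using gq by simp
    have [simp]: "x \<odot> ev x (Tgt K (\<chi> e \<beta>)) v = Tgt K (\<chi> e \<beta>)" "ev x (Tgt K (\<chi> e \<beta>)) v \<in> Arr K"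
      "Cod K (ev x (Tgt K (\<chi> e \<beta>)) v) = Dom K x" "Dom K (ev x (Tgt K (\<chi> e \<beta>)) v) = Dom K v"
      by simp_all
    have "cl E x \<lhd> (\<psi> \<odot> (\<theta> \<odot> q)) = \<chi> e \<beta>" using c1 by simp
    then show ?thesis
      by - (rule comma_arr_eqI[of E x], simp_all add: evs[symmetric] del: whisker_Comp)
  qed
  also have "a \<odot> carr E x e (ev x (Tgt K (\<chi> e \<beta>)) v) (\<chi> e \<beta>) = act E A (ev x (Tgt K (\<chi> e \<beta>)) v) (\<chi> e \<beta>)"
    unfolding act_def D(1,2)[symmetric] using split_opfibD(2)[OF opfib, of e \<beta>] by simp
  finally show "ev (fst A) e (\<alpha> \<odot> carr (Cod K p) (zz (fst A)) (Src K \<beta>) v \<beta>) = act (Dom K p) A (ev (fst A) (Tgt K (\<chi> e \<beta>)) v) (\<chi> e \<beta>)"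
    unfolding w_def D(1)[symmetric] by simp
qed

abbreviation "PB A \<equiv> fob (PiBar K pb cm Pi p \<chi>) A"
abbreviation "pact A v \<beta> \<equiv> act (Cod K p) (PB A) v \<beta>"

lemma PB_eq:
  assumes A: "alg (Dom K p) A"
  shows "PB A = (zz (fst A), (cd (Cod K p) (zz (fst A)), mid (snd (PB A)), zz (fst A)))"
  using PiBar_action[OF A] by (cases "snd (PB A)"; cases "PB A") auto

lemma PB_simps:
  assumes A: "alg (Dom K p) A"
  shows "fst (PB A) = zz (fst A)" "mid (snd (PB A)) \<in> Arr K" "Dom K (mid (snd (PB A))) = Dom K (cd (Cod K p) (zz (fst A)))"
    "Cod K (mid (snd (PB A))) = Dom K (zz (fst A))" "zz (fst A) \<odot> mid (snd (PB A)) = cd (Cod K p) (zz (fst A))"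
  using PiBar_action(1,4-7)[OF A] PB_eq[OF A] by (metis fst_conv snd_conv)+

lemma pact_simps:
  assumes A: "alg (Dom K p) A" and lp: "lift_problem K (zz (fst A)) v \<beta>"
  shows "pact A v \<beta> \<in> Arr K" "Dom K (pact A v \<beta>) = Dom K v" "Cod K (pact A v \<beta>) = Dom K (zz (fst A))" "zz (fst A) \<odot> pact A v \<beta> = Src K \<beta>"
  using PB_simps[OF A] lift_problemD[OF lp] zz_simps[of "fst A"] algD[OF A]
  unfolding act_def by (simp_all add: Comp_reassoc[OF PB_simps(5)[OF A]])

text \<open>
  The action on \<open>\<Pi>\<^sub>p\<close> of an algebra: push e forward along the chosen opcartesian lift
  of \<beta>, evaluate there, and act by the lift.
\<close>

lemma pact_ev:
  assumes A: "alg (Dom K p) A" and lp: "lift_problem K (zz (fst A)) v \<beta>"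
    and h: "h \<in> Arr K" "Cod K h = Dom K v" and e: "e \<in> Arr K" "Cod K e = Dom K p" "Dom K e = Dom K h" "p \<odot> e = Src K \<beta> \<odot> h"
  shows "ev (fst A) e (pact A v \<beta> \<odot> h) = act (Dom K p) A (ev (fst A) (Tgt K (\<chi> e (\<beta> \<lhd> h))) (v \<odot> h)) (\<chi> e (\<beta> \<lhd> h))"
proof -
  note [simp] = algD(1,2)[OF A] zz_simps[OF algD(1,2)[OF A]] lift_problemD[OF lp] lift_problem_ends[OF lp] h e
  have lp': "lift_problem K (zz (fst A)) (v \<odot> h) (\<beta> \<lhd> h)" by (rule lift_problem_restrict[OF lp]) simp_all
  have "pact A v \<beta> \<odot> h = mid (snd (PB A)) \<odot> carr (Cod K p) (zz (fst A)) (Src K (\<beta> \<lhd> h)) (v \<odot> h) (\<beta> \<lhd> h)"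
    unfolding act_def using PB_simps[OF A] by (simp add: carr_comp[OF _ _ lp])
  moreover obtain d \<alpha> y where "snd (PB A) = (d, \<alpha>, y)" by (cases "snd (PB A)")
  ultimately show ?thesis using PiBar_action(8)[OF A _ lp', of d \<alpha> y e] by simp
qed

text \<open>
  By joint faithfulness of the evaluations the laws can be checked on values. There they are the laws of A
  together with the two laws of a split opcleavage, for identities and for composites.
\<close>

lemma PB_alg:
  assumes A: "alg (Dom K p) A"
  shows "alg (Cod K p) (PB A)"
proof -
  define x z where D: "x = fst A" "z = zz x"
  have xx: "x \<in> Arr K" "Cod K x = Dom K p" using algD[OF A] unfolding D by simp_all
  have z [simp]: "z \<in> Arr K" "Cod K z = Cod K p" unfolding D(2) using zz_simps[OF xx] by simp_all
  note ps = pact_simps[OF A, folded D(1), folded D(2)]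
  note pe = pact_ev[OF A, folded D(1), folded D(2)]
  have eq: "PB A = (z, (cd (Cod K p) z, mid (snd (PB A)), z))" using PB_eq[OF A] unfolding D .
  have lpI: "lift_problem K z v (\<beta> \<bullet> \<gamma>)" if "lift_problem K z v \<beta>" "\<gamma> \<in> Cell K" "Tgt K \<gamma> = Src K \<beta>" for v \<beta> \<gamma>
    using lift_problemD[OF that(1)] that(2,3) by (simp add: lift_problem_def)
  have lpJ: "lift_problem K z (pact A v \<beta>) \<gamma>" if "lift_problem K z v \<beta>" "\<gamma> \<in> Cell K" "Tgt K \<gamma> = Src K \<beta>" for v \<beta> \<gamma>
    using ps[OF that(1)] that(2,3) by (simp add: lift_problem_def)
  have 1: "pact A v (Id2 K (z \<odot> v)) = v" if v [simp]: "v \<in> Arr K" "Cod K v = Dom K z" for v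
  proof (rule ev_eqI[OF xx, folded D])
    have lp: "lift_problem K z v (Id2 K (z \<odot> v))" by (rule lift_problem_Id2) simp_all
    note [simp] = ps[OF lp]
    define b e h where beh: "b = z \<odot> v" "e = pr1 p b" "h = pr2 p b"
    have [simp]: "b \<in> Arr K" "Dom K b = Dom K v" "Cod K b = Cod K p" unfolding beh(1) by simp_all
    have [simp]: "e \<in> Arr K" "h \<in> Arr K" "Cod K e = Dom K p" "Dom K h = Dom K e" "Cod K h = Dom K v" 
      unfolding beh(2,3) by simp_all
    have bh: "p \<odot> e = b \<odot> h" unfolding beh(2,3) by simp
    have zvh: "z \<odot> (v \<odot> h) = p \<odot> e" using Comp_reassoc[of z v b h] bh beh(1) by simp
    have evs: "ev x e (v \<odot> h) \<in> Arr K" "Cod K (ev x e (v \<odot> h)) = Dom K x" "x \<odot> ev x e (v \<odot> h) = e"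
      using ev_simps[OF xx, folded D, of e "v \<odot> h"] by (simp_all add: zvh)
    have "\<chi> e (Id2 K (p \<odot> e)) = Id2 K e"
      by (rule split_opfib_Id2[OF opfib]) simp_all
    moreover have "Id2 K (z \<odot> v) \<lhd> h = Id2 K (p \<odot> e)" by (simp add: zvh)
    ultimately show "ev x (pr1 p (z \<odot> v)) (pact A v (Id2 K (z \<odot> v)) \<odot> pr2 p (z \<odot> v)) = ev x (pr1 p (z \<odot> v)) (v \<odot> pr2 p (z \<odot> v))"
      unfolding beh(1)[symmetric] beh(2,3)[symmetric] 
      using act_Id2[OF A, folded D, OF evs(1,2)] evs(3) pe[OF lp, of h e]
      by (simp add: beh(1)[symmetric] bh zvh)
    show "z \<odot> pact A v (Id2 K (z \<odot> v)) = z \<odot> v" "z \<odot> v = z \<odot> v"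
      "pact A v (Id2 K (z \<odot> v)) \<in> Arr K" "Cod K (pact A v (Id2 K (z \<odot> v))) = Dom K z"
      "v \<in> Arr K" "Cod K v = Dom K z" by simp_all
  qed
  have 2: "pact A v (\<beta> \<bullet> \<gamma>) = pact A (pact A v \<beta>) \<gamma>"
    if lp: "lift_problem K z v \<beta>" and c: "\<gamma> \<in> Cell K" "Tgt K \<gamma> = Src K \<beta>" for v \<beta> \<gamma>
  proof (rule ev_eqI[OF xx, folded D])
    note l2 = lpI[OF lp c] and l3 = lpJ[OF lp c]
    note [simp] = ps[OF l2] ps[OF l3] ps[OF lp] c lift_problemD[OF lp] lift_problem_ends[OF lp]
    have [simp]: "Dom K (Src K \<gamma>) = Dom K v" "Cod K (Src K \<gamma>) = Cod K p"
      using Cell_ends(3,4)[OF c(1)] by simp_all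
    define b e h where beh: "b = Src K \<gamma>" "e = pr1 p b" "h = pr2 p b"
    have [simp]: "b \<in> Arr K" unfolding beh(1) using Cell_ends(1)[OF c(1)] .
    have [simp]: "Dom K b = Dom K v" "Cod K b = Cod K p" unfolding beh(1) by simp_all
    have [simp]: "Src K \<gamma> = b" by (simp add: beh)
    have [simp]: "e \<in> Arr K" "h \<in> Arr K" "Cod K e = Dom K p" "Dom K h = Dom K e" "Cod K h = Dom K v" "p \<odot> e = b \<odot> h"
      unfolding beh(2,3) by simp_all
    define e' where "e' = Tgt K (\<chi> e (\<gamma> \<lhd> h))"
    have g: "\<gamma> \<lhd> h \<in> Cell K" "Src K (\<gamma> \<lhd> h) = p \<odot> e" by simp_all
    note o1 = split_opfibD[OF opfib _ _ g, simplified] split_opfib_ends[OF opfib p _ _ g, simplified, folded e'_def, simplified]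
    note [simp] = o1(1,2,3,6-9) e'_def[symmetric]
    have g': "\<beta> \<lhd> h \<in> Cell K" "Src K (\<beta> \<lhd> h) = p \<odot> e'" by simp_all
    note o2 = split_opfibD(1-3)[OF opfib _ _ g', simplified] split_opfib_ends[OF opfib p _ _ g', simplified]
    note [simp] = o2
    \<comment> \<open>Splitness of the opcleavage; this is where pushing forward in one step or in two agrees.\<close>
    have \<chi>c: "\<chi> e ((\<beta> \<lhd> h) \<bullet> (\<gamma> \<lhd> h)) = \<chi> e' (\<beta> \<lhd> h) \<bullet> \<chi> e (\<gamma> \<lhd> h)"
      by (rule o1(4)[folded e'_def]) simp_all
    define E where "E = ev x (Tgt K (\<chi> e' (\<beta> \<lhd> h))) (v \<odot> h)"
    have E [simp]: "E \<in> Arr K" "Dom K E = Dom K e" "Cod K E = Dom K x" "x \<odot> E = Tgt K (\<chi> e' (\<beta> \<lhd> h))"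
      unfolding E_def using ev_simps[OF xx, folded D, of "Tgt K (\<chi> e' (\<beta> \<lhd> h))" "v \<odot> h"] by simp_all
    have lA: "lift_problem K (fst A) E (\<chi> e' (\<beta> \<lhd> h))" unfolding D(1)[symmetric] by (simp add: lift_problem_def)
    have "ev x e (pact A v (\<beta> \<bullet> \<gamma>) \<odot> h) = act (Dom K p) A E (\<chi> e' (\<beta> \<lhd> h) \<bullet> \<chi> e (\<gamma> \<lhd> h))"
      using pe[OF l2, of h e] by (simp add: \<chi>c E_def)
    also have "\<dots> = act (Dom K p) A (act (Dom K p) A E (\<chi> e' (\<beta> \<lhd> h))) (\<chi> e (\<gamma> \<lhd> h))"
      by (rule act_VComp[OF A lA]) simp_all
    also have "act (Dom K p) A E (\<chi> e' (\<beta> \<lhd> h)) = ev x e' (pact A v \<beta> \<odot> h)"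
      using pe[OF lp, of h e'] by (simp add: E_def)
    also have "act (Dom K p) A (ev x e' (pact A v \<beta> \<odot> h)) (\<chi> e (\<gamma> \<lhd> h)) = ev x e (pact A (pact A v \<beta>) \<gamma> \<odot> h)"
      using pe[OF l3, of h e] by simp
    finally show "ev x (pr1 p b) (pact A v (\<beta> \<bullet> \<gamma>) \<odot> pr2 p b) = ev x (pr1 p b) (pact A (pact A v \<beta>) \<gamma> \<odot> pr2 p b)"
      unfolding beh(2,3) .
    show "z \<odot> pact A v (\<beta> \<bullet> \<gamma>) = b" "z \<odot> pact A (pact A v \<beta>) \<gamma> = b" by simp_all
    show "pact A v (\<beta> \<bullet> \<gamma>) \<in> Arr K" "Cod K (pact A v (\<beta> \<bullet> \<gamma>)) = Dom K z"
      "pact A (pact A v \<beta>) \<gamma> \<in> Arr K" "Cod K (pact A (pact A v \<beta>) \<gamma>) = Dom K z" by simp_all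
  qed
  have "alg (Cod K p) (z, (cd (Cod K p) z, mid (snd (PB A)), z))"
    by (rule algI; (fold eq)?) (use PB_simps[OF A, folded D(1), folded D(2)] 1 2 in simp_all)
  then show ?thesis using eq by simp
qed

text \<open>Evaluation is natural in x, so u commutes with the formula for the action on values.\<close>

lemma PB_mor:
  assumes u: "algmor (Dom K p) A u A'"
  shows "algmor (Cod K p) (PB A) (farr (rfun R) u) (PB A')"
proof -
  note A = algmorD(1)[OF u] and A' = algmorD(2)[OF u]
  define k x x' z z' where D: "k = mid u" "x = fst A" "x' = fst A'" "z = zz x" "z' = zz x'"
  note [simp] = algD(1,2)[OF A, folded D] algD(1,2)[OF A', folded D] algmorD(4-7)[OF u, folded D]
  have u': "u = (x, k, x')" using algmorD(3)[OF u] unfolding D .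
  have z [simp]: "z \<in> Arr K" "Cod K z = Cod K p" "z' \<in> Arr K" "Cod K z' = Cod K p" "zz x = z" "zz x' = z'"
    unfolding D(4,5) by simp_all
  define t where "t = tr x k x'"
  have [simp]: "t \<in> Arr K" "Dom K t = Dom K z" "Cod K t = Dom K z'" "z' \<odot> t = z"
    unfolding t_def using tr_simps[of x x' k] by simp_all
  have [simp]: "z' \<odot> (t \<odot> h) = z \<odot> h" if "h \<in> Arr K" "Cod K h = Dom K z" for h
    using that by (simp add: Comp_reassoc[of z' t z])
  have [simp]: "x' \<odot> (k \<odot> h) = x \<odot> h" if "h \<in> Arr K" "Cod K h = Dom K x" for h
    using that by (simp add: Comp_reassoc[of x' k x])
  have tr: "ev x' e (t \<odot> v) = k \<odot> ev x e v" if "e \<in> Arr K" "v \<in> Arr K" "Dom K e = Dom K v" "Cod K e = Dom K p" "Cod K v = Dom K z" "p \<odot> e = z \<odot> v" for e v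
    unfolding t_def using that by (intro ev_tr) simp_all
  have P: "fst (PB A) = z" "fst (PB A') = z'" using PB_simps(1)[OF A] PB_simps(1)[OF A'] unfolding D[symmetric] by simp_all
  have "algmor (Cod K p) (PB A) (fst (PB A), t, fst (PB A')) (PB A')"
  proof (rule algmorI[OF PB_alg[OF A] PB_alg[OF A']])
    show "t \<in> Arr K" "Dom K t = Dom K (fst (PB A))" "Cod K t = Dom K (fst (PB A'))" "fst (PB A') \<odot> t = fst (PB A)"
      unfolding P by simp_all
    fix v \<beta> assume "lift_problem K (fst (PB A)) v \<beta>"
    then have lp: "lift_problem K z v \<beta>" unfolding P .
    note [simp] = lift_problemD[OF lp] lift_problem_ends[OF lp]
    have lp': "lift_problem K z' (t \<odot> v) \<beta>" by (simp add: lift_problem_def)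
    note ps = pact_simps[OF A, folded D(2), simplified, OF lp] pact_simps[OF A', folded D(3), simplified, OF lp']
    note pe = pact_ev[OF A, folded D(2), simplified, OF lp] pact_ev[OF A', folded D(3), simplified, OF lp']
    note [simp] = ps
    show "t \<odot> pact A v \<beta> = pact A' (t \<odot> v) \<beta>"
    proof (rule ev_eqI[of x'])
      define b e h where beh: "b = Src K \<beta>" "e = pr1 p b" "h = pr2 p b"
        have [simp]: "b \<in> Arr K" unfolding beh(1) by simp
      have [simp]: "Dom K b = Dom K v" "Cod K b = Cod K p" unfolding beh(1) by simp_all
    have [simp]: "Src K \<beta> = b" by (simp add: beh)
      have [simp]: "e \<in> Arr K" "h \<in> Arr K" "Cod K e = Dom K p" "Dom K h = Dom K e" "Cod K h = Dom K v" "p \<odot> e = b \<odot> h"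
        unfolding beh(2,3) by simp_all
      have g: "\<beta> \<lhd> h \<in> Cell K" "Src K (\<beta> \<lhd> h) = p \<odot> e" by simp_all
      define e' where "e' = Tgt K (\<chi> e (\<beta> \<lhd> h))"
      note o1 = split_opfibD(1-3)[OF opfib _ _ g, simplified] split_opfib_ends[OF opfib p _ _ g, simplified, folded e'_def, simplified]
      note [simp] = o1 e'_def[symmetric]
      define E where "E = ev x e' (v \<odot> h)"
      have E [simp]: "E \<in> Arr K" "Cod K E = Dom K x" "x \<odot> E = e'"
        unfolding E_def using ev_simps[of x e' "v \<odot> h"] by simp_all
      have lA: "lift_problem K (fst A) E (\<chi> e (\<beta> \<lhd> h))" unfolding D(2)[symmetric] by (simp add: lift_problem_def)
      have "ev x' e (t \<odot> (pact A v \<beta> \<odot> h)) = k \<odot> act (Dom K p) A E (\<chi> e (\<beta> \<lhd> h))"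
        using pe(1)[of h e] by (subst tr) (simp_all add: Comp_reassoc[OF ps(4)] E_def)
      also have "\<dots> = act (Dom K p) A' (k \<odot> E) (\<chi> e (\<beta> \<lhd> h))"
        using algmorD(8)[OF u lA] unfolding D(1)[symmetric] .
      also have "k \<odot> E = ev x' e' (t \<odot> (v \<odot> h))" unfolding E_def by (subst tr) simp_all
      finally show "ev x' (pr1 p b) ((t \<odot> pact A v \<beta>) \<odot> pr2 p b) = ev x' (pr1 p b) (pact A' (t \<odot> v) \<beta> \<odot> pr2 p b)"
        using pe(2)[of h e] unfolding beh(2,3)[symmetric] by simp
      show "zz x' \<odot> (t \<odot> pact A v \<beta>) = b" "zz x' \<odot> pact A' (t \<odot> v) \<beta> = b" by simp_all
    qed simp_all
  qed
  then show ?thesis unfolding u' using farr_R[of x k x'] P by (simp add: t_def)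
qed

lemma PiBar_fun2: "is_fun2 (PhiAlg K cm (Dom K p)) (PhiAlg K cm (Cod K p)) (PiBar K pb cm Pi p \<chi>)"
proof -
  have e: "(fob (rfun (Pi p)) (fst A), farr (rfun (Pi p)) (snd A) \<odot>\<^bsub>slice K (Cod K p)\<^esub> Pi_lax K pb cm Pi p \<chi> (fst A)) = PB A" for A
    by (simp add: PiBar_def alg_lift_def)
  show ?thesis
    unfolding PiBar_def R[symmetric]
    by (rule alg_lift_fun2[OF adj2D(2)[OF adj]]; unfold R e)
       (use PB_alg PB_simps(1) PB_mor in \<open>simp_all add: R\<close>)
qed

end

section \<open>2-natural transformations\<close>

lemma is_nat2I:
  assumes "\<And>X. X \<in> Ob C \<Longrightarrow> \<tau> X \<in> Arr D \<and> Dom D (\<tau> X) = fob F X \<and> Cod D (\<tau> X) = fob G X"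
    "\<And>f. f \<in> Arr C \<Longrightarrow> \<tau> (Cod C f) \<odot>\<^bsub>D\<^esub> farr F f = farr G f \<odot>\<^bsub>D\<^esub> \<tau> (Dom C f)"
    "\<And>\<alpha>. \<alpha> \<in> Cell C \<Longrightarrow> \<tau> (Cod C (Src C \<alpha>)) \<rhd>\<^bsub>D\<^esub> fcell F \<alpha> = fcell G \<alpha> \<lhd>\<^bsub>D\<^esub> \<tau> (Dom C (Src C \<alpha>))"
  shows "is_nat2 C D F G \<tau>"
  using assms unfolding is_nat2_def hom1_iff by blast

lemma comp_fun2_assoc: "H1 \<circ>\<^sub>2 (H2 \<circ>\<^sub>2 H3) = H1 \<circ>\<^sub>2 H2 \<circ>\<^sub>2 H3" "H1 \<circ>\<^sub>2 id_fun2 = H1" "id_fun2 \<circ>\<^sub>2 H1 = H1"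
  by (simp_all add: comp_fun2_def id_fun2_def comp_def)

lemma is_nat2_cong:
  assumes "is_nat2 C D F G \<tau>" "fun2_eq C F F'" "fun2_eq C G G'" "\<And>X. X \<in> Ob C \<Longrightarrow> \<tau> X = \<tau>' X" "two_category C"
  shows "is_nat2 C D F' G' \<tau>'"
proof -
  interpret C: two_category C by fact
  show ?thesis
    using is_nat2D[OF assms(1)] assms(2-4) unfolding fun2_eq_def
    by (intro is_nat2I) (metis C.Arr_ends C.Cell_ends)+
qed

lemma is_nat2_comp:
  assumes s: "is_nat2 C D F G \<sigma>" and t: "is_nat2 C D G H \<tau>" and F: "is_fun2 C D F" and G: "is_fun2 C D G" and H: "is_fun2 C D H"
    and C: "two_category C" and D: "two_category D"
  shows "is_nat2 C D F H (\<lambda>X. \<tau> X \<odot>\<^bsub>D\<^esub> \<sigma> X)"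
proof -
  interpret C: two_category C by fact
  interpret D: two_category D by fact
  note [simp] = is_fun2D[OF F] is_fun2D[OF G] is_fun2D[OF H] is_nat2D(1-3)[OF s] is_nat2D(1-3)[OF t]
  show ?thesis
  proof (rule is_nat2I)
    fix f assume [simp]: "f \<in> Arr C"
    have "(\<tau> (Cod C f) \<odot>\<^bsub>D\<^esub> \<sigma> (Cod C f)) \<odot>\<^bsub>D\<^esub> farr F f = \<tau> (Cod C f) \<odot>\<^bsub>D\<^esub> (farr G f \<odot>\<^bsub>D\<^esub> \<sigma> (Dom C f))"
      by (simp add: is_nat2D(4)[OF s])
    also have "\<dots> = (\<tau> (Cod C f) \<odot>\<^bsub>D\<^esub> farr G f) \<odot>\<^bsub>D\<^esub> \<sigma> (Dom C f)" by simp
    also have "\<dots> = farr H f \<odot>\<^bsub>D\<^esub> (\<tau> (Dom C f) \<odot>\<^bsub>D\<^esub> \<sigma> (Dom C f))" by (subst is_nat2D(4)[OF t]) simp_all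
    finally show "(\<tau> (Cod C f) \<odot>\<^bsub>D\<^esub> \<sigma> (Cod C f)) \<odot>\<^bsub>D\<^esub> farr F f = farr H f \<odot>\<^bsub>D\<^esub> (\<tau> (Dom C f) \<odot>\<^bsub>D\<^esub> \<sigma> (Dom C f))" .
  next
    fix \<alpha> assume [simp]: "\<alpha> \<in> Cell C"
    let ?c = "Cod C (Src C \<alpha>)" and ?d = "Dom C (Src C \<alpha>)"
    have "(\<tau> ?c \<odot>\<^bsub>D\<^esub> \<sigma> ?c) \<rhd>\<^bsub>D\<^esub> fcell F \<alpha> = \<tau> ?c \<rhd>\<^bsub>D\<^esub> (fcell G \<alpha> \<lhd>\<^bsub>D\<^esub> \<sigma> ?d)"
      by (simp add: is_nat2D(5)[OF s])
    also have "\<dots> = (\<tau> ?c \<rhd>\<^bsub>D\<^esub> fcell G \<alpha>) \<lhd>\<^bsub>D\<^esub> \<sigma> ?d" by simp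
    also have "\<dots> = fcell H \<alpha> \<lhd>\<^bsub>D\<^esub> (\<tau> ?d \<odot>\<^bsub>D\<^esub> \<sigma> ?d)" by (subst is_nat2D(5)[OF t]) simp_all
    finally show "(\<tau> ?c \<odot>\<^bsub>D\<^esub> \<sigma> ?c) \<rhd>\<^bsub>D\<^esub> fcell F \<alpha> = fcell H \<alpha> \<lhd>\<^bsub>D\<^esub> (\<tau> ?d \<odot>\<^bsub>D\<^esub> \<sigma> ?d)" .
  qed simp
qed

lemma is_nat2_whisker_l:
  assumes t: "is_nat2 C D F G \<tau>" and F: "is_fun2 C D F" and G: "is_fun2 C D G" and H: "is_fun2 D E H"
    and C: "two_category C" and D: "two_category D"
  shows "is_nat2 C E (H \<circ>\<^sub>2 F) (H \<circ>\<^sub>2 G) (\<lambda>X. farr H (\<tau> X))"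
proof -
  interpret C: two_category C by fact
  interpret D: two_category D by fact
  note [simp] = is_fun2D[OF F] is_fun2D[OF G] is_nat2D(1-3)[OF t] is_fun2D(3-5)[OF H]
  show ?thesis
  proof (rule is_nat2I)
    fix f assume [simp]: "f \<in> Arr C"
    show "farr H (\<tau> (Cod C f)) \<odot>\<^bsub>E\<^esub> farr (H \<circ>\<^sub>2 F) f = farr (H \<circ>\<^sub>2 G) f \<odot>\<^bsub>E\<^esub> farr H (\<tau> (Dom C f))"
      using arg_cong[OF is_nat2D(4)[OF t, of f], of "farr H"] by (simp add: is_fun2D(10)[OF H])
  next
    fix \<alpha> assume [simp]: "\<alpha> \<in> Cell C"
    show "farr H (\<tau> (Cod C (Src C \<alpha>))) \<rhd>\<^bsub>E\<^esub> fcell (H \<circ>\<^sub>2 F) \<alpha> = fcell (H \<circ>\<^sub>2 G) \<alpha> \<lhd>\<^bsub>E\<^esub> farr H (\<tau> (Dom C (Src C \<alpha>)))"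
      using arg_cong[OF is_nat2D(5)[OF t, of \<alpha>], of "fcell H"] by (simp add: is_fun2_whisker[OF H D])
  qed simp
qed

lemma is_nat2_whisker_r:
  assumes t: "is_nat2 C D F G \<tau>" and H: "is_fun2 B C H" and B: "two_category B"
  shows "is_nat2 B D (F \<circ>\<^sub>2 H) (G \<circ>\<^sub>2 H) (\<lambda>X. \<tau> (fob H X))"
proof (rule is_nat2I)
  interpret B: two_category B by fact
  show "\<tau> (fob H X) \<in> Arr D \<and> Dom D (\<tau> (fob H X)) = fob (F \<circ>\<^sub>2 H) X \<and> Cod D (\<tau> (fob H X)) = fob (G \<circ>\<^sub>2 H) X" if "X \<in> Ob B" for X
    using is_nat2D(1-3)[OF t is_fun2D(1)[OF H that]] by simp
  show "\<tau> (fob H (Cod B f)) \<odot>\<^bsub>D\<^esub> farr (F \<circ>\<^sub>2 H) f = farr (G \<circ>\<^sub>2 H) f \<odot>\<^bsub>D\<^esub> \<tau> (fob H (Dom B f))" if "f \<in> Arr B" for f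
    using is_nat2D(4)[OF t is_fun2D(3)[OF H that]] is_fun2D(4,5)[OF H that] by simp
  show "\<tau> (fob H (Cod B (Src B \<alpha>))) \<rhd>\<^bsub>D\<^esub> fcell (F \<circ>\<^sub>2 H) \<alpha> = fcell (G \<circ>\<^sub>2 H) \<alpha> \<lhd>\<^bsub>D\<^esub> \<tau> (fob H (Dom B (Src B \<alpha>)))"
    if "\<alpha> \<in> Cell B" for \<alpha>
    using is_nat2D(5)[OF t is_fun2D(7)[OF H that(1)]] is_fun2D(8)[OF H that(1)] is_fun2D(4,5)[OF H B.Cell_ends(1)[OF that]] by simp
qed

lemma is_nat2_inverse:
  assumes t: "is_nat2 C D F G \<tau>" and F: "is_fun2 C D F" and G: "is_fun2 C D G" and C: "two_category C" and D: "two_category D"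
    and s: "\<And>X. X \<in> Ob C \<Longrightarrow> \<sigma> X \<in> Arr D \<and> Dom D (\<sigma> X) = fob G X \<and> Cod D (\<sigma> X) = fob F X
      \<and> \<sigma> X \<odot>\<^bsub>D\<^esub> \<tau> X = Id1 D (fob F X) \<and> \<tau> X \<odot>\<^bsub>D\<^esub> \<sigma> X = Id1 D (fob G X)"
  shows "is_nat2 C D G F \<sigma>"
proof -
  interpret C: two_category C by fact
  interpret D: two_category D by fact
  note [simp] = is_fun2D[OF F] is_fun2D[OF G] is_nat2D(1-3)[OF t]
  have s1 [simp]: "\<sigma> X \<in> Arr D" "Dom D (\<sigma> X) = fob G X" "Cod D (\<sigma> X) = fob F X" if "X \<in> Ob C" for X
    using s[OF that] by blast+
  have s2: "\<sigma> X \<odot>\<^bsub>D\<^esub> \<tau> X = Id1 D (fob F X)" "\<tau> X \<odot>\<^bsub>D\<^esub> \<sigma> X = Id1 D (fob G X)" if "X \<in> Ob C" for X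
    using s[OF that] by blast+
  show ?thesis
  proof (rule is_nat2I)
    fix f assume [simp]: "f \<in> Arr C"
    let ?c = "Cod C f" and ?d = "Dom C f"
    have "\<sigma> ?c \<odot>\<^bsub>D\<^esub> farr G f = \<sigma> ?c \<odot>\<^bsub>D\<^esub> ((farr G f \<odot>\<^bsub>D\<^esub> \<tau> ?d) \<odot>\<^bsub>D\<^esub> \<sigma> ?d)" by (simp add: s2)
    also have "farr G f \<odot>\<^bsub>D\<^esub> \<tau> ?d = \<tau> ?c \<odot>\<^bsub>D\<^esub> farr F f" by (simp add: is_nat2D(4)[OF t])
    also have "\<sigma> ?c \<odot>\<^bsub>D\<^esub> ((\<tau> ?c \<odot>\<^bsub>D\<^esub> farr F f) \<odot>\<^bsub>D\<^esub> \<sigma> ?d) = farr F f \<odot>\<^bsub>D\<^esub> \<sigma> ?d"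
      by (simp add: D.Comp_reassoc[OF s2(1)])
    finally show "\<sigma> ?c \<odot>\<^bsub>D\<^esub> farr G f = farr F f \<odot>\<^bsub>D\<^esub> \<sigma> ?d" .
  next
    fix \<alpha> assume [simp]: "\<alpha> \<in> Cell C"
    let ?c = "Cod C (Src C \<alpha>)" and ?d = "Dom C (Src C \<alpha>)"
    have "(fcell G \<alpha> \<lhd>\<^bsub>D\<^esub> \<tau> ?d) \<lhd>\<^bsub>D\<^esub> \<sigma> ?d = fcell G \<alpha>" by (simp add: D.whisker_r_reassoc[OF s2(2)])
    then have "\<sigma> ?c \<rhd>\<^bsub>D\<^esub> fcell G \<alpha> = \<sigma> ?c \<rhd>\<^bsub>D\<^esub> ((fcell G \<alpha> \<lhd>\<^bsub>D\<^esub> \<tau> ?d) \<lhd>\<^bsub>D\<^esub> \<sigma> ?d)" by simp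
    also have "fcell G \<alpha> \<lhd>\<^bsub>D\<^esub> \<tau> ?d = \<tau> ?c \<rhd>\<^bsub>D\<^esub> fcell F \<alpha>" by (simp add: is_nat2D(5)[OF t])
    also have "\<sigma> ?c \<rhd>\<^bsub>D\<^esub> ((\<tau> ?c \<rhd>\<^bsub>D\<^esub> fcell F \<alpha>) \<lhd>\<^bsub>D\<^esub> \<sigma> ?d) = fcell F \<alpha> \<lhd>\<^bsub>D\<^esub> \<sigma> ?d"
      by (simp add: D.whisker_l_reassoc[OF s2(1)])
    finally show "\<sigma> ?c \<rhd>\<^bsub>D\<^esub> fcell G \<alpha> = fcell F \<alpha> \<lhd>\<^bsub>D\<^esub> \<sigma> ?d" .
  qed simp
qed

section \<open>Canonical maps between pullbacks\<close>

context pullbacks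
begin

lemma pr2_eqI:
  assumes "f \<in> Arr K" "g \<in> Arr K" "z \<in> Arr K" "Dom K g = Cod K f" "Cod K g = Cod K z"
    and "w \<in> Arr K" "w' \<in> Arr K" "Dom K w = Dom K w'" "Cod K w = Dom K (pr1 f (pr1 g z))" "Cod K w' = Dom K (pr1 f (pr1 g z))"
    and "pr1 f (pr1 g z) \<odot> w = pr1 f (pr1 g z) \<odot> w'" "pr2 g z \<odot> (pr2 f (pr1 g z) \<odot> w) = pr2 g z \<odot> (pr2 f (pr1 g z) \<odot> w')"
  shows "w = w'"
proof (rule pr_eqI[of f "pr1 g z"])
  show "pr2 f (pr1 g z) \<odot> w = pr2 f (pr1 g z) \<odot> w'"
    by (rule pr_eqI[of g z]) (use assms in simp_all)
qed (use assms in simp_all)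

lemma pr2_cell_eqI:
  assumes "f \<in> Arr K" "g \<in> Arr K" "z \<in> Arr K" "Dom K g = Cod K f" "Cod K g = Cod K z"
    and "w \<in> Cell K" "w' \<in> Cell K" "Cod K (Src K w) = Dom K (pr1 f (pr1 g z))" "Cod K (Src K w') = Dom K (pr1 f (pr1 g z))"
    and "pr1 f (pr1 g z) \<rhd> w = pr1 f (pr1 g z) \<rhd> w'" "pr2 g z \<rhd> (pr2 f (pr1 g z) \<rhd> w) = pr2 g z \<rhd> (pr2 f (pr1 g z) \<rhd> w')"
  shows "w = w'"
proof (rule pr_cell_eqI[of f "pr1 g z"])
  show "pr2 f (pr1 g z) \<rhd> w = pr2 f (pr1 g z) \<rhd> w'"
    by (rule pr_cell_eqI[of g z]) (use assms in simp_all)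
qed (use assms in simp_all)

lemma pb_arr2_simps:
  assumes "f \<in> Arr K" "g \<in> Arr K" "z \<in> Arr K" "Dom K g = Cod K f" "Cod K g = Cod K z"
    "u \<in> Arr K" "v \<in> Arr K" "Dom K u = Dom K v" "Cod K u = Dom K f" "Cod K v = Dom K z" "g \<odot> (f \<odot> u) = z \<odot> v"
    and w: "w = pb_arr2 K pb f g z u v"
  shows "w \<in> Arr K" "Dom K w = Dom K u" "Cod K w = Dom K (pr1 f (pr1 g z))" "pr1 f (pr1 g z) \<odot> w = u"
    "pr2 f (pr1 g z) \<odot> w = pb_arr K pb g z (f \<odot> u) v" "pr2 g z \<odot> (pr2 f (pr1 g z) \<odot> w) = v"
proof -
  define i where "i = pb_arr K pb g z (f \<odot> u) v"
  have i: "i \<in> Arr K" "Dom K i = Dom K u" "Cod K i = Dom K (pr1 g z)" "pr1 g z \<odot> i = f \<odot> u" "pr2 g z \<odot> i = v"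
    unfolding i_def using pb_arr_simps[of g z "f \<odot> u" v] assms(1-11) by simp_all
  have wi: "w = pb_arr K pb f (pr1 g z) u i" unfolding w pb_arr2_def i_def ..
  have "w \<in> Arr K" "Dom K w = Dom K u" "Cod K w = Dom K (pr1 f (pr1 g z))" "pr1 f (pr1 g z) \<odot> w = u" "pr2 f (pr1 g z) \<odot> w = i"
    unfolding wi using pb_arr_simps[of f "pr1 g z" u i] i assms(1-10) by simp_all
  then show "w \<in> Arr K" "Dom K w = Dom K u" "Cod K w = Dom K (pr1 f (pr1 g z))" "pr1 f (pr1 g z) \<odot> w = u"
    "pr2 f (pr1 g z) \<odot> w = pb_arr K pb g z (f \<odot> u) v" "pr2 g z \<odot> (pr2 f (pr1 g z) \<odot> w) = v"
    using i(5) unfolding i_def by simp_all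
qed

lemma Del_fcell_simps:
  assumes s: "s \<in> Arr K" and c: "(x, \<alpha>, y) \<in> Cell (slice K (Cod K s))"
  shows "mid (fcell (Del K pb s) (x, \<alpha>, y)) \<in> Cell K" "Dom K (Src K (mid (fcell (Del K pb s) (x, \<alpha>, y)))) = Dom K (pr1 s x)"
    "Cod K (Src K (mid (fcell (Del K pb s) (x, \<alpha>, y)))) = Dom K (pr1 s y)"
    "pr1 s y \<rhd> mid (fcell (Del K pb s) (x, \<alpha>, y)) = Id2 K (pr1 s x)" "pr2 s y \<rhd> mid (fcell (Del K pb s) (x, \<alpha>, y)) = \<alpha> \<lhd> pr2 s x"
proof -
  have [simp]: "x \<in> Arr K" "y \<in> Arr K" "Cod K x = Cod K s" "Cod K y = Cod K s" "\<alpha> \<in> Cell K" "Dom K (Src K \<alpha>) = Dom K x" "Cod K (Src K \<alpha>) = Dom K y"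
    "y \<rhd> \<alpha> = Id2 K x" "s \<in> Arr K"
    using c s by simp_all
  have [simp]: "y \<rhd> (\<alpha> \<lhd> pr2 s x) = Id2 K (s \<odot> pr1 s x)" "y \<odot> (Src K \<alpha> \<odot> pr2 s x) = s \<odot> pr1 s x"
    using whisker_Comp(3)[of "pr2 s x" y \<alpha>] slice_Cell_Arr[OF c] by (simp_all add: Comp_reassoc[of y "Src K \<alpha>" x])
  show "mid (fcell (Del K pb s) (x, \<alpha>, y)) \<in> Cell K" "Dom K (Src K (mid (fcell (Del K pb s) (x, \<alpha>, y)))) = Dom K (pr1 s x)"
    "Cod K (Src K (mid (fcell (Del K pb s) (x, \<alpha>, y)))) = Dom K (pr1 s y)"
    "pr1 s y \<rhd> mid (fcell (Del K pb s) (x, \<alpha>, y)) = Id2 K (pr1 s x)" "pr2 s y \<rhd> mid (fcell (Del K pb s) (x, \<alpha>, y)) = \<alpha> \<lhd> pr2 s x"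
    by simp_all
qed

lemma Del_farr_simps:
  assumes s: "s \<in> Arr K" and c: "(x, k, y) \<in> Arr (slice K (Cod K s))"
  shows "mid (farr (Del K pb s) (x, k, y)) \<in> Arr K" "Dom K (mid (farr (Del K pb s) (x, k, y))) = Dom K (pr1 s x)"
    "Cod K (mid (farr (Del K pb s) (x, k, y))) = Dom K (pr1 s y)"
    "pr1 s y \<odot> mid (farr (Del K pb s) (x, k, y)) = pr1 s x" "pr2 s y \<odot> mid (farr (Del K pb s) (x, k, y)) = k \<odot> pr2 s x"
proof -
  have [simp]: "x \<in> Arr K" "y \<in> Arr K" "Cod K x = Cod K s" "Cod K y = Cod K s" "k \<in> Arr K" "Dom K k = Dom K x" "Cod K k = Dom K y"
    "y \<odot> k = x" "s \<in> Arr K"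
    using c s by simp_all
  have [simp]: "y \<odot> (k \<odot> pr2 s x) = s \<odot> pr1 s x"
    by (simp add: Comp_reassoc[of y k x])
  show "mid (farr (Del K pb s) (x, k, y)) \<in> Arr K" "Dom K (mid (farr (Del K pb s) (x, k, y))) = Dom K (pr1 s x)"
    "Cod K (mid (farr (Del K pb s) (x, k, y))) = Dom K (pr1 s y)"
    "pr1 s y \<odot> mid (farr (Del K pb s) (x, k, y)) = pr1 s x" "pr2 s y \<odot> mid (farr (Del K pb s) (x, k, y)) = k \<odot> pr2 s x"
    by simp_all
qed

text \<open>
  An arrow into \<open>\<Delta>\<^sub>f \<Delta>\<^sub>g x\<close> over the domain of f amounts to an arrow
  m x into the domain of x, and naturality of the former is naturality of the latter.
\<close>

lemma nat_into_Del_Del: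
  assumes f: "f \<in> Arr K" and g: "g \<in> Arr K" "Dom K g = Cod K f"
    and F: "is_fun2 (slice K (Cod K g)) (slice K (Dom K f)) F"
    and m: "\<And>x. \<lbrakk>x \<in> Arr K; Cod K x = Cod K g\<rbrakk> \<Longrightarrow> m x \<in> Arr K \<and> Dom K (m x) = Dom K (fob F x) \<and> Cod K (m x) = Dom K x \<and> x \<odot> m x = g \<odot> (f \<odot> fob F x)"
    and m1: "\<And>x k y. (x, k, y) \<in> Arr (slice K (Cod K g)) \<Longrightarrow> m y \<odot> mid (farr F (x, k, y)) = k \<odot> m x"
    and m2: "\<And>x \<alpha> y. (x, \<alpha>, y) \<in> Cell (slice K (Cod K g)) \<Longrightarrow> m y \<rhd> mid (fcell F (x, \<alpha>, y)) = \<alpha> \<lhd> m x"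
    and \<tau>: "\<And>x. \<lbrakk>x \<in> Arr K; Cod K x = Cod K g\<rbrakk> \<Longrightarrow> \<tau> x = (fob F x, pb_arr2 K pb f g x (fob F x) (m x), pr1 f (pr1 g x))"
  shows "is_nat2 (slice K (Cod K g)) (slice K (Dom K f)) F (Del K pb f \<circ>\<^sub>2 Del K pb g) \<tau>"
proof -
  let ?S = "slice K (Cod K g)" and ?S2 = "slice K (Dom K f)"
  note [simp] = f g
  have Fo [simp]: "fob F x \<in> Arr K" "Cod K (fob F x) = Dom K f" if "x \<in> Arr K" "Cod K x = Cod K g" for x
    using is_fun2D(1)[OF F, of x] that by simp_all
  have mm [simp]: "m x \<in> Arr K" "Dom K (m x) = Dom K (fob F x)" "Cod K (m x) = Dom K x" "x \<odot> m x = g \<odot> (f \<odot> fob F x)"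
    if "x \<in> Arr K" "Cod K x = Cod K g" for x using m[OF that] by blast+
  define t where "t x = pb_arr2 K pb f g x (fob F x) (m x)" for x
  have t: "t x \<in> Arr K" "Dom K (t x) = Dom K (fob F x)" "Cod K (t x) = Dom K (pr1 f (pr1 g x))" "pr1 f (pr1 g x) \<odot> t x = fob F x"
     "pr2 g x \<odot> (pr2 f (pr1 g x) \<odot> t x) = m x" if "x \<in> Arr K" "Cod K x = Cod K g" for x
    using pb_arr2_simps[of f g x "fob F x" "m x", OF _ _ _ _ _ _ _ _ _ _ _ t_def] that by simp_all
  note [simp] = t
  show ?thesis
  proof (rule is_nat2I)
    fix X assume "X \<in> Ob ?S"
    then show "\<tau> X \<in> Arr ?S2 \<and> Dom ?S2 (\<tau> X) = fob F X \<and> Cod ?S2 (\<tau> X) = fob (Del K pb f \<circ>\<^sub>2 Del K pb g) X"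
      by (simp add: \<tau> flip: t_def)
  next
    fix u assume "u \<in> Arr ?S"
    then obtain x k y where u: "u = (x, k, y)" and c: "(x, k, y) \<in> Arr ?S" by (cases u) auto
    have [simp]: "x \<in> Arr K" "y \<in> Arr K" "Cod K x = Cod K g" "Cod K y = Cod K g" "k \<in> Arr K" "Dom K k = Dom K x" "Cod K k = Dom K y" "y \<odot> k = x"
      using c by simp_all
    define F1 where "F1 = mid (farr F (x, k, y))"
    have Fu: "farr F (x, k, y) = (fob F x, F1, fob F y)" 
      using is_fun2D(4,5)[OF F c] is_fun2D(3)[OF F c] unfolding F1_def by (cases "farr F (x, k, y)") simp
    have [simp]: "F1 \<in> Arr K" "Dom K F1 = Dom K (fob F x)" "Cod K F1 = Dom K (fob F y)" "fob F y \<odot> F1 = fob F x"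
      using is_fun2D(3)[OF F c] unfolding Fu by simp_all
    define G1 where "G1 = mid (farr (Del K pb g) (x, k, y))"
    note D1 [simp] = Del_farr_simps[OF g(1) c, folded G1_def]
    have Gu: "farr (Del K pb g) (x, k, y) = (pr1 g x, G1, pr1 g y)" unfolding G1_def by simp
    have c2: "(pr1 g x, G1, pr1 g y) \<in> Arr (slice K (Cod K f))" by simp
    define G2 where "G2 = mid (farr (Del K pb f) (pr1 g x, G1, pr1 g y))"
    note D2 [simp] = Del_farr_simps[OF f c2, folded G2_def]
    have Gu2: "farr (Del K pb f) (pr1 g x, G1, pr1 g y) = (pr1 f (pr1 g x), G2, pr1 f (pr1 g y))" unfolding G2_def by simp
    have "t y \<odot> F1 = G2 \<odot> t x"
      by (rule pr2_eqI[of f g y])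
        (simp_all add: Comp_reassoc[OF t(4)] Comp_reassoc[OF D2(4)] Comp_reassoc[OF D2(5)] Comp_reassoc[OF D1(5)] 
          m1[OF c, folded F1_def] Comp_reassoc[of "pr2 g y" "pr2 f (pr1 g y) \<odot> t y" "m y" F1, simplified])
    then show "\<tau> (Cod ?S u) \<odot>\<^bsub>?S2\<^esub> farr F u = farr (Del K pb f \<circ>\<^sub>2 Del K pb g) u \<odot>\<^bsub>?S2\<^esub> \<tau> (Dom ?S u)"
      unfolding u by (simp add: \<tau> Fu Gu Gu2 del: Del_simps flip: t_def)
  next
    fix u assume "u \<in> Cell ?S"
    then obtain x k y where u: "u = (x, k, y)" and c: "(x, k, y) \<in> Cell ?S" by (cases u) auto
    have [simp]: "x \<in> Arr K" "y \<in> Arr K" "Cod K x = Cod K g" "Cod K y = Cod K g" "k \<in> Cell K" "Dom K (Src K k) = Dom K x" "Cod K (Src K k) = Dom K y" "y \<rhd> k = Id2 K x"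
      using c by simp_all
    have ca: "(x, Src K k, y) \<in> Arr ?S" using slice_Cell_Arr[OF c] by simp
    define F1 where "F1 = mid (fcell F (x, k, y))"
    obtain a b where fc: "fcell F (x, k, y) = (a, F1, b)" unfolding F1_def by (cases "fcell F (x, k, y)") simp
    have sf: "(a, Src K F1, b) = farr F (x, Src K k, y)" using is_fun2D(8)[OF F c] unfolding fc by simp
    have ab: "a = fob F x" "b = fob F y" using is_fun2D(4,5)[OF F ca] unfolding sf[symmetric] by simp_all
    have Fu: "fcell F (x, k, y) = (fob F x, F1, fob F y)" using fc ab by simp
    have [simp]: "F1 \<in> Cell K" "Dom K (Src K F1) = Dom K (fob F x)" "Cod K (Src K F1) = Dom K (fob F y)" "fob F y \<rhd> F1 = Id2 K (fob F x)"
      using is_fun2D(7)[OF F c] unfolding Fu by simp_all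
    define G1 where "G1 = mid (fcell (Del K pb g) (x, k, y))"
    note D1 [simp] = Del_fcell_simps[OF g(1) c, folded G1_def]
    have Gu: "fcell (Del K pb g) (x, k, y) = (pr1 g x, G1, pr1 g y)" unfolding G1_def by simp
    have c2: "(pr1 g x, G1, pr1 g y) \<in> Cell (slice K (Cod K f))" by simp
    define G2 where "G2 = mid (fcell (Del K pb f) (pr1 g x, G1, pr1 g y))"
    note D2 [simp] = Del_fcell_simps[OF f c2, folded G2_def]
    have Gu2: "fcell (Del K pb f) (pr1 g x, G1, pr1 g y) = (pr1 f (pr1 g x), G2, pr1 f (pr1 g y))" unfolding G2_def by simp
    have "pr1 f (pr1 g y) \<rhd> (G2 \<lhd> t x) = Id2 K (fob F x)"
      using whisker_Comp(3)[of "t x" "pr1 f (pr1 g y)" G2] by simp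
    moreover have "pr2 f (pr1 g y) \<rhd> (G2 \<lhd> t x) = G1 \<lhd> (pr2 f (pr1 g x) \<odot> t x)"
      using whisker_Comp(3)[of "t x" "pr2 f (pr1 g y)" G2] by simp
    moreover have "pr2 g y \<rhd> (G1 \<lhd> (pr2 f (pr1 g x) \<odot> t x)) = k \<lhd> m x"
      using whisker_Comp(3)[of "pr2 f (pr1 g x) \<odot> t x" "pr2 g y" G1] whisker_Comp(2)[of "pr2 f (pr1 g x) \<odot> t x" "pr2 g x" k]
      by (simp del: whisker_Comp)
    moreover have "pr2 g y \<rhd> (pr2 f (pr1 g y) \<rhd> (t y \<rhd> F1)) = k \<lhd> m x"
    proof -
      have "pr2 g y \<rhd> (pr2 f (pr1 g y) \<rhd> (t y \<rhd> F1)) = (pr2 g y \<odot> (pr2 f (pr1 g y) \<odot> t y)) \<rhd> F1"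
        by (simp del: t(5))
      then show ?thesis using m2[OF c, folded F1_def] by simp
    qed
    ultimately have "t y \<rhd> F1 = G2 \<lhd> t x"
      by (intro pr2_cell_eqI[of f g y _ "G2 \<lhd> t x"]) (simp_all add: whisker_l_reassoc[OF t(4)])
    then show "\<tau> (Cod ?S (Src ?S u)) \<rhd>\<^bsub>?S2\<^esub> fcell F u
       = fcell (Del K pb f \<circ>\<^sub>2 Del K pb g) u \<lhd>\<^bsub>?S2\<^esub> \<tau> (Dom ?S (Src ?S u))"
      unfolding u by (simp add: \<tau> Fu Gu Gu2 del: Del_simps flip: t_def)
  qed
qed

lemma Del_comp_nat:
  assumes g: "g \<in> Arr K" and f: "f \<in> Arr K" "Dom K g = Cod K f"
  shows "is_nat2 (slice K (Cod K g)) (slice K (Dom K f)) (Del K pb (g \<odot> f)) (Del K pb f \<circ>\<^sub>2 Del K pb g) (Del_comp K pb g f)"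
proof -
  note [simp] = g f
  have h: "g \<odot> f \<in> Arr K" "Cod K (g \<odot> f) = Cod K g" "Dom K (g \<odot> f) = Dom K f" by simp_all
  show ?thesis
  proof (rule nat_into_Del_Del[OF f(1) g f(2), where m = "pr2 (g \<odot> f)"])
    show "is_fun2 (slice K (Cod K g)) (slice K (Dom K f)) (Del K pb (g \<odot> f))"
      using Del_fun2[OF h(1)] by simp
    show "pr2 (g \<odot> f) x \<in> Arr K \<and> Dom K (pr2 (g \<odot> f) x) = Dom K (fob (Del K pb (g \<odot> f)) x)
      \<and> Cod K (pr2 (g \<odot> f) x) = Dom K x \<and> x \<odot> pr2 (g \<odot> f) x = g \<odot> (f \<odot> fob (Del K pb (g \<odot> f)) x)"
      if "x \<in> Arr K" "Cod K x = Cod K g" for x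
      using that pr_simps[of "g \<odot> f" x] by simp
    show "pr2 (g \<odot> f) y \<odot> mid (farr (Del K pb (g \<odot> f)) (x, k, y)) = k \<odot> pr2 (g \<odot> f) x"
      if "(x, k, y) \<in> Arr (slice K (Cod K g))" for x k y
      using Del_farr_simps(5)[OF h(1), unfolded h(2), OF that] .
    show "pr2 (g \<odot> f) y \<rhd> mid (fcell (Del K pb (g \<odot> f)) (x, \<alpha>, y)) = \<alpha> \<lhd> pr2 (g \<odot> f) x"
      if "(x, \<alpha>, y) \<in> Cell (slice K (Cod K g))" for x \<alpha> y
      using Del_fcell_simps(5)[OF h(1), unfolded h(2), OF that] .
  qed (simp add: Del_comp_def Let_def)
qed

lemma Del_square_nat:
  assumes p1: "p1 \<in> Arr K" and p2: "p2 \<in> Arr K" and f2: "f2 \<in> Arr K" "Dom K f2 = Dom K p1" "Cod K f2 = Dom K p2"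
    and f1: "f1 \<in> Arr K" "Dom K f1 = Cod K p1" "Cod K f1 = Cod K p2" and sq: "p2 \<odot> f2 = f1 \<odot> p1"
  shows "is_nat2 (slice K (Cod K p2)) (slice K (Dom K p1)) (Del K pb p1 \<circ>\<^sub>2 Del K pb f1) (Del K pb f2 \<circ>\<^sub>2 Del K pb p2) (Del_square K pb p1 p2 f2 f1)"
proof -
  note [simp] = p1 p2 f2 f1
  have [simp]: "p2 \<odot> (f2 \<odot> h) = f1 \<odot> (p1 \<odot> h)" if "h \<in> Arr K" "Cod K h = Dom K p1" for h
    using that by (simp add: Comp_reassoc[OF sq])
  have Fc: "farr (Del K pb p1 \<circ>\<^sub>2 Del K pb f1) (x, k, y) = (pr1 p1 (pr1 f1 x), mid (farr (Del K pb p1) (pr1 f1 x, mid (farr (Del K pb f1) (x, k, y)), pr1 f1 y)), pr1 p1 (pr1 f1 y))" for x k y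
    by simp
  have Fcc: "fcell (Del K pb p1 \<circ>\<^sub>2 Del K pb f1) (x, k, y) = (pr1 p1 (pr1 f1 x), mid (fcell (Del K pb p1) (pr1 f1 x, mid (fcell (Del K pb f1) (x, k, y)), pr1 f1 y)), pr1 p1 (pr1 f1 y))" for x k y
    by simp
  show ?thesis unfolding f2(2)[symmetric]
  proof (rule nat_into_Del_Del[OF f2(1) p2 f2(3)[symmetric], where m = "\<lambda>x. pr2 f1 x \<odot> pr2 p1 (pr1 f1 x)"])
    show "is_fun2 (slice K (Cod K p2)) (slice K (Dom K f2)) (Del K pb p1 \<circ>\<^sub>2 Del K pb f1)"
      by (rule is_fun2_comp[of _ "slice K (Cod K p1)"]) (use Del_fun2[OF f1(1)] Del_fun2[OF p1] two_category_slice[of "Cod K p2"] in simp_all)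
    show "pr2 f1 x \<odot> pr2 p1 (pr1 f1 x) \<in> Arr K \<and> Dom K (pr2 f1 x \<odot> pr2 p1 (pr1 f1 x)) = Dom K (fob (Del K pb p1 \<circ>\<^sub>2 Del K pb f1) x)
      \<and> Cod K (pr2 f1 x \<odot> pr2 p1 (pr1 f1 x)) = Dom K x \<and> x \<odot> (pr2 f1 x \<odot> pr2 p1 (pr1 f1 x)) = p2 \<odot> (f2 \<odot> fob (Del K pb p1 \<circ>\<^sub>2 Del K pb f1) x)"
      if "x \<in> Arr K" "Cod K x = Cod K p2" for x
      using that by simp
    show "(pr2 f1 y \<odot> pr2 p1 (pr1 f1 y)) \<odot> mid (farr (Del K pb p1 \<circ>\<^sub>2 Del K pb f1) (x, k, y)) = k \<odot> (pr2 f1 x \<odot> pr2 p1 (pr1 f1 x))"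
      if c: "(x, k, y) \<in> Arr (slice K (Cod K p2))" for x k y
    proof -
      have [simp]: "x \<in> Arr K" "y \<in> Arr K" "Cod K x = Cod K p2" "Cod K y = Cod K p2" "k \<in> Arr K" "Dom K k = Dom K x" "Cod K k = Dom K y" "y \<odot> k = x"
        using c by simp_all
      define G1 where "G1 = mid (farr (Del K pb f1) (x, k, y))"
      note D1 [simp] = Del_farr_simps[OF f1(1), unfolded f1(3), OF c, folded G1_def]
      have c2: "(pr1 f1 x, G1, pr1 f1 y) \<in> Arr (slice K (Cod K p1))" by simp
      note D2 = Del_farr_simps[OF p1 c2]
      note [simp] = D2(1-3,5)
      show ?thesis unfolding Fc G1_def[symmetric] mid_simp
        using D1(5) by (simp add: Comp_reassoc[OF D1(5)] del: Del_simps)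
    qed
    show "(pr2 f1 y \<odot> pr2 p1 (pr1 f1 y)) \<rhd> mid (fcell (Del K pb p1 \<circ>\<^sub>2 Del K pb f1) (x, \<alpha>, y)) = \<alpha> \<lhd> (pr2 f1 x \<odot> pr2 p1 (pr1 f1 x))"
      if c: "(x, \<alpha>, y) \<in> Cell (slice K (Cod K p2))" for x \<alpha> y
    proof -
      have [simp]: "x \<in> Arr K" "y \<in> Arr K" "Cod K x = Cod K p2" "Cod K y = Cod K p2" "\<alpha> \<in> Cell K" "Dom K (Src K \<alpha>) = Dom K x" "Cod K (Src K \<alpha>) = Dom K y"
        using c by simp_all
      define G1 where "G1 = mid (fcell (Del K pb f1) (x, \<alpha>, y))"
      note D1 [simp] = Del_fcell_simps[OF f1(1), unfolded f1(3), OF c, folded G1_def]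
      have c2: "(pr1 f1 x, G1, pr1 f1 y) \<in> Cell (slice K (Cod K p1))" by simp
      note D2 = Del_fcell_simps[OF p1 c2]
      note [simp] = D2(1-3,5)
      show ?thesis unfolding Fcc G1_def[symmetric] mid_simp
        using whisker_Comp(3)[of "pr2 p1 (pr1 f1 x)" "pr2 f1 y" G1] by (simp del: Del_simps)
    qed
  qed (simp_all add: Del_square_def Let_def)
qed

section \<open>The adjunction between \<open>\<Sigma>\<close> and \<open>\<Delta>\<close>\<close>

definition Sig_Del_unit :: "'a \<Rightarrow> 'a \<Rightarrow> 'a sarr" where
  "Sig_Del_unit s x = (x, pb_arr K pb s (s \<odot> x) x (Id1 K (Dom K x)), pr1 s (s \<odot> x))"

lemma Sig_Del_counit_nat:
  assumes f [simp]: "f \<in> Arr K"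
  shows "is_nat2 (slice K (Cod K f)) (slice K (Cod K f)) (Sig K f \<circ>\<^sub>2 Del K pb f) id_fun2 (Sig_Del_counit K pb f)"
proof (rule is_nat2I)
  fix X assume "X \<in> Ob (slice K (Cod K f))"
  then show "Sig_Del_counit K pb f X \<in> Arr (slice K (Cod K f)) \<and> Dom (slice K (Cod K f)) (Sig_Del_counit K pb f X) = fob (Sig K f \<circ>\<^sub>2 Del K pb f) X
    \<and> Cod (slice K (Cod K f)) (Sig_Del_counit K pb f X) = fob id_fun2 X"
    by (simp add: Sig_Del_counit_def)
next
  fix u assume "u \<in> Arr (slice K (Cod K f))"
  then obtain x k y where u: "u = (x, k, y)" and c: "(x, k, y) \<in> Arr (slice K (Cod K f))" by (cases u) auto
  define G1 where "G1 = mid (farr (Del K pb f) (x, k, y))"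
  have e: "farr (Del K pb f) (x, k, y) = (pr1 f x, G1, pr1 f y)" by (simp add: G1_def)
  show "Sig_Del_counit K pb f (Cod (slice K (Cod K f)) u) \<odot>\<^bsub>slice K (Cod K f)\<^esub> farr (Sig K f \<circ>\<^sub>2 Del K pb f) u
     = farr id_fun2 u \<odot>\<^bsub>slice K (Cod K f)\<^esub> Sig_Del_counit K pb f (Dom (slice K (Cod K f)) u)"
    using Del_farr_simps(5)[OF f c, folded G1_def] by (simp add: u Sig_Del_counit_def e del: Del_simps)
next
  fix u assume "u \<in> Cell (slice K (Cod K f))"
  then obtain x k y where u: "u = (x, k, y)" and c: "(x, k, y) \<in> Cell (slice K (Cod K f))" by (cases u) auto
  define G1 where "G1 = mid (fcell (Del K pb f) (x, k, y))"
  have e: "fcell (Del K pb f) (x, k, y) = (pr1 f x, G1, pr1 f y)" by (simp add: G1_def)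
  show "Sig_Del_counit K pb f (Cod (slice K (Cod K f)) (Src (slice K (Cod K f)) u)) \<rhd>\<^bsub>slice K (Cod K f)\<^esub> fcell (Sig K f \<circ>\<^sub>2 Del K pb f) u
     = fcell id_fun2 u \<lhd>\<^bsub>slice K (Cod K f)\<^esub> Sig_Del_counit K pb f (Dom (slice K (Cod K f)) (Src (slice K (Cod K f)) u))"
    using Del_fcell_simps(5)[OF f c, folded G1_def] by (simp add: u Sig_Del_counit_def e del: Del_simps)
qed

lemma Sig_Del_unit_nat:
  assumes s [simp]: "s \<in> Arr K"
  shows "is_nat2 (slice K (Dom K s)) (slice K (Dom K s)) id_fun2 (Del K pb s \<circ>\<^sub>2 Sig K s) (Sig_Del_unit s)"
proof -
  let ?S = "slice K (Dom K s)"
  define t where "t x = pb_arr K pb s (s \<odot> x) x (Id1 K (Dom K x))" for x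
  have t [simp]: "t x \<in> Arr K" "Dom K (t x) = Dom K x" "Cod K (t x) = Dom K (pr1 s (s \<odot> x))" "pr1 s (s \<odot> x) \<odot> t x = x" "pr2 s (s \<odot> x) \<odot> t x = Id1 K (Dom K x)"
    if "x \<in> Arr K" "Cod K x = Dom K s" for x
    unfolding t_def using that pb_arr_simps[of s "s \<odot> x" x "Id1 K (Dom K x)"] by simp_all
  show ?thesis
  proof (rule is_nat2I)
    fix X assume "X \<in> Ob ?S"
    then show "Sig_Del_unit s X \<in> Arr ?S \<and> Dom ?S (Sig_Del_unit s X) = fob id_fun2 X
      \<and> Cod ?S (Sig_Del_unit s X) = fob (Del K pb s \<circ>\<^sub>2 Sig K s) X"
      by (simp add: Sig_Del_unit_def flip: t_def)
  next
    fix u assume "u \<in> Arr ?S"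
    then obtain x k y where u: "u = (x, k, y)" and c: "(x, k, y) \<in> Arr ?S" by (cases u) auto
    have [simp]: "x \<in> Arr K" "y \<in> Arr K" "Cod K x = Dom K s" "Cod K y = Dom K s" "k \<in> Arr K" "Dom K k = Dom K x" "Cod K k = Dom K y" "y \<odot> k = x"
      using c by simp_all
    have c2: "(s \<odot> x, k, s \<odot> y) \<in> Arr (slice K (Cod K s))" by simp
    define G1 where "G1 = mid (farr (Del K pb s) (s \<odot> x, k, s \<odot> y))"
    note D [simp] = Del_farr_simps[OF s c2, folded G1_def]
    have e: "farr (Del K pb s) (s \<odot> x, k, s \<odot> y) = (pr1 s (s \<odot> x), G1, pr1 s (s \<odot> y))" by (simp add: G1_def)
    have "t y \<odot> k = G1 \<odot> t x"
      by (rule pr_eqI[of s "s \<odot> y"]) (simp_all add: Comp_reassoc[OF t(4)] Comp_reassoc[OF t(5)] Comp_reassoc[OF D(4)] Comp_reassoc[OF D(5)])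
    then show "Sig_Del_unit s (Cod ?S u) \<odot>\<^bsub>?S\<^esub> farr id_fun2 u
      = farr (Del K pb s \<circ>\<^sub>2 Sig K s) u \<odot>\<^bsub>?S\<^esub> Sig_Del_unit s (Dom ?S u)"
      by (simp add: u Sig_Del_unit_def e del: Del_simps flip: t_def)
  next
    fix u assume "u \<in> Cell ?S"
    then obtain x k y where u: "u = (x, k, y)" and c: "(x, k, y) \<in> Cell ?S" by (cases u) auto
    have [simp]: "x \<in> Arr K" "y \<in> Arr K" "Cod K x = Dom K s" "Cod K y = Dom K s" "k \<in> Cell K" "Dom K (Src K k) = Dom K x" "Cod K (Src K k) = Dom K y" "y \<rhd> k = Id2 K x"
      using c by simp_all
    have c2: "(s \<odot> x, k, s \<odot> y) \<in> Cell (slice K (Cod K s))" by simp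
    define G1 where "G1 = mid (fcell (Del K pb s) (s \<odot> x, k, s \<odot> y))"
    note D [simp] = Del_fcell_simps[OF s c2, folded G1_def]
    have e: "fcell (Del K pb s) (s \<odot> x, k, s \<odot> y) = (pr1 s (s \<odot> x), G1, pr1 s (s \<odot> y))" by (simp add: G1_def)
    have [simp]: "pr1 s (s \<odot> y) \<rhd> (G1 \<lhd> t x) = Id2 K x"
      using whisker_Comp(3)[of "t x" "pr1 s (s \<odot> y)" G1] by simp
    have [simp]: "pr2 s (s \<odot> y) \<rhd> (G1 \<lhd> t x) = k"
      using whisker_Comp(3)[of "t x" "pr2 s (s \<odot> y)" G1] by (simp add: whisker_r_reassoc[OF t(5)])
    have "t y \<rhd> k = G1 \<lhd> t x"
      by (rule pr_cell_eqI[of s "s \<odot> y"]) (simp_all add: whisker_l_reassoc[OF t(4)] whisker_l_reassoc[OF t(5)])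
    then show "Sig_Del_unit s (Cod ?S (Src ?S u)) \<rhd>\<^bsub>?S\<^esub> fcell id_fun2 u
      = fcell (Del K pb s \<circ>\<^sub>2 Sig K s) u \<lhd>\<^bsub>?S\<^esub> Sig_Del_unit s (Dom ?S (Src ?S u))"
      by (simp add: u Sig_Del_unit_def e del: Del_simps flip: t_def)
  qed
qed

theorem Sig_Del_adj:
  assumes s [simp]: "s \<in> Arr K"
  shows "adj2 (slice K (Dom K s)) (slice K (Cod K s)) (Sig K s) (Del K pb s) (Sig_Del_unit s) (Sig_Del_counit K pb s)"
  unfolding adj2_def
proof (intro conjI ballI Sig_fun2 Del_fun2 Sig_Del_unit_nat Sig_Del_counit_nat s)
  fix X assume "X \<in> Ob (slice K (Dom K s))"
  then have [simp]: "X \<in> Arr K" "Cod K X = Dom K s" by simp_all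
  show "Sig_Del_counit K pb s (fob (Sig K s) X) \<odot>\<^bsub>slice K (Cod K s)\<^esub> farr (Sig K s) (Sig_Del_unit s X) = Id1 (slice K (Cod K s)) (fob (Sig K s) X)"
    by (simp add: Sig_Del_unit_def Sig_Del_counit_def)
next
  fix Y assume "Y \<in> Ob (slice K (Cod K s))"
  then have [simp]: "Y \<in> Arr K" "Cod K Y = Cod K s" by simp_all
  define x where "x = pr1 s Y"
  have [simp]: "x \<in> Arr K" "Cod K x = Dom K s" "pr1 s Y = x" "Dom K (pr2 s Y) = Dom K x" "Y \<odot> pr2 s Y = s \<odot> x"
    unfolding x_def by simp_all
  have c: "(s \<odot> x, pr2 s Y, Y) \<in> Arr (slice K (Cod K s))" by simp
  define G1 where "G1 = mid (farr (Del K pb s) (s \<odot> x, pr2 s Y, Y))"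
  note D [simp] = Del_farr_simps[OF s c, folded G1_def, simplified]
  have e: "farr (Del K pb s) (s \<odot> x, pr2 s Y, Y) = (pr1 s (s \<odot> x), G1, pr1 s Y)" by (simp add: G1_def)
  define t where "t = pb_arr K pb s (s \<odot> x) x (Id1 K (Dom K x))"
  have t [simp]: "t \<in> Arr K" "Dom K t = Dom K x" "Cod K t = Dom K (pr1 s (s \<odot> x))" "pr1 s (s \<odot> x) \<odot> t = x" "pr2 s (s \<odot> x) \<odot> t = Id1 K (Dom K x)"
    unfolding t_def by simp_all
  have "G1 \<odot> t = Id1 K (Dom K x)"
    by (rule pr_eqI[of s Y]) (simp_all add: Comp_reassoc[OF D(4)] Comp_reassoc[OF D(5)])
  then show "farr (Del K pb s) (Sig_Del_counit K pb s Y) \<odot>\<^bsub>slice K (Dom K s)\<^esub> Sig_Del_unit s (fob (Del K pb s) Y) = Id1 (slice K (Dom K s)) (fob (Del K pb s) Y)"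
    by (simp add: Sig_Del_unit_def Sig_Del_counit_def e del: Del_simps(2) flip: t_def)
qed

end

section \<open>The Beck-Chevalley isomorphism\<close>

text \<open>
  The prefix l refers to \<open>\<Pi>\<^bsub>p1\<^esub>\<close>, the prefix r to
  \<open>\<Pi>\<^bsub>p2\<^esub>\<close>.
\<close>

locale beck_chevalley_square = pullbacks K pb + l: pushforward K pb p1 "Pi p1" + r: pushforward K pb p2 "Pi p2"
  for K :: "('o, 'a, 'c) twocat" (structure) and pb :: "'a pbs" and Pi :: "'a \<Rightarrow> ('a, 'c) radj" and p1 p2 :: 'a +
  fixes f2 f1 :: 'a
  assumes square: "is_pullback K p2 f1 f2 p1"
begin

lemma f_simps [simp]: "f2 \<in> Arr K" "Dom K f2 = Dom K p1" "Cod K f2 = Dom K p2" "f1 \<in> Arr K" "Dom K f1 = Cod K p1" "Cod K f1 = Cod K p2"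
  using is_pullbackD[OF square] by simp_all

lemma sq: "p2 \<odot> f2 = f1 \<odot> p1"
  using is_pullbackD(9)[OF square] by simp

lemma sq_reassoc [simp]: "\<lbrakk>h \<in> Arr K; Cod K h = Dom K p1\<rbrakk> \<Longrightarrow> p2 \<odot> (f2 \<odot> h) = f1 \<odot> (p1 \<odot> h)"
  by (simp add: Comp_reassoc[OF sq])

definition bc :: "'a \<Rightarrow> 'a" where "bc y = mid (beck_chevalley K pb Pi p1 p2 f2 f1 y)"

lemma BC_nat:
  "is_nat2 (slice K (Dom K p2)) (slice K (Cod K p1)) (Del K pb f1 \<circ>\<^sub>2 rfun (Pi p2)) (rfun (Pi p1) \<circ>\<^sub>2 Del K pb f2) (beck_chevalley K pb Pi p1 p2 f2 f1)"
proof -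
  let ?S = "slice K (Dom K p2)" and ?S2 = "slice K (Dom K p1)" and ?S3 = "slice K (Cod K p1)"
  note G1 = adj2D(2)[OF l.adj] and G2 = adj2D(2)[OF r.adj] and D1 = adj2D(1)[OF l.adj] and D2 = adj2D(1)[OF r.adj]
  have F1: "is_fun2 (slice K (Cod K p2)) ?S3 (Del K pb f1)" using Del_fun2[of f1] by simp
  have F2: "is_fun2 ?S ?S2 (Del K pb f2)" using Del_fun2[of f2] by simp
  have S: "two_category ?S" "two_category (slice K (Cod K p2))" "two_category ?S2" "two_category ?S3"
    by (rule two_category_slice; simp)+
  have sqn: "is_nat2 ?S ?S2 (Del K pb p1 \<circ>\<^sub>2 Del K pb f1 \<circ>\<^sub>2 rfun (Pi p2)) (Del K pb f2 \<circ>\<^sub>2 Del K pb p2 \<circ>\<^sub>2 rfun (Pi p2))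
     (\<lambda>y. Del_square K pb p1 p2 f2 f1 (fob (rfun (Pi p2)) y))"
    by (rule is_nat2_whisker_r[OF Del_square_nat G2 S(1)]) (simp_all add: sq)
  have en: "is_nat2 ?S ?S2 (Del K pb f2 \<circ>\<^sub>2 (Del K pb p2 \<circ>\<^sub>2 rfun (Pi p2))) (Del K pb f2 \<circ>\<^sub>2 id_fun2)
     (\<lambda>y. farr (Del K pb f2) (rcounit (Pi p2) y))"
    by (rule is_nat2_whisker_l[OF adj2D(4)[OF r.adj] is_fun2_comp[OF G2 D2 S(1)] _ F2 S(1) S(1)])
       (simp add: is_fun2_def hom1_iff hom2_iff two_category.Cell_ends[OF S(1)])
  have m: "is_nat2 ?S ?S2 (Del K pb p1 \<circ>\<^sub>2 Del K pb f1 \<circ>\<^sub>2 rfun (Pi p2)) (Del K pb f2)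
     (\<lambda>y. farr (Del K pb f2) (rcounit (Pi p2) y) \<odot>\<^bsub>?S2\<^esub> Del_square K pb p1 p2 f2 f1 (fob (rfun (Pi p2)) y))"
    by (rule is_nat2_comp[OF sqn _ _ _ F2 S(1,3)])
      (use en is_fun2_comp[OF is_fun2_comp[OF G2 F1 S(1)] D1 S(1)] is_fun2_comp[OF is_fun2_comp[OF G2 D2 S(1)] F2 S(1)] in \<open>simp_all add: comp_fun2_assoc\<close>)
  have FG: "is_fun2 ?S ?S3 (Del K pb f1 \<circ>\<^sub>2 rfun (Pi p2))" by (rule is_fun2_comp[OF G2 F1 S(1)])
  have GF: "is_fun2 ?S ?S3 (rfun (Pi p1) \<circ>\<^sub>2 Del K pb f2)" by (rule is_fun2_comp[OF F2 G1 S(1)])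
  have GD: "is_fun2 ?S ?S2 (Del K pb p1 \<circ>\<^sub>2 Del K pb f1 \<circ>\<^sub>2 rfun (Pi p2))"
    using is_fun2_comp[OF FG D1 S(1)] by (simp add: comp_fun2_assoc)
  have gm: "is_nat2 ?S ?S3 (rfun (Pi p1) \<circ>\<^sub>2 (Del K pb p1 \<circ>\<^sub>2 Del K pb f1 \<circ>\<^sub>2 rfun (Pi p2))) (rfun (Pi p1) \<circ>\<^sub>2 Del K pb f2)
     (\<lambda>y. farr (rfun (Pi p1)) (farr (Del K pb f2) (rcounit (Pi p2) y) \<odot>\<^bsub>?S2\<^esub> Del_square K pb p1 p2 f2 f1 (fob (rfun (Pi p2)) y)))"
    by (rule is_nat2_whisker_l[OF m GD F2 G1 S(1,3)])
  have un: "is_nat2 ?S ?S3 (id_fun2 \<circ>\<^sub>2 (Del K pb f1 \<circ>\<^sub>2 rfun (Pi p2))) (rfun (Pi p1) \<circ>\<^sub>2 Del K pb p1 \<circ>\<^sub>2 (Del K pb f1 \<circ>\<^sub>2 rfun (Pi p2)))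
     (\<lambda>y. runit (Pi p1) (fob (Del K pb f1 \<circ>\<^sub>2 rfun (Pi p2)) y))"
    by (rule is_nat2_whisker_r[OF adj2D(3)[OF l.adj] FG S(1)])
  show ?thesis
    using is_nat2_comp[OF _ gm FG _ GF S(1,4), of "\<lambda>y. runit (Pi p1) (fob (Del K pb f1 \<circ>\<^sub>2 rfun (Pi p2)) y)"] un is_fun2_comp[OF GD G1 S(1)]
    unfolding beck_chevalley_def[abs_def] Let_def by (simp add: comp_fun2_assoc)
qed

lemma BC_simps:
  assumes y: "y \<in> Arr K" "Cod K y = Dom K p2"
  shows "beck_chevalley K pb Pi p1 p2 f2 f1 y = (pr1 f1 (r.zz y), bc y, l.zz (pr1 f2 y))"
    "bc y \<in> Arr K" "Dom K (bc y) = Dom K (pr1 f1 (r.zz y))" "Cod K (bc y) = Dom K (l.zz (pr1 f2 y))"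
    "l.zz (pr1 f2 y) \<odot> bc y = pr1 f1 (r.zz y)"
proof -
  note b = is_nat2D(1-3)[OF BC_nat, of y, simplified, OF conjI[OF y]]
  then show e: "beck_chevalley K pb Pi p1 p2 f2 f1 y = (pr1 f1 (r.zz y), bc y, l.zz (pr1 f2 y))"
    unfolding bc_def by (cases "beck_chevalley K pb Pi p1 p2 f2 f1 y") simp
  show "bc y \<in> Arr K" "Dom K (bc y) = Dom K (pr1 f1 (r.zz y))" "Cod K (bc y) = Dom K (l.zz (pr1 f2 y))"
    "l.zz (pr1 f2 y) \<odot> bc y = pr1 f1 (r.zz y)"
    using b(1) unfolding e by simp_all
qed

text \<open>
  The value of BC w at e is the value of w at \<open>f\<^sub>2 e\<close>. This formula characterizes the
  Beck-Chevalley map.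
\<close>

lemma BC_ev:
  assumes y: "y \<in> Arr K" "Cod K y = Dom K p2" and e: "e \<in> Arr K" "Cod K e = Dom K p1"
    and w: "w \<in> Arr K" "Cod K w = Dom K (pr1 f1 (r.zz y))" "Dom K e = Dom K w" "p1 \<odot> e = pr1 f1 (r.zz y) \<odot> w"
  shows "pr2 f2 y \<odot> l.ev (pr1 f2 y) e (bc y \<odot> w) = r.ev y (f2 \<odot> e) (pr2 f1 (r.zz y) \<odot> w)"
proof -
  define z n where D: "z = r.zz y" "n = pr1 f1 z"
  note [simp] = y e w[folded D]
  have [simp]: "z \<in> Arr K" "Cod K z = Cod K p2" unfolding D(1) by simp_all
  have [simp]: "n \<in> Arr K" "Cod K n = Cod K p1" "Dom K (pr2 f1 z) = Dom K n" "z \<odot> pr2 f1 z = f1 \<odot> n" "pr2 f1 z \<in> Arr K" "Cod K (pr2 f1 z) = Dom K z"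
    "\<And>h. h \<in> Arr K \<Longrightarrow> Cod K h = Dom K n \<Longrightarrow> z \<odot> (pr2 f1 z \<odot> h) = f1 \<odot> (n \<odot> h)"
    unfolding D(2) by simp_all
  note [simp] = D[symmetric] r.ce_simps[OF y, folded D]
  have [simp]: "n \<odot> (pr2 p1 n \<odot> h) = p1 \<odot> (pr1 p1 n \<odot> h)" if "h \<in> Arr K" "Cod K h = Dom K (pr1 p1 n)" for h
    using that by simp
  define q where "q = pb_arr2 K pb f2 p2 z (pr1 p1 n) (pr2 f1 z \<odot> pr2 p1 n)"
  note q [simp] = pb_arr2_simps[of f2 p2 z "pr1 p1 n" "pr2 f1 z \<odot> pr2 p1 n", OF _ _ _ _ _ _ _ _ _ _ _ q_def, simplified]
  have c: "(pr1 p2 z, r.ce y, y) \<in> Arr (slice K (Cod K f2))" by simp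
  define G1 where "G1 = mid (farr (Del K pb f2) (pr1 p2 z, r.ce y, y))"
  note G [simp] = Del_farr_simps[OF _ c, folded G1_def, simplified]
  have Ge: "farr (Del K pb f2) (pr1 p2 z, r.ce y, y) = (pr1 f2 (pr1 p2 z), G1, pr1 f2 y)" by (simp add: G1_def)
  have m: "farr (rfun (Pi p1)) (pr1 p1 n, G1 \<odot> q, pr1 f2 y) = (l.zz (pr1 p1 n), l.tr (pr1 p1 n) (G1 \<odot> q) (pr1 f2 y), l.zz (pr1 f2 y))"
    by (rule l.farr_R) (simp add: Comp_reassoc[OF G(4)])
  have bc: "bc y = l.tr (pr1 p1 n) (G1 \<odot> q) (pr1 f2 y) \<odot> l.un n"
    unfolding bc_def beck_chevalley_def Let_def Del_square_def
    using l.un_simps[of n] by (simp add: Ge m del: Del_simps(2) slice_simps(2) flip: q_def)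
  note un [simp] = l.un_simps[of n, simplified]
  have [simp]: "l.zz (pr1 p1 n) \<odot> (l.un n \<odot> h) = n \<odot> h" if "h \<in> Arr K" "Cod K h = Dom K n" for h
    using that by (simp add: Comp_reassoc[OF un(5)])
  have t: "l.tr (pr1 p1 n) (G1 \<odot> q) (pr1 f2 y) \<in> Arr K" "Dom K (l.tr (pr1 p1 n) (G1 \<odot> q) (pr1 f2 y)) = Dom K (l.zz (pr1 p1 n))"
    using l.tr_simps[of "pr1 p1 n" "pr1 f2 y" "G1 \<odot> q"] by (simp_all add: Comp_reassoc[OF G(4)])
  define a where "a = pb_arr K pb p1 n e w"
  have [simp]: "a \<in> Arr K" "Dom K a = Dom K w" "Cod K a = Dom K (pr1 p1 n)" "pr1 p1 n \<odot> a = e" "pr2 p1 n \<odot> a = w"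
    unfolding a_def by simp_all
  have "l.ev (pr1 f2 y) e (bc y \<odot> w) = l.ev (pr1 f2 y) e (l.tr (pr1 p1 n) (G1 \<odot> q) (pr1 f2 y) \<odot> (l.un n \<odot> w))"
    unfolding bc using t by simp
  also have "\<dots> = (G1 \<odot> q) \<odot> l.ev (pr1 p1 n) e (l.un n \<odot> w)"
    by (rule l.ev_tr) (simp_all add: Comp_reassoc[OF G(4)])
  also have "l.ev (pr1 p1 n) e (l.un n \<odot> w) = a"
    unfolding a_def by (rule l.ev_un) simp_all
  finally have 1: "pr2 f2 y \<odot> l.ev (pr1 f2 y) e (bc y \<odot> w) = r.ce y \<odot> (pr2 f2 (pr1 p2 z) \<odot> (q \<odot> a))"
    by (simp add: Comp_reassoc[OF G(5)])
  have qa: "pr2 f2 (pr1 p2 z) \<odot> (q \<odot> a) = pb_arr K pb p2 z (f2 \<odot> e) (pr2 f1 z \<odot> w)"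
    by (simp add: Comp_reassoc[OF q(5)] pb_arr_comp)
  show ?thesis unfolding 1 qa r.ev_def by simp
qed

text \<open>
  Given a family indexed by the fibre of \<open>p\<^sub>1\<close> over b, the pullback property makes it a
  family over the fibre of \<open>p\<^sub>2\<close> over \<open>f\<^sub>1 b\<close>, hence an element u of
  \<open>\<Pi>\<^bsub>p2\<^esub> y\<close>; together with b this is an element of its pullback along
  \<open>f\<^sub>1\<close>.
\<close>

lemma BC_inverse_ex:
  assumes y: "y \<in> Arr K" "Cod K y = Dom K p2"
  obtains j where "j \<in> Arr K" "Dom K j = Dom K (l.zz (pr1 f2 y))" "Cod K j = Dom K (pr1 f1 (r.zz y))" "pr1 f1 (r.zz y) \<odot> j = l.zz (pr1 f2 y)"
    "bc y \<odot> j = Id1 K (Dom K (l.zz (pr1 f2 y)))" "j \<odot> bc y = Id1 K (Dom K (pr1 f1 (r.zz y)))"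
proof -
  define z n N where D: "z = r.zz y" "n = pr1 f1 z" "N = l.zz (pr1 f2 y)"
  note [simp] = y
  have [simp]: "z \<in> Arr K" "Cod K z = Cod K p2" unfolding D(1) by simp_all
  have [simp]: "N \<in> Arr K" "Cod K N = Cod K p1" unfolding D(3) by simp_all
  have [simp]: "n \<in> Arr K" "Cod K n = Cod K p1" "Dom K (pr2 f1 z) = Dom K n" "z \<odot> pr2 f1 z = f1 \<odot> n" "pr2 f1 z \<in> Arr K" "Cod K (pr2 f1 z) = Dom K z"
    "\<And>h. h \<in> Arr K \<Longrightarrow> Cod K h = Dom K n \<Longrightarrow> z \<odot> (pr2 f1 z \<odot> h) = f1 \<odot> (n \<odot> h)"
    unfolding D(2) by simp_all
  note [simp] = D[symmetric]
  note bc [simp] = BC_simps(2-5)[OF y, folded D, unfolded D(2)[symmetric]]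
  have [simp]: "N \<odot> (bc y \<odot> h) = n \<odot> h" if "h \<in> Arr K" "Cod K h = Dom K n" for h
    using that by (simp add: Comp_reassoc[OF bc(4)])
  note bev = BC_ev[OF y, folded D, unfolded D(2)[symmetric]]
  have lift: "\<exists>e1. e1 \<in> Arr K \<and> Dom K e1 = Dom K e \<and> Cod K e1 = Dom K p1 \<and> f2 \<odot> e1 = e \<and> p1 \<odot> e1 = b"
    if "e \<in> Arr K" "b \<in> Arr K" "Dom K e = Dom K b" "Cod K e = Dom K p2" "Cod K b = Cod K p1" "p2 \<odot> e = f1 \<odot> b" for e b
    using is_pullback_arr[OF square, of e b] that unfolding hom1_iff by auto
  define b where "b = f1 \<odot> N"
  have [simp]: "b \<in> Arr K" "Dom K b = Dom K N" "Cod K b = Cod K p2" unfolding b_def by simp_all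
  have bN: "b \<odot> h = f1 \<odot> (N \<odot> h)" if "h \<in> Arr K" "Cod K h = Dom K N" for h
    using that unfolding b_def by simp
  define h where "h = pr2 p2 b"
  have [simp]: "h \<in> Arr K" "Cod K h = Dom K N" "Dom K h = Dom K (pr1 p2 b)" and pbh: "p2 \<odot> pr1 p2 b = b \<odot> h" unfolding h_def by simp_all
  \<comment> \<open>An element of the fibre of p2 over an element in the image of f1 comes from a unique element of the fibre of p1.\<close>
  obtain e1 where e1 [simp]: "e1 \<in> Arr K" "Dom K e1 = Dom K (pr1 p2 b)" "Cod K e1 = Dom K p1" "f2 \<odot> e1 = pr1 p2 b" "p1 \<odot> e1 = N \<odot> h"
    using lift[of "pr1 p2 b" "N \<odot> h"] pbh by (auto simp: bN)
  \<comment> \<open>k is the given family, reindexed by the fibres of p2 over f1.\<close>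
  define k where "k = pr2 f2 y \<odot> l.ev (pr1 f2 y) e1 h"
  have lev [simp]: "l.ev (pr1 f2 y) e v \<in> Arr K" "Dom K (l.ev (pr1 f2 y) e v) = Dom K v" "Cod K (l.ev (pr1 f2 y) e v) = Dom K (pr1 f2 y)" "pr1 f2 y \<odot> l.ev (pr1 f2 y) e v = e"
    if "e \<in> Arr K" "v \<in> Arr K" "Dom K e = Dom K v" "Cod K e = Dom K p1" "Cod K v = Dom K N" "p1 \<odot> e = N \<odot> v" for e v
    using l.ev_simps[of "pr1 f2 y" e v] that by simp_all
  have [simp]: "k \<in> Arr K" "Dom K k = Dom K (pr1 p2 b)" "Cod K k = Dom K y" "y \<odot> k = pr1 p2 b"
    unfolding k_def by simp_all
  obtain u where u [simp]: "u \<in> Arr K" "Dom K u = Dom K N" "Cod K u = Dom K z" "z \<odot> u = b" and uk: "r.ev y (pr1 p2 b) (u \<odot> h) = k"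
    by (rule r.ev_ex[OF y, of b k]) (simp_all add: h_def)
  have uev: "r.ev y (f2 \<odot> e) (u \<odot> w) = pr2 f2 y \<odot> l.ev (pr1 f2 y) e w"
    if [simp]: "e \<in> Arr K" "w \<in> Arr K" "Dom K e = Dom K w" "Cod K e = Dom K p1" "Cod K w = Dom K N" and pe [simp]: "p1 \<odot> e = N \<odot> w" for e w
  proof -
    define q where "q = pb_arr K pb p2 b (f2 \<odot> e) w"
    have q [simp]: "q \<in> Arr K" "Dom K q = Dom K w" "Cod K q = Dom K (pr1 p2 b)" "pr1 p2 b \<odot> q = f2 \<odot> e" "h \<odot> q = w"
      unfolding q_def h_def by (simp_all add: bN)
    have e1q: "e1 \<odot> q = e"
      by (rule is_pullback_arr_eqI[OF square]) (simp_all add: Comp_reassoc[OF e1(4)] Comp_reassoc[OF e1(5)])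
    have zu: "p2 \<odot> pr1 p2 b = z \<odot> (u \<odot> h)" by (simp add: Comp_reassoc[OF u(4)] pbh)
    have "r.ev y (pr1 p2 b) (u \<odot> h) \<odot> q = r.ev y (pr1 p2 b \<odot> q) ((u \<odot> h) \<odot> q)"
      by (rule r.ev_restrict) (simp_all add: zu)
    moreover have "l.ev (pr1 f2 y) e1 h \<odot> q = l.ev (pr1 f2 y) (e1 \<odot> q) (h \<odot> q)"
      by (rule l.ev_restrict) simp_all
    ultimately show ?thesis using uk unfolding k_def by (simp add: e1q)
  qed
  define j where "j = pb_arr K pb f1 z N u"
  have j: "j \<in> Arr K" "Dom K j = Dom K N" "Cod K j = Dom K n" "n \<odot> j = N" "pr2 f1 z \<odot> j = u"
    unfolding j_def D(2) using pb_arr_simps[of f1 z N u] u(4) unfolding b_def by simp_all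
  note [simp] = j
  have 1: "bc y \<odot> j = Id1 K (Dom K N)"
  proof (rule l.ev_eqI[of "pr1 f2 y"])
    have nj: "n \<odot> (j \<odot> pr2 p1 N) = p1 \<odot> pr1 p1 N" by (simp add: Comp_reassoc[OF j(4)])
    show "l.ev (pr1 f2 y) (pr1 p1 N) ((bc y \<odot> j) \<odot> pr2 p1 N) = l.ev (pr1 f2 y) (pr1 p1 N) (Id1 K (Dom K N) \<odot> pr2 p1 N)"
    proof (rule pr_eqI[of f2 y])
      have "pr2 f2 y \<odot> l.ev (pr1 f2 y) (pr1 p1 N) (bc y \<odot> (j \<odot> pr2 p1 N)) = r.ev y (f2 \<odot> pr1 p1 N) (pr2 f1 z \<odot> (j \<odot> pr2 p1 N))"
        by (rule bev) (simp_all add: nj)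
      also have "pr2 f1 z \<odot> (j \<odot> pr2 p1 N) = u \<odot> pr2 p1 N" by (simp add: Comp_reassoc[OF j(5)])
      also have "r.ev y (f2 \<odot> pr1 p1 N) (u \<odot> pr2 p1 N) = pr2 f2 y \<odot> l.ev (pr1 f2 y) (pr1 p1 N) (pr2 p1 N)"
        by (rule uev) simp_all
      finally show "pr2 f2 y \<odot> l.ev (pr1 f2 y) (pr1 p1 N) ((bc y \<odot> j) \<odot> pr2 p1 N) = pr2 f2 y \<odot> l.ev (pr1 f2 y) (pr1 p1 N) (Id1 K (Dom K N) \<odot> pr2 p1 N)"
        by simp
    qed (simp_all add: nj)
  qed simp_all
  have 2: "j \<odot> bc y = Id1 K (Dom K n)"
  proof (rule pr_eqI[of f1 z])
    have ub: "u \<odot> bc y = pr2 f1 z"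
    proof (rule r.ev_eqI[OF y])
      define b' e h' where B: "b' = f1 \<odot> n" "e = pr1 p2 b'" "h' = pr2 p2 b'"
      have [simp]: "b' \<in> Arr K" "Dom K b' = Dom K n" "Cod K b' = Cod K p2" unfolding B(1) by simp_all
      have [simp]: "e \<in> Arr K" "h' \<in> Arr K" "Cod K e = Dom K p2" "Dom K h' = Dom K e" "Cod K h' = Dom K n" unfolding B(2,3) by simp_all
      have "p2 \<odot> e = b' \<odot> h'" unfolding B(2,3) by simp
      then have pe: "p2 \<odot> e = f1 \<odot> (n \<odot> h')" unfolding B(1) by simp
      obtain e' where e' [simp]: "e' \<in> Arr K" "Dom K e' = Dom K e" "Cod K e' = Dom K p1" "f2 \<odot> e' = e" "p1 \<odot> e' = n \<odot> h'"
        using lift[of e "n \<odot> h'"] pe by auto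
      have "r.ev y (f2 \<odot> e') (u \<odot> (bc y \<odot> h')) = pr2 f2 y \<odot> l.ev (pr1 f2 y) e' (bc y \<odot> h')"
        by (rule uev) simp_all
      also have "\<dots> = r.ev y (f2 \<odot> e') (pr2 f1 z \<odot> h')" by (rule bev) simp_all
      finally show "r.ev y (pr1 p2 (f1 \<odot> n)) ((u \<odot> bc y) \<odot> pr2 p2 (f1 \<odot> n)) = r.ev y (pr1 p2 (f1 \<odot> n)) (pr2 f1 z \<odot> pr2 p2 (f1 \<odot> n))"
        unfolding B(1)[symmetric] B(2,3)[symmetric] by simp
      show "r.zz y \<odot> (u \<odot> bc y) = f1 \<odot> n" by (simp add: Comp_reassoc[OF u(4)] bN)
    qed simp_all
    then show "pr2 f1 z \<odot> (j \<odot> bc y) = pr2 f1 z \<odot> Id1 K (Dom K n)" by (simp add: Comp_reassoc[OF j(5)])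
  qed (simp_all add: Comp_reassoc[OF j(4)])
  show ?thesis using that[of j] j 1 2 unfolding D by simp
qed

lemma arr_inv_slice:
  assumes B: "B \<in> Ob K" and c: "(x, k, y) \<in> Arr (slice K B)" "(y, j, x) \<in> Arr (slice K B)" and i: "k \<odot> j = Id1 K (Dom K y)" "j \<odot> k = Id1 K (Dom K x)"
  shows "arr_inv (slice K B) (x, k, y) = (y, j, x)"
  unfolding arr_inv_def
proof (rule the_equality)
  show "(y, j, x) \<in> hom1 (slice K B) (Cod (slice K B) (x, k, y)) (Dom (slice K B) (x, k, y)) \<and> (y, j, x) \<odot>\<^bsub>slice K B\<^esub> (x, k, y) = Id1 (slice K B) (Dom (slice K B) (x, k, y)) \<and>
     (x, k, y) \<odot>\<^bsub>slice K B\<^esub> (y, j, x) = Id1 (slice K B) (Cod (slice K B) (x, k, y))"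
    using c i by (simp add: hom1_iff)
  fix g assume g: "g \<in> hom1 (slice K B) (Cod (slice K B) (x, k, y)) (Dom (slice K B) (x, k, y)) \<and> g \<odot>\<^bsub>slice K B\<^esub> (x, k, y) = Id1 (slice K B) (Dom (slice K B) (x, k, y)) \<and>
     (x, k, y) \<odot>\<^bsub>slice K B\<^esub> g = Id1 (slice K B) (Cod (slice K B) (x, k, y))"
  then obtain l where gl: "g = (y, l, x)" and l: "l \<in> Arr K" "Dom K l = Dom K y" "Cod K l = Dom K x" "l \<odot> k = Id1 K (Dom K x)"
    by (cases g) (auto simp: hom1_iff)
  have "l = l \<odot> (k \<odot> j)" using l c i by simp
  also have "\<dots> = j" using l c by (simp add: Comp_reassoc[OF l(4)])
  finally show "g = (y, j, x)" unfolding gl by simp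
qed

definition bci :: "'a \<Rightarrow> 'a" where "bci y = mid (arr_inv (slice K (Cod K p1)) (beck_chevalley K pb Pi p1 p2 f2 f1 y))"

lemma bci:
  assumes y: "y \<in> Arr K" "Cod K y = Dom K p2"
  shows "arr_inv (slice K (Cod K p1)) (beck_chevalley K pb Pi p1 p2 f2 f1 y) = (l.zz (pr1 f2 y), bci y, pr1 f1 (r.zz y))"
    "bci y \<in> Arr K" "Dom K (bci y) = Dom K (l.zz (pr1 f2 y))" "Cod K (bci y) = Dom K (pr1 f1 (r.zz y))" "pr1 f1 (r.zz y) \<odot> bci y = l.zz (pr1 f2 y)"
    "bc y \<odot> bci y = Id1 K (Dom K (l.zz (pr1 f2 y)))" "bci y \<odot> bc y = Id1 K (Dom K (pr1 f1 (r.zz y)))"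
proof -
  obtain j where j: "j \<in> Arr K" "Dom K j = Dom K (l.zz (pr1 f2 y))" "Cod K j = Dom K (pr1 f1 (r.zz y))" "pr1 f1 (r.zz y) \<odot> j = l.zz (pr1 f2 y)"
    "bc y \<odot> j = Id1 K (Dom K (l.zz (pr1 f2 y)))" "j \<odot> bc y = Id1 K (Dom K (pr1 f1 (r.zz y)))"
    by (rule BC_inverse_ex[OF y])
  have e: "arr_inv (slice K (Cod K p1)) (beck_chevalley K pb Pi p1 p2 f2 f1 y) = (l.zz (pr1 f2 y), j, pr1 f1 (r.zz y))"
    unfolding BC_simps(1)[OF y] by (rule arr_inv_slice) (use y j BC_simps[OF y] in simp_all)
  then have "bci y = j" unfolding bci_def by simp
  with e j show "arr_inv (slice K (Cod K p1)) (beck_chevalley K pb Pi p1 p2 f2 f1 y) = (l.zz (pr1 f2 y), bci y, pr1 f1 (r.zz y))"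
    "bci y \<in> Arr K" "Dom K (bci y) = Dom K (l.zz (pr1 f2 y))" "Cod K (bci y) = Dom K (pr1 f1 (r.zz y))" "pr1 f1 (r.zz y) \<odot> bci y = l.zz (pr1 f2 y)"
    "bc y \<odot> bci y = Id1 K (Dom K (l.zz (pr1 f2 y)))" "bci y \<odot> bc y = Id1 K (Dom K (pr1 f1 (r.zz y)))" by simp_all
qed

lemma BC_inv_nat:
  "is_nat2 (slice K (Dom K p2)) (slice K (Cod K p1)) (rfun (Pi p1) \<circ>\<^sub>2 Del K pb f2) (Del K pb f1 \<circ>\<^sub>2 rfun (Pi p2))
     (\<lambda>y. arr_inv (slice K (Cod K p1)) (beck_chevalley K pb Pi p1 p2 f2 f1 y))"
proof (rule is_nat2_inverse[OF BC_nat])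
  show S: "two_category (slice K (Dom K p2))" "two_category (slice K (Cod K p1))"
    by (rule two_category_slice; simp)+
  show "is_fun2 (slice K (Dom K p2)) (slice K (Cod K p1)) (Del K pb f1 \<circ>\<^sub>2 rfun (Pi p2))"
    using is_fun2_comp[OF adj2D(2)[OF r.adj] _ S(1), of "slice K (Cod K p1)"] Del_fun2[of f1] by simp
  show "is_fun2 (slice K (Dom K p2)) (slice K (Cod K p1)) (rfun (Pi p1) \<circ>\<^sub>2 Del K pb f2)"
    using is_fun2_comp[OF _ adj2D(2)[OF l.adj] S(1)] Del_fun2[of f2] by simp
  fix y assume "y \<in> Ob (slice K (Dom K p2))"
  then have y: "y \<in> Arr K" "Cod K y = Dom K p2" by simp_all
  note [simp] = bci(2-7)[OF y] BC_simps(2-5)[OF y]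
  show "arr_inv (slice K (Cod K p1)) (beck_chevalley K pb Pi p1 p2 f2 f1 y) \<in> Arr (slice K (Cod K p1)) \<and>
     Dom (slice K (Cod K p1)) (arr_inv (slice K (Cod K p1)) (beck_chevalley K pb Pi p1 p2 f2 f1 y)) = fob (rfun (Pi p1) \<circ>\<^sub>2 Del K pb f2) y \<and>
     Cod (slice K (Cod K p1)) (arr_inv (slice K (Cod K p1)) (beck_chevalley K pb Pi p1 p2 f2 f1 y)) = fob (Del K pb f1 \<circ>\<^sub>2 rfun (Pi p2)) y \<and>
     arr_inv (slice K (Cod K p1)) (beck_chevalley K pb Pi p1 p2 f2 f1 y) \<odot>\<^bsub>slice K (Cod K p1)\<^esub> beck_chevalley K pb Pi p1 p2 f2 f1 y = Id1 (slice K (Cod K p1)) (fob (Del K pb f1 \<circ>\<^sub>2 rfun (Pi p2)) y) \<and>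
     beck_chevalley K pb Pi p1 p2 f2 f1 y \<odot>\<^bsub>slice K (Cod K p1)\<^esub> arr_inv (slice K (Cod K p1)) (beck_chevalley K pb Pi p1 p2 f2 f1 y) = Id1 (slice K (Cod K p1)) (fob (rfun (Pi p1) \<circ>\<^sub>2 Del K pb f2) y)"
    unfolding BC_simps(1)[OF y] bci(1)[OF y, unfolded BC_simps(1)[OF y]] using y by simp
qed

end

section \<open>The transformation associated to a cartesian morphism\<close>

context two_category
begin

text \<open>
  A chosen cell is determined by its codomain and the cell under it, so that preservation of chosen cells as
  a set is preservation of each chosen lift.
\<close>

lemma split_fib_mor_cleavage:
  assumes m: "split_fib_mor K f \<chi> g \<psi> u v" and \<chi>: "split_fib K f \<chi>" and \<psi>: "split_fib K g \<psi>" and lp: "lift_problem K f k \<beta>"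
  shows "u \<rhd> \<chi> k \<beta> = \<psi> (u \<odot> k) (v \<rhd> \<beta>)"
proof -
  have uv [simp]: "u \<in> Arr K" "v \<in> Arr K" "Dom K u = Dom K f" "Cod K u = Dom K g" "Dom K v = Cod K f" "Cod K v = Cod K g" and sq: "g \<odot> u = v \<odot> f"
    using m unfolding split_fib_mor_def by (auto simp: hom1_iff)
  note [simp] = split_fibD(1)[OF \<chi>] split_fibD(1)[OF \<psi>] split_fibD(3-5)[OF \<chi> lp] split_fib_ends(1,2)[OF \<chi> lp] lift_problemD[OF lp]
  have "\<chi> k \<beta> \<in> chosen_cells K f \<chi>" using lp unfolding chosen_cells_def by blast
  then have "u \<rhd> \<chi> k \<beta> \<in> chosen_cells K g \<psi>" using m unfolding split_fib_mor_def by blast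
  then obtain k' \<beta>' where e: "u \<rhd> \<chi> k \<beta> = \<psi> k' \<beta>'" and lp': "lift_problem K g k' \<beta>'"
    unfolding chosen_cells_def by blast
  have "k' = u \<odot> k" using arg_cong[OF e, of "Tgt K"] split_fibD(4)[OF \<psi> lp'] by simp
  moreover have "\<beta>' = v \<rhd> \<beta>"
  proof -
    have "\<beta>' = g \<rhd> (u \<rhd> \<chi> k \<beta>)" unfolding e using split_fibD(5)[OF \<psi> lp'] by simp
    also have "\<dots> = v \<rhd> (f \<rhd> \<chi> k \<beta>)" using whisker_Comp(1)[of u g "\<chi> k \<beta>"] whisker_Comp(1)[of f v "\<chi> k \<beta>"] by (simp add: sq)
    finally show ?thesis by simp
  qed
  ultimately show ?thesis using e by simp
qed

lemma split_opfib_mor_cleavage: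
  assumes m: "split_opfib_mor K f \<chi> g \<psi> u v" and \<chi>: "split_opfib K f \<chi>" and \<psi>: "split_opfib K g \<psi>" and fg: "f \<in> Arr K" "g \<in> Arr K"
    and k: "k \<in> Arr K" "Cod K k = Dom K f" "\<beta> \<in> Cell K" "Src K \<beta> = f \<odot> k"
  shows "u \<rhd> \<chi> k \<beta> = \<psi> (u \<odot> k) (v \<rhd> \<beta>)"
proof -
  have uv [simp]: "u \<in> Arr K" "v \<in> Arr K" "Dom K u = Dom K f" "Cod K u = Dom K g" "Dom K v = Cod K f" "Cod K v = Cod K g" and sq: "g \<odot> u = v \<odot> f"
    using m unfolding split_opfib_mor_def split_fib_mor_def by (auto simp: hom1_iff co_def)
  note [simp] = fg k split_opfibD(1-3)[OF \<chi> k]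
  have "lift_problem (co K) f k \<beta>" using k unfolding lift_problem_def by (simp add: co_def)
  then have "\<chi> k \<beta> \<in> chosen_cells (co K) f \<chi>" unfolding chosen_cells_def by blast
  then have "u \<rhd> \<chi> k \<beta> \<in> chosen_cells (co K) g \<psi>"
    using m unfolding split_opfib_mor_def split_fib_mor_def by (auto simp: co_def whisker_l_def)
  then obtain k' \<beta>' where e: "u \<rhd> \<chi> k \<beta> = \<psi> k' \<beta>'" and "lift_problem (co K) g k' \<beta>'"
    unfolding chosen_cells_def by blast
  then have k': "k' \<in> Arr K" "Cod K k' = Dom K g" "\<beta>' \<in> Cell K" "Src K \<beta>' = g \<odot> k'"
    unfolding lift_problem_def by (simp_all add: co_def)
  have "k' = u \<odot> k" using arg_cong[OF e, of "Src K"] split_opfibD(2)[OF \<psi> k'] by simp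
  moreover have "\<beta>' = v \<rhd> \<beta>"
  proof -
    have "\<beta>' = g \<rhd> (u \<rhd> \<chi> k \<beta>)" unfolding e using split_opfibD(3)[OF \<psi> k'] by simp
    also have "\<dots> = v \<rhd> (f \<rhd> \<chi> k \<beta>)" using whisker_Comp(1)[of u g "\<chi> k \<beta>"] whisker_Comp(1)[of f v "\<chi> k \<beta>"] by (simp add: sq)
    finally show ?thesis by simp
  qed
  ultimately show ?thesis using e by simp
qed

lemma split_fib_morI:
  assumes \<chi>: "split_fib K f \<chi>" and \<psi>: "split_fib K g \<psi>" and uv: "u \<in> Arr K" "v \<in> Arr K" "Dom K u = Dom K f" "Cod K u = Dom K g" "Dom K v = Cod K f" "Cod K v = Cod K g"
    and sq: "g \<odot> u = v \<odot> f" and c: "\<And>k \<beta>. lift_problem K f k \<beta> \<Longrightarrow> u \<rhd> \<chi> k \<beta> = \<psi> (u \<odot> k) (v \<rhd> \<beta>)"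
  shows "split_fib_mor K f \<chi> g \<psi> u v"
proof -
  note [simp] = split_fibD(1)[OF \<chi>] split_fibD(1)[OF \<psi>] uv
  have "u \<rhd> \<chi> k \<beta> \<in> chosen_cells K g \<psi>" if lp: "lift_problem K f k \<beta>" for k \<beta>
  proof -
    note [simp] = lift_problemD[OF lp] lift_problem_ends[OF lp]
    have "lift_problem K g (u \<odot> k) (v \<rhd> \<beta>)" unfolding lift_problem_def by (simp add: Comp_reassoc[OF sq])
    then show ?thesis unfolding c[OF lp] chosen_cells_def by blast
  qed
  then show ?thesis unfolding split_fib_mor_def chosen_cells_def[of K f] using sq by (auto simp: hom1_iff)
qed

end

context commas
begin

lemma algmor_comp:
  assumes u: "algmor B A u A'" and v: "algmor B A' v A''"
  shows "algmor B A (v \<odot>\<^bsub>slice K B\<^esub> u) A''"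
proof -
  note U = algmorD[OF u] and V = algmorD[OF v]
  have "algmor B A (fst A, mid v \<odot> mid u, fst A'') A''"
  proof (rule algmorI[OF U(1) V(2)])
    fix w \<beta> assume lp: "lift_problem K (fst A) w \<beta>"
    have lp': "lift_problem K (fst A') (mid u \<odot> w) \<beta>"
      by (rule lift_problem_mor[OF lp]) (use U V algD[OF U(1)] algD[OF U(2)] in simp_all)
    show "(mid v \<odot> mid u) \<odot> act B A w \<beta> = act B A'' ((mid v \<odot> mid u) \<odot> w) \<beta>"
      using U(8)[OF lp] V(8)[OF lp'] act_simps[OF U(1) lp] lift_problemD[OF lp] U(4-6) V(4-6) by simp
  qed (use U V algD(1,2)[OF U(1)] algD(1,2)[OF U(2)] algD(1,2)[OF V(2)] in \<open>simp_all add: Comp_reassoc[OF V(7)]\<close>)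
  then show ?thesis by (subst U(3), subst V(3)) simp
qed

lemma algmor_inverse:
  assumes u: "algmor B A (x, k, y) A'" and j: "j \<in> Arr K" "Dom K j = Dom K y" "Cod K j = Dom K x" "k \<odot> j = Id1 K (Dom K y)" "j \<odot> k = Id1 K (Dom K x)"
  shows "algmor B A' (y, j, x) A"
proof -
  note U = algmorD[OF u, simplified]
  have xy [simp]: "x = fst A" "y = fst A'" using U(3) by simp_all
  note [simp] = U(4-7) j[simplified] algD(1,2)[OF U(1)] algD(1,2)[OF U(2)]
  have kj [simp]: "k \<odot> (j \<odot> h) = h" if "h \<in> Arr K" "Cod K h = Dom K (fst A')" for h
    using that by (simp add: Comp_reassoc[OF j(4)])
  have jk [simp]: "j \<odot> (k \<odot> h) = h" if "h \<in> Arr K" "Cod K h = Dom K (fst A)" for h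
    using that by (simp add: Comp_reassoc[OF j(5)])
  have xj: "fst A \<odot> j = fst A'"
  proof -
    have "fst A \<odot> j = fst A' \<odot> (k \<odot> j)" using Comp_assoc'[of j k "fst A'"] by simp
    then show ?thesis by simp
  qed
  show ?thesis unfolding xy
  proof (rule algmorI[OF U(2,1)])
    fix w \<beta> assume lp: "lift_problem K (fst A') w \<beta>"
    have lp': "lift_problem K (fst A) (j \<odot> w) \<beta>"
      by (rule lift_problem_mor[OF lp]) (simp_all add: xj)
    note [simp] = act_simps[OF U(1) lp'] act_simps[OF U(2) lp] lift_problemD[OF lp]
    have "j \<odot> act B A' (k \<odot> (j \<odot> w)) \<beta> = act B A (j \<odot> w) \<beta>"
      by (simp flip: U(8)[OF lp'] del: kj)
    then show "j \<odot> act B A' w \<beta> = act B A (j \<odot> w) \<beta>" by simp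
  qed (simp_all add: xj)
qed

end

context pullbacks_commas
begin

lemma SigBar_mor:
  assumes t: "split_fib K t \<chi>t" and u: "algmor (Dom K t) A u A'"
  shows "algmor (Cod K t) (fob (SigBar K cm t \<chi>t) A) (farr (Sig K t) u) (fob (SigBar K cm t \<chi>t) A')"
  using is_fun2D(3)[OF SigBar_fun2[OF t], of "(A, u, A')"] u by (simp add: SigBar_def alg_lift_def)

lemma DelBar_mor:
  assumes s: "s \<in> Arr K" and u: "algmor (Cod K s) A u A'"
  shows "algmor (Dom K s) (fob (DelBar K pb cm s) A) (farr (Del K pb s) u) (fob (DelBar K pb cm s) A')"
  using is_fun2D(3)[OF DelBar_fun2[OF s], of "(A, u, A')"] u by (simp add: DelBar_def alg_lift_def)

text \<open>
  Both iterated pullback cleavages are determined by their components in the original fibration, where they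
  agree.
\<close>

lemma Del_comp_algmor:
  assumes g: "g \<in> Arr K" and f: "f \<in> Arr K" "Dom K g = Cod K f" and A: "alg (Cod K g) A"
  shows "algmor (Dom K f) (fob (DelBar K pb cm (g \<odot> f)) A) (Del_comp K pb g f (fst A)) (fob (DelBar K pb cm f) (fob (DelBar K pb cm g) A))"
proof -
  define x where "x = fst A"
  note [simp] = g f algD(1,2)[OF A, folded x_def]
  have h: "g \<odot> f \<in> Arr K" "Cod K (g \<odot> f) = Cod K g" "Dom K (g \<odot> f) = Dom K f" by simp_all
  have A2: "alg (Cod K (g \<odot> f)) A" using A by simp
  define H G F where D: "H = fob (DelBar K pb cm (g \<odot> f)) A" "G = fob (DelBar K pb cm g) A" "F = fob (DelBar K pb cm f) G"
  note Hs = DelBar_simps[OF h(1) A2, folded D, unfolded h, folded x_def]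
  note Gs = DelBar_simps[OF g A, folded D, folded x_def]
  have G2: "alg (Cod K f) G" using Gs(2) by simp
  note Fs = DelBar_simps[OF f(1) G2, folded D, unfolded Gs(1)]
  define n where "n = pr1 (g \<odot> f) x"
  define q where "q = pr2 (g \<odot> f) x"
  have n [simp]: "n \<in> Arr K" "Cod K n = Dom K f" "q \<in> Arr K" "Dom K q = Dom K n" "Cod K q = Dom K x" and nq: "x \<odot> q = g \<odot> (f \<odot> n)"
    using pr_simps[of "g \<odot> f" x] unfolding n_def q_def by simp_all
  define w where "w = pb_arr2 K pb f g x n q"
  define i where "i = pb_arr K pb g x (f \<odot> n) q"
  have i [simp]: "i \<in> Arr K" "Dom K i = Dom K n" "Cod K i = Dom K (pr1 g x)" "pr1 g x \<odot> i = f \<odot> n" and i5 [simp]: "pr2 g x \<odot> i = q"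
    unfolding i_def using pb_arr_simps[of g x "f \<odot> n" q] nq by simp_all
  have xn: "x \<in> Arr K" "Cod K g = Cod K x" "Dom K n = Dom K q" by simp_all
  note W = pb_arr2_simps[OF f(1) g xn(1) f(2) xn(2) n(1,3) xn(3) n(2,5) nq[symmetric] w_def]
  note w [simp] = W(1-4) and w5 [simp] = W(5)[folded i_def]
  have dc: "Del_comp K pb g f x = (n, w, pr1 f (pr1 g x))" unfolding Del_comp_def Let_def w_def n_def q_def ..
  have [simp]: "pr1 f (pr1 g x) \<odot> (w \<odot> h) = n \<odot> h" if "h \<in> Arr K" "Cod K h = Dom K n" for h
    using that by (simp add: Comp_reassoc[OF w(4)])
  have [simp]: "pr2 f (pr1 g x) \<odot> (w \<odot> h) = i \<odot> h" "pr2 g x \<odot> (i \<odot> h) = q \<odot> h" if "h \<in> Arr K" "Cod K h = Dom K n" for h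
    using that by (simp_all add: Comp_reassoc[OF w5] Comp_reassoc[OF i5])
  have "algmor (Dom K f) H (fst H, w, fst F) F"
  proof (rule algmorI[OF Hs(2) Fs(2)])
    fix v \<beta> assume "lift_problem K (fst H) v \<beta>"
    then have lp: "lift_problem K n v \<beta>" unfolding Hs n_def .
    note [simp] = lift_problemD[OF lp] lift_problem_ends[OF lp]
    have lp2: "lift_problem K (pr1 f (pr1 g x)) (w \<odot> v) \<beta>" by (simp add: lift_problem_def)
    have lp3: "lift_problem K (pr1 g x) (i \<odot> v) (f \<rhd> \<beta>)" using pb_lift_problem[OF lp2] by simp
    note a1 = act_simps[OF Hs(2), unfolded Hs(1) n_def[symmetric], OF lp] and a2 = act_simps[OF Fs(2), unfolded Fs(1), OF lp2]
    note [simp] = a1 a2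
    have e1: "q \<odot> act (Dom K f) H v \<beta> = act (Cod K g) A (q \<odot> v) (g \<rhd> (f \<rhd> \<beta>))"
      using Hs(3)[OF lp[unfolded n_def]] unfolding n_def[symmetric] q_def[symmetric] by simp
    have e2: "pr2 f (pr1 g x) \<odot> act (Dom K f) F (w \<odot> v) \<beta> = act (Cod K f) G (i \<odot> v) (f \<rhd> \<beta>)"
      using Fs(3)[OF lp2] by simp
    have e3: "pr2 g x \<odot> act (Dom K g) G (i \<odot> v) (f \<rhd> \<beta>) = act (Cod K g) A (q \<odot> v) (g \<rhd> (f \<rhd> \<beta>))"
      using Gs(3)[OF lp3] by simp
    show "w \<odot> act (Dom K f) H v \<beta> = act (Dom K f) F (w \<odot> v) \<beta>"
      by (rule pr2_eqI[of f g x]) (use e3 in \<open>simp_all add: e1 e2\<close>)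
  qed (simp_all add: Hs Fs n_def[symmetric])
  then show ?thesis unfolding D(1,2,3)[symmetric] x_def[symmetric] dc Hs(1) Fs(1) n_def .
qed

text \<open>
  The action for the composite with \<open>t\<^sub>1\<close> first lifts along \<open>t\<^sub>1\<close>;
  \<open>f\<^sub>1\<close> turns this into the lift along \<open>t\<^sub>2\<close>, and the projection from
  the pullback preserves the remaining lift by construction.
\<close>

lemma counit_algmor:
  assumes f: "split_fib_mor K t1 \<chi>1 t2 \<chi>2 f1 (Id1 K (Cod K t1))" and t1: "split_fib K t1 \<chi>1" and t2: "split_fib K t2 \<chi>2" and A: "alg (Dom K t2) A"
  shows "algmor (Cod K t2) (fob (SigBar K cm t1 \<chi>1) (fob (DelBar K pb cm f1) A)) (farr (Sig K t2) (Sig_Del_counit K pb f1 (fst A))) (fob (SigBar K cm t2 \<chi>2) A)"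
proof -
  define x where "x = fst A"
  have f1 [simp]: "f1 \<in> Arr K" "Dom K f1 = Dom K t1" "Cod K f1 = Dom K t2" and J: "Cod K t1 = Cod K t2" and sq: "t2 \<odot> f1 = t1"
    using f split_fibD(1)[OF t1] unfolding split_fib_mor_def by (auto simp: hom1_iff)
  note [simp] = split_fibD(1)[OF t1] split_fibD(1)[OF t2] algD(1,2)[OF A, folded x_def]
  have [simp]: "t2 \<odot> (f1 \<odot> h) = t1 \<odot> h" if "h \<in> Arr K" "Cod K h = Dom K t1" for h
    using that by (simp add: Comp_reassoc[OF sq])
  define D where "D = fob (DelBar K pb cm f1) A"
  have A': "alg (Cod K f1) A" using A by simp
  note Ds = DelBar_simps[OF f1(1) A', folded D_def, folded x_def, simplified]
  note S1 = SigBar_simps[OF t1 Ds(2)] and S2 = SigBar_simps[OF t2 A, folded x_def]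
  have e: "farr (Sig K t2) (Sig_Del_counit K pb f1 x) = (t1 \<odot> pr1 f1 x, pr2 f1 x, t2 \<odot> x)"
    by (simp add: Sig_Del_counit_def)
  have "algmor (Cod K t2) (fob (SigBar K cm t1 \<chi>1) D) (fst (fob (SigBar K cm t1 \<chi>1) D), pr2 f1 x, fst (fob (SigBar K cm t2 \<chi>2) A)) (fob (SigBar K cm t2 \<chi>2) A)"
  proof (rule algmorI[OF S1(2)[unfolded J] S2(2)])
    fix v \<beta> assume "lift_problem K (fst (fob (SigBar K cm t1 \<chi>1) D)) v \<beta>"
    then have lp: "lift_problem K (t1 \<odot> pr1 f1 x) v \<beta>" unfolding S1(1) Ds(1) .
    note [simp] = lift_problemD[OF lp] 
    have lp2: "lift_problem K (t2 \<odot> x) (pr2 f1 x \<odot> v) \<beta>" by (simp add: lift_problem_def)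
    have l1: "lift_problem K t1 (pr1 f1 x \<odot> v) \<beta>" by (simp add: lift_problem_def)
    have l2: "lift_problem K (pr1 f1 x) v (\<chi>1 (pr1 f1 x \<odot> v) \<beta>)"
      using split_fibD(3,4)[OF t1 l1] by (simp add: lift_problem_def)
    have "act (Cod K t1) (fob (SigBar K cm t1 \<chi>1) D) v \<beta> = act (Dom K t1) D v (\<chi>1 (pr1 f1 x \<odot> v) \<beta>)"
      using S1(3)[of v \<beta>] lp unfolding Ds(1) by simp
    moreover have "pr2 f1 x \<odot> act (Dom K t1) D v (\<chi>1 (pr1 f1 x \<odot> v) \<beta>) = act (Dom K t2) A (pr2 f1 x \<odot> v) (f1 \<rhd> \<chi>1 (pr1 f1 x \<odot> v) \<beta>)"
      using Ds(3)[OF l2] by simp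
    moreover have "f1 \<rhd> \<chi>1 (pr1 f1 x \<odot> v) \<beta> = \<chi>2 (f1 \<odot> (pr1 f1 x \<odot> v)) \<beta>"
      using split_fib_mor_cleavage[OF f t1 t2 l1] lift_problem_ends[OF l1] by simp
    moreover have "act (Cod K t2) (fob (SigBar K cm t2 \<chi>2) A) (pr2 f1 x \<odot> v) \<beta> = act (Dom K t2) A (pr2 f1 x \<odot> v) (\<chi>2 (x \<odot> (pr2 f1 x \<odot> v)) \<beta>)"
      by (rule S2(3)[OF lp2])
    ultimately show "pr2 f1 x \<odot> act (Cod K t2) (fob (SigBar K cm t1 \<chi>1) D) v \<beta> = act (Cod K t2) (fob (SigBar K cm t2 \<chi>2) A) (pr2 f1 x \<odot> v) \<beta>"
      by (simp add: J)
  qed (simp_all add: S1 S2 Ds)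
  then show ?thesis unfolding x_def[symmetric] e D_def[symmetric] by (simp add: S1 S2 Ds)
qed

end

locale opfib_square = pullbacks_commas K pb cm + l: pushforward_opfib K pb cm p1 "Pi p1" Pi \<chi>1 + r: pushforward_opfib K pb cm p2 "Pi p2" Pi \<chi>2
    + beck_chevalley_square K pb Pi p1 p2 f2 f1
  for K :: "('o, 'a, 'c) twocat" (structure) and pb :: "'a pbs" and cm :: "('a, 'c) commas" and Pi :: "'a \<Rightarrow> ('a, 'c) radj" and p1 p2 :: 'a
    and \<chi>1 \<chi>2 :: "('a, 'c) cleavage" and f2 f1 :: 'a +
  assumes opfib_mor: "split_opfib_mor K p1 \<chi>1 p2 \<chi>2 f2 f1"
begin

text \<open>
  Evaluate both sides at an arbitrary e. One side pushes e forward by \<open>p\<^sub>1\<close> and then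
  applies \<open>f\<^sub>2\<close>, the other one applies \<open>f\<^sub>2\<close> and pushes forward by
  \<open>p\<^sub>2\<close>; these agree since \<open>(f\<^sub>2, f\<^sub>1)\<close> preserves chosen
  opcartesian cells.
\<close>

theorem BC_algmor:
  assumes A: "alg (Dom K p2) A"
  shows "algmor (Cod K p1) (fob (DelBar K pb cm f1) (r.PB A)) (beck_chevalley K pb Pi p1 p2 f2 f1 (fst A)) (l.PB (fob (DelBar K pb cm f2) A))"
proof -
  define y where "y = fst A"
  have y [simp]: "y \<in> Arr K" "Cod K y = Dom K p2" using algD[OF A] unfolding y_def by simp_all
  define z n N where D: "z = r.zz y" "n = pr1 f1 z" "N = l.zz (pr1 f2 y)"
  have [simp]: "z \<in> Arr K" "Cod K z = Cod K p2" unfolding D(1) by simp_all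
  have [simp]: "N \<in> Arr K" "Cod K N = Cod K p1" unfolding D(3) by simp_all
  have [simp]: "n \<in> Arr K" "Cod K n = Cod K p1" "Dom K (pr2 f1 z) = Dom K n" "z \<odot> pr2 f1 z = f1 \<odot> n" "pr2 f1 z \<in> Arr K" "Cod K (pr2 f1 z) = Dom K z"
    "\<And>h. h \<in> Arr K \<Longrightarrow> Cod K h = Dom K n \<Longrightarrow> z \<odot> (pr2 f1 z \<odot> h) = f1 \<odot> (n \<odot> h)"
    unfolding D(2) by simp_all
  note [simp] = D[symmetric]
  note bc [simp] = BC_simps(2-5)[OF y, folded D, unfolded D(2)[symmetric]]
  have [simp]: "N \<odot> (bc y \<odot> h) = n \<odot> h" if "h \<in> Arr K" "Cod K h = Dom K n" for h
    using that by (simp add: Comp_reassoc[OF bc(4)])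
  note bev = BC_ev[OF y, folded D, unfolded D(2)[symmetric]]
  note P = r.PB_simps(1)[OF A, folded y_def, folded D(1)] r.PB_alg[OF A]
  have P2: "alg (Cod K f1) (r.PB A)" using P(2) by simp
  have A2: "alg (Cod K f2) A" using A by simp
  define C L where CL: "C = fob (DelBar K pb cm f1) (r.PB A)" "L = fob (DelBar K pb cm f2) A"
  note C = DelBar_simps[OF f_simps(4) P2, unfolded P(1), folded CL D, unfolded D(2)[symmetric], simplified]
  note L = DelBar_simps[OF f_simps(1) A2, folded CL y_def, simplified]
  note LP = l.PB_simps(1)[OF L(2), unfolded L(1), folded D] l.PB_alg[OF L(2)]
  have "algmor (Cod K p1) C (fst C, bc y, fst (l.PB L)) (l.PB L)"
  proof (rule algmorI[OF C(2) LP(2)])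
    fix w \<beta> assume "lift_problem K (fst C) w \<beta>"
    then have lp: "lift_problem K n w \<beta>" unfolding C(1) .
    note [simp] = lift_problemD[OF lp] lift_problem_ends[OF lp]
    have lp': "lift_problem K N (bc y \<odot> w) \<beta>" by (simp add: lift_problem_def)
    have lp2: "lift_problem K z (pr2 f1 z \<odot> w) (f1 \<rhd> \<beta>)" by (simp add: lift_problem_def)
    note a1 [simp] = act_simps[OF C(2), unfolded C(1), OF lp]
    note a2 [simp] = l.pact_simps[OF L(2), unfolded L(1) D(3)[symmetric], OF lp']
    show "bc y \<odot> act (Cod K p1) C w \<beta> = l.pact L (bc y \<odot> w) \<beta>"
    proof (rule l.ev_eqI[of "pr1 f2 y"])
      define b e h where beh: "b = Src K \<beta>" "e = pr1 p1 b" "h = pr2 p1 b"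
      have [simp]: "b \<in> Arr K" "Dom K b = Dom K w" "Cod K b = Cod K p1" unfolding beh(1) by simp_all
      have [simp]: "Src K \<beta> = b" by (simp add: beh)
      have [simp]: "e \<in> Arr K" "h \<in> Arr K" "Cod K e = Dom K p1" "Dom K h = Dom K e" "Cod K h = Dom K w" "p1 \<odot> e = b \<odot> h"
        unfolding beh(2,3) by simp_all
      have g: "\<beta> \<lhd> h \<in> Cell K" "Src K (\<beta> \<lhd> h) = p1 \<odot> e" by simp_all
      define e' where "e' = Tgt K (\<chi>1 e (\<beta> \<lhd> h))"
      note o1 = split_opfibD(1-3)[OF l.opfib _ _ g, simplified] split_opfib_ends[OF l.opfib l.p _ _ g, simplified, folded e'_def, simplified]
      note [simp] = o1 e'_def[symmetric]
      have mor: "f2 \<rhd> \<chi>1 e (\<beta> \<lhd> h) = \<chi>2 (f2 \<odot> e) (f1 \<rhd> (\<beta> \<lhd> h))"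
        by (rule split_opfib_mor_cleavage[OF opfib_mor l.opfib r.opfib]) simp_all
      have tmor: "Tgt K (\<chi>2 (f2 \<odot> e) (f1 \<rhd> (\<beta> \<lhd> h))) = f2 \<odot> e'" using arg_cong[OF mor, of "Tgt K"] by simp
      define E where "E = l.ev (pr1 f2 y) e' (bc y \<odot> (w \<odot> h))"
      have E [simp]: "E \<in> Arr K" "Dom K E = Dom K e" "Cod K E = Dom K (pr1 f2 y)" "pr1 f2 y \<odot> E = e'"
        unfolding E_def using l.ev_simps[of "pr1 f2 y" e' "bc y \<odot> (w \<odot> h)"] by simp_all
      have E2: "pr2 f2 y \<odot> E = r.ev y (f2 \<odot> e') (pr2 f1 z \<odot> (w \<odot> h))"
        unfolding E_def by (rule bev) simp_all
      have lpE: "lift_problem K (pr1 f2 y) E (\<chi>1 e (\<beta> \<lhd> h))" by (simp add: lift_problem_def)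
      have C3: "pr2 f1 z \<odot> (act (Cod K p1) C w \<beta> \<odot> h) = r.pact A (pr2 f1 z \<odot> w) (f1 \<rhd> \<beta>) \<odot> h"
        using C(3)[OF lp] by (simp add: Comp_reassoc)
      have lhs: "pr2 f2 y \<odot> l.ev (pr1 f2 y) e (bc y \<odot> (act (Cod K p1) C w \<beta> \<odot> h))
         = act (Dom K p2) A (r.ev y (f2 \<odot> e') (pr2 f1 z \<odot> (w \<odot> h))) (f2 \<rhd> \<chi>1 e (\<beta> \<lhd> h))"
      proof -
        have "n \<odot> (act (Cod K p1) C w \<beta> \<odot> h) = b \<odot> h" by (simp add: Comp_reassoc[OF a1(4)])
        then have "pr2 f2 y \<odot> l.ev (pr1 f2 y) e (bc y \<odot> (act (Cod K p1) C w \<beta> \<odot> h)) = r.ev y (f2 \<odot> e) (pr2 f1 z \<odot> (act (Cod K p1) C w \<beta> \<odot> h))"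
          by (intro bev) simp_all
        also have "\<dots> = r.ev (fst A) (f2 \<odot> e) (r.pact A (pr2 f1 z \<odot> w) (f1 \<rhd> \<beta>) \<odot> h)" unfolding C3 y_def ..
        also have "\<dots> = act (Dom K p2) A (r.ev (fst A) (Tgt K (\<chi>2 (f2 \<odot> e) ((f1 \<rhd> \<beta>) \<lhd> h))) ((pr2 f1 z \<odot> w) \<odot> h)) (\<chi>2 (f2 \<odot> e) ((f1 \<rhd> \<beta>) \<lhd> h))"
          by (rule r.pact_ev[OF A]) (use lp2 in \<open>simp_all flip: y_def\<close>)
        finally show ?thesis by (simp add: mor tmor flip: y_def)
      qed
      have rhs: "pr2 f2 y \<odot> l.ev (pr1 f2 y) e (l.pact L (bc y \<odot> w) \<beta> \<odot> h)
         = act (Dom K p2) A (r.ev y (f2 \<odot> e') (pr2 f1 z \<odot> (w \<odot> h))) (f2 \<rhd> \<chi>1 e (\<beta> \<lhd> h))"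
      proof -
        have "l.ev (pr1 f2 y) e (l.pact L (bc y \<odot> w) \<beta> \<odot> h) = act (Dom K p1) L E (\<chi>1 e (\<beta> \<lhd> h))"
          using l.pact_ev[OF L(2), unfolded L(1) D(3)[symmetric], OF lp', of h e] by (simp add: E_def)
        then show ?thesis using L(3)[OF lpE] by (simp add: E2)
      qed
      have nb: "n \<odot> (act (Cod K p1) C w \<beta> \<odot> h) = b \<odot> h" "N \<odot> (l.pact L (bc y \<odot> w) \<beta> \<odot> h) = b \<odot> h"
        by (simp_all add: Comp_reassoc[OF a1(4)] Comp_reassoc[OF a2(4)])
      have ev1: "l.ev (pr1 f2 y) e v \<in> Arr K" "Dom K (l.ev (pr1 f2 y) e v) = Dom K v" "Cod K (l.ev (pr1 f2 y) e v) = Dom K (pr1 f2 y)" "pr1 f2 y \<odot> l.ev (pr1 f2 y) e v = e"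
        if "v \<in> Arr K" "Dom K e = Dom K v" "Cod K v = Dom K N" "b \<odot> h = N \<odot> v" for v
        using l.ev_simps[of "pr1 f2 y" e v] that by simp_all
      have "l.ev (pr1 f2 y) e (bc y \<odot> (act (Cod K p1) C w \<beta> \<odot> h)) = l.ev (pr1 f2 y) e (l.pact L (bc y \<odot> w) \<beta> \<odot> h)"
        by (rule pr_eqI[of f2 y]) (simp_all add: lhs rhs ev1 nb)
      then show "l.ev (pr1 f2 y) (pr1 p1 b) ((bc y \<odot> act (Cod K p1) C w \<beta>) \<odot> pr2 p1 b) = l.ev (pr1 f2 y) (pr1 p1 b) (l.pact L (bc y \<odot> w) \<beta> \<odot> pr2 p1 b)"
        unfolding beh(2,3)[symmetric] by simp
      show "l.zz (pr1 f2 y) \<odot> (bc y \<odot> act (Cod K p1) C w \<beta>) = b" "l.zz (pr1 f2 y) \<odot> l.pact L (bc y \<odot> w) \<beta> = b" by simp_all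
    qed simp_all
  qed (simp_all add: C LP)
  then show ?thesis using BC_simps(1)[OF y, folded D, unfolded D(2)[symmetric]] C(1) LP(1) unfolding CL y_def by simp
qed

text \<open>
  The part
  \<open>\<Pi>\<^bsub>p1\<^esub> \<Delta>\<^bsub>s1\<^esub> \<cong> \<Delta>\<^bsub>f1\<^esub> \<Pi>\<^bsub>p2\<^esub> \<Delta>\<^bsub>s2\<^esub>\<close>
  of \<phi>, over the domain of \<open>t\<^sub>1\<close>.
\<close>

definition comparison :: "'a \<Rightarrow> 'a \<Rightarrow> 'a sarr" where
  "comparison s2 x = arr_inv (slice K (Cod K p1)) (beck_chevalley K pb Pi p1 p2 f2 f1 (pr1 s2 x)) \<odot>\<^bsub>slice K (Cod K p1)\<^esub> farr (rfun (Pi p1)) (Del_comp K pb s2 f2 x)"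

lemma comparison_algmor:
  assumes s2: "s2 \<in> Arr K" "Dom K s2 = Dom K p2" and A: "alg (Cod K s2) A"
  shows "algmor (Cod K p1) (l.PB (fob (DelBar K pb cm (s2 \<odot> f2)) A)) (comparison s2 (fst A)) (fob (DelBar K pb cm f1) (r.PB (fob (DelBar K pb cm s2) A)))"
proof -
  note S = DelBar_simps[OF s2(1) A, unfolded s2(2)]
  note [simp] = s2 algD(1,2)[OF A]
  have dc: "algmor (Dom K p1) (fob (DelBar K pb cm (s2 \<odot> f2)) A) (Del_comp K pb s2 f2 (fst A)) (fob (DelBar K pb cm f2) (fob (DelBar K pb cm s2) A))"
    using Del_comp_algmor[OF s2(1) _ _ A, of f2] by simp
  define y where "y = pr1 s2 (fst A)"
  have y: "y \<in> Arr K" "Cod K y = Dom K p2" unfolding y_def by simp_all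
  have "algmor (Cod K p1) (l.PB (fob (DelBar K pb cm f2) (fob (DelBar K pb cm s2) A))) (arr_inv (slice K (Cod K p1)) (beck_chevalley K pb Pi p1 p2 f2 f1 y)) (fob (DelBar K pb cm f1) (r.PB (fob (DelBar K pb cm s2) A)))"
    unfolding bci(1)[OF y]
    by (rule algmor_inverse[OF BC_algmor[OF S(2), unfolded S(1), folded y_def, unfolded BC_simps(1)[OF y]]]) (use bci(2-7)[OF y] in simp_all)
  from algmor_comp[OF l.PB_mor[OF dc] this] show ?thesis unfolding comparison_def y_def .
qed

lemma comparison_nat:
  assumes s2: "s2 \<in> Arr K" "Dom K s2 = Dom K p2"
  shows "is_nat2 (slice K (Cod K s2)) (slice K (Cod K p1)) (rfun (Pi p1) \<circ>\<^sub>2 Del K pb (s2 \<odot> f2)) (Del K pb f1 \<circ>\<^sub>2 rfun (Pi p2) \<circ>\<^sub>2 Del K pb s2) (comparison s2)"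
proof -
  let ?S = "slice K (Cod K p1)" and ?S2 = "slice K (Cod K s2)"
  note [simp] = s2
  have S: "two_category ?S2" "two_category (slice K (Dom K p2))" "two_category (slice K (Cod K p2))" "two_category (slice K (Dom K p1))" "two_category ?S"
    by (rule two_category_slice; simp)+
  note G1 = adj2D(2)[OF l.adj] and G2 = adj2D(2)[OF r.adj]
  have F1: "is_fun2 (slice K (Cod K p2)) ?S (Del K pb f1)" using Del_fun2[of f1] by simp
  have F2: "is_fun2 (slice K (Dom K p2)) (slice K (Dom K p1)) (Del K pb f2)" using Del_fun2[of f2] by simp
  have F3: "is_fun2 ?S2 (slice K (Dom K p2)) (Del K pb s2)" using Del_fun2[of s2] by simp
  have F4: "is_fun2 ?S2 (slice K (Dom K p1)) (Del K pb (s2 \<odot> f2))" using Del_fun2[of "s2 \<odot> f2"] by simp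
  have k: "is_nat2 ?S2 ?S (rfun (Pi p1) \<circ>\<^sub>2 Del K pb (s2 \<odot> f2)) (rfun (Pi p1) \<circ>\<^sub>2 (Del K pb f2 \<circ>\<^sub>2 Del K pb s2))
     (\<lambda>x. farr (rfun (Pi p1)) (Del_comp K pb s2 f2 x))"
    by (rule is_nat2_whisker_l[OF _ F4 is_fun2_comp[OF F3 F2 S(1)] G1 S(1,4)])
      (use Del_comp_nat[of s2 f2] in simp)
  have b: "is_nat2 ?S2 ?S (rfun (Pi p1) \<circ>\<^sub>2 Del K pb f2 \<circ>\<^sub>2 Del K pb s2) (Del K pb f1 \<circ>\<^sub>2 rfun (Pi p2) \<circ>\<^sub>2 Del K pb s2)
     (\<lambda>x. arr_inv ?S (beck_chevalley K pb Pi p1 p2 f2 f1 (fob (Del K pb s2) x)))"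
    by (rule is_nat2_whisker_r[OF BC_inv_nat F3 S(1)])
  have "is_nat2 ?S2 ?S (rfun (Pi p1) \<circ>\<^sub>2 Del K pb (s2 \<odot> f2)) (Del K pb f1 \<circ>\<^sub>2 rfun (Pi p2) \<circ>\<^sub>2 Del K pb s2)
     (\<lambda>x. arr_inv ?S (beck_chevalley K pb Pi p1 p2 f2 f1 (fob (Del K pb s2) x)) \<odot>\<^bsub>?S\<^esub> farr (rfun (Pi p1)) (Del_comp K pb s2 f2 x))"
    by (rule is_nat2_comp[OF _ b is_fun2_comp[OF F4 G1 S(1)] _ _ S(1,5)])
      (use k is_fun2_comp[OF F3 is_fun2_comp[OF F2 G1 S(2)] S(1)] is_fun2_comp[OF F3 is_fun2_comp[OF G2 F1 S(2)] S(1)] in \<open>simp_all add: comp_fun2_assoc\<close>)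
  then show ?thesis unfolding comparison_def[abs_def] by simp
qed

end

section \<open>Polynomial 2-functors and their lifts\<close>

lemma is_fun2_comp_weak:
  assumes F: "is_fun2 C D F" and G: "is_fun2 D E G" and C: "\<And>\<alpha>. \<alpha> \<in> Cell C \<Longrightarrow> Src C \<alpha> \<in> Arr C"
  shows "is_fun2 C E (G \<circ>\<^sub>2 F)"
  by (rule is_fun2I) (simp_all add: is_fun2D[OF F] is_fun2D[OF G] C)

lemma fun2_eq_comp: "\<lbrakk>fun2_eq D G G'; is_fun2 C D H\<rbrakk> \<Longrightarrow> fun2_eq C (G \<circ>\<^sub>2 H) (G' \<circ>\<^sub>2 H)"
  unfolding fun2_eq_def using is_fun2D[of C D H] by simp

lemma (in two_category) Sig_Comp:
  assumes "f \<in> Arr K" "g \<in> Arr K" "Dom K g = Cod K f"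
  shows "fun2_eq (slice K (Dom K f)) (Sig K g \<circ>\<^sub>2 Sig K f) (Sig K (g \<odot> f))"
  unfolding fun2_eq_def using assms by (auto simp: Ball_slice)

context commas
begin

lemma PhiAlg_Src: "\<alpha> \<in> Cell (PhiAlg K cm B) \<Longrightarrow> Src (PhiAlg K cm B) \<alpha> \<in> Arr (PhiAlg K cm B)"
  by (cases \<alpha>) simp

text \<open>An arrow of algebras is determined by the arrow under it, so naturality is inherited.\<close>

lemma alg_nat_lift:
  assumes \<tau>: "is_nat2 (slice K B) (slice K B') F G \<tau>"
    and F: "\<And>A u A'. farr F' (A, u, A') = (fob F' A, farr F u, fob F' A')" "\<And>A u A'. fcell F' (A, u, A') = (fob F' A, fcell F u, fob F' A')"
    and G: "\<And>A u A'. farr G' (A, u, A') = (fob G' A, farr G u, fob G' A')" "\<And>A u A'. fcell G' (A, u, A') = (fob G' A, fcell G u, fob G' A')"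
    and m: "\<And>A. alg B A \<Longrightarrow> algmor B' (fob F' A) (\<tau> (fst A)) (fob G' A)"
  shows "is_nat2 (PhiAlg K cm B) (PhiAlg K cm B') F' G' (\<lambda>A. (fob F' A, \<tau> (fst A), fob G' A))"
proof (rule is_nat2I)
  fix f assume f: "f \<in> Arr (PhiAlg K cm B)"
  with is_nat2D(4)[OF \<tau>, of "mid f"] algmor_slice[of B "fst f" "mid f" "snd (snd f)"]
  show "(fob F' (Cod (PhiAlg K cm B) f), \<tau> (fst (Cod (PhiAlg K cm B) f)), fob G' (Cod (PhiAlg K cm B) f)) \<odot>\<^bsub>PhiAlg K cm B'\<^esub> farr F' f
    = farr G' f \<odot>\<^bsub>PhiAlg K cm B'\<^esub> (fob F' (Dom (PhiAlg K cm B) f), \<tau> (fst (Dom (PhiAlg K cm B) f)), fob G' (Dom (PhiAlg K cm B) f))"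
    by (cases f) (simp add: F G del: slice_simps)
next
  fix f assume f: "f \<in> Cell (PhiAlg K cm B)"
  with is_nat2D(5)[OF \<tau>, of "mid f"] algmor_slice[of B "fst f" "Src (slice K B) (mid f)" "snd (snd f)"]
  show "(fob F' (Cod (PhiAlg K cm B) (Src (PhiAlg K cm B) f)), \<tau> (fst (Cod (PhiAlg K cm B) (Src (PhiAlg K cm B) f))), fob G' (Cod (PhiAlg K cm B) (Src (PhiAlg K cm B) f))) \<rhd>\<^bsub>PhiAlg K cm B'\<^esub> fcell F' f
    = fcell G' f \<lhd>\<^bsub>PhiAlg K cm B'\<^esub> (fob F' (Dom (PhiAlg K cm B) (Src (PhiAlg K cm B) f)), \<tau> (fst (Dom (PhiAlg K cm B) (Src (PhiAlg K cm B) f))), fob G' (Dom (PhiAlg K cm B) (Src (PhiAlg K cm B) f)))"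
    by (cases f) (simp add: F G del: slice_simps)
qed (simp add: m)

end

locale fibred_polynomial = pushforward_opfib K pb cm "pp P" "Pi (pp P)" Pi \<chi>p
  for K :: "('o, 'a, 'c) twocat" (structure) and pb :: "'a pbs" and cm :: "('a, 'c) commas" and Pi :: "'a \<Rightarrow> ('a, 'c) radj"
    and P :: "'a poly" and \<chi>p :: "('a, 'c) cleavage" +
  fixes \<chi>t :: "('a, 'c) cleavage"
  assumes P: "polynomial K pb P" and \<chi>t: "split_fib K (pt P) \<chi>t"
begin

lemma P_simps [simp]: "ps P \<in> Arr K" "pt P \<in> Arr K" "Dom K (ps P) = Dom K (pp P)" "Dom K (pt P) = Cod K (pp P)"
  using P unfolding polynomial_def by auto

abbreviation "I \<equiv> Cod K (ps P)"
abbreviation "J \<equiv> Cod K (pt P)"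
abbreviation "B \<equiv> Cod K (pp P)"
abbreviation "PF \<equiv> poly_fun K pb Pi P"
abbreviation "PFbar \<equiv> poly_bar K pb cm Pi P \<chi>p \<chi>t"
abbreviation "DB A \<equiv> fob (DelBar K pb cm (ps P)) A"
abbreviation "SB A \<equiv> fob (SigBar K cm (pt P) \<chi>t) A"

lemma PF_fun2: "is_fun2 (slice K I) (slice K J) PF"
proof -
  have S: "two_category (slice K I)" "two_category (slice K B)" by (rule two_category_slice; simp)+
  have "is_fun2 (slice K I) (slice K (Dom K (pp P))) (Del K pb (ps P))" using Del_fun2[of "ps P"] by simp
  moreover have "is_fun2 (slice K B) (slice K J) (Sig K (pt P))" using Sig_fun2[of "pt P"] by simp
  ultimately show ?thesis
    unfolding poly_fun_def comp_fun2_assoc(1)[symmetric]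
    by (intro is_fun2_comp[of _ "slice K B"] is_fun2_comp[of _ "slice K (Dom K (pp P))"] S adj2D(2)[OF adj])
qed

lemma PFbar_simps:
  "fob PFbar A = SB (PB (DB A))"
  "farr PFbar (A, u, A') = (fob PFbar A, farr PF u, fob PFbar A')"
  "fcell PFbar (A, \<sigma>, A') = (fob PFbar A, fcell PF \<sigma>, fob PFbar A')"
  by (simp_all add: poly_bar_def poly_fun_def SigBar_def PiBar_def DelBar_def alg_lift_def)

lemma DB_simps: "alg I A \<Longrightarrow> alg (Dom K (pp P)) (DB A)" "alg I A \<Longrightarrow> fst (DB A) = pr1 (ps P) (fst A)"
  using DelBar_simps(1,2)[of "ps P" A] by simp_all

lemma PDB_simps: "alg I A \<Longrightarrow> alg B (PB (DB A))" "alg I A \<Longrightarrow> fst (PB (DB A)) = zz (pr1 (ps P) (fst A))"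
  using DB_simps[of A] PB_alg[of "DB A"] PB_simps(1)[of "DB A"] by simp_all

lemma PDB_mor: "algmor I A u A' \<Longrightarrow> algmor B (PB (DB A)) (farr (rfun (Pi (pp P))) (farr (Del K pb (ps P)) u)) (PB (DB A'))"
  using DelBar_mor[of "ps P" A u A'] PB_mor by simp

theorem PFbar_fun2: "is_fun2 (PhiAlg K cm I) (PhiAlg K cm J) PFbar"
proof -
  have D: "is_fun2 (PhiAlg K cm I) (PhiAlg K cm (Dom K (pp P))) (DelBar K pb cm (ps P))" using DelBar_fun2[of "ps P"] by simp
  have S: "is_fun2 (PhiAlg K cm B) (PhiAlg K cm J) (SigBar K cm (pt P) \<chi>t)" using SigBar_fun2[OF \<chi>t] by simp
  show ?thesis
    unfolding poly_bar_def comp_fun2_assoc(1)[symmetric]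
    by (rule is_fun2_comp_weak[OF is_fun2_comp_weak[OF D PiBar_fun2 PhiAlg_Src] S PhiAlg_Src])
qed

theorem PFbar_forget: "fun2_eq (PhiAlg K cm I) (forget \<circ>\<^sub>2 PFbar) (PF \<circ>\<^sub>2 forget)"
proof -
  have "fst (fob PFbar A) = fob PF (fst A)" if A: "alg I A" for A
    using PDB_simps[OF A] SigBar_simps(1)[OF \<chi>t, of "PB (DB A)"] by (simp add: PFbar_simps poly_fun_def)
  then show ?thesis unfolding fun2_eq_def forget_def by (auto simp: PFbar_simps)
qed

end

lemma fibred_polynomialI:
  assumes "two_category K" "chosen_pullbacks K pb" "chosen_commas K cm" "chosen_Pi K pb Pi"
    and "polynomial K pb P" "split_opfib K (pp P) \<chi>p" "split_fib K (pt P) \<chi>t"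
  shows "fibred_polynomial K pb cm Pi P \<chi>p \<chi>t"
proof -
  interpret two_category K by fact
  show ?thesis
    using assms
    by unfold_locales (auto simp: polynomial_def chosen_Pi_def)
qed

locale fibred_polynomial_mor = opfib_square K pb cm Pi "pp P" "pp Q" \<chi>p1 \<chi>p2 f2 f1
    + p: fibred_polynomial K pb cm Pi P \<chi>p1 \<chi>t1 + q: fibred_polynomial K pb cm Pi Q \<chi>p2 \<chi>t2
  for K :: "('o, 'a, 'c) twocat" (structure) and pb :: "'a pbs" and cm :: "('a, 'c) commas" and Pi :: "'a \<Rightarrow> ('a, 'c) radj"
    and P Q :: "'a poly" and \<chi>p1 \<chi>t1 \<chi>p2 \<chi>t2 :: "('a, 'c) cleavage" and f2 f1 :: 'a +
  assumes f: "cart_poly_mor K P Q f2 f1"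
    and ft: "split_fib_mor K (pt P) \<chi>t1 (pt Q) \<chi>t2 f1 (Id1 K (Cod K (pt P)))"
begin

lemma Q_P: "ps Q \<odot> f2 = ps P" "pt Q \<odot> f1 = pt P"
  using f unfolding cart_poly_mor_def by blast+

lemma Q_P_Cod [simp]: "Cod K (ps P) = Cod K (ps Q)" "Cod K (pt P) = Cod K (pt Q)"
  using Comp_simps(3)[of f2 "ps Q"] Comp_simps(3)[of f1 "pt Q"] Q_P by simp_all

abbreviation "\<phi> \<equiv> poly_nat K pb Pi P Q f2 f1"

text \<open>
  The invertible part over the domain of \<open>t\<^sub>1\<close>, followed by the counit of
  \<Sigma> \<stileturn> \<Delta>.
\<close>

lemma phi_eq:
  "\<phi> x = farr (Sig K (pt Q)) (Sig_Del_counit K pb f1 (r.zz (pr1 (ps Q) x))) \<odot>\<^bsub>slice K (Cod K (pt Q))\<^esub> farr (Sig K (pt P)) (comparison (ps Q) x)"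
  unfolding poly_nat_def Let_def comparison_def by simp

theorem phi_nat: "is_nat2 (slice K q.I) (slice K q.J) p.PF q.PF \<phi>"
proof -
  let ?S = "slice K q.I" and ?S2 = "slice K q.J" and ?S3 = "slice K q.B"
  have S: "two_category ?S" "two_category ?S3" "two_category (slice K p.B)" "two_category ?S2" "two_category (slice K (Dom K (pp Q)))"
    by (rule two_category_slice; simp)+
  note G1 = adj2D(2)[OF l.adj] and G2 = adj2D(2)[OF r.adj]
  have F1: "is_fun2 ?S3 (slice K p.B) (Del K pb f1)" using Del_fun2[of f1] by simp
  have F3: "is_fun2 ?S (slice K (Dom K (pp Q))) (Del K pb (ps Q))" using Del_fun2[of "ps Q"] by simp
  have F4: "is_fun2 ?S (slice K (Dom K (pp P))) (Del K pb (ps P))" using Del_fun2[of "ps P"] by simp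
  have T1: "is_fun2 (slice K p.B) ?S2 (Sig K (pt P))" using Sig_fun2[of "pt P"] by simp
  have T2: "is_fun2 ?S3 ?S2 (Sig K (pt Q))" using Sig_fun2[of "pt Q"] by simp
  have T3: "is_fun2 (slice K p.B) ?S3 (Sig K f1)" using Sig_fun2[of "f1"] by simp
  note H = is_fun2_comp[OF F3 G2 S(1)]
  note FH = is_fun2_comp[OF H F1 S(1)]
  have 1: "is_nat2 ?S ?S2 (Sig K (pt P) \<circ>\<^sub>2 (rfun (Pi (pp P)) \<circ>\<^sub>2 Del K pb (ps P)))
     (Sig K (pt P) \<circ>\<^sub>2 (Del K pb f1 \<circ>\<^sub>2 (rfun (Pi (pp Q)) \<circ>\<^sub>2 Del K pb (ps Q)))) (\<lambda>x. farr (Sig K (pt P)) (comparison (ps Q) x))"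
    using is_nat2_whisker_l[OF comparison_nat[of "ps Q", unfolded Q_P comp_fun2_assoc(1)[symmetric]] is_fun2_comp[OF F4 G1 S(1)] FH T1 S(1,3)] by simp
  have 2: "is_nat2 ?S3 ?S2 (Sig K (pt Q) \<circ>\<^sub>2 (Sig K f1 \<circ>\<^sub>2 Del K pb f1)) (Sig K (pt Q) \<circ>\<^sub>2 id_fun2) (\<lambda>z. farr (Sig K (pt Q)) (Sig_Del_counit K pb f1 z))"
    by (rule is_nat2_whisker_l[OF _ is_fun2_comp[OF F1 T3 S(2)] _ T2 S(2,2)])
      (use Sig_Del_counit_nat[of f1] in \<open>simp_all add: is_fun2_def hom1_iff hom2_iff two_category.Cell_ends[OF S(2)]\<close>)
  have 3: "is_nat2 ?S ?S2 (Sig K (pt Q) \<circ>\<^sub>2 (Sig K f1 \<circ>\<^sub>2 Del K pb f1) \<circ>\<^sub>2 (rfun (Pi (pp Q)) \<circ>\<^sub>2 Del K pb (ps Q)))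
      (Sig K (pt Q) \<circ>\<^sub>2 id_fun2 \<circ>\<^sub>2 (rfun (Pi (pp Q)) \<circ>\<^sub>2 Del K pb (ps Q))) (\<lambda>x. farr (Sig K (pt Q)) (Sig_Del_counit K pb f1 (fob (rfun (Pi (pp Q)) \<circ>\<^sub>2 Del K pb (ps Q)) x)))"
    by (rule is_nat2_whisker_r[OF 2 H S(1)])
  have e: "fun2_eq ?S (Sig K (pt Q) \<circ>\<^sub>2 Sig K f1 \<circ>\<^sub>2 (Del K pb f1 \<circ>\<^sub>2 (rfun (Pi (pp Q)) \<circ>\<^sub>2 Del K pb (ps Q)))) (Sig K (pt P) \<circ>\<^sub>2 (Del K pb f1 \<circ>\<^sub>2 (rfun (Pi (pp Q)) \<circ>\<^sub>2 Del K pb (ps Q))))"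
    using fun2_eq_comp[OF Sig_Comp[of f1 "pt Q"], of "?S"] FH by (simp add: Q_P)
  have 4: "is_nat2 ?S ?S2 (Sig K (pt P) \<circ>\<^sub>2 (Del K pb f1 \<circ>\<^sub>2 (rfun (Pi (pp Q)) \<circ>\<^sub>2 Del K pb (ps Q)))) q.PF
     (\<lambda>x. farr (Sig K (pt Q)) (Sig_Del_counit K pb f1 (r.zz (pr1 (ps Q) x))))"
    by (rule is_nat2_cong[OF 3 _ _ _ S(1)]) (use e in \<open>simp_all add: comp_fun2_assoc poly_fun_def fun2_eq_def\<close>)
  show ?thesis
    unfolding phi_eq[abs_def]
    by (rule is_nat2_comp[OF _ 4 _ _ _ S(1,4)])
      (use 1 p.PF_fun2 q.PF_fun2 is_fun2_comp[OF FH T1 S(1)] in \<open>simp_all add: poly_fun_def comp_fun2_assoc\<close>)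
qed

theorem phi_algmor:
  assumes A: "alg q.I A"
  shows "algmor q.J (fob p.PFbar A) (\<phi> (fst A)) (fob q.PFbar A)"
proof -
  note q = q.DB_simps[OF A] q.PDB_simps[OF A]
  have c: "algmor p.B (l.PB (p.DB A)) (comparison (ps Q) (fst A)) (fob (DelBar K pb cm f1) (r.PB (q.DB A)))"
    using comparison_algmor[of "ps Q" A] A by (simp add: Q_P)
  have "algmor (Cod K (pt P)) (fob p.PFbar A) (farr (Sig K (pt P)) (comparison (ps Q) (fst A))) (p.SB (fob (DelBar K pb cm f1) (r.PB (q.DB A))))"
    unfolding p.PFbar_simps(1) by (rule SigBar_mor[OF p.\<chi>t]) (use c in simp)
  moreover have "algmor q.J (p.SB (fob (DelBar K pb cm f1) (r.PB (q.DB A)))) (farr (Sig K (pt Q)) (Sig_Del_counit K pb f1 (fst (r.PB (q.DB A))))) (fob q.PFbar A)"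
    unfolding q.PFbar_simps(1) by (rule counit_algmor[OF ft p.\<chi>t q.\<chi>t]) (use q in simp)
  ultimately show ?thesis
    using algmor_comp unfolding phi_eq q(4) by simp
qed

end

section \<open>Comma objects in slices\<close>

context two_category
begin

lemma is_commaD:
  assumes "is_comma K f g d q l"
  shows "f \<in> Arr K" "g \<in> Arr K" "Cod K f = Cod K g" "d \<in> Arr K" "q \<in> Arr K" "Dom K q = Dom K d" "Cod K d = Dom K f" "Cod K q = Dom K g"
    "l \<in> Cell K" "Src K l = f \<odot> d" "Tgt K l = g \<odot> q"
    and "\<lbrakk>u \<in> Arr K; v \<in> Arr K; Dom K u = Dom K v; Cod K u = Dom K f; Cod K v = Dom K g; \<beta> \<in> hom2 K (f \<odot> u) (g \<odot> v)\<rbrakk>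
      \<Longrightarrow> \<exists>!w. w \<in> hom1 K (Dom K u) (Dom K d) \<and> d \<odot> w = u \<and> q \<odot> w = v \<and> l \<lhd> w = \<beta>"
    and "\<lbrakk>w \<in> Arr K; w' \<in> Arr K; Dom K w = Dom K w'; Cod K w = Dom K d; Cod K w' = Dom K d;
      \<zeta> \<in> hom2 K (d \<odot> w) (d \<odot> w'); \<xi> \<in> hom2 K (q \<odot> w) (q \<odot> w'); (l \<lhd> w') \<bullet> (f \<rhd> \<zeta>) = (g \<rhd> \<xi>) \<bullet> (l \<lhd> w)\<rbrakk>
      \<Longrightarrow> \<exists>!\<theta>. \<theta> \<in> hom2 K w w' \<and> d \<rhd> \<theta> = \<zeta> \<and> q \<rhd> \<theta> = \<xi>"
proof -
  show "f \<in> Arr K" "g \<in> Arr K" "Cod K f = Cod K g" "d \<in> Arr K" "q \<in> Arr K" "Dom K q = Dom K d" "Cod K d = Dom K f" "Cod K q = Dom K g"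
    "l \<in> Cell K" "Src K l = f \<odot> d" "Tgt K l = g \<odot> q"
    using assms unfolding is_comma_def hom2_iff by (elim conjE; simp)+
  show "\<lbrakk>u \<in> Arr K; v \<in> Arr K; Dom K u = Dom K v; Cod K u = Dom K f; Cod K v = Dom K g; \<beta> \<in> hom2 K (f \<odot> u) (g \<odot> v)\<rbrakk>
      \<Longrightarrow> \<exists>!w. w \<in> hom1 K (Dom K u) (Dom K d) \<and> d \<odot> w = u \<and> q \<odot> w = v \<and> l \<lhd> w = \<beta>"
    using assms unfolding is_comma_def by blast
  show "\<lbrakk>w \<in> Arr K; w' \<in> Arr K; Dom K w = Dom K w'; Cod K w = Dom K d; Cod K w' = Dom K d;
      \<zeta> \<in> hom2 K (d \<odot> w) (d \<odot> w'); \<xi> \<in> hom2 K (q \<odot> w) (q \<odot> w'); (l \<lhd> w') \<bullet> (f \<rhd> \<zeta>) = (g \<rhd> \<xi>) \<bullet> (l \<lhd> w)\<rbrakk>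
      \<Longrightarrow> \<exists>!\<theta>. \<theta> \<in> hom2 K w w' \<and> d \<rhd> \<theta> = \<zeta> \<and> q \<rhd> \<theta> = \<xi>"
    using assms unfolding is_comma_def by blast
qed

end

context pullbacks_commas
begin

text \<open>
  The comma object in K of the underlying arrows contains 2-cells l that are not over identities of B. Those
  over identities are cut out by pulling back, along
  \<open>B \<rightarrow> 1\<^sub>B \<down> 1\<^sub>B\<close>, the arrow classifying z l.
\<close>

lemma slice_comma:
  assumes F: "(x, f, z) \<in> Arr (slice K B)" and G: "(y, g, z) \<in> Arr (slice K B)" and B [simp]: "B \<in> Ob K"
  shows "\<exists>d q l. is_comma (slice K B) (x, f, z) (y, g, z) d q l"
proof -
  let ?S = "slice K B"
  have [simp]: "x \<in> Arr K" "y \<in> Arr K" "z \<in> Arr K" "Cod K x = B" "Cod K y = B" "Cod K z = B" "f \<in> Arr K" "g \<in> Arr K"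
    "Dom K f = Dom K x" "Dom K g = Dom K y" "Cod K f = Dom K z" "Cod K g = Dom K z" and zf [simp]: "z \<odot> f = x" and zg [simp]: "z \<odot> g = y"
    using F G by simp_all
  have [simp]: "z \<odot> (f \<odot> h) = x \<odot> h" if "h \<in> Arr K" "Cod K h = Dom K x" for h using that by (simp add: Comp_reassoc[OF zf])
  have [simp]: "z \<odot> (g \<odot> h) = y \<odot> h" if "h \<in> Arr K" "Cod K h = Dom K y" for h using that by (simp add: Comp_reassoc[OF zg])
  have [simp]: "z \<rhd> (f \<rhd> h) = x \<rhd> h" if "h \<in> Cell K" "Cod K (Src K h) = Dom K x" for h using that by (simp add: whisker_l_reassoc[OF zf])
  have [simp]: "z \<rhd> (g \<rhd> h) = y \<rhd> h" if "h \<in> Cell K" "Cod K (Src K h) = Dom K y" for h using that by (simp add: whisker_l_reassoc[OF zg])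
  obtain d q l where C: "is_comma K f g d q l"
    using chosen_commas[unfolded chosen_commas_def, rule_format, of f g] by (auto split: prod.splits)
  have c [simp]: "d \<in> Arr K" "q \<in> Arr K" "Dom K q = Dom K d" "Cod K d = Dom K x" "Cod K q = Dom K y" "l \<in> Cell K" "Src K l = f \<odot> d" "Tgt K l = g \<odot> q"
    using is_commaD(4-11)[OF C] by simp_all
  define o1 where "o1 = Id1 K B"
  have [simp]: "o1 \<in> Arr K" "Dom K o1 = B" "Cod K o1 = B" "\<And>h. h \<in> Arr K \<Longrightarrow> Cod K h = B \<Longrightarrow> o1 \<odot> h = h"
     "\<And>h. h \<in> Cell K \<Longrightarrow> Cod K (Src K h) = B \<Longrightarrow> o1 \<rhd> h = h"
    unfolding o1_def by simp_all
  \<comment> \<open>h classifies the cell z l and i the identity cell of \<open>1\<^sub>B\<close>.\<close>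
  define h where "h = carr B o1 (x \<odot> d) (y \<odot> q) (z \<rhd> l)"
  have h [simp]: "h \<in> Arr K" "Dom K h = Dom K d" "Cod K h = Dom K (cd B o1)" and h1: "cd B o1 \<odot> h = x \<odot> d" and h2: "cq B o1 \<odot> h = y \<odot> q" and h3: "cl B o1 \<lhd> h = z \<rhd> l"
    unfolding h_def by simp_all
  define i where "i = carr B o1 o1 o1 (Id2 K o1)"
  have i [simp]: "i \<in> Arr K" "Dom K i = B" "Cod K i = Dom K (cd B o1)" and i1: "cd B o1 \<odot> i = o1" and i2: "cq B o1 \<odot> i = o1" and i3: "cl B o1 \<lhd> i = Id2 K o1"
    unfolding i_def by simp_all
  define r j where rj: "r = pr1 h i" "j = pr2 h i"
  have r [simp]: "r \<in> Arr K" "j \<in> Arr K" "Dom K r = Dom K j" "Cod K r = Dom K d" "Cod K j = B" and hr: "h \<odot> r = i \<odot> j"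
    unfolding rj by simp_all
  note P = is_pb[of h i, simplified, folded rj]
  have ij: "cd B o1 \<odot> (i \<odot> v) = v" "cq B o1 \<odot> (i \<odot> v) = v" "(cl B o1 \<lhd> i) \<lhd> v = Id2 K v" if "v \<in> Arr K" "Cod K v = B" for v
    using that by (simp_all add: Comp_reassoc[OF i1] Comp_reassoc[OF i2] i3)
  have xdr: "x \<odot> (d \<odot> r) = j" "y \<odot> (q \<odot> r) = j"
  proof -
    have "x \<odot> (d \<odot> r) = cd B o1 \<odot> (h \<odot> r)" by (simp add: Comp_reassoc[OF h1])
    then show "x \<odot> (d \<odot> r) = j" by (simp add: hr ij)
    have "y \<odot> (q \<odot> r) = cq B o1 \<odot> (h \<odot> r)" by (simp add: Comp_reassoc[OF h2])
    then show "y \<odot> (q \<odot> r) = j" by (simp add: hr ij)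
  qed
  have zlr: "z \<rhd> (l \<lhd> r) = Id2 K j"
  proof -
    have "z \<rhd> (l \<lhd> r) = cl B o1 \<lhd> (h \<odot> r)" by (simp add: h3)
    then show ?thesis by (simp add: hr ij)
  qed
  let ?d = "(j, d \<odot> r, x)" and ?q = "(j, q \<odot> r, y)" and ?l = "(j, l \<lhd> r, z)" and ?f = "(x, f, z)" and ?g = "(y, g, z)"
  have A1: "\<exists>!w. w \<in> hom1 ?S (Dom ?S u) (Dom ?S ?d) \<and> ?d \<odot>\<^bsub>?S\<^esub> w = u
      \<and> ?q \<odot>\<^bsub>?S\<^esub> w = v \<and> ?l \<lhd>\<^bsub>?S\<^esub> w = \<beta>"
    if u: "u \<in> Arr ?S" and v: "v \<in> Arr ?S" and uv: "Dom ?S u = Dom ?S v" "Cod ?S u = Dom ?S ?f" "Cod ?S v = Dom ?S ?g"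
      and b: "\<beta> \<in> hom2 ?S (?f \<odot>\<^bsub>?S\<^esub> u) (?g \<odot>\<^bsub>?S\<^esub> v)" for u v \<beta>
  proof -
    obtain w u0 v0 where ue: "u = (w, u0, x)" and ve: "v = (w, v0, y)" using uv by (cases u; cases v) auto
    obtain \<sigma> where be: "\<beta> = (w, \<sigma>, z)" using b unfolding ue ve by (cases \<beta>) (auto simp: hom2_iff)
    have [simp]: "w \<in> Arr K" "Cod K w = B" "u0 \<in> Arr K" "v0 \<in> Arr K" "Dom K u0 = Dom K w" "Dom K v0 = Dom K w" "Cod K u0 = Dom K x" "Cod K v0 = Dom K y" "x \<odot> u0 = w" "y \<odot> v0 = w"
      using u v unfolding ue ve by simp_all
    have s [simp]: "\<sigma> \<in> Cell K" "Src K \<sigma> = f \<odot> u0" "Tgt K \<sigma> = g \<odot> v0" "z \<rhd> \<sigma> = Id2 K w"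
      using b unfolding ue ve be by (simp_all add: hom2_iff)
    have ex: "\<exists>!c. c \<in> hom1 K (Dom K u0) (Dom K d) \<and> d \<odot> c = u0 \<and> q \<odot> c = v0 \<and> l \<lhd> c = \<sigma>"
      by (rule is_commaD(12)[OF C]) (simp_all add: hom2_iff)
    then obtain c where c0: "c \<in> hom1 K (Dom K u0) (Dom K d) \<and> d \<odot> c = u0 \<and> q \<odot> c = v0 \<and> l \<lhd> c = \<sigma>" by blast
    then have c [simp]: "c \<in> Arr K" "Dom K c = Dom K w" "Cod K c = Dom K d" "d \<odot> c = u0" "q \<odot> c = v0" "l \<lhd> c = \<sigma>" by (simp_all add: hom1_iff)
    have hc: "h \<odot> c = i \<odot> w"
    proof (rule comma_arr_eqI[of B o1])
      have "(cl B o1 \<lhd> h) \<lhd> c = Id2 K w" unfolding h3 by simp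
      then show "cl B o1 \<lhd> (h \<odot> c) = cl B o1 \<lhd> (i \<odot> w)" by (simp add: ij)
      show "cq B o1 \<odot> (h \<odot> c) = cq B o1 \<odot> (i \<odot> w)" by (simp add: ij Comp_reassoc[OF h2])
    qed simp_all
    have exm: "\<exists>!m. m \<in> hom1 K (Dom K c) (Dom K r) \<and> r \<odot> m = c \<and> j \<odot> m = w"
      by (rule is_pullback_arr[OF P]) (simp_all add: hc)
    then obtain m where m0: "m \<in> hom1 K (Dom K c) (Dom K r) \<and> r \<odot> m = c \<and> j \<odot> m = w" by blast
    then have m [simp]: "m \<in> Arr K" "Dom K m = Dom K w" "Cod K m = Dom K j" "r \<odot> m = c" "j \<odot> m = w" by (simp_all add: hom1_iff)
    show ?thesis
    proof (rule ex1I[of _ "(w, m, j)"])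
      have "(l \<lhd> r) \<lhd> m = \<sigma>" by (simp add: whisker_r_reassoc[OF m(4)])
      then show "(w, m, j) \<in> hom1 ?S (Dom ?S u) (Dom ?S ?d) \<and> ?d \<odot>\<^bsub>?S\<^esub> (w, m, j) = u
        \<and> ?q \<odot>\<^bsub>?S\<^esub> (w, m, j) = v \<and> ?l \<lhd>\<^bsub>?S\<^esub> (w, m, j) = \<beta>"
        unfolding ue ve be by (simp add: hom1_iff)
      fix n assume n: "n \<in> hom1 ?S (Dom ?S u) (Dom ?S ?d) \<and> ?d \<odot>\<^bsub>?S\<^esub> n = u
        \<and> ?q \<odot>\<^bsub>?S\<^esub> n = v \<and> ?l \<lhd>\<^bsub>?S\<^esub> n = \<beta>"
      then obtain n0 where ne: "n = (w, n0, j)" unfolding ue ve be by (cases n) (auto simp: hom1_iff)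
      have [simp]: "n0 \<in> Arr K" "Dom K n0 = Dom K w" "Cod K n0 = Dom K j" "j \<odot> n0 = w" using n unfolding ne ue ve be by (simp_all add: hom1_iff)
      have "d \<odot> (r \<odot> n0) = u0" "q \<odot> (r \<odot> n0) = v0" "(l \<lhd> r) \<lhd> n0 = \<sigma>" using n unfolding ne ue ve be by simp_all
      then have "r \<odot> n0 \<in> hom1 K (Dom K u0) (Dom K d) \<and> d \<odot> (r \<odot> n0) = u0 \<and> q \<odot> (r \<odot> n0) = v0 \<and> l \<lhd> (r \<odot> n0) = \<sigma>"
        by (simp add: hom1_iff)
      then have "r \<odot> n0 = c" using ex c0 by blast
      then have "n0 \<in> hom1 K (Dom K c) (Dom K r) \<and> r \<odot> n0 = c \<and> j \<odot> n0 = w" by (simp add: hom1_iff)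
      then have "n0 = m" using exm m0 by blast
      then show "n = (w, m, j)" unfolding ne by simp
    qed
  qed
  have A2: "\<exists>!\<theta>. \<theta> \<in> hom2 ?S w w' \<and> ?d \<rhd>\<^bsub>?S\<^esub> \<theta> = \<zeta> \<and> ?q \<rhd>\<^bsub>?S\<^esub> \<theta> = \<xi>"
    if w: "w \<in> Arr ?S" "w' \<in> Arr ?S" and ww: "Dom ?S w = Dom ?S w'" "Cod ?S w = Dom ?S ?d" "Cod ?S w' = Dom ?S ?d"
      and z: "\<zeta> \<in> hom2 ?S (?d \<odot>\<^bsub>?S\<^esub> w) (?d \<odot>\<^bsub>?S\<^esub> w')"
      and x: "\<xi> \<in> hom2 ?S (?q \<odot>\<^bsub>?S\<^esub> w) (?q \<odot>\<^bsub>?S\<^esub> w')"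
      and eq: "(?l \<lhd>\<^bsub>?S\<^esub> w') \<bullet>\<^bsub>?S\<^esub> (?f \<rhd>\<^bsub>?S\<^esub> \<zeta>) = (?g \<rhd>\<^bsub>?S\<^esub> \<xi>) \<bullet>\<^bsub>?S\<^esub> (?l \<lhd>\<^bsub>?S\<^esub> w)" for w w' \<zeta> \<xi>
  proof -
    obtain a s s' where we: "w = (a, s, j)" "w' = (a, s', j)" using ww by (cases w; cases w') auto
    obtain Z where ze: "\<zeta> = (a, Z, x)" using z unfolding we by (cases \<zeta>) (auto simp: hom2_iff)
    obtain X where xe: "\<xi> = (a, X, y)" using x unfolding we by (cases \<xi>) (auto simp: hom2_iff)
    have [simp]: "a \<in> Arr K" "Cod K a = B" "s \<in> Arr K" "s' \<in> Arr K" "Dom K s = Dom K a" "Dom K s' = Dom K a" "Cod K s = Dom K j" "Cod K s' = Dom K j" "j \<odot> s = a" "j \<odot> s' = a"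
      using w unfolding we by simp_all
    have Z [simp]: "Z \<in> Cell K" "Src K Z = d \<odot> (r \<odot> s)" "Tgt K Z = d \<odot> (r \<odot> s')" "x \<rhd> Z = Id2 K a"
      using z unfolding we ze by (simp_all add: hom2_iff)
    have X [simp]: "X \<in> Cell K" "Src K X = q \<odot> (r \<odot> s)" "Tgt K X = q \<odot> (r \<odot> s')" "y \<rhd> X = Id2 K a"
      using x unfolding we xe by (simp_all add: hom2_iff)
    have eq': "((l \<lhd> r) \<lhd> s') \<bullet> (f \<rhd> Z) = (g \<rhd> X) \<bullet> ((l \<lhd> r) \<lhd> s)" using eq unfolding we ze xe by simp
    have ex: "\<exists>!\<theta>. \<theta> \<in> hom2 K (r \<odot> s) (r \<odot> s') \<and> d \<rhd> \<theta> = Z \<and> q \<rhd> \<theta> = X"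
      by (rule is_commaD(13)[OF C]) (simp_all add: hom2_iff eq')
    then obtain \<theta> where t0: "\<theta> \<in> hom2 K (r \<odot> s) (r \<odot> s') \<and> d \<rhd> \<theta> = Z \<and> q \<rhd> \<theta> = X" by blast
    then have t [simp]: "\<theta> \<in> Cell K" "Src K \<theta> = r \<odot> s" "Tgt K \<theta> = r \<odot> s'" "d \<rhd> \<theta> = Z" "q \<rhd> \<theta> = X" by (simp_all add: hom2_iff)
    have hs: "h \<odot> (r \<odot> s) = i \<odot> a" "h \<odot> (r \<odot> s') = i \<odot> a" by (simp_all add: Comp_reassoc[OF hr])
    have ht: "h \<rhd> \<theta> = i \<rhd> Id2 K a"
      by (rule comma_cell_eqI[of B o1]) (simp_all add: hs ij whisker_l_reassoc[OF h1] whisker_l_reassoc[OF h2])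
    have exg: "\<exists>!\<gamma>. \<gamma> \<in> Cell K \<and> Cod K (Src K \<gamma>) = Dom K r \<and> r \<rhd> \<gamma> = \<theta> \<and> j \<rhd> \<gamma> = Id2 K a"
      by (rule is_pullback_cell[OF P]) (simp_all add: ht)
    then obtain \<gamma> where g0: "\<gamma> \<in> Cell K \<and> Cod K (Src K \<gamma>) = Dom K r \<and> r \<rhd> \<gamma> = \<theta> \<and> j \<rhd> \<gamma> = Id2 K a" by blast
    then have g [simp]: "\<gamma> \<in> Cell K" "Cod K (Src K \<gamma>) = Dom K j" "r \<rhd> \<gamma> = \<theta>" "j \<rhd> \<gamma> = Id2 K a" by simp_all
    have gs: "r \<odot> Src K \<gamma> = r \<odot> s" "r \<odot> Tgt K \<gamma> = r \<odot> s'" "j \<odot> Src K \<gamma> = a" "j \<odot> Tgt K \<gamma> = a"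
      using whisker_l_simps(2,3)[of r \<gamma>] whisker_l_simps(2,3)[of j \<gamma>] by simp_all
    have gd: "Dom K (Src K \<gamma>) = Dom K a" using arg_cong[OF gs(3), of "Dom K"] by simp
    have sg [simp]: "Src K \<gamma> = s" by (rule is_pullback_arr_eqI[OF P]) (simp_all add: gs gd)
    have tg [simp]: "Tgt K \<gamma> = s'" by (rule is_pullback_arr_eqI[OF P]) (simp_all add: gs gd del: sg)
    show ?thesis
    proof (rule ex1I[of _ "(a, \<gamma>, j)"])
      show "(a, \<gamma>, j) \<in> hom2 ?S w w' \<and> ?d \<rhd>\<^bsub>?S\<^esub> (a, \<gamma>, j) = \<zeta> \<and> ?q \<rhd>\<^bsub>?S\<^esub> (a, \<gamma>, j) = \<xi>"
        unfolding we ze xe by (simp add: hom2_iff)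
      fix n assume n: "n \<in> hom2 ?S w w' \<and> ?d \<rhd>\<^bsub>?S\<^esub> n = \<zeta> \<and> ?q \<rhd>\<^bsub>?S\<^esub> n = \<xi>"
      then obtain n0 where ne: "n = (a, n0, j)" unfolding we by (cases n) (auto simp: hom2_iff)
      have [simp]: "n0 \<in> Cell K" "Src K n0 = s" "Tgt K n0 = s'" "j \<rhd> n0 = Id2 K a" using n unfolding ne we by (simp_all add: hom2_iff)
      have "d \<rhd> (r \<rhd> n0) = Z" "q \<rhd> (r \<rhd> n0) = X" using n unfolding ne we ze xe by simp_all
      then have "r \<rhd> n0 \<in> hom2 K (r \<odot> s) (r \<odot> s') \<and> d \<rhd> (r \<rhd> n0) = Z \<and> q \<rhd> (r \<rhd> n0) = X" by (simp add: hom2_iff)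
      then have "r \<rhd> n0 = \<theta>" using ex t0 by blast
      then have "n0 \<in> Cell K \<and> Cod K (Src K n0) = Dom K r \<and> r \<rhd> n0 = \<theta> \<and> j \<rhd> n0 = Id2 K a" by simp
      then have "n0 = \<gamma>" using exg g0 by blast
      then show "n = (a, \<gamma>, j)" unfolding ne by simp
    qed
  qed
  have "is_comma ?S ?f ?g ?d ?q ?l"
    unfolding is_comma_def
  proof (intro conjI ballI impI)
    show "?l \<in> hom2 ?S (?f \<odot>\<^bsub>?S\<^esub> ?d) (?g \<odot>\<^bsub>?S\<^esub> ?q)"
      by (simp add: hom2_iff xdr zlr)
  qed (use A1 A2 in \<open>(blast | simp add: xdr)+\<close>)
  then show ?thesis by blast
qed

theorem slice_has_commas:
  assumes "B \<in> Ob K"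
  shows "has_commas (slice K B)"
  unfolding has_commas_def
proof (intro ballI impI)
  fix f g assume "f \<in> Arr (slice K B)" "g \<in> Arr (slice K B)" "Cod (slice K B) f = Cod (slice K B) g"
  with slice_comma[of "fst f" "mid f" "snd (snd f)" B "fst g" "mid g"] assms
  show "\<exists>d q l. is_comma (slice K B) f g d q l" by (cases f; cases g) simp
qed

end

section \<open>Adjunctions and terminal objects\<close>

lemma id_fun2_is_fun2: "two_category C \<Longrightarrow> is_fun2 C C id_fun2"
  by (simp add: is_fun2_def hom1_iff hom2_iff two_category.Cell_ends)

lemma adj2_comp:
  assumes a: "adj2 C D F G \<eta> \<epsilon>" and b: "adj2 D E F' G' \<eta>' \<epsilon>'"
    and C: "two_category C" and D: "two_category D" and E: "two_category E"
  shows "\<exists>\<eta>'' \<epsilon>''. adj2 C E (F' \<circ>\<^sub>2 F) (G \<circ>\<^sub>2 G') \<eta>'' \<epsilon>''"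
proof -
  interpret C: two_category C by fact
  interpret D: two_category D by fact
  interpret E: two_category E by fact
  note A = adj2D[OF a] and B = adj2D[OF b]
  note IC = id_fun2_is_fun2[OF C] and ID = id_fun2_is_fun2[OF D] and IE = id_fun2_is_fun2[OF E]
  note [simp] = is_fun2D(1,3-5)[OF A(1)] is_fun2D(1,3-5)[OF A(2)] is_fun2D(1,3-5)[OF B(1)] is_fun2D(1,3-5)[OF B(2)]
    is_nat2D(1-3)[OF A(3), simplified] is_nat2D(1-3)[OF A(4), simplified] is_nat2D(1-3)[OF B(3), simplified] is_nat2D(1-3)[OF B(4), simplified]
  define \<eta>'' where "\<eta>'' X = farr G (\<eta>' (fob F X)) \<odot>\<^bsub>C\<^esub> \<eta> X" for X
  define \<epsilon>'' where "\<epsilon>'' Y = \<epsilon>' Y \<odot>\<^bsub>E\<^esub> farr F' (\<epsilon> (fob G' Y))" for Y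
  have FF: "is_fun2 C E (F' \<circ>\<^sub>2 F)" by (rule is_fun2_comp[OF A(1) B(1) C])
  have GG: "is_fun2 E C (G \<circ>\<^sub>2 G')" by (rule is_fun2_comp[OF B(2) A(2) E])
  have u1: "is_nat2 C D (id_fun2 \<circ>\<^sub>2 F) (G' \<circ>\<^sub>2 F' \<circ>\<^sub>2 F) (\<lambda>X. \<eta>' (fob F X))"
    by (rule is_nat2_whisker_r[OF B(3) A(1) C])
  have u2: "is_nat2 C C (G \<circ>\<^sub>2 (id_fun2 \<circ>\<^sub>2 F)) (G \<circ>\<^sub>2 (G' \<circ>\<^sub>2 F' \<circ>\<^sub>2 F)) (\<lambda>X. farr G (\<eta>' (fob F X)))"
    by (rule is_nat2_whisker_l[OF u1 _ _ A(2) C D])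
      (use A(1) is_fun2_comp[OF FF B(2) C] in \<open>simp_all add: comp_fun2_assoc\<close>)
  have u: "is_nat2 C C id_fun2 (G \<circ>\<^sub>2 G' \<circ>\<^sub>2 (F' \<circ>\<^sub>2 F)) \<eta>''"
    unfolding \<eta>''_def[abs_def]
    by (rule is_nat2_comp[OF A(3) _ IC is_fun2_comp[OF A(1,2) C] is_fun2_comp[OF FF GG C] C C])
      (use u2 in \<open>simp add: comp_fun2_assoc\<close>)
  have c1: "is_nat2 E D (F \<circ>\<^sub>2 G \<circ>\<^sub>2 G') (id_fun2 \<circ>\<^sub>2 G') (\<lambda>X. \<epsilon> (fob G' X))"
    by (rule is_nat2_whisker_r[OF A(4) B(2) E])
  have c2: "is_nat2 E E (F' \<circ>\<^sub>2 (F \<circ>\<^sub>2 G \<circ>\<^sub>2 G')) (F' \<circ>\<^sub>2 (id_fun2 \<circ>\<^sub>2 G')) (\<lambda>X. farr F' (\<epsilon> (fob G' X)))"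
    by (rule is_nat2_whisker_l[OF c1 _ _ B(1) E D])
      (use B(2) is_fun2_comp[OF GG A(1) E] in \<open>simp_all add: comp_fun2_assoc\<close>)
  have c: "is_nat2 E E (F' \<circ>\<^sub>2 F \<circ>\<^sub>2 (G \<circ>\<^sub>2 G')) id_fun2 \<epsilon>''"
    unfolding \<epsilon>''_def[abs_def]
    by (rule is_nat2_comp[OF _ B(4) is_fun2_comp[OF GG FF E] is_fun2_comp[OF B(2,1) E] IE E E])
      (use c2 in \<open>simp add: comp_fun2_assoc\<close>)
  have t1: "\<epsilon>'' (fob F' (fob F X)) \<odot>\<^bsub>E\<^esub> farr F' (farr F (\<eta>'' X)) = Id1 E (fob F' (fob F X))" if X [simp]: "X \<in> Ob C" for X
  proof -
    let ?Y = "fob F X"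
    have n: "\<epsilon> (fob G' (fob F' ?Y)) \<odot>\<^bsub>D\<^esub> farr F (farr G (\<eta>' ?Y)) = \<eta>' ?Y \<odot>\<^bsub>D\<^esub> \<epsilon> ?Y"
      using is_nat2D(4)[OF A(4), of "\<eta>' ?Y"] by simp
    have "farr F' (\<epsilon> (fob G' (fob F' ?Y))) \<odot>\<^bsub>E\<^esub> farr F' (farr F (\<eta>'' X)) = farr F' (\<epsilon> (fob G' (fob F' ?Y)) \<odot>\<^bsub>D\<^esub> (farr F (farr G (\<eta>' ?Y)) \<odot>\<^bsub>D\<^esub> farr F (\<eta> X)))"
      unfolding \<eta>''_def by (simp add: is_fun2D(10)[OF A(1)] is_fun2D(10)[OF B(1)])
    also have "\<dots> = farr F' (\<eta>' ?Y \<odot>\<^bsub>D\<^esub> (\<epsilon> ?Y \<odot>\<^bsub>D\<^esub> farr F (\<eta> X)))"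
      by (simp add: D.Comp_reassoc[OF n])
    also have "\<dots> = farr F' (\<eta>' ?Y)" by (simp add: A(5))
    finally show ?thesis unfolding \<epsilon>''_def using B(5)[of ?Y] by (simp add: \<eta>''_def)
  qed
  have t2: "farr G (farr G' (\<epsilon>'' Y)) \<odot>\<^bsub>C\<^esub> \<eta>'' (fob G (fob G' Y)) = Id1 C (fob G (fob G' Y))" if Y [simp]: "Y \<in> Ob E" for Y
  proof -
    let ?X = "fob G' Y"
    have n: "farr G' (farr F' (\<epsilon> ?X)) \<odot>\<^bsub>D\<^esub> \<eta>' (fob F (fob G ?X)) = \<eta>' ?X \<odot>\<^bsub>D\<^esub> \<epsilon> ?X"
      using is_nat2D(4)[OF B(3), of "\<epsilon> ?X"] by simp
    have "farr G (farr G' (\<epsilon>'' Y)) \<odot>\<^bsub>C\<^esub> farr G (\<eta>' (fob F (fob G ?X))) = farr G (farr G' (\<epsilon>' Y) \<odot>\<^bsub>D\<^esub> (farr G' (farr F' (\<epsilon> ?X)) \<odot>\<^bsub>D\<^esub> \<eta>' (fob F (fob G ?X))))"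
      unfolding \<epsilon>''_def by (simp add: is_fun2D(10)[OF A(2)] is_fun2D(10)[OF B(2)])
    also have "\<dots> = farr G ((farr G' (\<epsilon>' Y) \<odot>\<^bsub>D\<^esub> \<eta>' ?X) \<odot>\<^bsub>D\<^esub> \<epsilon> ?X)" by (simp add: n)
    also have "\<dots> = farr G (\<epsilon> ?X)" by (simp add: B(6) del: D.Comp_assoc')
    finally have e: "farr G (farr G' (\<epsilon>'' Y)) \<odot>\<^bsub>C\<^esub> farr G (\<eta>' (fob F (fob G ?X))) = farr G (\<epsilon> ?X)" .
    have "farr G (farr G' (\<epsilon>'' Y)) \<odot>\<^bsub>C\<^esub> \<eta>'' (fob G ?X) = (farr G (farr G' (\<epsilon>'' Y)) \<odot>\<^bsub>C\<^esub> farr G (\<eta>' (fob F (fob G ?X)))) \<odot>\<^bsub>C\<^esub> \<eta> (fob G ?X)"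
      unfolding \<eta>''_def \<epsilon>''_def by simp
    then show ?thesis unfolding e by (simp add: A(6))
  qed
  show ?thesis
    by (intro exI[of _ \<eta>''] exI[of _ \<epsilon>'']) (simp add: adj2_def FF GG u c t1 t2)
qed

text \<open>
  If H is fully faithful and \<open>H R\<^sub>1 = R\<close>, then a left adjoint L of R gives the left
  adjoint L H of \<open>R\<^sub>1\<close>: the unit of the given adjunction at objects in the image of H
  comes from a unique arrow before H.
\<close>

lemma adj2_transport:
  assumes a: "adj2 C D L R \<eta> \<epsilon>" and H: "is_fun2 C' C H" and R1: "is_fun2 D C' R1" and HR: "fun2_eq D (H \<circ>\<^sub>2 R1) R"
    and C: "two_category C" and C': "two_category C'" and D: "two_category D"
    and full: "\<And>X Y k. \<lbrakk>X \<in> Ob C'; Y \<in> Ob C'; k \<in> hom1 C (fob H X) (fob H Y)\<rbrakk> \<Longrightarrow> \<exists>k'. k' \<in> hom1 C' X Y \<and> farr H k' = k"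
    and faithful: "\<And>f g. \<lbrakk>f \<in> Arr C'; g \<in> Arr C'; Dom C' f = Dom C' g; Cod C' f = Cod C' g; farr H f = farr H g\<rbrakk> \<Longrightarrow> f = g"
    and faithful2: "\<And>\<alpha> \<beta>. \<lbrakk>\<alpha> \<in> Cell C'; \<beta> \<in> Cell C'; Dom C' (Src C' \<alpha>) = Dom C' (Src C' \<beta>); Cod C' (Src C' \<alpha>) = Cod C' (Src C' \<beta>);
       fcell H \<alpha> = fcell H \<beta>\<rbrakk> \<Longrightarrow> \<alpha> = \<beta>"
  shows "\<exists>\<eta>'. adj2 C' D (L \<circ>\<^sub>2 H) R1 \<eta>' \<epsilon>"
proof -
  interpret C: two_category C by fact
  interpret C': two_category C' by fact
  interpret D: two_category D by fact
  note A = adj2D[OF a]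
  note [simp] = is_fun2D(1,3-5,7-9)[OF A(1)] is_fun2D(1,3-5,7-9)[OF A(2)] is_fun2D(1,3-5,7-9)[OF H] is_fun2D(1,3-5,7-9)[OF R1]
    is_nat2D(1-3)[OF A(3), simplified] is_nat2D(1-3)[OF A(4), simplified]
  have HR' [simp]: "X \<in> Ob D \<Longrightarrow> fob H (fob R1 X) = fob R X" "f \<in> Arr D \<Longrightarrow> farr H (farr R1 f) = farr R f" "\<alpha> \<in> Cell D \<Longrightarrow> fcell H (fcell R1 \<alpha>) = fcell R \<alpha>" for X f \<alpha>
    using HR unfolding fun2_eq_def by simp_all
  have "\<exists>k. k \<in> hom1 C' X (fob R1 (fob L (fob H X))) \<and> farr H k = \<eta> (fob H X)" if X: "X \<in> Ob C'" for X
    by (rule full) (use X in \<open>simp_all add: hom1_iff\<close>)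
  then obtain \<eta>' where e: "\<And>X. X \<in> Ob C' \<Longrightarrow> \<eta>' X \<in> hom1 C' X (fob R1 (fob L (fob H X))) \<and> farr H (\<eta>' X) = \<eta> (fob H X)"
    by metis
  then have [simp]: "\<And>X. X \<in> Ob C' \<Longrightarrow> \<eta>' X \<in> Arr C'" "\<And>X. X \<in> Ob C' \<Longrightarrow> Dom C' (\<eta>' X) = X" "\<And>X. X \<in> Ob C' \<Longrightarrow> Cod C' (\<eta>' X) = fob R1 (fob L (fob H X))"
     "\<And>X. X \<in> Ob C' \<Longrightarrow> farr H (\<eta>' X) = \<eta> (fob H X)"
    by (simp_all add: hom1_iff)
  have u: "is_nat2 C' C' id_fun2 (R1 \<circ>\<^sub>2 (L \<circ>\<^sub>2 H)) \<eta>'"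
  proof (rule is_nat2I)
    fix f assume [simp]: "f \<in> Arr C'"
    show "\<eta>' (Cod C' f) \<odot>\<^bsub>C'\<^esub> farr id_fun2 f = farr (R1 \<circ>\<^sub>2 (L \<circ>\<^sub>2 H)) f \<odot>\<^bsub>C'\<^esub> \<eta>' (Dom C' f)"
      by (rule faithful) (use is_nat2D(4)[OF A(3), of "farr H f"] in \<open>simp_all add: is_fun2D(10)[OF H]\<close>)
  next
    fix \<alpha> assume [simp]: "\<alpha> \<in> Cell C'"
    show "\<eta>' (Cod C' (Src C' \<alpha>)) \<rhd>\<^bsub>C'\<^esub> fcell id_fun2 \<alpha> = fcell (R1 \<circ>\<^sub>2 (L \<circ>\<^sub>2 H)) \<alpha> \<lhd>\<^bsub>C'\<^esub> \<eta>' (Dom C' (Src C' \<alpha>))"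
      by (rule faithful2) (use is_nat2D(5)[OF A(3), of "fcell H \<alpha>"] in \<open>simp_all add: is_fun2_whisker[OF H C']\<close>)
  qed simp
  have c: "is_nat2 D D (L \<circ>\<^sub>2 H \<circ>\<^sub>2 R1) id_fun2 \<epsilon>"
    by (rule is_nat2_cong[OF A(4) _ _ _ D]) (simp_all add: fun2_eq_def)
  have t2: "farr R1 (\<epsilon> Y) \<odot>\<^bsub>C'\<^esub> \<eta>' (fob R1 Y) = Id1 C' (fob R1 Y)" if [simp]: "Y \<in> Ob D" for Y
    by (rule faithful) (use A(6)[of Y] in \<open>simp_all add: is_fun2D(10)[OF H] is_fun2D(2)[OF H]\<close>)
  show ?thesis
    by (intro exI[of _ \<eta>']) (simp add: adj2_def is_fun2_comp[OF H A(1) C'] R1 u c t2 A(5))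
qed

lemma right_adjoint_terminal:
  assumes a: "adj2 C D L R \<eta> \<epsilon>" and C: "two_category C" and D: "two_category D" and T: "T \<in> Ob D"
    and t: "\<And>X. X \<in> Ob D \<Longrightarrow> \<exists>!f. f \<in> hom1 D X T" and X: "X \<in> Ob C"
  shows "\<exists>!f. f \<in> hom1 C X (fob R T)"
proof -
  interpret C: two_category C by fact
  interpret D: two_category D by fact
  note A = adj2D[OF a]
  note [simp] = is_fun2D(1,3-5)[OF A(1)] is_fun2D(1,3-5)[OF A(2)]
    is_nat2D(1-3)[OF A(3), simplified] is_nat2D(1-3)[OF A(4), simplified] T X
  obtain b where b: "b \<in> hom1 D (fob L X) T" and u: "\<And>f. f \<in> hom1 D (fob L X) T \<Longrightarrow> f = b" using t[of "fob L X"] by auto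
  have [simp]: "b \<in> Arr D" "Dom D b = fob L X" "Cod D b = T" using b by (simp_all add: hom1_iff)
  show ?thesis
  proof (rule ex1I[of _ "farr R b \<odot>\<^bsub>C\<^esub> \<eta> X"])
    show "farr R b \<odot>\<^bsub>C\<^esub> \<eta> X \<in> hom1 C X (fob R T)" by (simp add: hom1_iff)
    fix f assume "f \<in> hom1 C X (fob R T)"
    then have [simp]: "f \<in> Arr C" "Dom C f = X" "Cod C f = fob R T" by (simp_all add: hom1_iff)
    have "\<epsilon> T \<odot>\<^bsub>D\<^esub> farr L f = b" by (rule u) (simp add: hom1_iff)
    then have rb: "farr R b = farr R (\<epsilon> T) \<odot>\<^bsub>C\<^esub> farr R (farr L f)" by (simp flip: is_fun2D(10)[OF A(2)])
    have n: "farr R (farr L f) \<odot>\<^bsub>C\<^esub> \<eta> X = \<eta> (fob R T) \<odot>\<^bsub>C\<^esub> f" using is_nat2D(4)[OF A(3), of f] by simp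
    show "f = farr R b \<odot>\<^bsub>C\<^esub> \<eta> X" unfolding rb by (simp add: n C.Comp_reassoc[OF A(6)])
  qed
qed

lemma bang_simps:
  assumes "terminal_ob A one" "X \<in> Ob A"
  shows "bang A one X \<in> Arr A" "Dom A (bang A one X) = X" "Cod A (bang A one X) = one"
    and "\<lbrakk>f \<in> Arr A; Dom A f = X; Cod A f = one\<rbrakk> \<Longrightarrow> f = bang A one X"
proof -
  have e: "\<exists>!f. f \<in> hom1 A X one" using assms unfolding terminal_ob_def by blast
  have "bang A one X \<in> hom1 A X one" unfolding bang_def by (rule theI'[OF e])
  then show "bang A one X \<in> Arr A" "Dom A (bang A one X) = X" "Cod A (bang A one X) = one"
    unfolding hom1_iff by auto
  then show "\<lbrakk>f \<in> Arr A; Dom A f = X; Cod A f = one\<rbrakk> \<Longrightarrow> f = bang A one X"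
    using e unfolding hom1_iff by blast
qed

lemma fun_at_one_fun2:
  assumes T: "is_fun2 A L T" and t: "terminal_ob A one" and A: "two_category A" and L: "two_category L"
  shows "is_fun2 A (slice L (fob T one)) (fun_at_one A one T)"
proof -
  interpret A: two_category A by fact
  interpret L: two_category L by fact
  have one [simp]: "one \<in> Ob A" using t unfolding terminal_ob_def by blast
  note b [simp] = bang_simps(1-3)[OF t]
  note [simp] = is_fun2D[OF T]
  have bf: "bang A one (Cod A f) \<odot>\<^bsub>A\<^esub> f = bang A one (Dom A f)" if "f \<in> Arr A" for f
    by (rule bang_simps(4)[OF t]) (use that in simp_all)
  have arr: "farr T (bang A one (Cod A f)) \<odot>\<^bsub>L\<^esub> farr T f = farr T (bang A one (Dom A f))" if "f \<in> Arr A" for f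
    using that by (simp add: bf flip: is_fun2D(10)[OF T])
  have cell: "farr T (bang A one (Cod A (Src A \<alpha>))) \<rhd>\<^bsub>L\<^esub> fcell T \<alpha> = Id2 L (farr T (bang A one (Dom A (Src A \<alpha>))))" if [simp]: "\<alpha> \<in> Cell A" for \<alpha>
  proof -
    let ?b = "bang A one (Cod A (Src A \<alpha>))"
    have "\<And>\<beta>. \<beta> \<in> Cell A \<Longrightarrow> Cod A (Src A \<beta>) = one \<Longrightarrow> \<beta> = Id2 A (Src A \<beta>)"
      using t unfolding terminal_ob_def by blast
    from this[of "?b \<rhd>\<^bsub>A\<^esub> \<alpha>"] have "?b \<rhd>\<^bsub>A\<^esub> \<alpha> = Id2 A (bang A one (Dom A (Src A \<alpha>)))" by (simp add: bf)
    then show ?thesis by (simp flip: is_fun2_whisker(1)[OF T A])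
  qed
  show ?thesis
    by (rule is_fun2I) (simp_all add: fun_at_one_def arr cell)
qed

section \<open>Slices over isomorphic objects\<close>

text \<open>
  For m : M \<rightarrow> B and n : M \<rightarrow> J, this regards an object of (K/J)/n, that is an arrow
  into M, as an object of K/B.
\<close>

definition post_iso :: "('o, 'a, 'c) twocat \<Rightarrow> 'a \<Rightarrow> ('a sarr, 'a sarr sarr, ('a sarr, ('a, 'c) scell) scell, 'a, 'a sarr, ('a, 'c) scell) fun2" where
  "post_iso K m = \<lparr>fob = (\<lambda>a. m \<odot>\<^bsub>K\<^esub> mid a), farr = (\<lambda>(a, k, b). (m \<odot>\<^bsub>K\<^esub> mid a, mid k, m \<odot>\<^bsub>K\<^esub> mid b)),
     fcell = (\<lambda>(a, \<alpha>, b). (m \<odot>\<^bsub>K\<^esub> mid a, mid \<alpha>, m \<odot>\<^bsub>K\<^esub> mid b))\<rparr>"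

lemma post_iso_simps [simp]:
  "fob (post_iso K m) a = m \<odot>\<^bsub>K\<^esub> mid a" "farr (post_iso K m) (a, k, b) = (m \<odot>\<^bsub>K\<^esub> mid a, mid k, m \<odot>\<^bsub>K\<^esub> mid b)"
  "fcell (post_iso K m) (a, \<alpha>, b) = (m \<odot>\<^bsub>K\<^esub> mid a, mid \<alpha>, m \<odot>\<^bsub>K\<^esub> mid b)"
  by (simp_all add: post_iso_def)

lemma arrow_triple_cases:
  obtains a1 a2 a3 k1 k2 k3 b1 b2 b3 where "f = ((a1, a2, a3), (k1, k2, k3), (b1, b2, b3))"
  by (metis prod.exhaust)

lemma post_iso_fun2:
  assumes K: "two_category K" and m: "m \<in> Arr K" "n \<in> Arr K" "Dom K n = Dom K m"
  shows "is_fun2 (slice (slice K (Cod K n)) n) (slice K (Cod K m)) (post_iso K m)"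
proof -
  interpret two_category K by fact
  note [simp] = m
  show ?thesis
  proof (rule is_fun2I, goal_cases)
    case (1 X) then show ?case by (cases X) simp
  next
    case (2 X) then show ?case by (cases X) auto
  next
    case (3 f)
    then show ?case by (cases f rule: arrow_triple_cases) simp
  next
    case (4 f)
    then show ?case by (cases f rule: arrow_triple_cases) simp
  next
    case (5 f)
    then show ?case by (cases f rule: arrow_triple_cases) simp
  next
    case (6 f g)
    obtain a1 a2 a3 k1 k2 k3 b1 b2 b3 where f: "f = ((a1, a2, a3), (k1, k2, k3), (b1, b2, b3))" by (rule arrow_triple_cases)
    obtain c1 c2 c3 l1 l2 l3 d1 d2 d3 where g: "g = ((c1, c2, c3), (l1, l2, l3), (d1, d2, d3))" by (metis prod.exhaust)
    show ?case unfolding f g by simp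
  next
    case (7 f g)
    obtain a1 a2 a3 k1 k2 k3 b1 b2 b3 where f: "f = ((a1, a2, a3), (k1, k2, k3), (b1, b2, b3))" by (rule arrow_triple_cases)
    obtain c1 c2 c3 l1 l2 l3 d1 d2 d3 where g: "g = ((c1, c2, c3), (l1, l2, l3), (d1, d2, d3))" by (metis prod.exhaust)
    show ?case unfolding f g by simp
  next
    case (8 f g)
    obtain a1 a2 a3 k1 k2 k3 b1 b2 b3 where f: "f = ((a1, a2, a3), (k1, k2, k3), (b1, b2, b3))" by (rule arrow_triple_cases)
    obtain c1 c2 c3 l1 l2 l3 d1 d2 d3 where g: "g = ((c1, c2, c3), (l1, l2, l3), (d1, d2, d3))" by (metis prod.exhaust)
    show ?case unfolding f g by simp
  qed
qed

context two_category
begin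

text \<open>
  A lifting problem \<beta> for f in K/J gives the problem m \<beta> for m f in K. As m is invertible, a
  solution of the latter lies over \<beta> itself, and it is a cell over J because \<beta> is one.
\<close>

lemma slice_split_fib:
  assumes m: "m \<in> Arr K" "m' \<in> Arr K" "Dom K m' = Cod K m" "Cod K m' = Dom K m" "m' \<odot> m = Id1 K (Dom K m)"
    and n: "n \<in> Arr K" "Dom K n = Dom K m" and f: "f \<in> Arr K" "Cod K f = Dom K m"
    and \<chi>: "split_fib K (m \<odot> f) \<chi>"
  shows "split_fib (slice K (Cod K n)) (n \<odot> f, f, n) (slice_cleavage K m \<chi>)"
proof -
  let ?f = "(n \<odot> f, f, n)" and ?\<psi> = "slice_cleavage K m \<chi>"
  let ?S = "slice K (Cod K n)"
  note [simp] = m(1-4) n f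
  have mm [simp]: "m' \<rhd> (m \<rhd> \<alpha>) = \<alpha>" if "\<alpha> \<in> Cell K" "Cod K (Src K \<alpha>) = Dom K m" for \<alpha>
  proof -
    have "m' \<rhd> (m \<rhd> \<alpha>) = Id1 K (Dom K m) \<rhd> \<alpha>" by (rule whisker_l_reassoc[OF m(5)]) (use m that in blast)+
    also have "\<dots> = \<alpha>" by (rule whisker_Id1(1)[OF that(1)]) (simp only: that(2))
    finally show ?thesis .
  qed
  \<comment> \<open>Whiskering with the invertible arrow m is injective on 2-cells.\<close>
  have mc: "\<alpha> = \<beta>" if "m \<rhd> \<alpha> = m \<rhd> \<beta>" "\<alpha> \<in> Cell K" "\<beta> \<in> Cell K" "Cod K (Src K \<alpha>) = Dom K m" "Cod K (Src K \<beta>) = Dom K m" for \<alpha> \<beta>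
    using mm that by metis
  have mma [simp]: "m' \<odot> (m \<odot> h) = h" if "h \<in> Arr K" "Cod K h = Dom K m" for h
  proof -
    have "m' \<odot> (m \<odot> h) = Id1 K (Dom K m) \<odot> h" by (rule Comp_reassoc[OF m(5)]) (use m that in blast)+
    also have "\<dots> = h" by (rule Id1_Comp'[OF that(1)]) (simp only: that(2))
    finally show ?thesis .
  qed
  have lpD: "\<exists>w g0 b. g = (w, g0, n \<odot> f) \<and> \<beta> = (w, b, n) \<and> w \<in> Arr K \<and> Cod K w = Cod K n \<and> g0 \<in> Arr K \<and> Dom K g0 = Dom K w \<and> Cod K g0 = Dom K f
       \<and> n \<odot> (f \<odot> g0) = w \<and> b \<in> Cell K \<and> Tgt K b = f \<odot> g0 \<and> n \<rhd> b = Id2 K w \<and> Dom K (Src K b) = Dom K w \<and> Cod K (Src K b) = Dom K m"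
    if "lift_problem ?S ?f g \<beta>" for g \<beta>
    using that unfolding lift_problem_def by (cases g; cases \<beta>) auto
  have lp: "lift_problem K (m \<odot> f) g0 (m \<rhd> b)" if "g0 \<in> Arr K" "Cod K g0 = Dom K f" "b \<in> Cell K" "Tgt K b = f \<odot> g0" "Cod K (Src K b) = Dom K m" for g0 b
    using that unfolding lift_problem_def by simp
  have main: "cartesian_cell ?S ?f (?\<psi> g \<beta>) \<and> Tgt ?S (?\<psi> g \<beta>) = g
     \<and> ?f \<rhd>\<^bsub>?S\<^esub> ?\<psi> g \<beta> = \<beta>"
    if l: "lift_problem ?S ?f g \<beta>" for g \<beta>
  proof -
    obtain w g0 b where e: "g = (w, g0, n \<odot> f)" "\<beta> = (w, b, n)" and [simp]: "w \<in> Arr K" "Cod K w = Cod K n" "g0 \<in> Arr K" "Dom K g0 = Dom K w" "Cod K g0 = Dom K f"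
       "b \<in> Cell K" "Tgt K b = f \<odot> g0" "n \<rhd> b = Id2 K w" "Dom K (Src K b) = Dom K w" "Cod K (Src K b) = Dom K m" and w: "n \<odot> (f \<odot> g0) = w"
      using lpD[OF l] by blast
    have l0: "lift_problem K (m \<odot> f) g0 (m \<rhd> b)" by (rule lp) simp_all
    define c where "c = \<chi> g0 (m \<rhd> b)"
    note c0 = split_fibD(2-5)[OF \<chi> l0, folded c_def] split_fib_ends[OF \<chi> l0, folded c_def]
    have [simp]: "c \<in> Cell K" "Tgt K c = g0" "Dom K (Src K c) = Dom K w" "Cod K (Src K c) = Dom K f" using c0 by simp_all
    have fc [simp]: "f \<rhd> c = b" by (rule mc) (use c0 in simp_all)
    have fsc [simp]: "f \<odot> Src K c = Src K b" using whisker_l_simps(2)[of f c] by simp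
    have sc: "?\<psi> g \<beta> = (w, c, n \<odot> f)" unfolding slice_cleavage_def e c_def by simp
    have "\<exists>!\<tau>. \<tau> \<in> hom2 ?S (Src ?S \<rho>) (Src ?S (w, c, n \<odot> f)) \<and> ?f \<rhd>\<^bsub>?S\<^esub> \<tau> = \<delta>
       \<and> (w, c, n \<odot> f) \<bullet>\<^bsub>?S\<^esub> \<tau> = \<rho>"
      if r: "\<rho> \<in> Cell ?S" "Tgt ?S \<rho> = Tgt ?S (w, c, n \<odot> f)"
       and d: "\<delta> \<in> hom2 ?S (?f \<odot>\<^bsub>?S\<^esub> Src ?S \<rho>) (?f \<odot>\<^bsub>?S\<^esub> Src ?S (w, c, n \<odot> f))"
       and eq: "(?f \<rhd>\<^bsub>?S\<^esub> (w, c, n \<odot> f)) \<bullet>\<^bsub>?S\<^esub> \<delta> = ?f \<rhd>\<^bsub>?S\<^esub> \<rho>" for \<rho> \<delta>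
    proof -
      obtain r0 where re: "\<rho> = (w, r0, n \<odot> f)" using r by (cases \<rho>) auto
      have r0 [simp]: "r0 \<in> Cell K" "Tgt K r0 = g0" "Dom K (Src K r0) = Dom K w" "Cod K (Src K r0) = Dom K f" using r unfolding re by simp_all
      obtain d0 where de: "\<delta> = (w, d0, n)" using d unfolding re by (cases \<delta>) (auto simp: hom2_iff)
      have d0 [simp]: "d0 \<in> Cell K" "Src K d0 = f \<odot> Src K r0" "Tgt K d0 = Src K b" "n \<rhd> d0 = Id2 K w" using d unfolding re de by (simp_all add: hom2_iff)
      have eq0 [simp]: "b \<bullet> d0 = f \<rhd> r0" using eq unfolding re de by simp
      have "m \<rhd> (b \<bullet> d0) = (m \<rhd> b) \<bullet> (m \<rhd> d0)" by (rule whisker_VComp) simp_all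
      then have mb: "(m \<rhd> b) \<bullet> (m \<rhd> d0) = m \<rhd> (f \<rhd> r0)" by simp
      have ex: "\<exists>!\<tau>. \<tau> \<in> hom2 K (Src K r0) (Src K c) \<and> (m \<odot> f) \<rhd> \<tau> = m \<rhd> d0 \<and> c \<bullet> \<tau> = r0"
        by (rule cartesian_cellD[OF c0(1)]) (simp_all add: mb)
      then obtain \<tau> where t0: "\<tau> \<in> hom2 K (Src K r0) (Src K c) \<and> (m \<odot> f) \<rhd> \<tau> = m \<rhd> d0 \<and> c \<bullet> \<tau> = r0" by blast
      then have t [simp]: "\<tau> \<in> Cell K" "Src K \<tau> = Src K r0" "Tgt K \<tau> = Src K c" "c \<bullet> \<tau> = r0" by (simp_all add: hom2_iff)
      have mt: "m \<rhd> (f \<rhd> \<tau>) = m \<rhd> d0" using t0 by simp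
      have ft [simp]: "f \<rhd> \<tau> = d0" by (rule mc[OF mt]) simp_all
      show ?thesis
      proof (rule ex1I[of _ "(w, \<tau>, n \<odot> f)"])
        show "(w, \<tau>, n \<odot> f) \<in> hom2 ?S (Src ?S \<rho>) (Src ?S (w, c, n \<odot> f)) \<and> ?f \<rhd>\<^bsub>?S\<^esub> (w, \<tau>, n \<odot> f) = \<delta>
           \<and> (w, c, n \<odot> f) \<bullet>\<^bsub>?S\<^esub> (w, \<tau>, n \<odot> f) = \<rho>"
          unfolding re de by (simp add: hom2_iff)
        fix t assume t: "t \<in> hom2 ?S (Src ?S \<rho>) (Src ?S (w, c, n \<odot> f)) \<and> ?f \<rhd>\<^bsub>?S\<^esub> t = \<delta>
           \<and> (w, c, n \<odot> f) \<bullet>\<^bsub>?S\<^esub> t = \<rho>"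
        then obtain t1 where te: "t = (w, t1, n \<odot> f)" unfolding re by (cases t) (auto simp: hom2_iff)
        have "t1 \<in> hom2 K (Src K r0) (Src K c) \<and> (m \<odot> f) \<rhd> t1 = m \<rhd> d0 \<and> c \<bullet> t1 = r0"
          using t unfolding te re de by (simp add: hom2_iff)
        with ex t0 have "t1 = \<tau>" by blast
        then show "t = (w, \<tau>, n \<odot> f)" unfolding te by simp
      qed
    qed
    then have "cartesian_cell ?S ?f (w, c, n \<odot> f)"
      unfolding cartesian_cell_def by simp
    then show ?thesis unfolding sc by (simp add: e)
  qed
  have idc: "?\<psi> g (Id2 ?S (?f \<odot>\<^bsub>?S\<^esub> g)) = Id2 ?S g"
    if g: "g \<in> Arr ?S" "Cod ?S g = Dom ?S ?f" for g
  proof -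
    obtain w g0 where e: "g = (w, g0, n \<odot> f)" and [simp]: "g0 \<in> Arr K" "Cod K g0 = Dom K f" using g by (cases g) auto
    show ?thesis using split_fibD(6)[OF \<chi>, of g0] unfolding slice_cleavage_def e by simp
  qed
  have comp: "?\<psi> g (\<beta> \<bullet>\<^bsub>?S\<^esub> \<gamma>) = ?\<psi> g \<beta> \<bullet>\<^bsub>?S\<^esub> ?\<psi> (Src ?S (?\<psi> g \<beta>)) \<gamma>"
    if l: "lift_problem ?S ?f g \<beta>" and c: "\<gamma> \<in> Cell ?S" "Tgt ?S \<gamma> = Src ?S \<beta>" for g \<beta> \<gamma>
  proof -
    obtain w g0 b where e: "g = (w, g0, n \<odot> f)" "\<beta> = (w, b, n)" and [simp]: "w \<in> Arr K" "Cod K w = Cod K n" "g0 \<in> Arr K" "Dom K g0 = Dom K w" "Cod K g0 = Dom K f"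
       "b \<in> Cell K" "Tgt K b = f \<odot> g0" "n \<rhd> b = Id2 K w" "Dom K (Src K b) = Dom K w" "Cod K (Src K b) = Dom K m"
      using lpD[OF l] by blast
    have l0: "lift_problem K (m \<odot> f) g0 (m \<rhd> b)" by (rule lp) simp_all
    obtain c0 where ce: "\<gamma> = (w, c0, n)" and [simp]: "c0 \<in> Cell K" "Tgt K c0 = Src K b" "Cod K (Src K c0) = Dom K m" using c unfolding e by (cases \<gamma>) auto
    have "\<chi> g0 ((m \<rhd> b) \<bullet> (m \<rhd> c0)) = \<chi> g0 (m \<rhd> b) \<bullet> \<chi> (Src K (\<chi> g0 (m \<rhd> b))) (m \<rhd> c0)"
      by (rule split_fibD(7)[OF \<chi> l0]) simp_all
    then show ?thesis unfolding slice_cleavage_def e ce by simp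
  qed
  have restr: "?\<psi> g \<beta> \<lhd>\<^bsub>?S\<^esub> h = ?\<psi> (g \<odot>\<^bsub>?S\<^esub> h) (\<beta> \<lhd>\<^bsub>?S\<^esub> h)"
    if l: "lift_problem ?S ?f g \<beta>" and h: "h \<in> Arr ?S" "Cod ?S h = Dom ?S g" for g \<beta> h
  proof -
    obtain w g0 b where e: "g = (w, g0, n \<odot> f)" "\<beta> = (w, b, n)" and [simp]: "w \<in> Arr K" "Cod K w = Cod K n" "g0 \<in> Arr K" "Dom K g0 = Dom K w" "Cod K g0 = Dom K f"
       "b \<in> Cell K" "Tgt K b = f \<odot> g0" "n \<rhd> b = Id2 K w" "Dom K (Src K b) = Dom K w" "Cod K (Src K b) = Dom K m"
      using lpD[OF l] by blast
    have l0: "lift_problem K (m \<odot> f) g0 (m \<rhd> b)" by (rule lp) simp_all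
    obtain v h0 where he: "h = (v, h0, w)" and [simp]: "h0 \<in> Arr K" "Cod K h0 = Dom K w" using h unfolding e by (cases h) auto
    have "\<chi> g0 (m \<rhd> b) \<lhd> h0 = \<chi> (g0 \<odot> h0) ((m \<rhd> b) \<lhd> h0)"
      by (rule split_fibD(8)[OF \<chi> l0]) simp_all
    then show ?thesis unfolding slice_cleavage_def e he by simp
  qed
  show ?thesis unfolding split_fib_def using main idc comp restr by simp
qed

text \<open>
  A cone in the slice is a cone in K over an object of the slice, whose comparison arrow lies over B
  automatically.
\<close>

lemma is_pullback_slice:
  assumes P: "is_pullback K f g p q" and s: "(x, f, z) \<in> Arr (slice K B)" "(y, g, z) \<in> Arr (slice K B)" "(w, p, x) \<in> Arr (slice K B)" "(w, q, y) \<in> Arr (slice K B)"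
  shows "is_pullback (slice K B) (x, f, z) (y, g, z) (w, p, x) (w, q, y)"
proof -
  let ?f = "(x, f, z)" and ?g = "(y, g, z)" and ?p = "(w, p, x)" and ?q = "(w, q, y)"
  let ?S = "slice K B"
  note [simp] = is_pullbackD[OF P]
  have [simp]: "x \<in> Arr K" "y \<in> Arr K" "z \<in> Arr K" "w \<in> Arr K" "Cod K x = B" "Cod K y = B" "Cod K z = B" "Cod K w = B" "Dom K f = Dom K x" "Dom K g = Dom K y" "Cod K f = Dom K z" "Cod K g = Dom K z"
      "Dom K p = Dom K w" "Dom K q = Dom K w" "Cod K p = Dom K x" "Cod K q = Dom K y" and zf: "z \<odot> f = x" "z \<odot> g = y" "x \<odot> p = w" "y \<odot> q = w"
    using s by simp_all
  have A1: "\<exists>!m. m \<in> hom1 ?S (Dom ?S u) (Dom ?S ?p) \<and> ?p \<odot>\<^bsub>?S\<^esub> m = u \<and> ?q \<odot>\<^bsub>?S\<^esub> m = v"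
    if u: "u \<in> Arr ?S" and v: "v \<in> Arr ?S" and c: "Dom ?S u = Dom ?S v" "Cod ?S u = Dom ?S ?f" "Cod ?S v = Dom ?S ?g"
      and eq: "?f \<odot>\<^bsub>?S\<^esub> u = ?g \<odot>\<^bsub>?S\<^esub> v" for u v
  proof -
    obtain a u0 v0 where e: "u = (a, u0, x)" "v = (a, v0, y)" using c by (cases u; cases v) auto
    have [simp]: "a \<in> Arr K" "Cod K a = B" "u0 \<in> Arr K" "v0 \<in> Arr K" "Dom K u0 = Dom K a" "Dom K v0 = Dom K a" "Cod K u0 = Dom K x" "Cod K v0 = Dom K y" "x \<odot> u0 = a" "y \<odot> v0 = a"
      using u v unfolding e by simp_all
    have ex: "\<exists>!m. m \<in> hom1 K (Dom K u0) (Dom K p) \<and> p \<odot> m = u0 \<and> q \<odot> m = v0"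
      by (rule is_pullback_arr[OF P]) (use eq in \<open>simp_all add: e\<close>)
    then obtain m where m0: "m \<in> hom1 K (Dom K u0) (Dom K p) \<and> p \<odot> m = u0 \<and> q \<odot> m = v0" by blast
    then have m: "m \<in> Arr K" "Dom K m = Dom K a" "Cod K m = Dom K w" "p \<odot> m = u0" "q \<odot> m = v0" by (simp_all add: hom1_iff)
    have wm: "w \<odot> m = a" using Comp_assoc'[of m p x] m zf(3) by simp
    show ?thesis
    proof (rule ex1I[of _ "(a, m, w)"])
      show "(a, m, w) \<in> hom1 ?S (Dom ?S u) (Dom ?S ?p) \<and> ?p \<odot>\<^bsub>?S\<^esub> (a, m, w) = u \<and> ?q \<odot>\<^bsub>?S\<^esub> (a, m, w) = v"
        unfolding e using m wm by (simp add: hom1_iff)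
      fix k assume k: "k \<in> hom1 ?S (Dom ?S u) (Dom ?S ?p) \<and> ?p \<odot>\<^bsub>?S\<^esub> k = u \<and> ?q \<odot>\<^bsub>?S\<^esub> k = v"
      then obtain k0 where ke: "k = (a, k0, w)" unfolding e by (cases k) (auto simp: hom1_iff)
      have "k0 \<in> hom1 K (Dom K u0) (Dom K p) \<and> p \<odot> k0 = u0 \<and> q \<odot> k0 = v0" using k unfolding ke e by (simp add: hom1_iff)
      with ex m0 have "k0 = m" by blast
      then show "k = (a, m, w)" unfolding ke by simp
    qed
  qed
  have A2: "\<exists>!m. m \<in> Cell ?S \<and> Cod ?S (Src ?S m) = Dom ?S ?p \<and> ?p \<rhd>\<^bsub>?S\<^esub> m = u \<and> ?q \<rhd>\<^bsub>?S\<^esub> m = v"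
    if u: "u \<in> Cell ?S" and v: "v \<in> Cell ?S" and c: "Dom ?S (Src ?S u) = Dom ?S (Src ?S v)" "Cod ?S (Src ?S u) = Dom ?S ?f" "Cod ?S (Src ?S v) = Dom ?S ?g"
      and eq: "?f \<rhd>\<^bsub>?S\<^esub> u = ?g \<rhd>\<^bsub>?S\<^esub> v" for u v
  proof -
    obtain a u0 v0 where e: "u = (a, u0, x)" "v = (a, v0, y)" using c by (cases u; cases v) auto
    have [simp]: "a \<in> Arr K" "Cod K a = B" "u0 \<in> Cell K" "v0 \<in> Cell K" "Dom K (Src K u0) = Dom K a" "Dom K (Src K v0) = Dom K a" "Cod K (Src K u0) = Dom K x" "Cod K (Src K v0) = Dom K y" "x \<rhd> u0 = Id2 K a" "y \<rhd> v0 = Id2 K a"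
      using u v unfolding e by simp_all
    have ex: "\<exists>!m. m \<in> Cell K \<and> Cod K (Src K m) = Dom K p \<and> p \<rhd> m = u0 \<and> q \<rhd> m = v0"
      by (rule is_pullback_cell[OF P]) (use eq in \<open>simp_all add: e\<close>)
    then obtain m where m0: "m \<in> Cell K \<and> Cod K (Src K m) = Dom K p \<and> p \<rhd> m = u0 \<and> q \<rhd> m = v0" by blast
    then have m: "m \<in> Cell K" "Cod K (Src K m) = Dom K w" "p \<rhd> m = u0" "q \<rhd> m = v0" by simp_all
    have md: "Dom K (Src K m) = Dom K a" using arg_cong[OF m(3), of "\<lambda>\<alpha>. Dom K (Src K \<alpha>)"] m(1,2) by simp
    have wm: "w \<rhd> m = Id2 K a" using whisker_Comp(1)[of p x m] m zf(3) by simp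
    show ?thesis
    proof (rule ex1I[of _ "(a, m, w)"])
      show "(a, m, w) \<in> Cell ?S \<and> Cod ?S (Src ?S (a, m, w)) = Dom ?S ?p \<and> ?p \<rhd>\<^bsub>?S\<^esub> (a, m, w) = u \<and> ?q \<rhd>\<^bsub>?S\<^esub> (a, m, w) = v"
        unfolding e using m wm md by simp
      fix k assume k: "k \<in> Cell ?S \<and> Cod ?S (Src ?S k) = Dom ?S ?p \<and> ?p \<rhd>\<^bsub>?S\<^esub> k = u \<and> ?q \<rhd>\<^bsub>?S\<^esub> k = v"
      then obtain k0 where ke: "k = (a, k0, w)" unfolding e by (cases k) auto
      have "k0 \<in> Cell K \<and> Cod K (Src K k0) = Dom K p \<and> p \<rhd> k0 = u0 \<and> q \<rhd> k0 = v0" using k unfolding ke e by simp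
      with ex m0 have "k0 = m" by blast
      then show "k = (a, m, w)" unfolding ke by simp
    qed
  qed
  show ?thesis
    unfolding is_pullback_def
    using s A1 A2 is_pullbackD(9)[OF P] by (auto simp del: slice_simps(1-3))
qed

end

section \<open>Familial polynomial 2-functors\<close>

lemma slice_farr:
  assumes F: "is_fun2 C (slice K B) F" and f: "f \<in> Arr C"
  shows "farr F f = (fob F (Dom C f), mid (farr F f), fob F (Cod C f))"
    and "mid (farr F f) \<in> Arr K" "Dom K (mid (farr F f)) = Dom K (fob F (Dom C f))" "Cod K (mid (farr F f)) = Dom K (fob F (Cod C f))"
    "fob F (Cod C f) \<odot>\<^bsub>K\<^esub> mid (farr F f) = fob F (Dom C f)"
  using is_fun2D(3-5)[OF F f] by (cases "farr F f"; simp)+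

lemma slice_fcell:
  assumes F: "is_fun2 C (slice K B) F" and C: "two_category C" and f: "\<alpha> \<in> Cell C"
  shows "fcell F \<alpha> = (fob F (Dom C (Src C \<alpha>)), mid (fcell F \<alpha>), fob F (Cod C (Src C \<alpha>)))"
    and "mid (fcell F \<alpha>) \<in> Cell K" "Dom K (Src K (mid (fcell F \<alpha>))) = Dom K (fob F (Dom C (Src C \<alpha>)))"
    "Cod K (Src K (mid (fcell F \<alpha>))) = Dom K (fob F (Cod C (Src C \<alpha>)))"
proof -
  obtain a \<sigma> b where e: "fcell F \<alpha> = (a, \<sigma>, b)" by (metis prod.exhaust)
  have s: "Src (slice K B) (fcell F \<alpha>) = (fob F (Dom C (Src C \<alpha>)), mid (farr F (Src C \<alpha>)), fob F (Cod C (Src C \<alpha>)))"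
    using is_fun2D(8)[OF F f] slice_farr(1)[OF F two_category.Src_Arr[OF C f]] by simp
  have ab: "a = fob F (Dom C (Src C \<alpha>))" "b = fob F (Cod C (Src C \<alpha>))"
    using s unfolding e by simp_all
  have "(a, \<sigma>, b) \<in> Cell (slice K B)" using is_fun2D(7)[OF F f] unfolding e .
  then have "\<sigma> \<in> Cell K" "Dom K (Src K \<sigma>) = Dom K a" "Cod K (Src K \<sigma>) = Dom K b" by simp_all
  then show "fcell F \<alpha> = (fob F (Dom C (Src C \<alpha>)), mid (fcell F \<alpha>), fob F (Cod C (Src C \<alpha>)))"
    "mid (fcell F \<alpha>) \<in> Cell K" "Dom K (Src K (mid (fcell F \<alpha>))) = Dom K (fob F (Dom C (Src C \<alpha>)))"
    "Cod K (Src K (mid (fcell F \<alpha>))) = Dom K (fob F (Cod C (Src C \<alpha>)))"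
    unfolding e ab by simp_all
qed

context two_category
begin

lemma slice_terminal:
  assumes X: "X \<in> Ob K"
  shows "terminal_ob (slice K X) (Id1 K X)"
    and "\<lbrakk>x \<in> Arr K; Cod K x = X\<rbrakk> \<Longrightarrow> bang (slice K X) (Id1 K X) x = (x, x, Id1 K X)"
proof -
  let ?S = "slice K X"
  have u: "f = (x, x, Id1 K X)" if "f \<in> hom1 ?S x (Id1 K X)" for f x
    using that X by (cases f) (auto simp: hom1_iff)
  have e: "(x, x, Id1 K X) \<in> hom1 ?S x (Id1 K X)" if "x \<in> Arr K" "Cod K x = X" for x
    using that X by (simp add: hom1_iff)
  have c: "\<alpha> = Id2 ?S (Src ?S \<alpha>)" if al: "\<alpha> \<in> Cell ?S" "Cod ?S (Src ?S \<alpha>) = Id1 K X" for \<alpha>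
  proof -
    obtain a \<sigma> where a: "\<alpha> = (a, \<sigma>, Id1 K X)" using al(2) by (cases \<alpha>) auto
    have s: "a \<in> Arr K" "\<sigma> \<in> Cell K" "X = Cod K (Src K \<sigma>)" "Id1 K X \<rhd> \<sigma> = Id2 K a" using al(1) X unfolding a by auto
    then have "\<sigma> = Id2 K a" using whisker_Id1(1)[OF s(2,3)] by metis
    then show ?thesis using s(1) unfolding a by simp
  qed
  have "\<exists>!f. f \<in> hom1 ?S x (Id1 K X)" if "x \<in> Ob ?S" for x
  proof (rule ex1I)
    show "(x, x, Id1 K X) \<in> hom1 ?S x (Id1 K X)" by (rule e) (use that in simp_all)
  qed (rule u)
  then show "terminal_ob ?S (Id1 K X)"
    unfolding terminal_ob_def using c X by (auto simp del: slice_simps(2,3))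
  assume "x \<in> Arr K" "Cod K x = X"
  then show "bang ?S (Id1 K X) x = (x, x, Id1 K X)"
    unfolding bang_def by (intro the_equality e u)
qed

lemma post_iso_full_faithful:
  assumes m: "m \<in> Arr K" "m' \<in> Arr K" "Dom K m' = Cod K m" "Cod K m' = Dom K m" "m' \<odot> m = Id1 K (Dom K m)"
    and n: "n \<in> Arr K" "Dom K n = Dom K m"
  defines "S \<equiv> slice (slice K (Cod K n)) n"
  shows "\<lbrakk>X \<in> Ob S; Y \<in> Ob S; k \<in> hom1 (slice K (Cod K m)) (fob (post_iso K m) X) (fob (post_iso K m) Y)\<rbrakk>
      \<Longrightarrow> \<exists>k'. k' \<in> hom1 S X Y \<and> farr (post_iso K m) k' = k"
    and "\<lbrakk>f \<in> Arr S; g \<in> Arr S; Dom S f = Dom S g; Cod S f = Cod S g; farr (post_iso K m) f = farr (post_iso K m) g\<rbrakk> \<Longrightarrow> f = g"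
    and "\<lbrakk>\<alpha> \<in> Cell S; \<beta> \<in> Cell S; Dom S (Src S \<alpha>) = Dom S (Src S \<beta>); Cod S (Src S \<alpha>) = Cod S (Src S \<beta>);
      fcell (post_iso K m) \<alpha> = fcell (post_iso K m) \<beta>\<rbrakk> \<Longrightarrow> \<alpha> = \<beta>"
proof -
  have mono: "h = h'" if "m \<odot> h = m \<odot> h'" "h \<in> Arr K" "h' \<in> Arr K" "Cod K h = Dom K m" "Cod K h' = Dom K m" for h h'
  proof -
    have "Id1 K (Dom K m) \<odot> h = Id1 K (Dom K m) \<odot> h'"
      using Comp_reassoc[OF m(5,1,2,3) that(2,4)] Comp_reassoc[OF m(5,1,2,3) that(3,5)] that(1) by simp
    then show ?thesis using Id1_Comp'[OF that(2)] Id1_Comp'[OF that(3)] that(4,5) by simp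
  qed
  show "\<exists>k'. k' \<in> hom1 S X Y \<and> farr (post_iso K m) k' = k"
    if X: "X \<in> Ob S" and Y: "Y \<in> Ob S" and k: "k \<in> hom1 (slice K (Cod K m)) (fob (post_iso K m) X) (fob (post_iso K m) Y)"
  proof -
    obtain a1 a2 where Xe: "X = (a1, a2, n)" using X unfolding S_def by (cases X) auto
    obtain b1 b2 where Ye: "Y = (b1, b2, n)" using Y unfolding S_def by (cases Y) auto
    have a: "a1 \<in> Arr K" "a2 \<in> Arr K" "Dom K a2 = Dom K a1" "Cod K a2 = Dom K n" "n \<odot> a2 = a1" "Cod K a1 = Cod K n"
      using X unfolding S_def Xe by simp_all
    have b: "b1 \<in> Arr K" "b2 \<in> Arr K" "Dom K b2 = Dom K b1" "Cod K b2 = Dom K n" "n \<odot> b2 = b1" "Cod K b1 = Cod K n"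
      using Y unfolding S_def Ye by simp_all
    obtain k0 where ke: "k = (m \<odot> a2, k0, m \<odot> b2)" using k unfolding Xe Ye by (cases k) (auto simp: hom1_iff)
    have k0: "k0 \<in> Arr K" "Dom K k0 = Dom K a1" "Cod K k0 = Dom K b1" and e: "m \<odot> (b2 \<odot> k0) = m \<odot> a2"
      using k a b m(1) n(2) Comp_assoc'[of k0 b2 m] unfolding ke Xe Ye by (auto simp: hom1_iff)
    have e1: "b2 \<odot> k0 = a2" by (rule mono[OF e]) (use a b k0 n in simp_all)
    have e2: "b1 \<odot> k0 = a1" using Comp_assoc'[of k0 b2 n] a b k0 n e1 by simp
    show ?thesis
      by (rule exI[of _ "(X, (a1, k0, b1), Y)"]) (use X Y a b k0 e1 e2 n in \<open>simp add: S_def hom1_iff Xe Ye ke\<close>)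
  qed
  show "f = g" if f: "f \<in> Arr S" and g: "g \<in> Arr S" and c: "Dom S f = Dom S g" "Cod S f = Cod S g" "farr (post_iso K m) f = farr (post_iso K m) g"
  proof -
    obtain a1 a2 a3 k1 k2 k3 b1 b2 b3 where fe: "f = ((a1, a2, a3), (k1, k2, k3), (b1, b2, b3))" by (metis prod.exhaust)
    obtain c1 c2 c3 l1 l2 l3 d1 d2 d3 where ge: "g = ((c1, c2, c3), (l1, l2, l3), (d1, d2, d3))" by (metis prod.exhaust)
    have "k1 = a1" "k3 = b1" using f unfolding S_def fe by simp_all
    moreover have "l1 = c1" "l3 = d1" using g unfolding S_def ge by simp_all
    ultimately show ?thesis using c unfolding S_def fe ge by simp
  qed
  show "f = g" if f: "f \<in> Cell S" and g: "g \<in> Cell S" and c: "Dom S (Src S f) = Dom S (Src S g)" "Cod S (Src S f) = Cod S (Src S g)" "fcell (post_iso K m) f = fcell (post_iso K m) g" for f g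
  proof -
    obtain a1 a2 a3 k1 k2 k3 b1 b2 b3 where fe: "f = ((a1, a2, a3), (k1, k2, k3), (b1, b2, b3))" by (metis prod.exhaust)
    obtain c1 c2 c3 l1 l2 l3 d1 d2 d3 where ge: "g = ((c1, c2, c3), (l1, l2, l3), (d1, d2, d3))" by (metis prod.exhaust)
    have "k1 = a1" "k3 = b1" using f unfolding S_def fe by simp_all
    moreover have "l1 = c1" "l3 = d1" using g unfolding S_def ge by simp_all
    ultimately show ?thesis using c unfolding S_def fe ge by simp
  qed
qed

end

context commas
begin

lemma disc_alg:
  assumes I: "discrete_ob K I" and x: "x \<in> Arr K" "Cod K x = I"
  shows "alg I (disc_alg K cm I x)" "fst (disc_alg K cm I x) = x"
  unfolding disc_alg_def using alg_of_fib[OF discrete_split_fib[OF I x]] x by simp_all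

text \<open>The action of a discrete fibration over I is trivial, all lifting problems being identities.\<close>

lemma disc_algmor:
  assumes I: "discrete_ob K I" and u: "(x, k, y) \<in> Arr (slice K I)"
  shows "algmor I (disc_alg K cm I x) (x, k, y) (disc_alg K cm I y)"
proof -
  have xy: "x \<in> Arr K" "Cod K x = I" "y \<in> Arr K" "Cod K y = I" "k \<in> Arr K" "Dom K k = Dom K x" "Cod K k = Dom K y" "y \<odot> k = x"
    using u by simp_all
  note X = disc_alg[OF I xy(1,2)] and Y = disc_alg[OF I xy(3,4)]
  have a: "act I (disc_alg K cm I z) v \<beta> = v" if "lift_problem K z v \<beta>" "z \<in> Arr K" "Cod K z = I" for z v \<beta>
    unfolding disc_alg_def using act_alg_of_fib[OF discrete_split_fib[OF I that(2,3)] that(3,1)] lift_problemD[OF that(1)] by simp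
  have "algmor I (disc_alg K cm I x) (fst (disc_alg K cm I x), k, fst (disc_alg K cm I y)) (disc_alg K cm I y)"
  proof (rule algmorI[OF X(1) Y(1)])
    fix v \<beta> assume "lift_problem K (fst (disc_alg K cm I x)) v \<beta>"
    then have lp: "lift_problem K x v \<beta>" unfolding X(2) .
    show "k \<odot> act I (disc_alg K cm I x) v \<beta> = act I (disc_alg K cm I y) (k \<odot> v) \<beta>"
      using a[OF lp xy(1,2)] a[OF lift_problem_mor[OF lp xy(1,3,5-8)] xy(3,4)] by simp
  qed (use xy X Y in simp_all)
  then show ?thesis unfolding X Y .
qed

end

context fibred_polynomial
begin

definition RD where "RD = rfun (Pi (pp P)) \<circ>\<^sub>2 Del K pb (ps P)"

text \<open>
  This is \<open>\<Pi>\<^sub>p \<Delta>\<^sub>s (1\<^sub>I)\<close>; it is an isomorphism onto B, although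
  not necessarily an identity.
\<close>

definition base :: 'a where "base = fob RD (Id1 K I)"

definition disp :: "'a \<Rightarrow> 'a" where "disp x = mid (farr RD (x, x, Id1 K I))"

lemma slice_cats: "two_category (slice K I)" "two_category (slice K B)" "two_category (slice K J)" "two_category (slice K (Dom K (pp P)))"
  by (rule two_category_slice; simp)+

lemma RD_fun2: "is_fun2 (slice K I) (slice K B) RD"
  unfolding RD_def
  by (rule is_fun2_comp[OF _ adj2D(2)[OF adj] slice_cats(1)]) (use Del_fun2[of "ps P"] in simp)

lemma RD_adj: "\<exists>\<eta> \<epsilon>. adj2 (slice K B) (slice K I) (Sig K (ps P) \<circ>\<^sub>2 Del K pb (pp P)) RD \<eta> \<epsilon>"
proof -
  have "adj2 (slice K (Dom K (pp P))) (slice K I) (Sig K (ps P)) (Del K pb (ps P)) (Sig_Del_unit (ps P)) (Sig_Del_counit K pb (ps P))"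
    using Sig_Del_adj[of "ps P"] by simp
  from adj2_comp[OF adj this slice_cats(2,4,1)] show ?thesis unfolding RD_def .
qed

lemma PF_RD: "PF = Sig K (pt P) \<circ>\<^sub>2 RD"
  unfolding poly_fun_def RD_def comp_fun2_assoc(1) ..

lemma fob_RD: "fob RD x = zz (pr1 (ps P) x)"
  by (simp add: RD_def)

lemma RD_ob [simp]:
  assumes "x \<in> Arr K" "Cod K x = I"
  shows "fob RD x \<in> Arr K" "Cod K (fob RD x) = B"
  using is_fun2D(1)[OF RD_fun2, of x] assms by simp_all

lemma farr_RD:
  assumes "(x, k, y) \<in> Arr (slice K I)"
  shows "farr RD (x, k, y) = (fob RD x, mid (farr RD (x, k, y)), fob RD y)" "mid (farr RD (x, k, y)) \<in> Arr K"
    "Dom K (mid (farr RD (x, k, y))) = Dom K (fob RD x)" "Cod K (mid (farr RD (x, k, y))) = Dom K (fob RD y)" "fob RD y \<odot> mid (farr RD (x, k, y)) = fob RD x"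
  using slice_farr[OF RD_fun2 assms] by simp_all

lemma base_simps [simp]: "base \<in> Arr K" "Cod K base = B"
  unfolding base_def by simp_all

lemma disp_simps [simp]:
  assumes "x \<in> Arr K" "Cod K x = I"
  shows "disp x \<in> Arr K" "Dom K (disp x) = Dom K (fob RD x)" "Cod K (disp x) = Dom K base" "base \<odot> disp x = fob RD x"
  using farr_RD[of x x "Id1 K I"] assms unfolding disp_def base_def by simp_all

text \<open>
  A right adjoint preserves the terminal object, and a terminal object of K/B is isomorphic to
  \<open>1\<^sub>B\<close>.
\<close>

lemma base_iso:
  obtains k where "k \<in> Arr K" "Dom K k = B" "Cod K k = Dom K base" "base \<odot> k = Id1 K B" "k \<odot> base = Id1 K (Dom K base)"
proof -
  let ?S = "slice K B"
  obtain \<eta> \<epsilon> where a: "adj2 ?S (slice K I) (Sig K (ps P) \<circ>\<^sub>2 Del K pb (pp P)) RD \<eta> \<epsilon>" using RD_adj by blast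
  have t: "\<exists>!f. f \<in> hom1 (slice K I) X (Id1 K I)" if "X \<in> Ob (slice K I)" for X
    using slice_terminal(1)[of I] that unfolding terminal_ob_def by simp
  have u: "\<exists>!f. f \<in> hom1 ?S X base" if "X \<in> Arr K" "Cod K X = B" for X
    unfolding base_def by (rule right_adjoint_terminal[OF a slice_cats(2,1) _ t]) (use that in simp_all)
  obtain f where f: "f \<in> hom1 ?S (Id1 K B) base" using u[of "Id1 K B"] by auto
  define k where "k = mid f"
  have k: "k \<in> Arr K" "Dom K k = B" "Cod K k = Dom K base" "base \<odot> k = Id1 K B"
    using f unfolding k_def by (cases f; simp add: hom1_iff)+
  have "base \<odot> (k \<odot> base) = base" using k by (simp add: Comp_reassoc[OF k(4)])
  then have "(base, k \<odot> base, base) \<in> hom1 ?S base base" "(base, Id1 K (Dom K base), base) \<in> hom1 ?S base base"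
    using k(1-3) by (simp_all add: hom1_iff)
  then have "k \<odot> base = Id1 K (Dom K base)" using u[of base] by auto
  with k that show ?thesis by blast
qed

abbreviation "T1 \<equiv> fun_at_one (slice K I) (Id1 K I) PF"

lemma PF_one: "fob PF (Id1 K I) = pt P \<odot> base"
  unfolding PF_RD base_def by simp

lemma farr_PF:
  assumes "(x, k, y) \<in> Arr (slice K I)"
  shows "farr PF (x, k, y) = (pt P \<odot> fob RD x, mid (farr RD (x, k, y)), pt P \<odot> fob RD y)"
  unfolding PF_RD comp_fun2_simps by (subst farr_RD(1)[OF assms]) simp

lemma PF_bang: 
  assumes "x \<in> Arr K" "Cod K x = I"
  shows "farr PF (bang (slice K I) (Id1 K I) x) = (pt P \<odot> fob RD x, disp x, pt P \<odot> base)"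
  using assms farr_PF[of x x "Id1 K I"] by (simp add: slice_terminal(2) disp_def base_def)

lemma T1_fun2: "is_fun2 (slice K I) (slice (slice K J) (pt P \<odot> base)) T1"
  using fun_at_one_fun2[OF PF_fun2 slice_terminal(1) slice_cats(1,3)] by (simp add: PF_one)

lemma T1_simps:
  "\<lbrakk>x \<in> Arr K; Cod K x = I\<rbrakk> \<Longrightarrow> fob T1 x = (pt P \<odot> fob RD x, disp x, pt P \<odot> base)"
  "(x, k, y) \<in> Arr (slice K I) \<Longrightarrow> farr T1 (x, k, y) = (fob T1 x, farr PF (x, k, y), fob T1 y)"
  "(x, \<alpha>, y) \<in> Cell (slice K I) \<Longrightarrow> fcell T1 (x, \<alpha>, y) = (fob T1 x, fcell PF (x, \<alpha>, y), fob T1 y)"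
  by (simp_all add: fun_at_one_def PF_bang)

lemma post_iso_T1: "fun2_eq (slice K I) (post_iso K base \<circ>\<^sub>2 T1) RD"
  unfolding fun2_eq_def Ball_slice
proof (intro conjI ballI allI impI)
  fix x assume "x \<in> Ob (slice K I)"
  then show "fob (post_iso K base \<circ>\<^sub>2 T1) x = fob RD x" by (simp add: T1_simps(1))
next
  fix x k y assume f: "(x, k, y) \<in> Arr (slice K I)"
  then have "x \<in> Arr K" "Cod K x = I" "y \<in> Arr K" "Cod K y = I" by simp_all
  then show "farr (post_iso K base \<circ>\<^sub>2 T1) (x, k, y) = farr RD (x, k, y)"
    unfolding comp_fun2_simps T1_simps(2)[OF f] farr_PF[OF f] by (subst farr_RD(1)[OF f]) (simp add: T1_simps(1))
next
  fix x \<alpha> y assume f: "(x, \<alpha>, y) \<in> Cell (slice K I)"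
  then have xy: "x \<in> Arr K" "Cod K x = I" "y \<in> Arr K" "Cod K y = I" by simp_all
  obtain \<sigma> where e: "fcell RD (x, \<alpha>, y) = (fob RD x, \<sigma>, fob RD y)"
    using slice_fcell(1)[OF RD_fun2 slice_cats(1) f] by auto
  have "fcell PF (x, \<alpha>, y) = (pt P \<odot> fob RD x, \<sigma>, pt P \<odot> fob RD y)" unfolding PF_RD by (simp add: e)
  then show "fcell (post_iso K base \<circ>\<^sub>2 T1) (x, \<alpha>, y) = fcell RD (x, \<alpha>, y)"
    unfolding comp_fun2_simps T1_simps(3)[OF f] using xy by (simp add: T1_simps(1) e)
qed

text \<open>
  Composition with the isomorphism base is fully faithful and sends \<open>P\<^sub>1\<close> to
  \<open>\<Pi>\<^sub>p \<Delta>\<^sub>s\<close>, which has a left adjoint.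
\<close>

theorem T1_left_adjoint: "\<exists>F \<eta> \<epsilon>. adj2 (slice (slice K J) (pt P \<odot> base)) (slice K I) F T1 \<eta> \<epsilon>"
proof -
  obtain \<eta> \<epsilon> where a: "adj2 (slice K B) (slice K I) (Sig K (ps P) \<circ>\<^sub>2 Del K pb (pp P)) RD \<eta> \<epsilon>" using RD_adj by blast
  obtain k where k: "k \<in> Arr K" "Dom K k = B" "Cod K k = Dom K base" "base \<odot> k = Id1 K B" "k \<odot> base = Id1 K (Dom K base)"
    by (rule base_iso)
  have n: "pt P \<odot> base \<in> Arr K" "Dom K (pt P \<odot> base) = Dom K base" "Cod K (pt P \<odot> base) = J" by simp_all
  interpret SJ: two_category "slice K J" by (rule slice_cats)
  have S: "two_category (slice (slice K J) (pt P \<odot> base))" by (rule SJ.two_category_slice) simp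
  note ff = post_iso_full_faithful[OF base_simps(1) k(1) _ k(3,5) n(1,2), unfolded base_simps n(3), OF k(2)]
  have H: "is_fun2 (slice (slice K J) (pt P \<odot> base)) (slice K B) (post_iso K base)"
    using post_iso_fun2[OF two_category_axioms base_simps(1) n(1,2)] by simp
  show ?thesis
    using adj2_transport[OF a H T1_fun2 post_iso_T1 slice_cats(2) S slice_cats(1) ff] by blast
qed

end

context fibred_polynomial
begin

definition CB :: "'a \<Rightarrow> ('a, 'a sarr) alg" where "CB x = PB (DB (disc_alg K cm I x))"

abbreviation "bar1 cmJ \<equiv> poly_bar1 K pb cm cmJ Pi P \<chi>p"

abbreviation "cleav1 x \<equiv> slice_cleavage K base (fib_of_alg K cm B (CB x))"

lemma bar1_eq: "bar1 cmJ = alg_lift0 (slice K I) T1 (\<lambda>x. alg_of_fib (slice K J) cmJ (pt P \<odot> base) (fob T1 x) (cleav1 x))"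
  unfolding poly_bar1_def Let_def PF_one CB_def base_def fob_RD by simp

lemma CB:
  assumes "discrete_ob K I" "x \<in> Arr K" "Cod K x = I"
  shows "alg B (CB x)" "fst (CB x) = fob RD x"
  using PDB_simps[OF disc_alg(1)[OF assms]] unfolding CB_def disc_alg(2)[OF assms] fob_RD by simp_all

lemma CB_mor:
  assumes "discrete_ob K I" "(x, k, y) \<in> Arr (slice K I)"
  shows "algmor B (CB x) (farr RD (x, k, y)) (CB y)"
  using PDB_mor[OF disc_algmor[OF assms]] unfolding CB_def RD_def by simp

lemma T1_split_fib:
  assumes "discrete_ob K I" "x \<in> Arr K" "Cod K x = I"
  shows "split_fib (slice K J) (fob T1 x) (cleav1 x)"
proof -
  obtain k where k: "k \<in> Arr K" "Dom K k = B" "Cod K k = Dom K base" "base \<odot> k = Id1 K B" "k \<odot> base = Id1 K (Dom K base)"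
    by (rule base_iso)
  have s: "split_fib K (base \<odot> disp x) (fib_of_alg K cm B (CB x))"
    using split_fib_of_alg[OF CB(1)[OF assms]] CB(2)[OF assms] assms by simp
  have n: "pt P \<odot> base \<in> Arr K" "Dom K (pt P \<odot> base) = Dom K base" "Cod K (pt P \<odot> base) = J" by simp_all
  have "split_fib (slice K (Cod K (pt P \<odot> base))) ((pt P \<odot> base) \<odot> disp x, disp x, pt P \<odot> base) (cleav1 x)"
    by (rule slice_split_fib[OF base_simps(1) k(1) _ k(3,5) n(1,2) _ _ s]) (use k assms in simp_all)
  then show ?thesis using assms by (simp add: T1_simps(1))
qed

lemma slice_lift_problem:
  assumes "lift_problem (slice K J) (a, f, n) g \<beta>" "(a, f, n) \<in> Arr (slice K J)"
  obtains w g0 b where "g = (w, g0, a)" "\<beta> = (w, b, n)" "g0 \<in> Arr K" "Cod K g0 = Dom K f" "Dom K g0 = Dom K w" "w \<in> Arr K"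
    "b \<in> Cell K" "Tgt K b = f \<odot> g0" "Cod K (Src K b) = Dom K n" "Dom K (Src K b) = Dom K w"
proof -
  obtain w g0 a' where g: "g = (w, g0, a')" by (metis prod.exhaust)
  obtain w' b n' where b: "\<beta> = (w', b, n')" by (metis prod.exhaust)
  have "a' = a" "w' = w" "n' = n" using assms unfolding lift_problem_def g b by simp_all
  with that[of w g0 b] assms show ?thesis unfolding lift_problem_def g b by auto
qed

lemma base_lift_problem:
  assumes "x \<in> Arr K" "Cod K x = I" "g0 \<in> Arr K" "Cod K g0 = Dom K (disp x)" 
    "b \<in> Cell K" "Tgt K b = disp x \<odot> g0" "Cod K (Src K b) = Dom K base"
  shows "lift_problem K (fob RD x) g0 (base \<rhd> b)"
  using assms Comp_reassoc[OF disp_simps(4)[OF assms(1,2)], of g0] unfolding lift_problem_def by simp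

context
  fixes cmJ
  assumes cmJ: "chosen_commas (slice K J) cmJ" and discrete: "discrete_ob K I"
begin

interpretation L: commas "slice K J" cmJ
  using slice_cats(3) cmJ by (simp add: commas_def commas_axioms_def)

lemma bar1_alg:
  assumes "x \<in> Arr K" "Cod K x = I"
  shows "L.alg (pt P \<odot> base) (fob (bar1 cmJ) x)" "fst (fob (bar1 cmJ) x) = fob T1 x"
    and "lift_problem (slice K J) (fob T1 x) g \<beta> \<Longrightarrow> fib_of_alg (slice K J) cmJ (pt P \<odot> base) (fob (bar1 cmJ) x) g \<beta> = cleav1 x g \<beta>"
proof -
  have c: "Cod (slice K J) (fob T1 x) = pt P \<odot> base" using assms by (simp add: T1_simps(1))
  note s = T1_split_fib[OF discrete assms]
  show "L.alg (pt P \<odot> base) (fob (bar1 cmJ) x)" "fst (fob (bar1 cmJ) x) = fob T1 x"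
    unfolding bar1_eq alg_lift0_def using L.alg_of_fib[OF s c] by simp_all
  show "fib_of_alg (slice K J) cmJ (pt P \<odot> base) (fob (bar1 cmJ) x) g \<beta> = cleav1 x g \<beta>" if "lift_problem (slice K J) (fob T1 x) g \<beta>"
    unfolding bar1_eq alg_lift0_def using L.fib_of_alg_of_fib[OF s c that] by simp
qed

text \<open>
  The underlying arrows in K preserve the chosen lifts over B, and the cleavages over P1 consist of the same
  cells.
\<close>

lemma T1_algmor:
  assumes u: "(x, k, y) \<in> Arr (slice K I)"
  shows "L.algmor (pt P \<odot> base) (fob (bar1 cmJ) x) (farr T1 (x, k, y)) (fob (bar1 cmJ) y)"
proof -
  have xy: "x \<in> Arr K" "Cod K x = I" "y \<in> Arr K" "Cod K y = I" using u by simp_all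
  note X = bar1_alg[OF xy(1,2)] and Y = bar1_alg[OF xy(3,4)]
  obtain h where h: "farr RD (x, k, y) = (fob RD x, h, fob RD y)" and hh: "h \<in> Arr K" "Dom K h = Dom K (fob RD x)" "Cod K h = Dom K (fob RD y)"
    "fob RD y \<odot> h = fob RD x"
    using farr_RD[OF u] by metis
  have pf: "farr PF (x, k, y) = (pt P \<odot> fob RD x, h, pt P \<odot> fob RD y)" unfolding PF_RD by (simp add: h)
  have f: "(fob T1 x, farr PF (x, k, y), fob T1 y) \<in> Arr (slice (slice K J) (pt P \<odot> base))"
    using is_fun2D(3)[OF T1_fun2 u] unfolding T1_simps(2)[OF u] .
  note F = f[unfolded slice_simps(2)]
  have "L.algmor (pt P \<odot> base) (fob (bar1 cmJ) x) (fst (fob (bar1 cmJ) x), farr PF (x, k, y), fst (fob (bar1 cmJ) y)) (fob (bar1 cmJ) y)"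
  proof (rule L.algmor_iff_fib[OF X(1) Y(1)])
    fix g \<beta> assume "lift_problem (slice K J) (fst (fob (bar1 cmJ) x)) g \<beta>"
    then have l: "lift_problem (slice K J) (fob T1 x) g \<beta>" unfolding X(2) .
    have l': "lift_problem (slice K J) (fob T1 y) (farr PF (x, k, y) \<odot>\<^bsub>slice K J\<^esub> g) \<beta>"
      by (rule L.lift_problem_mor[OF l]) (use F in blast)+
    obtain w g0 b where e: "g = (w, g0, pt P \<odot> fob RD x)" "\<beta> = (w, b, pt P \<odot> base)" and g0: "g0 \<in> Arr K" "Cod K g0 = Dom K (disp x)"
       and b: "b \<in> Cell K" "Tgt K b = disp x \<odot> g0" "Cod K (Src K b) = Dom K (pt P \<odot> base)"
      by (rule slice_lift_problem[OF l[unfolded T1_simps(1)[OF xy(1,2)]]]) (use F in \<open>simp_all add: T1_simps(1)[OF xy(1,2)]\<close>)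
    have lp: "lift_problem K (fob RD x) g0 (base \<rhd> b)"
      by (rule base_lift_problem[OF xy(1,2) g0 b(1,2)]) (use b in simp)
    have "h \<rhd> fib_of_alg K cm B (CB x) g0 (base \<rhd> b) = fib_of_alg K cm B (CB y) (h \<odot> g0) (base \<rhd> b)"
      using algmor_fib[OF CB_mor[OF discrete u], of g0 "base \<rhd> b"] lp unfolding CB(2)[OF discrete xy(1,2)] h by simp
    then show "farr PF (x, k, y) \<rhd>\<^bsub>slice K J\<^esub> fib_of_alg (slice K J) cmJ (pt P \<odot> base) (fob (bar1 cmJ) x) g \<beta>
        = fib_of_alg (slice K J) cmJ (pt P \<odot> base) (fob (bar1 cmJ) y) (farr PF (x, k, y) \<odot>\<^bsub>slice K J\<^esub> g) \<beta>"
      unfolding X(3)[OF l] Y(3)[OF l'] unfolding pf e slice_cleavage_def by simp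
  qed (use F in \<open>simp_all only: X(2) Y(2)\<close>)
  then show ?thesis unfolding X(2) Y(2) T1_simps(2)[OF u] .
qed

lemma bar1_fun2: "is_fun2 (slice K I) (PhiAlg (slice K J) cmJ (pt P \<odot> base)) (bar1 cmJ)"
proof -
  let ?S = "slice K I"
  have fb: "bar1 cmJ = alg_lift0 ?S T1 (fob (bar1 cmJ))"
    unfolding bar1_eq alg_lift0_def by simp
  have "is_fun2 ?S (PhiAlg (slice K J) cmJ (pt P \<odot> base)) (alg_lift0 ?S T1 (fob (bar1 cmJ)))"
  proof (rule L.alg_lift0_fun2[OF slice_cats(1) T1_fun2])
    fix X assume "X \<in> Ob ?S"
    then show "L.alg (pt P \<odot> base) (fob (bar1 cmJ) X)" "fst (fob (bar1 cmJ) X) = fob T1 X"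
      using bar1_alg[of X] by simp_all
  next
    fix u assume u: "u \<in> Arr ?S"
    obtain x k y where e: "u = (x, k, y)" by (metis prod.exhaust)
    show "L.algmor (pt P \<odot> base) (fob (bar1 cmJ) (Dom ?S u)) (farr T1 u) (fob (bar1 cmJ) (Cod ?S u))"
      using T1_algmor[of x k y] u unfolding e by simp
  qed
  then show ?thesis unfolding fb[symmetric] .
qed

theorem polynomial_familial: "familial_fun (slice K I) (slice K J) cmJ (Id1 K I) PF (bar1 cmJ)"
proof -
  have "fun2_eq (slice K I) (forget \<circ>\<^sub>2 bar1 cmJ) T1"
  proof -
    have "fob (forget \<circ>\<^sub>2 bar1 cmJ) X = fob T1 X" if "X \<in> Ob (slice K I)" for X
      using bar1_alg(2)[of X] that by (simp add: forget_def)
    moreover have "farr (forget \<circ>\<^sub>2 bar1 cmJ) f = farr T1 f" for f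
      unfolding bar1_eq by (simp add: forget_def alg_lift0_def)
    moreover have "fcell (forget \<circ>\<^sub>2 bar1 cmJ) \<alpha> = fcell T1 \<alpha>" for \<alpha>
      unfolding bar1_eq by (simp add: forget_def alg_lift0_def)
    ultimately show ?thesis unfolding fun2_eq_def by simp
  qed
  then show ?thesis
    unfolding familial_fun_def PF_one
    using slice_cats(1,3) slice_has_commas[of I] cmJ slice_terminal(1)[of I] PF_fun2 T1_left_adjoint bar1_fun2 by simp
qed

end

end

section \<open>Familial 2-natural transformations\<close>

context two_category
begin

lemma lift_problem_square:
  assumes lp: "lift_problem K f k \<beta>" and fg: "f \<in> Arr K" "g \<in> Arr K" and uv: "u \<in> Arr K" "v \<in> Arr K" "Dom K u = Dom K f" "Cod K u = Dom K g" "Dom K v = Cod K f" "Cod K v = Cod K g"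
    and sq: "g \<odot> u = v \<odot> f"
  shows "lift_problem K g (u \<odot> k) (v \<rhd> \<beta>)"
  using lift_problemD[OF lp] lift_problem_ends[OF lp fg(1)] fg uv Comp_reassoc[OF sq, of k] unfolding lift_problem_def by simp

text \<open>Pasting a pullback square with invertible arrows on two opposite sides.\<close>

lemma is_pullback_iso:
  assumes P: "is_pullback K h a b d" and i: "i \<in> Arr K" "i' \<in> Arr K" "Cod K i = Dom K a" "Dom K i' = Dom K a" "Cod K i' = Dom K i" "i' \<odot> i = Id1 K (Dom K i)"
    and j: "j \<in> Arr K" "j' \<in> Arr K" "Cod K j = Dom K b" "Dom K j' = Dom K b" "Cod K j' = Dom K j" "j \<odot> j' = Id1 K (Dom K b)" "j' \<odot> j = Id1 K (Dom K j)"
    and d: "d' \<in> Arr K" "Dom K d' = Dom K j" "Cod K d' = Dom K i" "i \<odot> d' = d \<odot> j"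
  shows "is_pullback K h (a \<odot> i) (b \<odot> j) d'"
proof -
  note p = is_pullbackD[OF P]
  note [simp] = p(1,2,4,5,7,8) p(3)[symmetric] p(6) i(1-5) j(1-5) d(1-3)
  have sq: "h \<odot> (b \<odot> j) = a \<odot> (i \<odot> d')"
    using arg_cong[OF p(9), of "\<lambda>t. t \<odot> j"] d(4) by simp
  have ii: "i' \<odot> (i \<odot> v) = v" if "v \<in> Arr K" "Cod K v = Dom K i" for v
    using Comp_reassoc[OF i(6), of v] that by simp
  have jj: "j' \<odot> (j \<odot> v) = v" if "v \<in> Arr K" "Cod K v = Dom K j" for v
    using Comp_reassoc[OF j(7), of v] that by simp
  have jj': "j \<odot> (j' \<odot> v) = v" if "v \<in> Arr K" "Cod K v = Dom K b" for v
    using Comp_reassoc[OF j(6), of v] that by simp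
  have dj: "i \<odot> (d' \<odot> v) = d \<odot> (j \<odot> v)" if "v \<in> Arr K" "Cod K v = Dom K j" for v
    using Comp_reassoc[OF d(4), of v] that by simp
  have ii2: "i' \<rhd> (i \<rhd> v) = v" if "v \<in> Cell K" "Cod K (Src K v) = Dom K i" for v
    using whisker_l_reassoc[OF i(6), of v] that by simp
  have jj2: "j' \<rhd> (j \<rhd> v) = v" if "v \<in> Cell K" "Cod K (Src K v) = Dom K j" for v
    using whisker_l_reassoc[OF j(7), of v] that by simp
  have jj2': "j \<rhd> (j' \<rhd> v) = v" if "v \<in> Cell K" "Cod K (Src K v) = Dom K b" for v
    using whisker_l_reassoc[OF j(6), of v] that by simp
  have dj2: "i \<rhd> (d' \<rhd> v) = d \<rhd> (j \<rhd> v)" if "v \<in> Cell K" "Cod K (Src K v) = Dom K j" for v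
    using whisker_l_reassoc[OF d(4), of v] that by simp
  have A1: "\<exists>!w. w \<in> hom1 K (Dom K u) (Dom K (b \<odot> j)) \<and> (b \<odot> j) \<odot> w = u \<and> d' \<odot> w = v"
    if u: "u \<in> Arr K" "v \<in> Arr K" "Dom K u = Dom K v" "Cod K u = Dom K h" "Cod K v = Dom K (a \<odot> i)" and e: "h \<odot> u = (a \<odot> i) \<odot> v" for u v
  proof -
    note [simp] = u(1-4) and v = u(5)[simplified, simp]
    have ex: "\<exists>!w. w \<in> hom1 K (Dom K u) (Dom K b) \<and> b \<odot> w = u \<and> d \<odot> w = i \<odot> v"
      by (rule is_pullback_arr[OF P]) (use e in simp_all)
    then obtain w where w0: "w \<in> hom1 K (Dom K u) (Dom K b) \<and> b \<odot> w = u \<and> d \<odot> w = i \<odot> v" by blast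
    then have w: "w \<in> Arr K" "Dom K w = Dom K v" "Cod K w = Dom K b" "b \<odot> w = u" "d \<odot> w = i \<odot> v" by (simp_all add: hom1_iff)
    have "i' \<odot> (i \<odot> (d' \<odot> (j' \<odot> w))) = i' \<odot> (i \<odot> v)" using w dj[of "j' \<odot> w"] jj'[of w] by simp
    then have dv: "d' \<odot> (j' \<odot> w) = v" using ii[of "d' \<odot> (j' \<odot> w)"] ii[of v] w by simp
    show ?thesis
    proof (rule ex1I[of _ "j' \<odot> w"])
      show "j' \<odot> w \<in> hom1 K (Dom K u) (Dom K (b \<odot> j)) \<and> (b \<odot> j) \<odot> (j' \<odot> w) = u \<and> d' \<odot> (j' \<odot> w) = v"
        using w dv jj'[of w] by (simp add: hom1_iff)
      fix x assume x: "x \<in> hom1 K (Dom K u) (Dom K (b \<odot> j)) \<and> (b \<odot> j) \<odot> x = u \<and> d' \<odot> x = v"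
      then have x': "x \<in> Arr K" "Dom K x = Dom K v" "Cod K x = Dom K j" "b \<odot> (j \<odot> x) = u" "d' \<odot> x = v" by (auto simp: hom1_iff)
      have "j \<odot> x \<in> hom1 K (Dom K u) (Dom K b) \<and> b \<odot> (j \<odot> x) = u \<and> d \<odot> (j \<odot> x) = i \<odot> v"
        using x' dj[of x] by (simp add: hom1_iff)
      then have "j \<odot> x = w" using ex w0 by blast
      then show "x = j' \<odot> w" using jj[of x] x' by simp
    qed
  qed
  have A2: "\<exists>!w. w \<in> Cell K \<and> Cod K (Src K w) = Dom K (b \<odot> j) \<and> (b \<odot> j) \<rhd> w = u \<and> d' \<rhd> w = v"
    if u: "u \<in> Cell K" "v \<in> Cell K" "Dom K (Src K u) = Dom K (Src K v)" "Cod K (Src K u) = Dom K h" "Cod K (Src K v) = Dom K (a \<odot> i)" and e: "h \<rhd> u = (a \<odot> i) \<rhd> v" for u v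
  proof -
    note [simp] = u(1-4) and v = u(5)[simplified, simp]
    have ex: "\<exists>!w. w \<in> Cell K \<and> Cod K (Src K w) = Dom K b \<and> b \<rhd> w = u \<and> d \<rhd> w = i \<rhd> v"
      by (rule is_pullback_cell[OF P]) (use e in simp_all)
    then obtain w where w0: "w \<in> Cell K \<and> Cod K (Src K w) = Dom K b \<and> b \<rhd> w = u \<and> d \<rhd> w = i \<rhd> v" by blast
    then have w: "w \<in> Cell K" "Cod K (Src K w) = Dom K b" "b \<rhd> w = u" "d \<rhd> w = i \<rhd> v" by simp_all
    have "i' \<rhd> (i \<rhd> (d' \<rhd> (j' \<rhd> w))) = i' \<rhd> (i \<rhd> v)" using w dj2[of "j' \<rhd> w"] jj2'[of w] by simp
    then have dv: "d' \<rhd> (j' \<rhd> w) = v" using ii2[of "d' \<rhd> (j' \<rhd> w)"] ii2[of v] w by simp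
    show ?thesis
    proof (rule ex1I[of _ "j' \<rhd> w"])
      show "j' \<rhd> w \<in> Cell K \<and> Cod K (Src K (j' \<rhd> w)) = Dom K (b \<odot> j) \<and> (b \<odot> j) \<rhd> (j' \<rhd> w) = u \<and> d' \<rhd> (j' \<rhd> w) = v"
        using w dv jj2'[of w] by simp
      fix x assume x: "x \<in> Cell K \<and> Cod K (Src K x) = Dom K (b \<odot> j) \<and> (b \<odot> j) \<rhd> x = u \<and> d' \<rhd> x = v"
      then have x': "x \<in> Cell K" "Cod K (Src K x) = Dom K j" "b \<rhd> (j \<rhd> x) = u" "d' \<rhd> x = v" by auto
      have "j \<rhd> x \<in> Cell K \<and> Cod K (Src K (j \<rhd> x)) = Dom K b \<and> b \<rhd> (j \<rhd> x) = u \<and> d \<rhd> (j \<rhd> x) = i \<rhd> v"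
        using x' dj2[of x] by simp
      then have "j \<rhd> x = w" using ex w0 by blast
      then show "x = j' \<rhd> w" using jj2[of x] x' by simp
    qed
  qed
  show ?thesis
    unfolding is_pullback_def using sq A1 A2 by auto
qed

end

context pullbacks
begin

text \<open>
  Pasting the naturality square at h with the pullback square defining the reindexing of its codomain gives
  the pullback square for its domain.
\<close>

lemma Del_counit_pullback:
  assumes f: "f \<in> Arr K" and h: "(z, h, z') \<in> Arr (slice K (Cod K f))"
  shows "is_pullback K h (pr2 f z') (pr2 f z) (mid (farr (Del K pb f) (z, h, z')))"
proof -
  define d where "d = mid (farr (Del K pb f) (z, h, z'))"
  note d = Del_farr_simps[OF f h, folded d_def]
  have H: "z \<in> Arr K" "z' \<in> Arr K" "h \<in> Arr K" "Cod K z = Cod K f" "Cod K z' = Cod K f" "Dom K h = Dom K z" "Cod K h = Dom K z'" and zh: "z' \<odot> h = z"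
    using h by simp_all
  note [simp] = f H d(1-3)
  have d1: "pr1 f z' \<odot> (d \<odot> w) = pr1 f z \<odot> w" "pr2 f z' \<odot> (d \<odot> w) = h \<odot> (pr2 f z \<odot> w)" if "w \<in> Arr K" "Cod K w = Dom K (pr1 f z)" for w
    using Comp_reassoc[OF d(4), of w] Comp_reassoc[OF d(5), of w] that by simp_all
  have d2: "pr1 f z' \<rhd> (d \<rhd> w) = pr1 f z \<rhd> w" "pr2 f z' \<rhd> (d \<rhd> w) = h \<rhd> (pr2 f z \<rhd> w)" if "w \<in> Cell K" "Cod K (Src K w) = Dom K (pr1 f z)" for w
    using whisker_l_reassoc[OF d(4), of w] whisker_l_reassoc[OF d(5), of w] that by simp_all
  have sq: "h \<odot> pr2 f z = pr2 f z' \<odot> d" using d(5) by simp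
  have A1: "\<exists>!w. w \<in> hom1 K (Dom K u) (Dom K (pr2 f z)) \<and> pr2 f z \<odot> w = u \<and> d \<odot> w = v"
    if u: "u \<in> Arr K" "v \<in> Arr K" "Dom K u = Dom K v" "Cod K u = Dom K h" "Cod K v = Dom K (pr2 f z')" and e: "h \<odot> u = pr2 f z' \<odot> v" for u v
  proof -
    have u' [simp]: "u \<in> Arr K" "v \<in> Arr K" "Dom K u = Dom K v" "Cod K u = Dom K z" "Cod K v = Dom K (pr1 f z')" using u by simp_all
    have "z' \<odot> (h \<odot> u) = z \<odot> u" by (rule Comp_reassoc[OF zh]) simp_all
    then have c: "f \<odot> (pr1 f z' \<odot> v) = z \<odot> u" unfolding e by simp
    define w where "w = pb_arr K pb f z (pr1 f z' \<odot> v) u"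
    have w [simp]: "w \<in> Arr K" "Dom K w = Dom K v" "Cod K w = Dom K (pr1 f z)" and w1: "pr1 f z \<odot> w = pr1 f z' \<odot> v" "pr2 f z \<odot> w = u"
      unfolding w_def using c by simp_all
    have dw: "d \<odot> w = v"
      by (rule pr_eqI[of f z']) (simp_all add: d1 w1 e)
    show ?thesis
    proof (rule ex1I[of _ w])
      show "w \<in> hom1 K (Dom K u) (Dom K (pr2 f z)) \<and> pr2 f z \<odot> w = u \<and> d \<odot> w = v" by (simp add: hom1_iff w1 dw)
      fix x assume x: "x \<in> hom1 K (Dom K u) (Dom K (pr2 f z)) \<and> pr2 f z \<odot> x = u \<and> d \<odot> x = v"
      then have x': "x \<in> Arr K" "Dom K x = Dom K v" "Cod K x = Dom K (pr1 f z)" "pr2 f z \<odot> x = u" "d \<odot> x = v" by (simp_all add: hom1_iff)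
      show "x = w" by (rule pr_eqI[of f z]) (use x' d1(1)[of x] in \<open>simp_all add: w1\<close>)
    qed
  qed
  have A2: "\<exists>!w. w \<in> Cell K \<and> Cod K (Src K w) = Dom K (pr2 f z) \<and> pr2 f z \<rhd> w = u \<and> d \<rhd> w = v"
    if u: "u \<in> Cell K" "v \<in> Cell K" "Dom K (Src K u) = Dom K (Src K v)" "Cod K (Src K u) = Dom K h" "Cod K (Src K v) = Dom K (pr2 f z')" and e: "h \<rhd> u = pr2 f z' \<rhd> v" for u v
  proof -
    have u' [simp]: "u \<in> Cell K" "v \<in> Cell K" "Dom K (Src K u) = Dom K (Src K v)" "Cod K (Src K u) = Dom K z" "Cod K (Src K v) = Dom K (pr1 f z')" using u by simp_all
    have "z' \<rhd> (h \<rhd> u) = z \<rhd> u" by (rule whisker_l_reassoc[OF zh]) simp_all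
    then have c: "f \<rhd> (pr1 f z' \<rhd> v) = z \<rhd> u" unfolding e by simp
    have "Src K (f \<rhd> (pr1 f z' \<rhd> v)) = f \<odot> (pr1 f z' \<odot> Src K v)" by simp
    then have cS: "f \<odot> (pr1 f z' \<odot> Src K v) = z \<odot> Src K u" unfolding c by simp
    define w where "w = pb_cell K pb f z (pr1 f z' \<rhd> v) u"
    have w [simp]: "w \<in> Cell K" "Cod K (Src K w) = Dom K (pr1 f z)" and w1: "pr1 f z \<rhd> w = pr1 f z' \<rhd> v" "pr2 f z \<rhd> w = u"
      unfolding w_def by (simp_all add: c cS)
    have dw: "d \<rhd> w = v"
      by (rule pr_cell_eqI[of f z']) (simp_all add: d2 w1 e)
    show ?thesis
    proof (rule ex1I[of _ w])
      show "w \<in> Cell K \<and> Cod K (Src K w) = Dom K (pr2 f z) \<and> pr2 f z \<rhd> w = u \<and> d \<rhd> w = v" by (simp add: w1 dw)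
      fix x assume x: "x \<in> Cell K \<and> Cod K (Src K x) = Dom K (pr2 f z) \<and> pr2 f z \<rhd> x = u \<and> d \<rhd> x = v"
      then have x': "x \<in> Cell K" "Cod K (Src K x) = Dom K (pr1 f z)" "pr2 f z \<rhd> x = u" "d \<rhd> x = v" by simp_all
      show "x = w" by (rule pr_cell_eqI[of f z]) (use x' d2(1)[of x] in \<open>simp_all add: w1\<close>)
    qed
  qed
  show ?thesis
    unfolding d_def[symmetric] is_pullback_def using sq A1 A2 by auto
qed

lemma Del_comp_inverse:
  assumes g: "g \<in> Arr K" and f: "f \<in> Arr K" "Dom K g = Cod K f" and x: "x \<in> Arr K" "Cod K x = Cod K g"
  obtains d j where "Del_comp K pb g f x = (pr1 (g \<odot> f) x, d, pr1 f (pr1 g x))"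
    "d \<in> Arr K" "Dom K d = Dom K (pr1 (g \<odot> f) x)" "Cod K d = Dom K (pr1 f (pr1 g x))" "pr1 f (pr1 g x) \<odot> d = pr1 (g \<odot> f) x"
    "j \<in> Arr K" "Dom K j = Dom K (pr1 f (pr1 g x))" "Cod K j = Dom K (pr1 (g \<odot> f) x)" "pr1 (g \<odot> f) x \<odot> j = pr1 f (pr1 g x)"
    "d \<odot> j = Id1 K (Dom K (pr1 f (pr1 g x)))" "j \<odot> d = Id1 K (Dom K (pr1 (g \<odot> f) x))"
proof -
  note [simp] = g f x
  define h where "h = g \<odot> f"
  have h [simp]: "h \<in> Arr K" "Dom K h = Dom K f" "Cod K h = Cod K g" unfolding h_def by simp_all
  have hv: "h \<odot> v = g \<odot> (f \<odot> v)" if "v \<in> Arr K" "Cod K v = Dom K f" for v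
    unfolding h_def using that by simp
  define d where "d = pb_arr2 K pb f g x (pr1 h x) (pr2 h x)"
  have c: "g \<odot> (f \<odot> pr1 h x) = x \<odot> pr2 h x" using hv[of "pr1 h x"] pr_simps[of h x] by simp
  have d: "d \<in> Arr K" "Dom K d = Dom K (pr1 h x)" "Cod K d = Dom K (pr1 f (pr1 g x))" "pr1 f (pr1 g x) \<odot> d = pr1 h x" "pr2 g x \<odot> (pr2 f (pr1 g x) \<odot> d) = pr2 h x"
    using pb_arr2_simps[of f g x "pr1 h x" "pr2 h x" d] c d_def by simp_all
  define n where "n = pr1 f (pr1 g x)"
  define q where "q = pr2 g x \<odot> pr2 f (pr1 g x)"
  have n [simp]: "n \<in> Arr K" "Cod K n = Dom K f" unfolding n_def by simp_all
  have q [simp]: "q \<in> Arr K" "Dom K q = Dom K n" "Cod K q = Dom K x" unfolding q_def n_def by simp_all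
  have c': "h \<odot> n = x \<odot> q"
  proof -
    have "f \<odot> n = pr1 g x \<odot> pr2 f (pr1 g x)" unfolding n_def using pr_simps[of f "pr1 g x"] by simp
    moreover have "g \<odot> (pr1 g x \<odot> pr2 f (pr1 g x)) = x \<odot> q" unfolding q_def using pr_simps[of g x] by simp
    ultimately show ?thesis using hv[of n] by simp
  qed
  define j where "j = pb_arr K pb h x n q"
  have j: "j \<in> Arr K" "Dom K j = Dom K n" "Cod K j = Dom K (pr1 h x)" "pr1 h x \<odot> j = n" "pr2 h x \<odot> j = q"
    unfolding j_def using c' by simp_all
  note [simp] = d(1-3)[folded n_def] j(1-3)
  have dj: "d \<odot> j = Id1 K (Dom K n)"
  proof (rule pr2_eqI[of f g x])
    show "pr1 f (pr1 g x) \<odot> (d \<odot> j) = pr1 f (pr1 g x) \<odot> Id1 K (Dom K n)"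
      using Comp_reassoc[OF d(4), of j] j(4) by (simp flip: n_def)
    have "pr2 g x \<odot> (pr2 f (pr1 g x) \<odot> (d \<odot> j)) = (pr2 g x \<odot> (pr2 f (pr1 g x) \<odot> d)) \<odot> j" by (simp add: n_def[symmetric])
    also have "\<dots> = q" unfolding d(5) j(5) ..
    finally show "pr2 g x \<odot> (pr2 f (pr1 g x) \<odot> (d \<odot> j)) = pr2 g x \<odot> (pr2 f (pr1 g x) \<odot> Id1 K (Dom K n))"
      unfolding q_def by (simp add: n_def)
  qed (simp_all add: n_def[symmetric])
  have jd: "j \<odot> d = Id1 K (Dom K (pr1 h x))"
  proof (rule pr_eqI[of h x])
    show "pr1 h x \<odot> (j \<odot> d) = pr1 h x \<odot> Id1 K (Dom K (pr1 h x))"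
      using Comp_reassoc[OF j(4), of d] d(4) by (simp add: n_def[symmetric])
    have "q \<odot> d = pr2 h x" using d(5) unfolding q_def by (simp add: n_def[symmetric])
    then show "pr2 h x \<odot> (j \<odot> d) = pr2 h x \<odot> Id1 K (Dom K (pr1 h x))"
      using Comp_reassoc[OF j(5), of d] by simp
  qed simp_all
  have "Del_comp K pb g f x = (pr1 h x, d, n)" unfolding Del_comp_def Let_def h_def[symmetric] d_def n_def ..
  with that[of d j] d j dj jd show ?thesis unfolding h_def[symmetric] n_def[symmetric] by blast
qed

end

context pushforward
begin

lemma tr_Id:
  assumes "x \<in> Arr K" "Cod K x = Dom K p"
  shows "tr x (Id1 K (Dom K x)) x = Id1 K (Dom K (zz x))"
  using is_fun2D(2)[OF adj2D(2)[OF adj], of x] assms unfolding tr_def by simp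

end

context fibred_polynomial_mor
begin

definition cmp :: "'a \<Rightarrow> 'a" where "cmp x = mid (comparison (ps Q) x)"

lemma comparison_nat': "is_nat2 (slice K q.I) (slice K p.B) p.RD (Del K pb f1 \<circ>\<^sub>2 q.RD) (comparison (ps Q))"
  using comparison_nat[of "ps Q"] unfolding Q_P p.RD_def q.RD_def comp_fun2_assoc(1) by simp

lemma RD_simps [simp]:
  assumes "x \<in> Arr K" "Cod K x = q.I"
  shows "fob p.RD x \<in> Arr K" "Cod K (fob p.RD x) = p.B" "fob q.RD x \<in> Arr K" "Cod K (fob q.RD x) = q.B"
  using p.RD_ob[of x] q.RD_ob[of x] assms by simp_all

lemma cmp_simps:
  assumes "x \<in> Arr K" "Cod K x = q.I"
  shows "comparison (ps Q) x = (fob p.RD x, cmp x, pr1 f1 (fob q.RD x))"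
    and "cmp x \<in> Arr K" "Dom K (cmp x) = Dom K (fob p.RD x)" "Cod K (cmp x) = Dom K (pr1 f1 (fob q.RD x))" "pr1 f1 (fob q.RD x) \<odot> cmp x = fob p.RD x"
proof -
  have "comparison (ps Q) x \<in> Arr (slice K p.B)" "Dom (slice K p.B) (comparison (ps Q) x) = fob p.RD x"
     "Cod (slice K p.B) (comparison (ps Q) x) = pr1 f1 (fob q.RD x)"
    using is_nat2D(1-3)[OF comparison_nat', of x] assms by simp_all
  then show "comparison (ps Q) x = (fob p.RD x, cmp x, pr1 f1 (fob q.RD x))"
    "cmp x \<in> Arr K" "Dom K (cmp x) = Dom K (fob p.RD x)" "Cod K (cmp x) = Dom K (pr1 f1 (fob q.RD x))" "pr1 f1 (fob q.RD x) \<odot> cmp x = fob p.RD x"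
    unfolding cmp_def by (cases "comparison (ps Q) x"; simp)+
qed

text \<open>
  The inverse Beck-Chevalley map is invertible, and so is the image under \<Pi> of an isomorphism.
\<close>

lemma cmp_inverse:
  assumes x: "x \<in> Arr K" "Cod K x = q.I"
  obtains i where "i \<in> Arr K" "Dom K i = Cod K (cmp x)" "Cod K i = Dom K (cmp x)" "cmp x \<odot> i = Id1 K (Cod K (cmp x))" "i \<odot> cmp x = Id1 K (Dom K (cmp x))"
proof -
  obtain d j where D: "Del_comp K pb (ps Q) f2 x = (pr1 (ps P) x, d, pr1 f2 (pr1 (ps Q) x))"
    "d \<in> Arr K" "Dom K d = Dom K (pr1 (ps P) x)" "Cod K d = Dom K (pr1 f2 (pr1 (ps Q) x))" "pr1 f2 (pr1 (ps Q) x) \<odot> d = pr1 (ps P) x"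
    "j \<in> Arr K" "Dom K j = Dom K (pr1 f2 (pr1 (ps Q) x))" "Cod K j = Dom K (pr1 (ps P) x)" "pr1 (ps P) x \<odot> j = pr1 f2 (pr1 (ps Q) x)"
    "d \<odot> j = Id1 K (Dom K (pr1 f2 (pr1 (ps Q) x)))" "j \<odot> d = Id1 K (Dom K (pr1 (ps P) x))"
    by (rule Del_comp_inverse[of "ps Q" f2 x, unfolded Q_P]) (use x in simp_all)
  define y u v where yuv: "y = pr1 (ps Q) x" "u = pr1 (ps P) x" "v = pr1 f2 y"
  note D = D[folded yuv(1), folded yuv(2,3)]
  have y: "y \<in> Arr K" "Cod K y = Dom K (pp Q)" and u: "u \<in> Arr K" "Cod K u = Dom K (pp P)"
    unfolding yuv(1,2) using x by simp_all
  have v: "v \<in> Arr K" "Cod K v = Dom K (pp P)" unfolding yuv(3) using y by simp_all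
  note [simp] = y u v D(2-4,6-8)
  have du: "(u, d, v) \<in> Arr (slice K (Dom K (pp P)))" "(v, j, u) \<in> Arr (slice K (Dom K (pp P)))" using D(5,9) by simp_all
  have t1: "l.tr u d v \<odot> l.tr v j u = Id1 K (Dom K (l.zz v))"
    using l.tr_Comp[OF du(2,1)] l.tr_Id[OF v] unfolding D(10) by simp
  have t2: "l.tr v j u \<odot> l.tr u d v = Id1 K (Dom K (l.zz u))"
    using l.tr_Comp[OF du] l.tr_Id[OF u] unfolding D(11) by simp
  have tu: "l.tr u d v \<in> Arr K" "Dom K (l.tr u d v) = Dom K (l.zz u)" "Cod K (l.tr u d v) = Dom K (l.zz v)"
    using D(5) by simp_all
  have tv: "l.tr v j u \<in> Arr K" "Dom K (l.tr v j u) = Dom K (l.zz v)" "Cod K (l.tr v j u) = Dom K (l.zz u)"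
    using D(9) by simp_all
  note b = bci[OF y, folded yuv(3)] and bs = BC_simps(2-4)[OF y, folded yuv(3)]
  have c: "cmp x = bci y \<odot> l.tr u d v"
    unfolding cmp_def comparison_def yuv(1)[symmetric] D(1) b(1) l.farr_R[OF du(1)] by simp
  define n where "n = Dom K (pr1 f1 (r.zz y))"
  note [simp] = tu tv b(2-4)[folded n_def] bs[folded n_def]
  have "bci y \<odot> (l.tr u d v \<odot> (l.tr v j u \<odot> bc y)) = bci y \<odot> bc y"
    by (simp add: Comp_reassoc[OF t1])
  then have 1: "cmp x \<odot> (l.tr v j u \<odot> bc y) = Id1 K n" unfolding c b(7)[folded n_def] by simp
  have "l.tr v j u \<odot> (bc y \<odot> (bci y \<odot> l.tr u d v)) = l.tr v j u \<odot> l.tr u d v"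
    by (simp add: Comp_reassoc[OF b(6)])
  then have 2: "(l.tr v j u \<odot> bc y) \<odot> cmp x = Id1 K (Dom K (l.zz u))" unfolding c t2 by simp
  show ?thesis
    by (rule that[of "l.tr v j u \<odot> bc y"]) (use 1 2 in \<open>simp_all add: c\<close>)
qed

definition phi_mid :: "'a \<Rightarrow> 'a" where "phi_mid x = pr2 f1 (fob q.RD x) \<odot> cmp x"

lemma phi_mid:
  assumes x: "x \<in> Arr K" "Cod K x = q.I"
  shows "\<phi> x = (pt P \<odot> fob p.RD x, phi_mid x, pt Q \<odot> fob q.RD x)" "phi_mid x \<in> Arr K"
    "Dom K (phi_mid x) = Dom K (fob p.RD x)" "Cod K (phi_mid x) = Dom K (fob q.RD x)" "fob q.RD x \<odot> phi_mid x = f1 \<odot> fob p.RD x"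
proof -
  note c = cmp_simps[OF x]
  note [simp] = c(2-4) RD_simps[OF x]
  have z: "r.zz (pr1 (ps Q) x) = fob q.RD x" by (simp add: q.fob_RD)
  show "\<phi> x = (pt P \<odot> fob p.RD x, phi_mid x, pt Q \<odot> fob q.RD x)"
    unfolding phi_eq c(1) z phi_mid_def by (simp add: Sig_Del_counit_def)
  show "phi_mid x \<in> Arr K"
    "Dom K (phi_mid x) = Dom K (fob p.RD x)" "Cod K (phi_mid x) = Dom K (fob q.RD x)" unfolding phi_mid_def by simp_all
  have sq: "fob q.RD x \<odot> pr2 f1 (fob q.RD x) = f1 \<odot> pr1 f1 (fob q.RD x)" by simp
  show "fob q.RD x \<odot> phi_mid x = f1 \<odot> fob p.RD x"
    unfolding phi_mid_def using Comp_reassoc[OF sq, of "cmp x"] c(5) by simp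
qed

text \<open>
  \<phi> is an isomorphism followed by a counit of \<Sigma> \<stileturn> \<Delta>, whose naturality squares
  are pullbacks.
\<close>

lemma phi_cartesian:
  assumes f: "f \<in> Arr (slice K q.I)"
  shows "is_pullback (slice K q.J) (farr q.PF f) (\<phi> (Cod (slice K q.I) f)) (\<phi> (Dom (slice K q.I) f)) (farr p.PF f)"
proof -
  let ?S = "slice K q.J"
  obtain x k y where fe: "f = (x, k, y)" by (metis prod.exhaust)
  have k: "(x, k, y) \<in> Arr (slice K q.I)" using f unfolding fe .
  then have kP: "(x, k, y) \<in> Arr (slice K (Cod K (ps P)))" by simp
  have x: "x \<in> Arr K" "Cod K x = q.I" and y: "y \<in> Arr K" "Cod K y = q.I" using k by simp_all
  obtain h where h: "farr q.RD (x, k, y) = (fob q.RD x, h, fob q.RD y)" and hh: "h \<in> Arr K" "Dom K h = Dom K (fob q.RD x)" "Cod K h = Dom K (fob q.RD y)" "fob q.RD y \<odot> h = fob q.RD x"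
    using q.farr_RD[OF k] by metis
  obtain e where e: "farr p.RD (x, k, y) = (fob p.RD x, e, fob p.RD y)" and ee: "e \<in> Arr K" "Dom K e = Dom K (fob p.RD x)" "Cod K e = Dom K (fob p.RD y)" "fob p.RD y \<odot> e = fob p.RD x"
    using p.farr_RD[OF kP] by metis
  note X = cmp_simps[OF x] RD_simps[OF x] and Y = cmp_simps[OF y] RD_simps[OF y]
  have zs: "(fob q.RD x, h, fob q.RD y) \<in> Arr (slice K (Cod K f1))" using hh X(6-) Y(6-) by simp
  define d where "d = mid (farr (Del K pb f1) (fob q.RD x, h, fob q.RD y))"
  note dd = Del_farr_simps[OF f_simps(4) zs, folded d_def]
  have P: "is_pullback K h (pr2 f1 (fob q.RD y)) (pr2 f1 (fob q.RD x)) d"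
    unfolding d_def by (rule Del_counit_pullback[OF f_simps(4) zs])
  have df: "farr (Del K pb f1) (fob q.RD x, h, fob q.RD y) = (pr1 f1 (fob q.RD x), d, pr1 f1 (fob q.RD y))" unfolding d_def by simp
  have sq: "cmp y \<odot> e = d \<odot> cmp x"
    using is_nat2D(4)[OF comparison_nat' k] unfolding comp_fun2_simps h df e by (simp add: X(1) Y(1))
  obtain i where i: "i \<in> Arr K" "Dom K i = Cod K (cmp x)" "Cod K i = Dom K (cmp x)" "cmp x \<odot> i = Id1 K (Cod K (cmp x))" "i \<odot> cmp x = Id1 K (Dom K (cmp x))"
    by (rule cmp_inverse[OF x])
  obtain j where j: "j \<in> Arr K" "Dom K j = Cod K (cmp y)" "Cod K j = Dom K (cmp y)" "cmp y \<odot> j = Id1 K (Cod K (cmp y))" "j \<odot> cmp y = Id1 K (Dom K (cmp y))"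
    by (rule cmp_inverse[OF y])
  have PK: "is_pullback K h (phi_mid y) (phi_mid x) e"
    unfolding phi_mid_def
    by (rule is_pullback_iso[OF P, of _ j _ i]) (use sq X Y i j ee in simp_all)
  have pf: "farr p.PF (x, k, y) = (pt P \<odot> fob p.RD x, e, pt P \<odot> fob p.RD y)" "farr q.PF (x, k, y) = (pt Q \<odot> fob q.RD x, h, pt Q \<odot> fob q.RD y)"
    unfolding p.PF_RD q.PF_RD by (simp_all add: e h)
  have a: "farr p.PF (x, k, y) \<in> Arr ?S" "farr q.PF (x, k, y) \<in> Arr ?S"
    using is_fun2D(3)[OF p.PF_fun2 kP] is_fun2D(3)[OF q.PF_fun2 k] by simp_all
  have b: "\<phi> x \<in> Arr ?S" "\<phi> y \<in> Arr ?S"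
    using is_nat2D(1)[OF phi_nat, of x] is_nat2D(1)[OF phi_nat, of y] x y by simp_all
  show ?thesis
    using is_pullback_slice[OF PK a(2)[unfolded pf] b(2)[unfolded phi_mid(1)[OF y]] b(1)[unfolded phi_mid(1)[OF x]] a(1)[unfolded pf]]
    unfolding fe pf using phi_mid(1)[OF x] phi_mid(1)[OF y] by simp
qed

text \<open>
  The comparison is an algebra morphism over the domain of \<open>f\<^sub>1\<close>, and the projection from
  a pullback along \<open>f\<^sub>1\<close> sends chosen lifts of \<beta> to chosen lifts of
  \<open>f\<^sub>1 \<beta>\<close>.
\<close>

lemma phi_mid_cleavage:
  assumes d: "discrete_ob K q.I" and x: "x \<in> Arr K" "Cod K x = q.I" and lp: "lift_problem K (fob p.RD x) g \<beta>"
  shows "phi_mid x \<rhd> fib_of_alg K cm p.B (p.CB x) g \<beta> = fib_of_alg K cm q.B (q.CB x) (phi_mid x \<odot> g) (f1 \<rhd> \<beta>)"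
proof -
  define z where "z = fob q.RD x"
  note c = cmp_simps[OF x, folded z_def]
  have z [simp]: "z \<in> Arr K" "Cod K z = q.B" unfolding z_def using x by simp_all
  have xP: "x \<in> Arr K" "Cod K x = Cod K (ps P)" using x by simp_all
  have dP: "discrete_ob K (Cod K (ps P))" using d by simp
  define C where "C = q.CB x"
  note C = q.CB[OF d x, folded C_def z_def]
  note CP = p.CB[OF dP xP]
  define \<chi> where "\<chi> = fib_of_alg K cm q.B C"
  have \<chi>: "split_fib K z \<chi>" using split_fib_of_alg[OF C(1)] unfolding C(2) \<chi>_def .
  have m: "algmor p.B (p.CB x) (comparison (ps Q) x) (fob (DelBar K pb cm f1) C)"
    using comparison_algmor[OF _ _ disc_alg(1)[OF d x]] unfolding Q_P disc_alg(2)[OF d x] p.CB_def C_def q.CB_def by simp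
  have lp1: "lift_problem K (pr1 f1 z) (cmp x \<odot> g) \<beta>"
    by (rule lift_problem_mor[OF lp]) (use c x in simp_all)
  have db: "fob (DelBar K pb cm f1) C = alg_of_fib K cm p.B (pr1 f1 z) (pb_cleavage K pb f1 z \<chi>)"
    unfolding DelBar_def alg_lift_def by (simp add: C(2) \<chi>_def)
  have ps: "split_fib K (pr1 f1 z) (pb_cleavage K pb f1 z \<chi>)" by (rule pb_split_fib[OF \<chi>]) simp_all
  have "cmp x \<rhd> fib_of_alg K cm p.B (p.CB x) g \<beta> = pb_cleavage K pb f1 z \<chi> (cmp x \<odot> g) \<beta>"
    using algmor_fib[OF m, of g \<beta>] lp fib_of_alg_of_fib[OF ps _ lp1, of "p.B"] unfolding CP(2) db c(1) by simp
  moreover have "pr2 f1 z \<rhd> pb_cleavage K pb f1 z \<chi> (cmp x \<odot> g) \<beta> = \<chi> (pr2 f1 z \<odot> (cmp x \<odot> g)) (f1 \<rhd> \<beta>)"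
    by (rule pb_cleavage_simps(5)[OF \<chi> _ _ lp1]) simp_all
  moreover have "fib_of_alg K cm p.B (p.CB x) g \<beta> \<in> Cell K" "Cod K (Src K (fib_of_alg K cm p.B (p.CB x) g \<beta>)) = Dom K (fob p.RD x)"
    using split_fibD(3)[OF split_fib_of_alg[OF CP(1)], of g \<beta>] split_fib_ends(2)[OF split_fib_of_alg[OF CP(1)], of g \<beta>] lp unfolding CP(2) by simp_all
  ultimately show ?thesis
    unfolding phi_mid_def z_def[symmetric] \<chi>_def C_def using c(2-4) lift_problemD[OF lp] by simp
qed

theorem polynomial_familial_nat:
  assumes d: "discrete_ob K q.I" and cmJ: "chosen_commas (slice K q.J) cmJ"
  shows "familial_nat (slice K q.I) (slice K q.J) cmJ (Id1 K q.I) p.PF (p.bar1 cmJ) q.PF (q.bar1 cmJ) \<phi>"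
proof -
  let ?S = "slice K q.J" and ?S2 = "slice K q.I"
  interpret L: commas "?S" cmJ
    using q.slice_cats(3) cmJ by (simp add: commas_def commas_axioms_def)
  have dP: "discrete_ob K (Cod K (ps P))" and cmJP: "chosen_commas (slice K (Cod K (pt P))) cmJ" using d cmJ by simp_all
  let ?one = "Id1 K q.I"
  have one: "?one \<in> Arr K" "Cod K ?one = q.I" by simp_all
  note o = phi_mid[OF one]
  have pb: "p.base = fob p.RD ?one" "q.base = fob q.RD ?one" unfolding p.base_def q.base_def by simp_all
  have mor: "split_fib_mor ?S
        (farr p.PF (bang ?S2 ?one x)) (fib_of_alg ?S cmJ (fob p.PF ?one) (fob (p.bar1 cmJ) x))
        (farr q.PF (bang ?S2 ?one x)) (fib_of_alg ?S cmJ (fob q.PF ?one) (fob (q.bar1 cmJ) x))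
        (\<phi> x) (\<phi> ?one)"
    if x: "x \<in> Arr K" "Cod K x = q.I" for x
  proof -
    have xP: "x \<in> Arr K" "Cod K x = Cod K (ps P)" using x by simp_all
    note A = p.bar1_alg[OF cmJP dP xP, unfolded Q_P_Cod(2)] and B = q.bar1_alg[OF cmJ d x]
    have t: "farr p.PF (bang ?S2 ?one x) = fob p.T1 x" "farr q.PF (bang ?S2 ?one x) = fob q.T1 x"
      by (simp_all add: fun_at_one_def)
    have n: "fob p.PF ?one = pt P \<odot> p.base" "fob q.PF ?one = pt Q \<odot> q.base" using p.PF_one q.PF_one by simp_all
    have sA: "split_fib ?S (fob p.T1 x) (fib_of_alg ?S cmJ (pt P \<odot> p.base) (fob (p.bar1 cmJ) x))"
      using L.split_fib_of_alg[OF A(1)] unfolding A(2) by simp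
    have sB: "split_fib ?S (fob q.T1 x) (fib_of_alg ?S cmJ (pt Q \<odot> q.base) (fob (q.bar1 cmJ) x))"
      using L.split_fib_of_alg[OF B(1)] unfolding B(2) by simp
    have T: "fob p.T1 x = (pt P \<odot> fob p.RD x, p.disp x, pt P \<odot> p.base)" "fob q.T1 x = (pt Q \<odot> fob q.RD x, q.disp x, pt Q \<odot> q.base)"
      using p.T1_simps(1)[OF xP] q.T1_simps(1)[OF x] by simp_all
    note PX = phi_mid[OF x]
    have ph: "\<phi> x \<in> Arr ?S" "\<phi> ?one \<in> Arr ?S"
      using is_nat2D(1)[OF phi_nat, of x] is_nat2D(1)[OF phi_nat, of ?one] x by simp_all
    have e: "Dom ?S (\<phi> x) = Dom ?S (fob p.T1 x)" "Cod ?S (\<phi> x) = Dom ?S (fob q.T1 x)"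
       "Dom ?S (\<phi> ?one) = Cod ?S (fob p.T1 x)" "Cod ?S (\<phi> ?one) = Cod ?S (fob q.T1 x)"
      unfolding PX(1) o(1) T pb by simp_all
    have sq: "fob q.T1 x \<odot>\<^bsub>?S\<^esub> \<phi> x = \<phi> ?one \<odot>\<^bsub>?S\<^esub> fob p.T1 x"
    proof -
      have b: "(x, x, ?one) \<in> Arr ?S2" using x by simp
      have "bang ?S2 ?one x = (x, x, ?one)" using slice_terminal(2)[OF _ x] by simp
      then show ?thesis using is_nat2D(4)[OF phi_nat b] unfolding t[symmetric] by simp
    qed
    have ta: "fob p.T1 x \<in> Arr ?S" "fob q.T1 x \<in> Arr ?S"
      using L.split_fibD(1)[OF sA] L.split_fibD(1)[OF sB] by simp_all
    show ?thesis
      unfolding t n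
    proof (rule L.split_fib_morI[OF sA sB ph e sq])
      fix g \<beta> assume l: "lift_problem ?S (fob p.T1 x) g \<beta>"
      have l': "lift_problem ?S (fob q.T1 x) (\<phi> x \<odot>\<^bsub>?S\<^esub> g) (\<phi> ?one \<rhd>\<^bsub>?S\<^esub> \<beta>)"
        by (rule L.lift_problem_square[OF l ta ph e sq])
      obtain w g0 b where ge: "g = (w, g0, pt P \<odot> fob p.RD x)" "\<beta> = (w, b, pt P \<odot> p.base)" and g0: "g0 \<in> Arr K" "Cod K g0 = Dom K (p.disp x)"
         and b: "b \<in> Cell K" "Tgt K b = p.disp x \<odot> g0" "Cod K (Src K b) = Dom K (pt P \<odot> p.base)"
        by (rule q.slice_lift_problem[OF l[unfolded T(1)] ta(1)[unfolded T(1)]])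
      have b3: "Cod K (Src K b) = Dom K p.base" using b(3) by simp
      have lp: "lift_problem K (fob p.RD x) g0 (p.base \<rhd> b)"
        by (rule p.base_lift_problem[OF xP g0 b(1,2) b3])
      \<comment> \<open>From \<open>m\<^sub>2 \<phi>\<^sub>1 = f\<^sub>1 m\<^sub>1\<close>, whiskered with b.\<close>
      have bb: "q.base \<rhd> (phi_mid ?one \<rhd> b) = f1 \<rhd> (p.base \<rhd> b)"
      proof -
        have "q.base \<rhd> (phi_mid ?one \<rhd> b) = (f1 \<odot> p.base) \<rhd> b"
          by (rule whisker_l_reassoc) (use o b(1) b3 in \<open>simp_all add: pb\<close>)
        then show ?thesis using b(1) b3 by simp
      qed
      show "\<phi> x \<rhd>\<^bsub>?S\<^esub> fib_of_alg ?S cmJ (pt P \<odot> p.base) (fob (p.bar1 cmJ) x) g \<beta>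
          = fib_of_alg ?S cmJ (pt Q \<odot> q.base) (fob (q.bar1 cmJ) x) (\<phi> x \<odot>\<^bsub>?S\<^esub> g) (\<phi> ?one \<rhd>\<^bsub>?S\<^esub> \<beta>)"
        unfolding A(3)[OF l] B(3)[OF l'] unfolding PX(1) o(1) ge slice_cleavage_def
        using phi_mid_cleavage[OF d x lp] bb by simp
    qed
  qed
  have fams: "familial_fun ?S2 ?S cmJ ?one p.PF (p.bar1 cmJ)"
      "familial_fun ?S2 ?S cmJ ?one q.PF (q.bar1 cmJ)"
    using p.polynomial_familial[OF cmJP dP] q.polynomial_familial[OF cmJ d] unfolding Q_P_Cod .
  show ?thesis
    unfolding familial_nat_def using fams phi_nat phi_cartesian mor by (simp del: slice_simps(2))
qed

end

section \<open>Lifting and familiality of polynomial 2-functors\<close>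

lemma fibred_polynomial_morI:
  assumes K: "two_category K" "chosen_pullbacks K pb" "chosen_commas K cm" "chosen_Pi K pb Pi"
    and P: "polynomial K pb P" "split_opfib K (pp P) \<chi>p1" "split_fib K (pt P) \<chi>t1"
    and Q: "polynomial K pb Q" "split_opfib K (pp Q) \<chi>p2" "split_fib K (pt Q) \<chi>t2"
    and f: "cart_poly_mor K P Q f2 f1" "split_opfib_mor K (pp P) \<chi>p1 (pp Q) \<chi>p2 f2 f1"
      "split_fib_mor K (pt P) \<chi>t1 (pt Q) \<chi>t2 f1 (Id1 K (Cod K (pt P)))"
  shows "fibred_polynomial_mor K pb cm Pi P Q \<chi>p1 \<chi>t1 \<chi>p2 \<chi>t2 f2 f1"
proof -
  interpret p: fibred_polynomial K pb cm Pi P \<chi>p1 \<chi>t1 by (rule fibred_polynomialI[OF K P])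
  interpret q: fibred_polynomial K pb cm Pi Q \<chi>p2 \<chi>t2 by (rule fibred_polynomialI[OF K Q])
  have "is_pullback K (pp Q) f1 f2 (pp P)" using f(1) unfolding cart_poly_mor_def by blast
  then show ?thesis by unfold_locales (use f in simp_all)
qed

theorem theorem4p4p5:
  fixes K :: "('o, 'a, 'c) twocat"
    and pb :: "'a pbs"
    and cm :: "('a, 'c) commas"
    and Pi :: "'a \<Rightarrow> ('a, 'c) radj"
  assumes "two_category K"
    and "chosen_pullbacks K pb"
    and "chosen_commas K cm"
    and "chosen_Pi K pb Pi"
  shows
    "(\<forall>P \<chi>p \<chi>t.
        polynomial K pb P \<and> split_opfib K (pp P) \<chi>p \<and> split_fib K (pt P) \<chi>t \<longrightarrow>
        (let I = Cod K (ps P); J = Cod K (pt P);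
             PF = poly_fun K pb Pi P; PFbar = poly_bar K pb cm Pi P \<chi>p \<chi>t in
         is_fun2 (PhiAlg K cm I) (PhiAlg K cm J) PFbar \<and>
         fun2_eq (PhiAlg K cm I) (forget \<circ>\<^sub>2 PFbar) (PF \<circ>\<^sub>2 forget) \<and>
         (discrete_ob K I \<longrightarrow>
            has_commas (slice K J) \<and>
            (\<forall>cmJ. chosen_commas (slice K J) cmJ \<longrightarrow>
               familial_fun (slice K I) (slice K J) cmJ (Id1 K I)
                 PF (poly_bar1 K pb cm cmJ Pi P \<chi>p)))))
     \<and>
     (\<forall>P Q f2 f1 \<chi>p1 \<chi>t1 \<chi>p2 \<chi>t2.
        polynomial K pb P \<and> polynomial K pb Q \<and> cart_poly_mor K P Q f2 f1 \<and>
        split_opfib K (pp P) \<chi>p1 \<and> split_fib K (pt P) \<chi>t1 \<and>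
        split_opfib K (pp Q) \<chi>p2 \<and> split_fib K (pt Q) \<chi>t2 \<and>
        split_opfib_mor K (pp P) \<chi>p1 (pp Q) \<chi>p2 f2 f1 \<and>
        split_fib_mor K (pt P) \<chi>t1 (pt Q) \<chi>t2 f1 (Id1 K (Cod K (pt P))) \<longrightarrow>
        (let I = Cod K (ps P); J = Cod K (pt P);
             PF = poly_fun K pb Pi P; PFbar = poly_bar K pb cm Pi P \<chi>p1 \<chi>t1;
             QF = poly_fun K pb Pi Q; QFbar = poly_bar K pb cm Pi Q \<chi>p2 \<chi>t2;
             \<phi> = poly_nat K pb Pi P Q f2 f1 in
         (\<exists>\<phi>bar. is_nat2 (PhiAlg K cm I) (PhiAlg K cm J) PFbar QFbar \<phi>bar \<and>
            (\<forall>A\<in>Ob (PhiAlg K cm I). farr forget (\<phi>bar A) = \<phi> (fob forget A))) \<and>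
         (discrete_ob K I \<longrightarrow>
            has_commas (slice K J) \<and>
            (\<forall>cmJ. chosen_commas (slice K J) cmJ \<longrightarrow>
               familial_nat (slice K I) (slice K J) cmJ (Id1 K I)
                 PF (poly_bar1 K pb cm cmJ Pi P \<chi>p1)
                 QF (poly_bar1 K pb cm cmJ Pi Q \<chi>p2)
                 \<phi>))))"
proof (intro conjI allI impI, goal_cases)
  case (1 P \<chi>p \<chi>t)
  interpret fibred_polynomial K pb cm Pi P \<chi>p \<chi>t by (rule fibred_polynomialI[OF assms]) (use 1 in blast)+
  show ?case
    unfolding Let_def
    using PFbar_fun2 PFbar_forget slice_has_commas[of "Cod K (pt P)"] polynomial_familial by simp
next
  case (2 P Q f2 f1 \<chi>p1 \<chi>t1 \<chi>p2 \<chi>t2)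
  interpret fibred_polynomial_mor K pb cm Pi P Q \<chi>p1 \<chi>t1 \<chi>p2 \<chi>t2 f2 f1
    by (rule fibred_polynomial_morI[OF assms]) (use 2 in blast)+
  define \<phi>bar where "\<phi>bar A = (fob p.PFbar A, \<phi> (fst A), fob q.PFbar A)" for A
  have "is_nat2 (PhiAlg K cm (Cod K (ps Q))) (PhiAlg K cm (Cod K (pt Q))) p.PFbar q.PFbar \<phi>bar"
    unfolding \<phi>bar_def
    by (rule alg_nat_lift[OF phi_nat p.PFbar_simps(2,3) q.PFbar_simps(2,3) phi_algmor])
  moreover have "farr forget (\<phi>bar A) = \<phi> (fob forget A)" for A
    by (simp add: \<phi>bar_def forget_def)
  ultimately have "\<exists>\<phi>bar. is_nat2 (PhiAlg K cm (Cod K (ps Q))) (PhiAlg K cm (Cod K (pt Q))) p.PFbar q.PFbar \<phi>bar \<and>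
            (\<forall>A\<in>Ob (PhiAlg K cm (Cod K (ps Q))). farr forget (\<phi>bar A) = \<phi> (fob forget A))"
    by blast
  then show ?case
    unfolding Let_def Q_P_Cod
    using slice_has_commas[of "Cod K (pt Q)"] polynomial_familial_nat by simp
qed

end
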